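(* Let $n\ge 1$ be an integer, let $\beta\in\mathbb{R}$, and let $\varphi$ be a pointwise multiplier of the Hardy-Sobolev space $H^2_\beta$ on the open unit ball $\mathbb{B}_n$. Then the essential spectrum of the bounded multiplication operator $M_\varphi: H^2_\beta\to H^2_\beta$, $M_\varphi f=\varphi f$, is given by $$\sigma_e(M_\varphi)=\bigcap_{r\in(0,1)}\overline{\varphi(\mathbb{B}_n\setminus r\mathbb{B}_n)},$$ where $r\mathbb{B}_n=\{z\in\mathbb{C}^n:|z|<r\}$ and the bar denotes closure in $\mathbb{C}$.
   Context: $\mathbb{B}_n$ is the open unit ball in $\mathbb{C}^n$, $H(\mathbb{B}_n)$ is the space of holomorphic functions on $\mathbb{B}_n$, and $\mathbb{S}_n=\partial\mathbb{B}_n$ carries the normalized Lebesgue measure $d\sigma$. The Hardy space $H^2$ consists of $f\in H(\mathbb{B}_n)$ with $\|f\|_{H^2}^2=\sup_{0<r<1}\int_{\mathbb{S}_n}|f(r\zeta)|^2\,d\sigma(\zeta)<\infty$. For $f\in H(\mathbb{B}_n)$ with homogeneous expansion $f=\sum_{k=0}^\infty f_k$ and $\beta\in\mathbb{R}$, set $R^\beta f=\sum_{k=1}^\infty k^\beta f_k$. The Hardy-Sobolev space $H^2_\beta$ consists of all $f\in H(\mathbb{B}_n)$ with $R^\beta f\in H^2$; it is a Hilbert space with inner product $\langle f,g\rangle_\beta=f(0)\overline{g(0)}+\langle R^\beta f,R^\beta g\rangle_{H^2}$. A pointwise multiplier of $H^2_\beta$ is a function $\varphi\in H(\mathbb{B}_n)$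 such that $\varphi f\in H^2_\beta$ for every $f\in H^2_\beta$; by the closed graph theorem $M_\varphi$ is then bounded on $H^2_\beta$. A bounded linear operator $T$ is Fredholm if it has closed range, finite dimensional kernel and finite dimensional co-kernel; the essential spectrum $\sigma_e(T)$ is the set of $\lambda\in\mathbb{C}$ such that $\lambda I-T$ is not Fredholm. *)

theory Defs
  imports "HOL-Analysis.Analysis" "HOL-Library.Function_Algebras"
begin

section \<open>Holomorphic functions on the unit ball and the Hardy space\<close>

text \<open>
  A function on the open unit ball of \<open>\<complex>\<^sup>n\<close> is represented by its extension by zero to the whole
  type. Distinct elements of the function spaces below are thus distinct as functions on the ball,
  so that kernels, ranges and dimensions computed in them are the intended ones. The norm of
  \<^typ>\<open>complex ^ 'n\<close> is the Hermitian norm.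
\<close>

definition holomorphic_ball :: "(complex ^ 'n \<Rightarrow> complex) set" where
  "holomorphic_ball =
     {f. (\<forall>z\<in>ball 0 1. \<exists>D. (f has_derivative D) (at z) \<and> (\<forall>c v. D (c *s v) = c * D v)) \<and>
         (\<forall>z. z \<notin> ball 0 1 \<longrightarrow> f z = 0)}"

text \<open>
  Normalized surface measure on the unit sphere, via polar coordinates: the measure of \<open>A\<close> is the
  proportion of the volume of the ball that is occupied by the cone over \<open>A\<close>.
\<close>

definition sphere_measure :: "(complex ^ 'n) measure" where
  "sphere_measure =
     restrict_space (distr (uniform_measure lborel (ball 0 1)) borel (\<lambda>z. z /\<^sub>R norm z)) (sphere 0 1)"

definition hardy_mean :: "(complex ^ 'n \<Rightarrow> complex) \<Rightarrow> real \<Rightarrow> real" where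
  "hardy_mean f r = (\<integral>\<zeta>. (cmod (f (r *\<^sub>R \<zeta>)))\<^sup>2 \<partial>sphere_measure)"

definition hardy_space :: "(complex ^ 'n \<Rightarrow> complex) set" where
  "hardy_space = {f \<in> holomorphic_ball. bdd_above (hardy_mean f ` {0<..<1})}"

definition hardy_norm :: "(complex ^ 'n \<Rightarrow> complex) \<Rightarrow> real" where
  "hardy_norm f = sqrt (SUP r\<in>{0<..<1}. hardy_mean f r)"

section \<open>Homogeneous expansions and Hardy-Sobolev spaces\<close>

definition homogeneous_polynomial :: "nat \<Rightarrow> (complex ^ 'n \<Rightarrow> complex) \<Rightarrow> bool" where
  "homogeneous_polynomial k p \<longleftrightarrow>
     (\<exists>c :: ('n \<Rightarrow> nat) \<Rightarrow> complex.
        \<forall>z. p z = (\<Sum>\<alpha> | (\<Sum>i\<in>UNIV. \<alpha> i) = k. c \<alpha> * (\<Prod>i\<in>UNIV. (z $ i) ^ \<alpha> i)))"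

definition homogeneous_expansion ::
  "(complex ^ 'n \<Rightarrow> complex) \<Rightarrow> nat \<Rightarrow> complex ^ 'n \<Rightarrow> complex" where
  "homogeneous_expansion f =
     (THE F. (\<forall>k. homogeneous_polynomial k (F k)) \<and> (\<forall>z\<in>ball 0 1. (\<lambda>k. F k z) sums f z))"

definition radial_power :: "real \<Rightarrow> (complex ^ 'n \<Rightarrow> complex) \<Rightarrow> complex ^ 'n \<Rightarrow> complex" where
  "radial_power \<beta> f z =
     (if z \<in> ball 0 1
      then \<Sum>k. of_real (real (Suc k) powr \<beta>) * homogeneous_expansion f (Suc k) z
      else 0)"

definition hardy_sobolev_space :: "real \<Rightarrow> (complex ^ 'n \<Rightarrow> complex) set" where
  "hardy_sobolev_space \<beta> = {f \<in> holomorphic_ball. radial_power \<beta> f \<in> hardy_space}"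

text \<open>
  The norm induced by the inner product
  \<open>\<langle>f, g\<rangle> = f(0) cnj (g(0)) + \<langle>R\<^sup>\<beta> f, R\<^sup>\<beta> g\<rangle>\<close>, where the second summand is the inner product of the
  Hardy space.
\<close>

definition hardy_sobolev_norm :: "real \<Rightarrow> (complex ^ 'n \<Rightarrow> complex) \<Rightarrow> real" where
  "hardy_sobolev_norm \<beta> f = sqrt ((cmod (f 0))\<^sup>2 + (hardy_norm (radial_power \<beta> f))\<^sup>2)"

definition pointwise_multiplier :: "real \<Rightarrow> (complex ^ 'n \<Rightarrow> complex) \<Rightarrow> bool" where
  "pointwise_multiplier \<beta> \<phi> \<longleftrightarrow>
     \<phi> \<in> holomorphic_ball \<and>
     (\<forall>f\<in>hardy_sobolev_space \<beta>. (\<lambda>z. \<phi> z * f z) \<in> hardy_sobolev_space \<beta>)"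

definition multiplication_operator ::
  "('a \<Rightarrow> complex) \<Rightarrow> ('a \<Rightarrow> complex) \<Rightarrow> 'a \<Rightarrow> complex" where
  "multiplication_operator \<phi> f = (\<lambda>z. \<phi> z * f z)"

section \<open>Fredholm operators and the essential spectrum\<close>

definition scale_fun :: "complex \<Rightarrow> ('a \<Rightarrow> complex) \<Rightarrow> 'a \<Rightarrow> complex" where
  "scale_fun c f = (\<lambda>x. c * f x)"

global_interpretation cfun: vector_space "scale_fun :: complex \<Rightarrow> ('a \<Rightarrow> complex) \<Rightarrow> 'a \<Rightarrow> complex"
  by standard (auto simp: scale_fun_def fun_eq_iff algebra_simps)

text \<open>
  Below, \<open>V\<close> is a complex linear subspace of a space of functions (with pointwise operations) and
  \<open>N\<close> is a norm on \<open>V\<close>. The values of \<open>N\<close> and of operators outside \<open>V\<close> are irrelevant.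
\<close>

definition bounded_operator_on ::
  "('a \<Rightarrow> complex) set \<Rightarrow> (('a \<Rightarrow> complex) \<Rightarrow> real) \<Rightarrow> (('a \<Rightarrow> complex) \<Rightarrow> 'a \<Rightarrow> complex) \<Rightarrow> bool" where
  "bounded_operator_on V N T \<longleftrightarrow>
     (\<forall>f\<in>V. T f \<in> V) \<and>
     (\<forall>f\<in>V. \<forall>g\<in>V. T (f + g) = T f + T g) \<and>
     (\<forall>c. \<forall>f\<in>V. T (scale_fun c f) = scale_fun c (T f)) \<and>
     (\<exists>C. \<forall>f\<in>V. N (T f) \<le> C * N f)"

text \<open>
  The last conjunct says that the quotient of \<open>V\<close> by the range of \<open>T\<close> is spanned by the cosets of
  finitely many elements.
\<close>

definition fredholm_on ::
  "('a \<Rightarrow> complex) set \<Rightarrow> (('a \<Rightarrow> complex) \<Rightarrow> real) \<Rightarrow> (('a \<Rightarrow> complex) \<Rightarrow> 'a \<Rightarrow> complex) \<Rightarrow> bool" where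
  "fredholm_on V N T \<longleftrightarrow>
     bounded_operator_on V N T \<and>
     closedin (Metric_space.mtopology V (\<lambda>f g. N (f - g))) (T ` V) \<and>
     (\<exists>B. finite B \<and> B \<subseteq> V \<and> {f \<in> V. T f = 0} \<subseteq> cfun.span B) \<and>
     (\<exists>B. finite B \<and> B \<subseteq> V \<and> (\<forall>g\<in>V. \<exists>f\<in>V. g - T f \<in> cfun.span B))"

definition essential_spectrum_on ::
  "('a \<Rightarrow> complex) set \<Rightarrow> (('a \<Rightarrow> complex) \<Rightarrow> real) \<Rightarrow> (('a \<Rightarrow> complex) \<Rightarrow> 'a \<Rightarrow> complex) \<Rightarrow> complex set"
  where
  "essential_spectrum_on V N T = {\<mu>. \<not> fredholm_on V N (\<lambda>f. scale_fun \<mu> f - T f)}"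

end

(*
  A function belongs to the Hardy-Sobolev space iff the squared Hardy norms of its homogeneous
  components are summable against the weights k^(2 beta), so everything is read off from weighted
  sums. Let psi = mu - phi.

  If |psi| >= delta > 0 near the sphere, division by psi preserves the space: for beta <= 0 the norm
  only depends on the growth near the sphere; interpolation gives multipliers for smaller exponents,
  and the radial derivative reduces beta to beta - 1. Together with the maximum principle this shows
  that the range of multiplication by psi is closed. If n >= 2, then psi has no zeros and the range
  is everything; if n = 1, division by the finitely many zeros of psi leaves remainders of bounded
  degree.

  Conversely, let multiplication by psi be Fredholm and psi(w_k) -> 0 with w_k -> zeta on the
  sphere. With chi(z) = 1 - <z, zeta>, the estimate N(eps h / (chi + eps)) = O(eps) for suitable h
  that vanish to high order at zeta shows that the closed multiples of chi^E do not depend on large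
  E and have finite codimension. Operators on finite dimensional quotients are annihilated by
  polynomials; applied to chi modulo the multiples of psi^(N+1) and to psi modulo the closed
  multiples of chi^E, this yields polynomials p, q with p(0) q(0) <> 0 such that p(chi) q(psi) / psi
  is a multiplier. But multipliers are bounded, which fails along w_k.
*)

theory Submission
  imports Defs "HOL-Complex_Analysis.Complex_Analysis"
begin

section \<open>Holomorphic functions on the ball and their homogeneous expansions\<close>

text \<open>For large \<open>\<beta>\<close> values and derivatives at the boundary point zeta are
  continuous functionals. Normalized kernels then do not tend weakly to zero there, so they cannot
  test the Fredholm property, and low powers of chi have multiples with different closures; hence
  the exponent E, taken larger than \<open>\<beta>\<close>. The argument is instead algebraic. Write
  V for the space, Z for the closure of chi^E V and U for psi^(N+1) V. If mu(psi) = psi^N q(psi)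
  maps V into Z and p0(chi) = chi^d p(chi) maps V into U, then, since Z is also the closure of
  chi^(E+d) V and U is closed, p(chi) Z lies in U. Hence p(chi) psi^N q(psi) V is contained in
  psi^(N+1) V, and cancelling psi^N gives p(chi) q(psi) V inside psi V. That Z does not change when
  E is increased is essential, because d is found only after E has been fixed; splitting off the
  powers psi^N and chi^d is what makes p(0) and q(0) nonzero.\<close>

lemma norm_smult [simp]:
  fixes v :: "complex ^ 'n"
  shows "norm (c *s v) = cmod c * norm v"
  by (simp add: norm_vec_def L2_set_def norm_mult power_mult_distrib real_sqrt_mult
      flip: sum_distrib_left)

lemma continuous_on_smult [continuous_intros]:
  fixes g :: "'a::topological_space \<Rightarrow> complex ^ 'n"
  assumes "continuous_on S f" "continuous_on S g"
  shows "continuous_on S (\<lambda>x. f x *s g x)"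
  unfolding vector_scalar_mult_def by (intro continuous_intros assms)

lemma scaleR_eq_smult: "r *\<^sub>R (v :: complex ^ 'n) = complex_of_real r *s v"
  by (simp add: vec_eq_iff) (simp add: scaleR_conv_of_real)

lemma bounded_linear_smult_left: "bounded_linear (\<lambda>t. t *s (b :: complex ^ 'n))"
  by (rule bounded_linear_intro[where K = "norm b"])
     (auto simp: vec_eq_iff algebra_simps)

text \<open>Holomorphy in several variables, encoded as continuity plus holomorphy on complex lines:
  sums, products, quotients and locally uniform limits then reduce to one variable. By
  \<open>holomorphic_ball_iff\<close> nothing is lost on the unit ball.\<close>

definition line_holo :: "(complex ^ 'n) set \<Rightarrow> (complex ^ 'n \<Rightarrow> complex) \<Rightarrow> bool" where
  "line_holo U f \<longleftrightarrow> continuous_on U f \<and>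
     (\<forall>a b. (\<lambda>t. f (a + t *s b)) holomorphic_on {t. a + t *s b \<in> U})"

lemma open_line: "open U \<Longrightarrow> open {t. a + t *s (b :: complex ^ 'n) \<in> U}"
proof -
  have "continuous_on UNIV (\<lambda>t. a + t *s b)"
    by (intro continuous_intros)
  from open_vimage[OF _ this, of U] show "open U \<Longrightarrow> open {t. a + t *s b \<in> U}" by (simp add: vimage_def)
qed

lemma holomorphic_ball_line_holo:
  fixes f :: "complex ^ 'n \<Rightarrow> complex"
  assumes "f \<in> holomorphic_ball"
  shows "line_holo (ball 0 1) f"
  unfolding line_holo_def
proof (intro conjI allI)
  have D: "\<exists>D. (f has_derivative D) (at z) \<and> (\<forall>c v. D (c *s v) = c * D v)" if "z \<in> ball 0 1" for z
    using assms that unfolding holomorphic_ball_def by blast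
  show "continuous_on (ball 0 1) f"
    using D by (meson continuous_at_imp_continuous_on has_derivative_continuous)
  fix a b :: "complex ^ 'n"
  have "(\<lambda>t. f (a + t *s b)) field_differentiable (at t)" if t: "a + t *s b \<in> ball 0 1" for t
  proof -
    obtain D where D: "(f has_derivative D) (at (a + t *s b))" "\<And>c v. D (c *s v) = c * D v"
      using D[OF t] by blast
    have "((\<lambda>t. a + t *s b) has_derivative (\<lambda>h. h *s b)) (at t)"
      by (auto intro!: derivative_eq_intros bounded_linear_imp_has_derivative bounded_linear_smult_left)
    from diff_chain_at[OF this D(1)]
    have "((\<lambda>t. f (a + t *s b)) has_derivative (\<lambda>h. D (h *s b))) (at t)"
      by (simp add: o_def)
    then have "((\<lambda>t. f (a + t *s b)) has_field_derivative D b) (at t)"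
      unfolding has_field_derivative_def D(2) by (simp add: mult.commute[of _ "D b"] mult_commute_abs)
    then show ?thesis by (auto simp: field_differentiable_def)
  qed
  then show "(\<lambda>t. f (a + t *s b)) holomorphic_on {t. a + t *s b \<in> ball 0 1}"
    by (auto simp: holomorphic_on_def intro: field_differentiable_at_within)
qed

text \<open>The k-th Taylor coefficient at 0 of the slice t -> f(t z). Every z is allowed, not only
  points of the ball, since the slice is holomorphic near 0; the parts therefore live on the whole
  space.\<close>

definition taylor_part :: "(complex ^ 'n \<Rightarrow> complex) \<Rightarrow> nat \<Rightarrow> complex ^ 'n \<Rightarrow> complex" where
  "taylor_part f k z = (deriv ^^ k) (\<lambda>t. f (t *s z)) 0 / fact k"

lemma line_holo_line0:
  assumes "line_holo (ball 0 1) f"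
  shows "(\<lambda>t. f (t *s z)) holomorphic_on {t. t *s z \<in> ball 0 1}"
  using assms unfolding line_holo_def by (metis (no_types, lifting) Collect_cong add_0 holomorphic_cong)

lemma line_holo_continuous: "line_holo (ball 0 1) f \<Longrightarrow> continuous_on (ball 0 1) f"
  by (simp add: line_holo_def)

lemma taylor_part_sums:
  assumes f: "line_holo (ball 0 1) f" and t: "norm (t *s z) < 1"
  shows "(\<lambda>k. taylor_part f k z * t ^ k) sums f (t *s z)"
proof -
  obtain r where r: "cmod t < r" "r * norm z < 1"
  proof (cases "z = 0")
    case True
    with that[of "cmod t + 1"] show ?thesis by simp
  next
    case False
    then have "cmod t < 1 / norm z" using t by (simp add: field_simps)
    then obtain r where "cmod t < r" "r < 1 / norm z" using dense by blast
    then show ?thesis using that[of r] False by (simp add: field_simps)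
  qed
  have "cmod x * norm z < 1" if "cmod x < r" for x
    using mult_right_mono[of "cmod x" r "norm z"] that r by auto
  then have "(\<lambda>t. f (t *s z)) holomorphic_on ball 0 r"
    by (intro holomorphic_on_subset[OF line_holo_line0[OF f]]) auto
  from holomorphic_power_series[OF this, of t] r show ?thesis
    by (simp add: taylor_part_def)
qed

lemma taylor_part_sums_ball:
  assumes "line_holo (ball 0 1) f" "z \<in> ball 0 1"
  shows "(\<lambda>k. taylor_part f k z) sums f z"
  using taylor_part_sums[OF assms(1), of 1 z] assms(2) by simp

lemma taylor_part_smult:
  assumes f: "line_holo (ball 0 1) f"
  shows "taylor_part f k (s *s z) = s ^ k * taylor_part f k z"
proof -
  define S where "S = {t. t *s (s *s z) \<in> ball 0 1}"
  define T where "T = {t. t *s z \<in> ball 0 1}"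
  have "(deriv ^^ k) (\<lambda>w. (\<lambda>t. f (t *s z)) (s * w)) 0 = s ^ k * (deriv ^^ k) (\<lambda>t. f (t *s z)) (s * 0)"
  proof (rule higher_deriv_compose_linear)
    show "(\<lambda>t. f (t *s z)) holomorphic_on T"
      unfolding T_def by (rule line_holo_line0[OF f])
    show "open S" "open T"
      using open_line[of "ball 0 1" 0 "s *s z"] open_line[of "ball 0 1" 0 z] by (simp_all add: S_def T_def)
    show "0 \<in> S" by (simp add: S_def)
    show "s * w \<in> T" if "w \<in> S" for w
      using that by (simp add: S_def T_def norm_mult mult_ac)
  qed
  then show ?thesis
    by (simp add: taylor_part_def mult.commute)
qed

text \<open>Cauchy's inequality on the circle of radius r in the direction of z, followed by
  homogeneity of degree k.\<close>

lemma taylor_part_bound: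
  fixes f :: "complex ^ 'n \<Rightarrow> complex"
  assumes f: "line_holo (ball 0 1) f" and r: "0 < r" "r < 1" and B: "\<And>z. norm z = r \<Longrightarrow> norm (f z) \<le> B"
  shows "norm (taylor_part f k z) \<le> B * (norm z / r) ^ k"
proof (cases "z = 0")
  case True
  \<comment> \<open>At the origin only k = 0 matters, where the claimed bound is B because 0 ^ 0 =
    1. An arbitrary unit direction v brings in the sphere of radius r.\<close>
  have "cmod (f 0) \<le> B"
  proof -
    define v :: "complex ^ 'n" where "v = axis undefined 1"
    have nv: "norm v = 1" by (simp add: v_def)
    have "norm ((deriv ^^ 0) (\<lambda>t. f (t *s v)) 0) \<le> fact 0 * B / r ^ 0"
    proof (rule Cauchy_inequality)
      have 1: "(\<lambda>t. f (t *s v)) holomorphic_on ball 0 1"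
        by (rule holomorphic_on_subset[OF line_holo_line0[OF f]]) (auto simp: nv)
      then show "(\<lambda>t. f (t *s v)) holomorphic_on ball 0 r"
        by (rule holomorphic_on_subset) (use r in auto)
      show "continuous_on (cball 0 r) (\<lambda>t. f (t *s v))"
        by (rule holomorphic_on_imp_continuous_on, rule holomorphic_on_subset[OF 1]) (use r in auto)
    qed (use r B nv in auto)
    then show ?thesis by simp
  qed
  then show ?thesis using True taylor_part_smult[OF f, of k 0 z]
    by (cases k) (auto simp: taylor_part_def)
next
  case False
  define v where "v = of_real (1 / norm z) *s z"
  have nv: "norm v = 1" using False by (simp add: v_def norm_divide)
  have "norm ((deriv ^^ k) (\<lambda>t. f (t *s v)) 0) \<le> fact k * B / r ^ k"
  proof (rule Cauchy_inequality)
    have 1: "(\<lambda>t. f (t *s v)) holomorphic_on ball 0 1"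
      by (rule holomorphic_on_subset[OF line_holo_line0[OF f]]) (auto simp: nv)
    then show "(\<lambda>t. f (t *s v)) holomorphic_on ball 0 r"
      by (rule holomorphic_on_subset) (use r in auto)
    show "continuous_on (cball 0 r) (\<lambda>t. f (t *s v))"
      by (rule holomorphic_on_imp_continuous_on, rule holomorphic_on_subset[OF 1]) (use r in auto)
  qed (use r B nv in auto)
  then have *: "norm (taylor_part f k v) \<le> B / r ^ k"
    by (simp add: taylor_part_def norm_divide field_simps)
  have "z = of_real (norm z) *s v" using False by (simp add: v_def vec_eq_iff)
  then have "taylor_part f k z = of_real (norm z) ^ k * taylor_part f k v"
    by (metis taylor_part_smult[OF f])
  then have "norm (taylor_part f k z) = norm z ^ k * norm (taylor_part f k v)"
    by (simp add: norm_mult norm_power)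
  also have "\<dots> \<le> norm z ^ k * (B / r ^ k)"
    by (intro mult_left_mono *) simp
  finally show ?thesis by (simp add: power_divide mult_ac)
qed

lemma line_holo_bounded_sphere:
  assumes "line_holo (ball 0 1) f" "r < 1"
  obtains B where "\<And>z. norm z \<le> r \<Longrightarrow> norm (f z) \<le> B" "B > 0"
proof -
  have "compact (f ` cball 0 r)"
    by (rule compact_continuous_image)
       (use assms in \<open>auto intro: continuous_on_subset[OF line_holo_continuous]\<close>)
  then obtain B where "\<And>w. w \<in> f ` cball 0 r \<Longrightarrow> norm w \<le> B" "B > 0"
    using compact_imp_bounded bounded_pos by metis
  then show ?thesis by (intro that[of B]) auto
qed

section \<open>Closure properties of holomorphy on lines\<close>

lemma line_holoI:
  assumes "continuous_on U f"
    and "\<And>a b. (\<lambda>t. f (a + t *s b)) holomorphic_on {t. a + t *s b \<in> U}"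
  shows "line_holo U f"
  using assms by (simp add: line_holo_def)

lemma line_holo_subset: "line_holo U f \<Longrightarrow> V \<subseteq> U \<Longrightarrow> line_holo V f"
  unfolding line_holo_def
  by (blast intro: continuous_on_subset holomorphic_on_subset)

lemma line_holo_cong: "(\<And>z. z \<in> U \<Longrightarrow> f z = g z) \<Longrightarrow> line_holo U f \<longleftrightarrow> line_holo U g"
  unfolding line_holo_def
  by (intro conj_cong continuous_on_cong all_cong1 holomorphic_cong) auto

lemma line_holo_const: "line_holo U (\<lambda>z. c)"
  by (auto simp: line_holo_def)

lemma line_holo_nth: "line_holo U (\<lambda>z. z $ i)"
  unfolding line_holo_def
  by (intro conjI allI continuous_on_component continuous_on_id) (simp, intro holomorphic_intros)

lemma line_holo_add: "line_holo U f \<Longrightarrow> line_holo U g \<Longrightarrow> line_holo U (\<lambda>z. f z + g z)"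
  unfolding line_holo_def
  by (elim conjE, intro conjI allI continuous_intros holomorphic_intros) auto

lemma line_holo_diff: "line_holo U f \<Longrightarrow> line_holo U g \<Longrightarrow> line_holo U (\<lambda>z. f z - g z)"
  unfolding line_holo_def
  by (elim conjE, intro conjI allI continuous_intros holomorphic_intros) auto

lemma line_holo_mult: "line_holo U f \<Longrightarrow> line_holo U g \<Longrightarrow> line_holo U (\<lambda>z. f z * g z)"
  unfolding line_holo_def
  by (elim conjE, intro conjI allI continuous_intros holomorphic_intros) auto

lemma line_holo_power: "line_holo U f \<Longrightarrow> line_holo U (\<lambda>z. f z ^ k)"
  unfolding line_holo_def
  by (elim conjE, intro conjI allI continuous_intros holomorphic_intros) auto

lemma line_holo_divide:
  "line_holo U f \<Longrightarrow> line_holo U g \<Longrightarrow> (\<And>z. z \<in> U \<Longrightarrow> g z \<noteq> 0) \<Longrightarrow> line_holo U (\<lambda>z. f z / g z)"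
  unfolding line_holo_def
  by (elim conjE, intro conjI allI continuous_intros holomorphic_intros) auto

lemma line_holo_sum:
  assumes "\<And>i. i \<in> A \<Longrightarrow> line_holo U (f i)"
  shows "line_holo U (\<lambda>z. \<Sum>i\<in>A. f i z)"
  using assms by (induction A rule: infinite_finite_induct) (auto intro: line_holo_const line_holo_add)

lemma line_holo_prod:
  assumes "\<And>i. i \<in> A \<Longrightarrow> line_holo U (f i)"
  shows "line_holo U (\<lambda>z. \<Prod>i\<in>A. f i z)"
  using assms by (induction A rule: infinite_finite_induct) (auto intro: line_holo_const line_holo_mult)

lemma line_holo_affine:
  fixes f :: "complex ^ 'n \<Rightarrow> complex"
  assumes f: "line_holo V f" and sub: "\<And>z. z \<in> U \<Longrightarrow> a + s *s z \<in> V"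
  shows "line_holo U (\<lambda>z. f (a + s *s z))"
proof (rule line_holoI)
  have c: "continuous_on U (\<lambda>z. a + s *s z)"
    by (intro continuous_on_add continuous_on_smult continuous_on_const continuous_on_id)
  have d: "continuous_on V f" using f unfolding line_holo_def by blast
  have e: "(\<lambda>z. a + s *s z) \<in> U \<rightarrow> V" using sub by blast
  show "continuous_on U (\<lambda>z. f (a + s *s z))"
    by (rule continuous_on_compose2[OF d c]) (use e in blast)
  fix c b :: "complex ^ 'n"
  have eq: "(a + s *s c) + t *s (s *s b) = a + s *s (c + t *s b)" for t
    by (simp add: vec_eq_iff distrib_left mult_ac)
  have h: "(\<lambda>t. f ((a + s *s c) + t *s (s *s b))) holomorphic_on {t. (a + s *s c) + t *s (s *s b) \<in> V}"
    using f unfolding line_holo_def by blast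
  show "(\<lambda>t. f (a + s *s (c + t *s b))) holomorphic_on {t. c + t *s b \<in> U}"
    using h unfolding eq by (rule holomorphic_on_subset) (use sub in blast)
qed

text \<open>Weierstrass's theorem on each slice: the slice of an open set is open by
  \<open>open_line\<close>, and locally uniform convergence restricts to it.\<close>

lemma line_holo_uniform_limit:
  fixes g :: "complex ^ 'n \<Rightarrow> complex"
  assumes U: "open U" and f: "\<And>n. line_holo U (f n)"
    and lim: "\<And>z. z \<in> U \<Longrightarrow> \<exists>d>0. uniform_limit (ball z d) f g sequentially"
  shows "line_holo U g"
proof (rule line_holoI)
  have "continuous (at z) g" if z: "z \<in> U" for z
  proof -
    obtain d where d: "d > 0" "uniform_limit (ball z d) f g sequentially" using lim[OF z] by blast
    obtain e where e: "e > 0" "ball z e \<subseteq> U" using U z by (meson open_contains_ball)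
    have "continuous_on (ball z (min d e)) (f n)" for n
    proof -
      have "ball z (min d e) \<subseteq> U" using e(2) by (auto simp: subset_iff)
      then show ?thesis using f[of n] unfolding line_holo_def by (blast intro: continuous_on_subset)
    qed
    then have "continuous_on (ball z (min d e)) g"
      by (intro uniform_limit_theorem[OF _ uniform_limit_on_subset[OF d(2)]] always_eventually) auto
    then show ?thesis using d(1) e(1) by (simp add: continuous_on_eq_continuous_at)
  qed
  then show "continuous_on U g" by (simp add: continuous_at_imp_continuous_on)
  fix a b :: "complex ^ 'n"
  show "(\<lambda>t. g (a + t *s b)) holomorphic_on {t. a + t *s b \<in> U}"
  proof (rule holomorphic_uniform_sequence[where f = "\<lambda>n t. f n (a + t *s b)"])
    show op: "open {t. a + t *s b \<in> U}" by (rule open_line[OF U])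
    show "(\<lambda>t. f n (a + t *s b)) holomorphic_on {t. a + t *s b \<in> U}" for n
      using f[of n] by (auto simp: line_holo_def)
    fix x assume x: "x \<in> {t. a + t *s b \<in> U}"
    then obtain d where d: "d > 0" "uniform_limit (ball (a + x *s b) d) f g sequentially"
      using lim by blast
    have "open {t. a + t *s b \<in> U \<inter> ball (a + x *s b) d}" by (rule open_line) (use U in auto)
    moreover have "x \<in> {t. a + t *s b \<in> U \<inter> ball (a + x *s b) d}" using x d by auto
    ultimately obtain e where e: "e > 0" "cball x e \<subseteq> {t. a + t *s b \<in> U \<inter> ball (a + x *s b) d}"
      by (meson open_contains_cball)
    have "uniform_limit (cball x e) (\<lambda>n t. f n (a + t *s b)) (\<lambda>t. g (a + t *s b)) sequentially"
      unfolding uniform_limit_iff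
    proof (intro allI impI)
      fix \<epsilon> :: real assume "\<epsilon> > 0"
      with d(2) have "\<forall>\<^sub>F n in sequentially. \<forall>z\<in>ball (a + x *s b) d. dist (f n z) (g z) < \<epsilon>"
        unfolding uniform_limit_iff by blast
      then show "\<forall>\<^sub>F n in sequentially. \<forall>t\<in>cball x e. dist (f n (a + t *s b)) (g (a + t *s b)) < \<epsilon>"
        by eventually_elim (use e in blast)
    qed
    then show "\<exists>d>0. cball x d \<subseteq> {t. a + t *s b \<in> U} \<and>
        uniform_limit (cball x d) (\<lambda>n t. f n (a + t *s b)) (\<lambda>t. g (a + t *s b)) sequentially"
      using e by blast
  qed
qed

section \<open>The Taylor parts are entire\<close>

lemma sums_tail_bound:
  fixes a :: "nat \<Rightarrow> 'a::banach"
  assumes a: "a sums s" and B: "\<And>k. norm (a k) \<le> B * q ^ k" and q: "0 \<le> q" "q \<le> 1/2" and "0 \<le> B"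
  shows "norm (s - (\<Sum>k<m. a k)) \<le> 2 * B * q ^ m"
proof -
  have 1: "(\<lambda>i. a (i + m)) sums (s - (\<Sum>k<m. a k))"
    by (rule sums_split_initial_segment[OF a])
  have g: "(\<lambda>i. (B * q ^ m) * q ^ i) sums ((B * q ^ m) * (1 / (1 - q)))"
    by (intro sums_mult geometric_sums) (use q in auto)
  have "norm (a (i + m)) \<le> (B * q ^ m) * q ^ i" for i
    using B[of "i + m"] by (simp add: power_add mult_ac)
  then have "norm (s - (\<Sum>k<m. a k)) \<le> (B * q ^ m) * (1 / (1 - q))"
    by (intro norm_sums_le[OF 1 g])
  also have "\<dots> \<le> (B * q ^ m) * 2"
    using q \<open>0 \<le> B\<close> by (intro mult_left_mono) (auto simp: field_simps)
  finally show ?thesis by (simp add: mult_ac)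
qed

lemma taylor_part_half_bound:
  assumes "line_holo (ball 0 1) f"
  obtains B where "B > 0" "\<And>k z. norm (taylor_part f k z) \<le> B * (2 * norm z) ^ k"
proof -
  obtain B where B: "\<And>z. norm z \<le> 1/2 \<Longrightarrow> norm (f z) \<le> B" "B > 0"
    using line_holo_bounded_sphere[OF assms, of "1/2"] by auto
  have "norm (taylor_part f k z) \<le> B * (2 * norm z) ^ k" for k z
    using taylor_part_bound[OF assms, of "1/2" B k z] B by (simp add: mult.commute)
  with B that show ?thesis by blast
qed

text \<open>The k-th part is the limit, as t tends to 0, of (f(t z) minus its parts of degree below
  k) / t^k. For small t the ball of any radius R is mapped into the unit ball, so the limit is
  uniform there, and the lower parts are entire by induction.\<close>

lemma taylor_part_entire:
  fixes f :: "complex ^ 'n \<Rightarrow> complex"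
  assumes f: "line_holo (ball 0 1) f"
  shows "line_holo UNIV (taylor_part f k)"
proof (induction k rule: less_induct)
  case (less k)
  obtain B where B: "B > 0" "\<And>k z. norm (taylor_part f k z) \<le> B * (2 * norm z) ^ k"
    using taylor_part_half_bound[OF f] by blast
  have part: "line_holo (ball 0 R) (taylor_part f k)" if R: "R \<ge> 1" for R :: real
  proof -
    \<comment> \<open>This choice gives \<open>2 * R * t n \<le> 1/2\<close>, the ratio required by
      \<open>sums_tail_bound\<close>, and at the same time moves \<open>t n *s z\<close> into the
      unit ball.\<close>
    define t where "t n = 1 / (4 * R * Suc n)" for n
    have t0: "t n > 0" and tR: "2 * R * t n \<le> 1/2" for n
    proof -
      show "t n > 0" using R by (simp add: t_def)
      have "2 * R * t n = 1 / 2 * (1 / Suc n)"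
        using R by (simp add: t_def) (simp add: add_divide_distrib[symmetric] divide_simps)
      also have "\<dots> \<le> 1 / 2" by simp
      finally show "2 * R * t n \<le> 1/2" .
    qed
    define g where "g n z = (f (of_real (t n) *s z) - (\<Sum>j<k. taylor_part f j z * of_real (t n) ^ j)) /
                   of_real (t n) ^ k" for n z
    have tz: "norm (of_real (t n) *s z :: complex^'n) < 1" if "norm z < R" for n z
    proof -
      have "t n * norm z \<le> t n * R" using that t0[of n] by (intro mult_left_mono) auto
      also have "\<dots> < 1" using tR[of n] by (simp add: mult_ac)
      finally show ?thesis using t0[of n] by simp
    qed
    show ?thesis
    proof (rule line_holo_uniform_limit)
      show "line_holo (ball 0 R) (g n)" for n
        unfolding g_def
      proof (intro line_holo_divide line_holo_diff line_holo_sum line_holo_mult line_holo_const)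
        show "line_holo (ball 0 R) (\<lambda>z. f (of_real (t n) *s z))"
          using line_holo_affine[OF f, of "ball 0 R" 0 "of_real (t n)"] tz by simp
        show "line_holo (ball 0 R) (taylor_part f j)" if "j \<in> {..<k}" for j
          using line_holo_subset[OF less.IH] that by auto
        show "complex_of_real (t n) ^ k \<noteq> 0" using t0[of n] by simp
      qed
      \<comment> \<open>The remainder starts in degree k + 1, so one factor \<open>t n\<close>
        survives the division by its k-th power.\<close>
      have est: "norm (g n z - taylor_part f k z) \<le> 2 * B * (2 * R) ^ Suc k * t n" if z: "norm z < R" for n z
      proof -
        have "norm (f (of_real (t n) *s z) - (\<Sum>j<Suc k. taylor_part f j z * of_real (t n) ^ j))
            \<le> 2 * B * (2 * R * t n) ^ Suc k"
        proof (rule sums_tail_bound)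
          show "(\<lambda>j. taylor_part f j z * of_real (t n) ^ j) sums f (of_real (t n) *s z)"
            by (rule taylor_part_sums[OF f tz[OF z]])
          show "norm (taylor_part f j z * of_real (t n) ^ j) \<le> B * (2 * R * t n) ^ j" for j
          proof -
            have "norm (taylor_part f j z * of_real (t n) ^ j) \<le> (B * (2 * norm z) ^ j) * t n ^ j"
              unfolding norm_mult norm_power using t0[of n] B(1) by (intro mult_mono B(2)) auto
            also have "\<dots> \<le> (B * (2 * R) ^ j) * t n ^ j"
              using z B(1) t0[of n] by (intro mult_right_mono mult_left_mono power_mono) auto
            also have "\<dots> = B * (2 * R * t n) ^ j" by (simp add: power_mult_distrib)
            finally show ?thesis .
          qed
          show "0 \<le> 2 * R * t n" "2 * R * t n \<le> 1/2" "0 \<le> B" using tR[of n] t0[of n] R B(1) by auto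
        qed
        then have "norm (f (of_real (t n) *s z) - (\<Sum>j<Suc k. taylor_part f j z * of_real (t n) ^ j)) / t n ^ k
            \<le> 2 * B * (2 * R * t n) ^ Suc k / t n ^ k"
          using t0[of n] by (intro divide_right_mono) auto
        also have "2 * B * (2 * R * t n) ^ Suc k / t n ^ k = 2 * B * (2 * R) ^ Suc k * t n"
          using t0[of n] by (simp add: power_mult_distrib)
        also have "norm (f (of_real (t n) *s z) - (\<Sum>j<Suc k. taylor_part f j z * of_real (t n) ^ j)) / t n ^ k
            = norm (g n z - taylor_part f k z)"
        proof -
          have "g n z - taylor_part f k z
             = (f (of_real (t n) *s z) - (\<Sum>j<Suc k. taylor_part f j z * of_real (t n) ^ j)) / of_real (t n) ^ k"
            using t0[of n] unfolding g_def by (simp add: diff_divide_distrib add_divide_distrib)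
          then show ?thesis using t0[of n] by (simp add: norm_divide norm_power)
        qed
        finally show ?thesis .
      qed
      have tlim: "(\<lambda>n. 2 * B * (2 * R) ^ Suc k * t n) \<longlonglongrightarrow> 0"
      proof -
        have "(\<lambda>n. (2 * B * (2 * R) ^ Suc k / (4 * R)) * inverse (real (Suc n))) \<longlonglongrightarrow> 0"
          by (intro tendsto_mult_right_zero LIMSEQ_inverse_real_of_nat)
        moreover have "2 * B * (2 * R) ^ Suc k * t n =
            (2 * B * (2 * R) ^ Suc k / (4 * R)) * inverse (real (Suc n))" for n
          unfolding t_def by (simp only: divide_inverse inverse_mult_distrib mult_ac mult_1_left)
        ultimately show ?thesis by simp
      qed
      fix z assume z: "z \<in> ball (0 :: complex^'n) R"
      have "uniform_limit (ball z (R - norm z)) g (taylor_part f k) sequentially"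
      proof (rule uniform_limitI)
        fix e :: real assume "e > 0"
        with tlim have "\<forall>\<^sub>F n in sequentially. 2 * B * (2 * R) ^ Suc k * t n < e"
          by (rule order_tendstoD)
        then show "\<forall>\<^sub>F n in sequentially. \<forall>x\<in>ball z (R - norm z). dist (g n x) (taylor_part f k x) < e"
        proof eventually_elim
          case (elim n)
          have "norm x < R" if "x \<in> ball z (R - norm z)" for x
            using that norm_triangle_ineq2[of x z] by (simp add: dist_norm norm_minus_commute)
          then show ?case using le_less_trans[OF est elim] by (auto simp: dist_norm)
        qed
      qed
      then show "\<exists>d>0. uniform_limit (ball z d) g (taylor_part f k) sequentially"
        using z by (intro exI[of _ "R - norm z"]) auto
    qed simp
  qed
  show ?case
  proof (rule line_holoI)
    have "continuous (at z) (taylor_part f k)" for z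
    proof -
      have "continuous_on (ball 0 (1 + norm z)) (taylor_part f k)"
        using part[of "1 + norm z"] by (simp add: line_holo_def)
      then show ?thesis by (simp add: continuous_on_eq_continuous_at)
    qed
    then show "continuous_on UNIV (taylor_part f k)" by (simp add: continuous_at_imp_continuous_on)
    fix a b :: "complex^'n"
    have "(\<lambda>t. taylor_part f k (a + t *s b)) field_differentiable at x" for x
    proof -
      define R where "R = 1 + norm (a + x *s b)"
      have "(\<lambda>t. taylor_part f k (a + t *s b)) holomorphic_on {t. a + t *s b \<in> ball 0 R}"
        using part[of R] by (simp add: line_holo_def R_def)
      moreover have "open {t. a + t *s b \<in> ball 0 R}" by (rule open_line) auto
      moreover have "x \<in> {t. a + t *s b \<in> ball 0 R}" by (simp add: R_def)
      ultimately show ?thesis using holomorphic_on_imp_differentiable_at by blast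
    qed
    then show "(\<lambda>t. taylor_part f k (a + t *s b)) holomorphic_on {t. a + t *s b \<in> UNIV}"
      by (auto simp: holomorphic_on_def intro: field_differentiable_at_within)
  qed
qed

section \<open>Polynomials in several complex variables\<close>

definition monomial :: "('n \<Rightarrow> nat) \<Rightarrow> complex ^ 'n \<Rightarrow> complex" where
  "monomial \<alpha> z = (\<Prod>i\<in>UNIV. (z $ i) ^ \<alpha> i)"

definition polys :: "(complex ^ 'n \<Rightarrow> complex) set" where
  "polys = cfun.span (range monomial)"

lemma polys_monomial: "monomial \<alpha> \<in> polys"
  by (simp add: polys_def cfun.span_base)

lemma polys_add: "p \<in> polys \<Longrightarrow> q \<in> polys \<Longrightarrow> (\<lambda>z. p z + q z) \<in> polys"
  using cfun.span_add[of p "range monomial" q] by (simp add: polys_def plus_fun_def)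

lemma polys_scale: "p \<in> polys \<Longrightarrow> (\<lambda>z. c * p z) \<in> polys"
  using cfun.span_scale[of p "range monomial" c] by (simp add: polys_def scale_fun_def)

lemma polys_const: "(\<lambda>z. c) \<in> polys"
  using polys_scale[OF polys_monomial[of "\<lambda>_. 0"], of c] by (simp add: monomial_def)

lemma polys_sum: "(\<And>i. i \<in> A \<Longrightarrow> p i \<in> polys) \<Longrightarrow> (\<lambda>z. \<Sum>i\<in>A. p i z) \<in> polys"
  by (induction A rule: infinite_finite_induct) (auto intro: polys_const polys_add)

lemma polys_induct [consumes 1, case_names zero add]:
  assumes "p \<in> polys" "P (\<lambda>z. 0)"
    and "\<And>c \<alpha> p. p \<in> polys \<Longrightarrow> P p \<Longrightarrow> P (\<lambda>z. c * monomial \<alpha> z + p z)"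
  shows "P p"
proof -
  have "p \<in> polys \<and> P p"
    using assms(1) unfolding polys_def
  proof (induction rule: cfun.span_induct_alt)
    case base
    then show ?case using assms(2) cfun.span_zero by (simp add: zero_fun_def)
  next
    case (step c x y)
    then obtain \<alpha> where x: "x = monomial \<alpha>" by blast
    have "scale_fun c x + y \<in> cfun.span (range monomial)"
      by (rule cfun.span_add[OF cfun.span_scale[OF cfun.span_base]]) (use step in auto)
    moreover have "P (\<lambda>z. c * monomial \<alpha> z + y z)"
      using assms(3)[of y c \<alpha>] step by (simp add: polys_def)
    moreover have "scale_fun c x + y = (\<lambda>z. c * monomial \<alpha> z + y z)"
      by (simp add: plus_fun_def scale_fun_def x)
    ultimately show ?case by simp
  qed
  then show ?thesis by blast
qed

lemma monomial_nth: "z $ i * monomial \<alpha> z = monomial (\<alpha>(i := Suc (\<alpha> i))) z"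
proof -
  have "monomial \<beta> z = (z $ i) ^ \<beta> i * (\<Prod>j\<in>UNIV - {i}. (z $ j) ^ \<beta> j)" for \<beta>
    unfolding monomial_def by (simp add: prod.remove[of UNIV i])
  then show ?thesis by (simp add: mult_ac)
qed

lemma polys_nth_mult: "p \<in> polys \<Longrightarrow> (\<lambda>z. z $ i * p z) \<in> polys"
proof (induction rule: polys_induct)
  case (add c \<alpha> p)
  have "(\<lambda>z. c * monomial (\<alpha>(i := Suc (\<alpha> i))) z + z $ i * p z) \<in> polys"
    by (intro polys_add polys_scale polys_monomial add)
  then show ?case unfolding monomial_nth[symmetric] by (simp add: algebra_simps)
qed (use polys_const[of 0] in simp)

lemma polys_nth_power_mult: "p \<in> polys \<Longrightarrow> (\<lambda>z. (z $ i) ^ m * p z) \<in> polys"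
proof (induction m)
  case (Suc m)
  from polys_nth_mult[OF Suc.IH[OF Suc.prems], of i] show ?case by (simp add: mult_ac)
qed simp

lemma polys_mult:
  assumes "p \<in> polys" "q \<in> polys"
  shows "(\<lambda>z. p z * q z) \<in> polys"
  using assms(1)
proof (induction rule: polys_induct)
  case (add c \<alpha> p)
  have "(\<lambda>z. (\<Prod>i\<in>A. (z $ i) ^ \<alpha> i) * q z) \<in> polys" if "finite A" for A
    using that
  proof (induction A)
    case (insert i A)
    from polys_nth_power_mult[OF insert.IH, of i "\<alpha> i"] insert.hyps show ?case by (simp add: mult_ac)
  qed (use assms in simp)
  from polys_add[OF polys_scale[OF this[of UNIV], of c] add.IH] show ?case
    by (simp add: monomial_def algebra_simps)
qed (use polys_const[of 0] in simp)

lemma polys_nth: "(\<lambda>z. z $ i) \<in> polys"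
  using polys_nth_mult[OF polys_const[of 1]] by simp

lemma polys_power: "p \<in> polys \<Longrightarrow> (\<lambda>z. p z ^ k) \<in> polys"
  by (induction k) (auto intro: polys_const polys_mult)

lemma polys_line_holo:
  assumes "p \<in> polys"
  shows "line_holo U p"
  using assms
proof (induction rule: polys_induct)
  case zero
  show ?case by (rule line_holo_const)
next
  case (add c \<alpha> p)
  show ?case unfolding monomial_def
    by (intro line_holo_add line_holo_mult line_holo_const line_holo_prod line_holo_power line_holo_nth add)
qed

lemma finite_multiindices: "finite {\<alpha> :: 'n::finite \<Rightarrow> nat. (\<Sum>i\<in>UNIV. \<alpha> i) = k}"
proof (rule finite_subset)
  show "{\<alpha> :: 'n \<Rightarrow> nat. (\<Sum>i\<in>UNIV. \<alpha> i) = k} \<subseteq> Pi\<^sub>E UNIV (\<lambda>_. {..k})"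
    by (auto intro!: member_le_sum)
qed (auto intro: finite_PiE)

lemma homogeneous_polynomial_polys:
  assumes "homogeneous_polynomial k p"
  shows "p \<in> polys"
proof -
  from assms obtain c where c: "\<And>z. p z = (\<Sum>\<alpha> | (\<Sum>i\<in>UNIV. \<alpha> i) = k. c \<alpha> * (\<Prod>i\<in>UNIV. (z $ i) ^ \<alpha> i))"
    unfolding homogeneous_polynomial_def by blast
  have "(\<lambda>z. \<Sum>\<alpha> | (\<Sum>i\<in>UNIV. \<alpha> i) = k. c \<alpha> * monomial \<alpha> z) \<in> polys"
    by (intro polys_sum polys_scale polys_monomial)
  moreover have "p = (\<lambda>z. \<Sum>\<alpha> | (\<Sum>i\<in>UNIV. \<alpha> i) = k. c \<alpha> * monomial \<alpha> z)"
    unfolding monomial_def using c by blast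
  ultimately show ?thesis by simp
qed

lemma monomial_smult: "monomial \<alpha> (s *s z) = s ^ (\<Sum>i\<in>UNIV. \<alpha> i) * monomial \<alpha> z"
  by (simp add: monomial_def power_mult_distrib prod.distrib power_sum)

lemma homogeneous_polynomial_smult:
  assumes "homogeneous_polynomial k p"
  shows "p (s *s z) = s ^ k * p z"
proof -
  from assms obtain c where c: "\<And>z. p z = (\<Sum>\<alpha> | (\<Sum>i\<in>UNIV. \<alpha> i) = k. c \<alpha> * monomial \<alpha> z)"
    unfolding homogeneous_polynomial_def monomial_def by blast
  show ?thesis unfolding c sum_distrib_left by (intro sum.cong refl) (auto simp: monomial_smult)
qed

text \<open>For fixed z both sides of the homogeneity equation are polynomials in s. Comparing the
  coefficients of s^k shows that p(z) equals the sum of its monomials of total degree k.\<close>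

lemma polys_homogeneous:
  assumes p: "p \<in> polys" and hom: "\<And>s z. p (s *s z) = s ^ k * p z"
  shows "homogeneous_polynomial k p"
proof -
  have "\<exists>A c. finite A \<and> (\<forall>z. p z = (\<Sum>\<alpha>\<in>A. c \<alpha> * monomial \<alpha> z))"
    using p
  proof (induction rule: polys_induct)
    case zero
    then show ?case by (intro exI[of _ "{}"]) auto
  next
    case (add c \<alpha> p)
    then obtain A d where A: "finite A" "\<And>z. p z = (\<Sum>\<alpha>\<in>A. d \<alpha> * monomial \<alpha> z)" by blast
    define d' where "d' \<gamma> = (if \<gamma> = \<alpha> then c else 0) + (if \<gamma> \<in> A then d \<gamma> else 0)" for \<gamma>
    have "c * monomial \<alpha> z + p z = (\<Sum>\<gamma>\<in>insert \<alpha> A. d' \<gamma> * monomial \<gamma> z)" for z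
    proof -
      have "(\<Sum>\<gamma>\<in>insert \<alpha> A. d' \<gamma> * monomial \<gamma> z) =
        (\<Sum>\<gamma>\<in>insert \<alpha> A. (if \<gamma> = \<alpha> then c * monomial \<gamma> z else 0)) +
        (\<Sum>\<gamma>\<in>insert \<alpha> A. (if \<gamma> \<in> A then d \<gamma> * monomial \<gamma> z else 0))"
        unfolding sum.distrib[symmetric] by (intro sum.cong) (auto simp: d'_def algebra_simps)
      also have "(\<Sum>\<gamma>\<in>insert \<alpha> A. (if \<gamma> = \<alpha> then c * monomial \<gamma> z else 0)) = c * monomial \<alpha> z"
        using A(1) by (subst sum.delta) auto
      also have "(\<Sum>\<gamma>\<in>insert \<alpha> A. (if \<gamma> \<in> A then d \<gamma> * monomial \<gamma> z else 0)) = p z"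
        unfolding A(2) using A(1) by (intro sum.mono_neutral_cong_right) auto
      finally show ?thesis by simp
    qed
    then show ?case using A(1) by (intro exI[of _ "insert \<alpha> A"] exI[of _ d']) auto
  qed
  then obtain A c where A: "finite A" "\<And>z. p z = (\<Sum>\<alpha>\<in>A. c \<alpha> * monomial \<alpha> z)" by blast
  define deg :: "('a \<Rightarrow> nat) \<Rightarrow> nat" where "deg \<alpha> = (\<Sum>i\<in>UNIV. \<alpha> i)" for \<alpha>
  define K where "K = Max (insert k (deg ` A))"
  have K: "k \<le> K" "\<And>\<alpha>. \<alpha> \<in> A \<Longrightarrow> deg \<alpha> \<le> K" using A(1) by (auto simp: K_def)
  have pz: "p z = (\<Sum>\<alpha> | \<alpha> \<in> A \<and> deg \<alpha> = k. c \<alpha> * monomial \<alpha> z)" for z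
  proof -
    have "(\<Sum>m\<le>K. (\<Sum>\<alpha> | \<alpha> \<in> A \<and> deg \<alpha> = m. c \<alpha> * monomial \<alpha> z) * s ^ m) =
          (\<Sum>m\<le>K. (if m = k then p z else 0) * s ^ m)" for s
    proof -
      have "(\<Sum>m\<le>K. (\<Sum>\<alpha> | \<alpha> \<in> A \<and> deg \<alpha> = m. c \<alpha> * monomial \<alpha> z) * s ^ m) =
            (\<Sum>m\<le>K. (\<Sum>\<alpha> | \<alpha> \<in> A \<and> deg \<alpha> = m. c \<alpha> * monomial \<alpha> (s *s z)))"
        unfolding sum_distrib_right
        by (intro sum.cong refl) (auto simp: monomial_smult deg_def)
      also have "\<dots> = p (s *s z)"
        unfolding A(2) using A(1) K(2) by (intro sum.group) auto
      also have "\<dots> = (\<Sum>m\<le>K. (if m = k then p z * s ^ m else 0))"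
        using K(1) by (simp add: hom mult.commute)
      also have "\<dots> = (\<Sum>m\<le>K. (if m = k then p z else 0) * s ^ m)"
        by (intro sum.cong) auto
      finally show ?thesis .
    qed
    then have "\<forall>m\<le>K. (\<Sum>\<alpha> | \<alpha> \<in> A \<and> deg \<alpha> = m. c \<alpha> * monomial \<alpha> z) = (if m = k then p z else 0)"
      by (subst polyfun_eq_coeffs[symmetric]) auto
    then show ?thesis using K(1) by auto
  qed
  have "p z = (\<Sum>\<alpha> | (\<Sum>i\<in>UNIV. \<alpha> i) = k. (if \<alpha> \<in> A then c \<alpha> else 0) * (\<Prod>i\<in>UNIV. (z $ i) ^ \<alpha> i))" for z
    unfolding pz
    by (intro sum.mono_neutral_cong_left) (auto simp: finite_multiindices deg_def monomial_def)
  then show ?thesis unfolding homogeneous_polynomial_def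
    by (intro exI[of _ "\<lambda>\<alpha>. if \<alpha> \<in> A then c \<alpha> else 0"] allI)
qed

section \<open>Homogeneous entire functions are polynomials\<close>

lemma root_of_unity_orthogonality:
  fixes j l M :: nat
  defines "e m \<equiv> exp (2 * of_real pi * \<i> * of_nat m / of_nat M)"
  assumes "j < M" "l < M"
  shows "(\<Sum>m<M. e m ^ l / e m ^ j) = (if l = j then of_nat M else 0)"
proof -
  define r where "r = e l / e j"
  have M: "M > 0" using assms by simp
  have nz: "e m \<noteq> 0" for m by (simp add: e_def)
  have ep: "e m ^ l = e l ^ m" for m l
    unfolding e_def exp_of_nat_mult[symmetric] by (simp add: mult_ac)
  have "r ^ m = e m ^ l / e m ^ j" for m
    by (simp add: r_def power_divide ep)
  then have *: "(\<Sum>m<M. e m ^ l / e m ^ j) = (\<Sum>m<M. r ^ m)" by simp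
  show ?thesis
  proof (cases "l = j")
    case True
    then have "r = 1" using nz by (simp add: r_def)
    then show ?thesis unfolding * using True by simp
  next
    case False
    have "e l \<noteq> e j"
      using complex_root_unity_eq[of M l j] M False assms by (simp add: e_def)
    then have "r \<noteq> 1" using nz by (simp add: r_def)
    moreover have "e m ^ M = 1" for m
    proof -
      have "of_nat M * (2 * of_real pi * \<i> * of_nat m / of_nat M) = of_nat m * (2 * of_real pi * \<i>)"
        using M by simp
      then show ?thesis unfolding e_def exp_of_nat_mult[symmetric]
        using exp_integer_2pi[of "of_nat m"] by (simp add: mult_ac)
    qed
    then have "r ^ M = 1" by (simp add: r_def power_divide)
    ultimately show ?thesis unfolding * using False by (simp add: geometric_sum)
  qed
qed

text \<open>Induction on a set S of variables that determine q. The coefficients of q as a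
  polynomial in one variable are linear combinations of values of q, hence again separately
  polynomial with the same degree bound k, and they depend on one variable less.\<close>

lemma separately_polynomial_polys:
  fixes q :: "complex ^ 'n \<Rightarrow> complex"
  assumes "finite S"
    and "\<And>z i. \<exists>c. \<forall>x. q (z + x *s axis i 1) = (\<Sum>l\<le>k. c l * x ^ l)"
    and "\<And>z w. (\<And>i. i \<in> S \<Longrightarrow> z $ i = w $ i) \<Longrightarrow> q z = q w"
  shows "q \<in> polys"
  using assms
proof (induction S arbitrary: q)
  case empty
  have "q = (\<lambda>z. q 0)" using empty(2)[of _ 0] by blast
  then show ?case using polys_const by metis
next
  case (insert i S)
  define e where "e m = exp (2 * of_real pi * \<i> * of_nat m / of_nat (Suc k))" for m
  define upd where "upd z x = z + (x - z $ i) *s axis i 1" for z :: "complex ^ 'n" and x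
  have upd_nth: "upd z x $ j = (if j = i then x else z $ j)" for z x j
    by (auto simp: upd_def axis_def)
  \<comment> \<open>Inverse discrete Fourier transform over the roots of unity of order k + 1:
    \<open>C j\<close> is the coefficient of the j-th power of the i-th variable.\<close>
  define C where "C j z = (\<Sum>m<Suc k. q (upd z (e m)) / e m ^ j) / of_nat (Suc k)" for j z
  have expand: "q z = (\<Sum>j\<le>k. (z $ i) ^ j * C j z)" for z
  proof -
    obtain c where c: "\<And>x. q (upd z 0 + x *s axis i 1) = (\<Sum>l\<le>k. c l * x ^ l)"
      using insert.prems(1)[of "upd z 0" i] by blast
    have u: "upd z 0 + x *s axis i 1 = upd z x" for x
      by (auto simp: vec_eq_iff upd_nth axis_def)
    have "C j z = c j" if "j \<le> k" for j
    proof -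
      have "(\<Sum>m<Suc k. q (upd z (e m)) / e m ^ j) = (\<Sum>m<Suc k. \<Sum>l\<le>k. c l * (e m ^ l / e m ^ j))"
        by (simp add: c[unfolded u] sum_divide_distrib)
      also have "\<dots> = (\<Sum>l\<le>k. c l * (\<Sum>m<Suc k. e m ^ l / e m ^ j))"
        unfolding sum_distrib_left by (rule sum.swap)
      also have "\<dots> = (\<Sum>l\<le>k. c l * (if l = j then of_nat (Suc k) else 0))"
        using that by (intro sum.cong refl arg_cong2[where f = "(*)"])
          (simp only: e_def atMost_iff, rule root_of_unity_orthogonality, auto)
      also have "\<dots> = (\<Sum>l\<le>k. if l = j then c l * of_nat (Suc k) else 0)"
        by (intro sum.cong) auto
      also have "\<dots> = c j * of_nat (Suc k)" using that by simp
      finally show ?thesis by (simp add: C_def del: of_nat_Suc)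
    qed
    moreover have "q z = (\<Sum>l\<le>k. c l * (z $ i) ^ l)"
    proof -
      have "upd z (z $ i) = z" by (simp add: upd_def)
      then show ?thesis using c[of "z $ i"] unfolding u by simp
    qed
    ultimately show ?thesis by (simp add: mult.commute)
  qed
  have "C j \<in> polys" for j
  proof (rule insert.IH)
    fix z w :: "complex ^ 'n" assume "\<And>i. i \<in> S \<Longrightarrow> z $ i = w $ i"
    then have "q (upd z x) = q (upd w x)" for x
      by (intro insert.prems(2)) (auto simp: upd_nth)
    then show "C j z = C j w" by (simp add: C_def)
  next
    fix z :: "complex ^ 'n" and i'
    show "\<exists>c. \<forall>x. C j (z + x *s axis i' 1) = (\<Sum>l\<le>k. c l * x ^ l)"
    proof (cases "i' = i")
      case True
      then have "upd (z + x *s axis i' 1) y = upd z y" for x y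
        by (auto simp: vec_eq_iff upd_nth axis_def)
      then have "C j (z + x *s axis i' 1) = C j z" for x by (simp add: C_def)
      moreover have "C j z = (\<Sum>l\<le>k. (if l = 0 then C j z else 0) * x ^ l)" for x
      proof -
        have "(\<Sum>l\<le>k. (if l = 0 then C j z else 0) * x ^ l) = (\<Sum>l\<le>k. if l = 0 then C j z else 0)"
          by (intro sum.cong) auto
        then show ?thesis by simp
      qed
      ultimately show ?thesis by (intro exI[of _ "\<lambda>l. if l = 0 then C j z else 0"]) metis
    next
      case False
      then have u: "upd (z + x *s axis i' 1) y = upd z y + x *s axis i' 1" for x y
        by (auto simp: vec_eq_iff upd_nth axis_def)
      obtain c where c: "\<And>y x. q (upd z y + x *s axis i' 1) = (\<Sum>l\<le>k. c y l * x ^ l)"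
        using insert.prems(1)[of "upd z _" i'] by metis
      have "C j (z + x *s axis i' 1) = (\<Sum>l\<le>k. ((\<Sum>m<Suc k. c (e m) l / e m ^ j) / of_nat (Suc k)) * x ^ l)" for x
      proof -
        have "(\<Sum>m<Suc k. (\<Sum>l\<le>k. c (e m) l * x ^ l) / e m ^ j) = (\<Sum>m<Suc k. \<Sum>l\<le>k. c (e m) l / e m ^ j * x ^ l)"
          by (simp add: sum_divide_distrib)
        also have "\<dots> = (\<Sum>l\<le>k. \<Sum>m<Suc k. c (e m) l / e m ^ j * x ^ l)" by (rule sum.swap)
        also have "\<dots> = (\<Sum>l\<le>k. (\<Sum>m<Suc k. c (e m) l / e m ^ j) * x ^ l)" by (simp only: sum_distrib_right)
        finally show ?thesis unfolding C_def u c by (simp only: sum_divide_distrib sum_distrib_right times_divide_eq_left)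
      qed
      then show ?thesis
        by (intro exI[of _ "\<lambda>l. (\<Sum>m<Suc k. c (e m) l / e m ^ j) / of_nat (Suc k)"] allI)
    qed
  qed
  then have "(\<lambda>z. \<Sum>j\<le>k. (z $ i) ^ j * C j z) \<in> polys"
    by (intro polys_sum polys_nth_power_mult)
  moreover have "q = (\<lambda>z. \<Sum>j\<le>k. (z $ i) ^ j * C j z)" using expand by blast
  ultimately show ?case by simp
qed

text \<open>Homogeneity bounds the growth of p by the k-th power of the norm, so Liouville's theorem
  makes p a polynomial of degree at most k along every coordinate direction. Separate polynomiality
  then gives joint polynomiality.\<close>

lemma entire_homogeneous_polynomial:
  fixes p :: "complex ^ 'n \<Rightarrow> complex"
  assumes p: "line_holo UNIV p" and hom: "\<And>s z. p (s *s z) = s ^ k * p z"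
  shows "homogeneous_polynomial k p"
proof (rule polys_homogeneous[OF _ hom])
  obtain B where B: "\<And>z. norm z \<le> 1/2 \<Longrightarrow> norm (p z) \<le> B" "B > 0"
    using line_holo_bounded_sphere[OF line_holo_subset[OF p], of "1/2"] by auto
  have bd: "norm (p z) \<le> B * (2 * norm z) ^ k" if "z \<noteq> 0" for z
  proof -
    define v where "v = of_real (1 / (2 * norm z)) *s z"
    have "norm v \<le> 1/2" using that by (simp add: v_def norm_divide)
    have "z = of_real (2 * norm z) *s v" using that by (simp add: v_def vec_eq_iff)
    then have "p z = of_real (2 * norm z) ^ k * p v" by (metis hom)
    then have "norm (p z) = (2 * norm z) ^ k * norm (p v)" by (simp add: norm_mult norm_power)
    also have "\<dots> \<le> (2 * norm z) ^ k * B" using B(1)[OF \<open>norm v \<le> 1/2\<close>] by (intro mult_left_mono) auto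
    finally show ?thesis by (simp add: mult.commute)
  qed
  have "\<exists>c. \<forall>x. p (z + x *s axis i 1) = (\<Sum>l\<le>k. c l * x ^ l)" for z i
  proof -
    have "p (z + x *s axis i 1) = (\<Sum>l\<le>k. (deriv ^^ l) (\<lambda>x. p (z + x *s axis i 1)) 0 / fact l * x ^ l)" for x
    proof (rule Liouville_polynomial)
      show "(\<lambda>x. p (z + x *s axis i 1)) holomorphic_on UNIV"
        using p unfolding line_holo_def by auto
      \<comment> \<open>For such x the point \<open>z + x *s axis i 1\<close> is nonzero and has
        norm at most 2 |x|; this is where the factor 4^k comes from.\<close>
      fix x :: complex assume x: "1 + norm z \<le> norm x"
      have n: "norm (z + x *s axis i 1) \<le> norm z + norm x"
        using norm_triangle_ineq[of z "x *s axis i 1"] by simp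
      have "norm (x *s (axis i 1 :: complex ^ 'n)) - norm z \<le> norm (z + x *s axis i 1)"
        by (metis add.commute norm_diff_ineq)
      then have "z + x *s axis i 1 \<noteq> 0" using x by auto
      from bd[OF this] have "norm (p (z + x *s axis i 1)) \<le> B * (2 * norm (z + x *s axis i 1)) ^ k" .
      also have "\<dots> \<le> B * (2 * (2 * norm x)) ^ k"
        using n x B(2) by (intro mult_left_mono power_mono) auto
      finally show "norm (p (z + x *s axis i 1)) \<le> (B * 4 ^ k) * norm x ^ k"
        by (simp add: power_mult_distrib mult_ac)
    qed
    then show ?thesis
      by (intro exI[of _ "\<lambda>l. (deriv ^^ l) (\<lambda>x. p (z + x *s axis i 1)) 0 / fact l"] allI)
  qed
  then show "p \<in> polys"
    by (rule separately_polynomial_polys[of "UNIV :: 'n set" p k, OF finite])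
      (metis UNIV_I vec_eq_iff)
qed

lemma taylor_part_homogeneous:
  assumes "line_holo (ball 0 1) f"
  shows "homogeneous_polynomial k (taylor_part f k)"
  using entire_homogeneous_polynomial[OF taylor_part_entire[OF assms]] taylor_part_smult[OF assms] by blast

section \<open>Uniqueness of homogeneous expansions, complex differentiability\<close>

lemma sums_eq_imp_coeffs_eq:
  fixes a b :: "nat \<Rightarrow> complex"
  assumes "\<And>t. norm t < r \<Longrightarrow> (\<lambda>k. a k * t ^ k) sums g t" "\<And>t. norm t < r \<Longrightarrow> (\<lambda>k. b k * t ^ k) sums g t" "0 < r"
  shows "a k = b k"
proof -
  have s: "(\<lambda>k. (a k - b k) * (t - 0) ^ k) sums 0" if "norm (t - 0) < r" for t
    using sums_diff[OF assms(1)[of t] assms(2)[of t]] that by (simp add: left_diff_distrib)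
  show ?thesis
  proof (rule ccontr)
    assume ne: "a k \<noteq> b k"
    have "a 0 = b 0" using s[of 0] assms(3) by simp
    with ne have "k > 0" by (cases k) auto
    obtain u where u: "0 < u" "\<And>z::complex. z \<in> cball 0 u - {0} \<Longrightarrow> (\<lambda>_. 0::complex) z \<noteq> 0"
      using powser_0_nonzero[OF assms(3) s, of k] ne \<open>k > 0\<close> by auto
    show False using u(2)[of "of_real u"] u(1) by simp
  qed
qed

text \<open>This resolves the definite description in \<open>homogeneous_expansion\<close>. On the
  line through z an expansion becomes a power series in t near 0 whose coefficients are the values
  of its terms at z. The terms are thus determined on the whole space although convergence is
  assumed only in the ball.\<close>

lemma homogeneous_expansion_eqI:
  fixes f :: "complex ^ 'n \<Rightarrow> complex"
  assumes F: "\<And>k. homogeneous_polynomial k (F k)" "\<And>z. z \<in> ball 0 1 \<Longrightarrow> (\<lambda>k. F k z) sums f z"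
  shows "homogeneous_expansion f = F"
  unfolding homogeneous_expansion_def
proof (rule the_equality)
  fix G assume G: "(\<forall>k. homogeneous_polynomial k (G k)) \<and> (\<forall>z\<in>ball 0 1. (\<lambda>k. G k z) sums f z)"
  show "G = F"
  proof (intro ext)
    fix k and z :: "complex ^ 'n"
    define r where "r = 1 / (norm z + 1)"
    have in_ball: "t *s z \<in> ball 0 1" if "norm t < r" for t
    proof -
      have "norm t * norm z \<le> r * norm z" using that by (intro mult_right_mono) auto
      also have "\<dots> = norm z / (norm z + 1)" by (simp add: r_def)
      also have "\<dots> < 1" using norm_ge_zero[of z] by (simp add: divide_less_eq add_nonneg_pos)
      finally show ?thesis by simp
    qed
    show "G k z = F k z"
    proof (rule sums_eq_imp_coeffs_eq[where g = "\<lambda>t. f (t *s z)"])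
      show "0 < r" using norm_ge_zero[of z] by (simp add: r_def add_nonneg_pos)
      fix t :: complex assume t: "norm t < r"
      have "(\<lambda>k. G k (t *s z)) sums f (t *s z)" using G in_ball[OF t] by blast
      then show "(\<lambda>k. G k z * t ^ k) sums f (t *s z)"
        using homogeneous_polynomial_smult G by (metis (no_types, lifting) mult.commute sums_cong)
      have "(\<lambda>k. F k (t *s z)) sums f (t *s z)" using F(2) in_ball[OF t] by blast
      then show "(\<lambda>k. F k z * t ^ k) sums f (t *s z)"
        using homogeneous_polynomial_smult F(1) by (metis (no_types, lifting) mult.commute sums_cong)
    qed
  qed
qed (use F in blast)

lemma homogeneous_expansion_taylor:
  assumes "line_holo (ball 0 1) f"
  shows "homogeneous_expansion f = taylor_part f"
  using homogeneous_expansion_eqI taylor_part_homogeneous[OF assms] taylor_part_sums_ball[OF assms] by blast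

lemma homogeneous_polynomial_1:
  fixes p :: "complex ^ 'n \<Rightarrow> complex"
  assumes "homogeneous_polynomial 1 p"
  obtains c where "\<And>z. p z = (\<Sum>i\<in>UNIV. c i * z $ i)"
proof -
  from assms obtain c where c: "\<And>z. p z = (\<Sum>\<alpha> | (\<Sum>i\<in>UNIV. \<alpha> i) = 1. c \<alpha> * (\<Prod>i\<in>UNIV. (z $ i) ^ \<alpha> i))"
    unfolding homogeneous_polynomial_def by blast
  define d :: "'n \<Rightarrow> 'n \<Rightarrow> nat" where "d i j = (if j = i then 1 else 0)" for i j
  have set: "{\<alpha> :: 'n \<Rightarrow> nat. (\<Sum>i\<in>UNIV. \<alpha> i) = 1} = range d"
  proof (intro equalityI subsetI)
    fix \<alpha> :: "'n \<Rightarrow> nat" assume "\<alpha> \<in> {\<alpha>. (\<Sum>i\<in>UNIV. \<alpha> i) = 1}"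
    then obtain i where "\<alpha> i = 1" "\<forall>j. i \<noteq> j \<longrightarrow> \<alpha> j = 0"
      by (auto simp: sum_eq_Suc0_iff)
    then have "\<alpha> = d i" by (auto simp: d_def fun_eq_iff)
    then show "\<alpha> \<in> range d" by blast
  next
    fix \<alpha> assume "\<alpha> \<in> range d"
    then show "\<alpha> \<in> {\<alpha>. (\<Sum>i\<in>UNIV. \<alpha> i) = 1}" by (auto simp: d_def)
  qed
  have inj: "inj d" by (rule injI) (metis d_def zero_neq_one)
  have pr: "(\<Prod>j\<in>UNIV. (z $ j) ^ d i j) = z $ i" for z :: "complex ^ 'n" and i
  proof -
    have "(\<Prod>j\<in>UNIV. (z $ j) ^ d i j) = (\<Prod>j\<in>UNIV. if j = i then z $ j else 1)"
      by (intro prod.cong) (auto simp: d_def)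
    then show ?thesis by simp
  qed
  have "p z = (\<Sum>i\<in>UNIV. c (d i) * z $ i)" for z
    unfolding c set by (simp add: sum.reindex[OF inj] pr)
  then show ?thesis by (rule that)
qed

text \<open>The part of degree one of the expansion about z is the derivative: it is linear because
  it is a homogeneous polynomial of degree one, and the tail from degree two on is quadratically
  small.\<close>

lemma line_holo_has_derivative:
  fixes f :: "complex ^ 'n \<Rightarrow> complex"
  assumes f: "line_holo (ball 0 1) f" and z: "z \<in> ball 0 1"
  shows "\<exists>D. (f has_derivative D) (at z) \<and> (\<forall>c v. D (c *s v) = c * D v)"
proof -
  \<comment> \<open>Recentring at z and scaling by the distance to the sphere gives a function g on
    the unit ball, so that the expansion at the origin applies.\<close>
  define s where "s = 1 - norm z"
  have s: "s > 0" using z by (simp add: s_def)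
  define g where "g h = f (z + of_real s *s h)" for h
  have "line_holo (ball 0 1) g"
    unfolding g_def
  proof (rule line_holo_affine[OF f])
    fix h :: "complex ^ 'n" assume "h \<in> ball 0 1"
    then have "s * norm h < s * 1" using s by (intro mult_strict_left_mono) auto
    then have "norm (of_real s *s h) < s" using s by simp
    then have "norm z + norm (of_real s *s h) < 1" unfolding s_def by linarith
    then show "z + of_real s *s h \<in> ball 0 1" using norm_triangle_ineq[of z "of_real s *s h"] by simp
  qed
  note g = this
  obtain B where B: "B > 0" "\<And>k z. norm (taylor_part g k z) \<le> B * (2 * norm z) ^ k"
    using taylor_part_half_bound[OF g] by blast
  define L where "L = taylor_part g 1"
  obtain c where c: "\<And>z. L z = (\<Sum>i\<in>UNIV. c i * z $ i)"
    using homogeneous_polynomial_1[OF taylor_part_homogeneous[OF g]] unfolding L_def by blast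
  have L: "bounded_linear L"
    unfolding c by (intro bounded_linear_sum bounded_linear_const_mult bounded_linear_vec_nth)
  have L2: "L (a *s v) = a * L v" for a v
    unfolding c by (simp add: sum_distrib_left mult_ac)
  have "(g has_derivative L) (at 0)"
  proof (rule has_derivativeI_sandwich[OF _ L])
    show "(0::real) < 1/4" by simp
    show "((\<lambda>y. 8 * B * norm y) \<longlongrightarrow> 0) (at 0)"
      by (auto intro!: tendsto_eq_intros)
    fix y :: "complex ^ 'n" assume y: "y \<noteq> 0" "dist y 0 < 1/4"
    have "norm (g y - (\<Sum>k<2. taylor_part g k y)) \<le> 2 * B * (2 * norm y) ^ 2"
      by (rule sums_tail_bound) (use B y taylor_part_sums_ball[OF g, of y] in auto)
    moreover have "(\<Sum>k<2. taylor_part g k y) = g 0 + L y"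
      by (simp add: numeral_2_eq_2 L_def) (simp add: taylor_part_def)
    ultimately have "norm ((g y - g 0) - L (y - 0)) \<le> 2 * B * (2 * norm y) ^ 2" by (simp add: algebra_simps)
    then have "norm ((g y - g 0) - L (y - 0)) / norm (y - 0) \<le> 2 * B * (2 * norm y) ^ 2 / norm y"
      by (simp add: divide_right_mono)
    also have "\<dots> = 8 * B * norm y" using y by (simp add: power2_eq_square)
    finally show "norm ((g y - g 0) - L (y - 0)) / norm (y - 0) \<le> 8 * B * norm y" .
  qed
  moreover have "((\<lambda>w. (1 / s) *\<^sub>R (w - z)) has_derivative (\<lambda>h. (1 / s) *\<^sub>R h)) (at z)"
    by (auto intro!: derivative_eq_intros)
  ultimately have "((\<lambda>w. g ((1 / s) *\<^sub>R (w - z))) has_derivative (\<lambda>h. L ((1 / s) *\<^sub>R h))) (at z)"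
    using diff_chain_at[of "\<lambda>w. (1 / s) *\<^sub>R (w - z)" _ z g L] by (simp add: o_def)
  moreover have "(\<lambda>w. g ((1 / s) *\<^sub>R (w - z))) = f"
    using s by (simp add: g_def fun_eq_iff flip: scaleR_eq_smult)
  ultimately show ?thesis
    unfolding scaleR_eq_smult by (intro exI[of _ "\<lambda>h. L (of_real (1 / s) *s h)"]) (simp add: L2)
qed

lemma holomorphic_ball_iff:
  "f \<in> holomorphic_ball \<longleftrightarrow> line_holo (ball 0 1) f \<and> (\<forall>z. z \<notin> ball 0 1 \<longrightarrow> f z = 0)"
proof
  assume "f \<in> holomorphic_ball"
  then show "line_holo (ball 0 1) f \<and> (\<forall>z. z \<notin> ball 0 1 \<longrightarrow> f z = 0)"
    using holomorphic_ball_line_holo[of f] unfolding holomorphic_ball_def by blast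
next
  assume "line_holo (ball 0 1) f \<and> (\<forall>z. z \<notin> ball 0 1 \<longrightarrow> f z = 0)"
  then show "f \<in> holomorphic_ball"
    unfolding holomorphic_ball_def using line_holo_has_derivative[of f] by blast
qed

section \<open>Functions with prescribed homogeneous components\<close>

definition on_ball :: "(complex ^ 'n \<Rightarrow> complex) \<Rightarrow> complex ^ 'n \<Rightarrow> complex" where
  "on_ball f z = (if z \<in> ball 0 1 then f z else 0)"

lemma on_ball_holomorphic: "line_holo (ball 0 1) f \<Longrightarrow> on_ball f \<in> holomorphic_ball"
  unfolding holomorphic_ball_iff using line_holo_cong[of "ball 0 1" "on_ball f" f]
  by (simp add: on_ball_def)

lemma homogeneous_polynomial_0: "homogeneous_polynomial k (\<lambda>z. 0)"
  unfolding homogeneous_polynomial_def by (rule exI[of _ "\<lambda>_. 0"]) simp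

text \<open>Majorants on all smaller balls give locally uniform convergence by the Weierstrass test.
  Uniqueness of the expansion then returns the prescribed terms as the components of the
  sum.\<close>

lemma homogeneous_series_holomorphic:
  assumes F: "\<And>k. homogeneous_polynomial k (F k)"
    and A: "\<And>\<rho>. 0 < \<rho> \<Longrightarrow> \<rho> < 1 \<Longrightarrow> \<exists>A. summable A \<and> (\<forall>k z. norm z \<le> \<rho> \<longrightarrow> norm (F k z) \<le> A k)"
  shows "on_ball (\<lambda>z. \<Sum>k. F k z) \<in> holomorphic_ball"
    and "homogeneous_expansion (on_ball (\<lambda>z. \<Sum>k. F k z)) = F"
    and "\<And>z. z \<in> ball 0 1 \<Longrightarrow> summable (\<lambda>k. norm (F k z))"
proof -
  have A': "\<exists>\<rho> A. norm z < \<rho> \<and> summable A \<and> (\<forall>k w. norm w \<le> \<rho> \<longrightarrow> norm (F k w) \<le> A k)"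
    if z: "z \<in> ball 0 1" for z
  proof -
    obtain \<rho> where \<rho>: "norm z < \<rho>" "\<rho> < 1" using z dense[of "norm z" 1] by auto
    then have "\<rho> > 0" using norm_ge_zero[of z] by linarith
    from A[OF this \<rho>(2)] \<rho>(1) show ?thesis by blast
  qed
  show abs: "summable (\<lambda>k. norm (F k z))" if z: "z \<in> ball 0 1" for z
  proof -
    obtain \<rho> A where *: "norm z < \<rho>" "summable A" "\<And>k w. norm w \<le> \<rho> \<Longrightarrow> norm (F k w) \<le> A k"
      using A'[OF z] by blast
    show ?thesis
      by (rule summable_comparison_test'[OF *(2), of 0]) (simp add: *(3) less_imp_le[OF *(1)])
  qed
  have "line_holo (ball 0 1) (\<lambda>z. \<Sum>k. F k z)"
  proof (rule line_holo_uniform_limit)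
    show "line_holo (ball 0 1) (\<lambda>z. \<Sum>k<n. F k z)" for n
      by (intro polys_line_holo polys_sum) (rule homogeneous_polynomial_polys[OF F])
    fix z :: "complex ^ 'a" assume z: "z \<in> ball 0 1"
    obtain \<rho> A where *: "norm z < \<rho>" "summable A" "\<And>k w. norm w \<le> \<rho> \<Longrightarrow> norm (F k w) \<le> A k"
      using A'[OF z] by blast
    have "uniform_limit (ball 0 \<rho>) (\<lambda>n z. \<Sum>k<n. F k z) (\<lambda>z. \<Sum>k. F k z) sequentially"
      by (rule Weierstrass_m_test[OF _ *(2)]) (simp add: *(3))
    moreover have "ball z (\<rho> - norm z) \<subseteq> ball 0 \<rho>"
    proof
      fix x assume "x \<in> ball z (\<rho> - norm z)"
      moreover have "norm x \<le> norm z + dist z x"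
        using norm_triangle_ineq[of z "x - z"] by (simp add: dist_norm norm_minus_commute)
      ultimately show "x \<in> ball 0 \<rho>" by simp
    qed
    ultimately show "\<exists>d>0. uniform_limit (ball z d) (\<lambda>n z. \<Sum>k<n. F k z) (\<lambda>z. \<Sum>k. F k z) sequentially"
      using *(1) by (intro exI[of _ "\<rho> - norm z"]) (auto intro: uniform_limit_on_subset)
  qed simp
  then show "on_ball (\<lambda>z. \<Sum>k. F k z) \<in> holomorphic_ball" by (rule on_ball_holomorphic)
  show "homogeneous_expansion (on_ball (\<lambda>z. \<Sum>k. F k z)) = F"
    by (rule homogeneous_expansion_eqI[OF F])
       (simp add: on_ball_def summable_sums[OF summable_norm_cancel[OF abs]])
qed

lemma homogeneous_expansion_homogeneous:
  assumes "f \<in> holomorphic_ball"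
  shows "homogeneous_polynomial k (homogeneous_expansion f k)"
  using assms by (simp add: holomorphic_ball_iff homogeneous_expansion_taylor taylor_part_homogeneous)

lemma homogeneous_expansion_sums:
  assumes "f \<in> holomorphic_ball" "z \<in> ball 0 1"
  shows "(\<lambda>k. homogeneous_expansion f k z) sums f z"
  using assms by (simp add: holomorphic_ball_iff homogeneous_expansion_taylor taylor_part_sums_ball)

lemma homogeneous_expansion_bound:
  assumes "f \<in> holomorphic_ball" "0 < r" "r < 1"
  obtains B where "B > 0" "\<And>k z. norm (homogeneous_expansion f k z) \<le> B * (norm z / r) ^ k"
proof -
  have f: "line_holo (ball 0 1) f" using assms by (simp add: holomorphic_ball_iff)
  obtain B where B: "\<And>z. norm z \<le> r \<Longrightarrow> norm (f z) \<le> B" "B > 0"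
    using line_holo_bounded_sphere[OF f] assms by blast
  have "norm (taylor_part f k z) \<le> B * (norm z / r) ^ k" for k z
    by (rule taylor_part_bound[OF f]) (use assms B in auto)
  with that[of B] B show ?thesis by (simp add: homogeneous_expansion_taylor[OF f])
qed

lemma homogeneous_polynomial_add:
  assumes "homogeneous_polynomial k p" "homogeneous_polynomial k q"
  shows "homogeneous_polynomial k (\<lambda>z. p z + q z)"
  by (rule polys_homogeneous)
     (use assms in \<open>auto simp: homogeneous_polynomial_smult algebra_simps intro: polys_add homogeneous_polynomial_polys\<close>)

lemma homogeneous_polynomial_scale:
  assumes "homogeneous_polynomial k p"
  shows "homogeneous_polynomial k (\<lambda>z. c * p z)"
  by (rule polys_homogeneous)
     (use assms in \<open>auto simp: homogeneous_polynomial_smult algebra_simps intro: polys_scale homogeneous_polynomial_polys\<close>)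

lemma holomorphic_ball_add: "f \<in> holomorphic_ball \<Longrightarrow> g \<in> holomorphic_ball \<Longrightarrow> (\<lambda>z. f z + g z) \<in> holomorphic_ball"
  by (auto simp: holomorphic_ball_iff intro: line_holo_add)

lemma holomorphic_ball_diff: "f \<in> holomorphic_ball \<Longrightarrow> g \<in> holomorphic_ball \<Longrightarrow> (\<lambda>z. f z - g z) \<in> holomorphic_ball"
  by (auto simp: holomorphic_ball_iff intro: line_holo_diff)

lemma holomorphic_ball_mult: "f \<in> holomorphic_ball \<Longrightarrow> g \<in> holomorphic_ball \<Longrightarrow> (\<lambda>z. f z * g z) \<in> holomorphic_ball"
  by (auto simp: holomorphic_ball_iff intro: line_holo_mult)

lemma holomorphic_ball_scale: "f \<in> holomorphic_ball \<Longrightarrow> (\<lambda>z. c * f z) \<in> holomorphic_ball"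
  by (auto simp: holomorphic_ball_iff intro: line_holo_mult line_holo_const)

lemma holomorphic_ball_0: "(\<lambda>z. 0) \<in> holomorphic_ball"
  by (auto simp: holomorphic_ball_iff intro: line_holo_const)

lemma homogeneous_expansion_add:
  assumes "f \<in> holomorphic_ball" "g \<in> holomorphic_ball"
  shows "homogeneous_expansion (\<lambda>z. f z + g z) = (\<lambda>k z. homogeneous_expansion f k z + homogeneous_expansion g k z)"
  by (intro homogeneous_expansion_eqI homogeneous_polynomial_add homogeneous_expansion_homogeneous
      sums_add homogeneous_expansion_sums assms)

lemma homogeneous_expansion_scale:
  assumes "f \<in> holomorphic_ball"
  shows "homogeneous_expansion (\<lambda>z. c * f z) = (\<lambda>k z. c * homogeneous_expansion f k z)"
  by (intro homogeneous_expansion_eqI homogeneous_polynomial_scale homogeneous_expansion_homogeneous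
      sums_mult homogeneous_expansion_sums assms)

lemma homogeneous_expansion_diff:
  assumes "f \<in> holomorphic_ball" "g \<in> holomorphic_ball"
  shows "homogeneous_expansion (\<lambda>z. f z - g z) = (\<lambda>k z. homogeneous_expansion f k z - homogeneous_expansion g k z)"
  using homogeneous_expansion_add[OF assms(1) holomorphic_ball_scale[OF assms(2), of "-1"]]
  by (simp add: homogeneous_expansion_scale[OF assms(2), of "-1", simplified])

section \<open>The normalized surface measure\<close>

text \<open>Serves to pass between \<open>complex ^ 'n\<close> and a real coordinate space. An
  isometry that permutes the bases pulls boxes back to boxes, and the product of the side lengths is
  only reindexed.\<close>

lemma distr_lborel_basis_isometry:
  fixes \<phi> :: "'a::euclidean_space \<Rightarrow> 'b::euclidean_space"
  assumes lin: "linear \<phi>" and inner: "\<And>x y. \<phi> x \<bullet> \<phi> y = x \<bullet> y" and basis: "\<phi> ` Basis = Basis"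
  shows "distr lborel borel \<phi> = lborel"
proof (rule lborel_eqI[symmetric])
  have meas: "\<phi> \<in> borel_measurable borel"
    using linear_continuous_on[OF linear_conv_bounded_linear[THEN iffD1, OF lin], of UNIV]
    by (rule borel_measurable_continuous_onI)
  fix l u :: 'b assume lu: "\<And>b. b \<in> Basis \<Longrightarrow> l \<bullet> b \<le> u \<bullet> b"
  define l' u' where "l' = (\<Sum>b\<in>Basis. (l \<bullet> \<phi> b) *\<^sub>R b)" and "u' = (\<Sum>b\<in>Basis. (u \<bullet> \<phi> b) *\<^sub>R b)"
  have l': "l' \<bullet> a = l \<bullet> \<phi> a" and u': "u' \<bullet> a = u \<bullet> \<phi> a" if "a \<in> Basis" for a
    using that by (simp_all add: l'_def u'_def inner_sum_left inner_Basis if_distrib cong: if_cong)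
  have inj: "inj_on \<phi> Basis"
  proof (rule inj_onI)
    fix x y assume "\<phi> x = \<phi> y"
    then have "\<phi> (x - y) = 0" by (simp add: linear_diff[OF lin])
    then have "(x - y) \<bullet> (x - y) = 0" using inner[of "x - y" "x - y"] by simp
    then show "x = y" by simp
  qed
  have "\<phi> x \<in> box l u \<longleftrightarrow> x \<in> box l' u'" for x
  proof -
    have "\<phi> x \<in> box l u \<longleftrightarrow> (\<forall>b\<in>\<phi> ` Basis. l \<bullet> b < \<phi> x \<bullet> b \<and> \<phi> x \<bullet> b < u \<bullet> b)"
      unfolding basis by (auto simp: box_def)
    also have "\<dots> \<longleftrightarrow> x \<in> box l' u'"
      by (auto simp: box_def inner l' u')
    finally show ?thesis .
  qed
  then have "\<phi> -` box l u = box l' u'" by blast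
  then have "emeasure (distr lborel borel \<phi>) (box l u) = emeasure lborel (box l' u')"
    using meas by (simp add: emeasure_distr)
  also have "\<dots> = (\<Prod>b\<in>Basis. (u' - l') \<bullet> b)"
    using lu basis by (intro emeasure_lborel_box) (auto simp: l' u')
  also have "(\<Prod>b\<in>Basis. (u' - l') \<bullet> b) = (\<Prod>b\<in>Basis. (u - l) \<bullet> \<phi> b)"
    by (intro prod.cong refl) (simp add: inner_diff_left l' u')
  also have "\<dots> = (\<Prod>b\<in>\<phi> ` Basis. (u - l) \<bullet> b)"
    by (simp add: prod.reindex[OF inj])
  finally show "emeasure (distr lborel borel \<phi>) (box l u) = ennreal (\<Prod>b\<in>Basis. (u - l) \<bullet> b)"
    unfolding basis .
qed simp

lemma distr_lborel_orthogonal_vec: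
  fixes T :: "real ^ 'm::{finite,wellorder} \<Rightarrow> real ^ 'm::_"
  assumes T: "orthogonal_transformation T"
  shows "distr lborel borel T = lborel"
proof (rule lborel_eqI[symmetric])
  have meas: "T \<in> borel_measurable borel"
    by (intro borel_measurable_continuous_onI linear_continuous_on linear_conv_bounded_linear[THEN iffD1]
        orthogonal_transformation_linear T)
  fix l u :: "real ^ 'm::_" assume lu: "\<And>b. b \<in> Basis \<Longrightarrow> l \<bullet> b \<le> u \<bullet> b"
  have inv: "orthogonal_transformation (inv T)" by (rule orthogonal_transformation_inv[OF T])
  have "bij T" by (rule orthogonal_transformation_bij[OF T])
  then have vim: "T -` box l u = inv T ` box l u" by (simp add: bij_vimage_eq_inv_image)
  have fm: "inv T ` box l u \<in> lmeasurable"
    by (rule measurable_orthogonal_image[OF inv lmeasurable_box])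
  have "T -` box l u \<in> sets borel" using measurable_sets[OF meas, of "box l u"] by simp
  then have "emeasure (distr lborel borel T) (box l u) = emeasure lebesgue (inv T ` box l u)"
    using meas by (simp add: emeasure_distr vim)
  also have "\<dots> = ennreal (measure lebesgue (inv T ` box l u))"
    using fm by (simp add: emeasure_eq_measure2)
  also have "\<dots> = ennreal (measure lebesgue (box l u))"
    by (simp add: measure_orthogonal_image[OF inv lmeasurable_box])
  also have "\<dots> = (\<Prod>b\<in>Basis. (u - l) \<bullet> b)" using lu by simp
  finally show "emeasure (distr lborel borel T) (box l u) = ennreal (\<Prod>b\<in>Basis. (u - l) \<bullet> b)" .
qed simp

lemma borel_measurable_smult [measurable]: "(\<lambda>z :: complex ^ 'n. w *s z) \<in> borel_measurable borel"
  by (intro borel_measurable_continuous_onI continuous_on_smult continuous_on_const continuous_on_id)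

text \<open>Multiplication by a unimodular scalar is orthogonal for the real structure. It is
  conjugated by an isometry to \<open>real ^ 'n bit0\<close>, which has the right dimension 2n and a
  well-ordered index type, as \<open>distr_lborel_orthogonal_vec\<close> requires.\<close>

lemma distr_lborel_smult:
  assumes w: "cmod w = 1"
  shows "distr lborel borel (\<lambda>z :: complex ^ 'n. w *s z) = lborel"
proof -
  have "card (Basis :: (real ^ 'n bit0) set) = card (Basis :: (complex ^ 'n) set)" by simp
  then obtain h where h: "bij_betw h (Basis :: (real ^ 'n bit0) set) (Basis :: (complex ^ 'n) set)"
    using finite_same_card_bij[OF finite_Basis finite_Basis] by blast
  define \<phi> where "\<phi> y = (\<Sum>b\<in>Basis. (y \<bullet> b) *\<^sub>R h b)" for y :: "real ^ 'n bit0"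
  define \<phi>i where "\<phi>i x = (\<Sum>b\<in>Basis. (x \<bullet> h b) *\<^sub>R b)" for x :: "complex ^ 'n"
  have lin: "linear \<phi>"
    unfolding \<phi>_def by (intro linear_compose_sum ballI bounded_linear.linear bounded_linear_intros)
  have lini: "linear \<phi>i"
    unfolding \<phi>i_def by (intro linear_compose_sum ballI bounded_linear.linear bounded_linear_intros)
  have hB: "h b \<in> Basis" if "b \<in> Basis" for b using h that by (auto simp: bij_betw_def)
  have hin: "h a \<bullet> h b = (if a = b then 1 else 0)" if "a \<in> Basis" "b \<in> Basis" for a b
    using h that hB by (auto simp: inner_Basis bij_betw_def inj_on_def)
  have \<phi>h: "\<phi> x \<bullet> h b = x \<bullet> b" if "b \<in> Basis" for x b
    using that by (simp add: \<phi>_def inner_sum_left hin if_distrib cong: if_cong)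
  have inner: "\<phi> x \<bullet> \<phi> y = x \<bullet> y" for x y
  proof -
    have "\<phi> x \<bullet> \<phi> y = (\<Sum>b\<in>Basis. (y \<bullet> b) * (\<phi> x \<bullet> h b))"
      by (simp add: \<phi>_def[of y] inner_sum_right)
    also have "\<dots> = (\<Sum>b\<in>Basis. (y \<bullet> b) * (x \<bullet> b))" by (simp add: \<phi>h)
    finally show ?thesis by (simp add: euclidean_inner[of x y] mult.commute)
  qed
  have basis_eq: "\<phi> b = h b" if "b \<in> Basis" for b
    using that by (simp add: \<phi>_def inner_Basis if_distrib[of "\<lambda>c. c *\<^sub>R _"] cong: if_cong)
  have basis: "\<phi> ` Basis = Basis" using h basis_eq by (auto simp: bij_betw_def)
  have inv: "\<phi> (\<phi>i x) = x" for x
  proof -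
    have "\<phi> (\<phi>i x) = (\<Sum>b\<in>Basis. (x \<bullet> h b) *\<^sub>R h b)"
      by (simp add: \<phi>i_def linear_sum[OF lin] linear_scale[OF lin] basis_eq)
    also have "\<dots> = (\<Sum>b\<in>Basis. (x \<bullet> b) *\<^sub>R b)"
      using sum.reindex_bij_betw[OF h, of "\<lambda>b. (x \<bullet> b) *\<^sub>R b"] by simp
    finally show ?thesis by (simp add: euclidean_representation)
  qed
  define M where "M z = w *s z" for z :: "complex ^ 'n"
  have linM: "linear M"
    by (rule linearI) (auto simp: M_def vec_eq_iff algebra_simps)
  have norm\<phi>: "norm (\<phi> x) = norm x" for x by (simp add: norm_eq_sqrt_inner inner)
  define T where "T = \<phi>i \<circ> (M \<circ> \<phi>)"
  have \<phi>T: "\<phi> (T x) = M (\<phi> x)" for x by (simp add: T_def inv)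
  have "orthogonal_transformation T"
    unfolding orthogonal_transformation
  proof (intro conjI allI)
    show "linear T" unfolding T_def by (intro linear_compose lin lini linM)
    show "norm (T v) = norm v" for v
      using norm\<phi>[of "T v"] by (simp add: \<phi>T M_def w norm\<phi>)
  qed
  from distr_lborel_orthogonal_vec[OF this] have DT: "distr lborel borel T = lborel" .
  have D\<phi>: "distr lborel borel \<phi> = lborel" by (rule distr_lborel_basis_isometry[OF lin inner basis])
  have cont: "f \<in> borel_measurable borel" if "linear f" for f :: "'x::euclidean_space \<Rightarrow> 'y::euclidean_space"
    by (intro borel_measurable_continuous_onI linear_continuous_on linear_conv_bounded_linear[THEN iffD1] that)
  have m: "\<phi> \<in> borel_measurable borel" "T \<in> borel_measurable borel" "M \<in> borel_measurable borel"
    using cont[OF lin] cont[OF linear_compose[OF linear_compose[OF lin linM] lini]] cont[OF linM]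
    by (simp_all add: T_def comp_assoc)
  have "distr lborel borel M = distr (distr lborel borel \<phi>) borel M" by (simp add: D\<phi>)
  also have "\<dots> = distr lborel borel (M \<circ> \<phi>)" using m by (intro distr_distr) auto
  also have "M \<circ> \<phi> = \<phi> \<circ> T" by (simp add: fun_eq_iff \<phi>T)
  also have "distr lborel borel (\<phi> \<circ> T) = distr (distr lborel borel T) borel \<phi>"
    using m by (intro distr_distr[symmetric]) auto
  also have "\<dots> = lborel" by (simp add: DT D\<phi>)
  finally show ?thesis by (simp add: M_def[abs_def])
qed

section \<open>Integration over the sphere\<close>

lemma emeasure_ball_pos: "emeasure lborel (ball (0 :: 'a::euclidean_space) 1) \<noteq> 0"
  and emeasure_ball_fin: "emeasure lborel (ball (0 :: 'a::euclidean_space) 1) \<noteq> \<infinity>"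
proof -
  have "ball (0 :: 'a) 1 \<notin> null_sets lborel"
    by (metis ball_eq_empty centre_in_ball empty_iff open_ball open_not_negligible negligible_iff_null_sets
        null_sets_completionI zero_less_one)
  then show "emeasure lborel (ball (0 :: 'a::euclidean_space) 1) \<noteq> 0" by auto
  show "emeasure lborel (ball (0 :: 'a::euclidean_space) 1) \<noteq> \<infinity>"
    using emeasure_lborel_ball_finite[of 0 1] by (metis less_irrefl)
qed

lemma space_sphere_measure [simp]: "space sphere_measure = sphere 0 1"
  by (simp add: sphere_measure_def space_restrict_space)

lemma sets_sphere_measure: "sets sphere_measure = sets (restrict_space borel (sphere 0 1))"
  unfolding sphere_measure_def by (rule sets_restrict_space_cong) simp

lemma borel_measurable_sphere:
  fixes g :: "complex ^ 'n \<Rightarrow> 'b::topological_space"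
  assumes "continuous_on (sphere 0 1) g"
  shows "g \<in> borel_measurable sphere_measure"
  using borel_measurable_continuous_on_restrict[OF assms]
    measurable_cong_sets[OF sets_sphere_measure refl] by blast

lemma nn_integral_sphere:
  fixes g :: "complex ^ 'n \<Rightarrow> ennreal"
  assumes g: "g \<in> borel_measurable sphere_measure"
  shows "(\<integral>\<^sup>+\<zeta>. g \<zeta> \<partial>sphere_measure) =
    (\<integral>\<^sup>+z. g (z /\<^sub>R norm z) * indicator (sphere 0 1) (z /\<^sub>R norm z) * indicator (ball 0 1) z \<partial>lborel)
      / emeasure lborel (ball (0 :: complex ^ 'n) 1)"
proof -
  have g': "(\<lambda>x. g x * indicator (sphere 0 1) x) \<in> borel_measurable borel"
  proof -
    have "g \<in> borel_measurable (restrict_space borel (sphere 0 1))"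
      using g measurable_cong_sets[OF sets_sphere_measure refl] by blast
    then show ?thesis by (subst (asm) borel_measurable_restrict_space_iff_ennreal) auto
  qed
  have u: "(\<lambda>z :: complex ^ 'n. z /\<^sub>R norm z) \<in> borel_measurable borel"
    by measurable
  have "(\<integral>\<^sup>+\<zeta>. g \<zeta> \<partial>sphere_measure) =
     (\<integral>\<^sup>+x. g x * indicator (sphere 0 1) x
        \<partial>distr (uniform_measure lborel (ball 0 1)) borel (\<lambda>z. z /\<^sub>R norm z))"
    unfolding sphere_measure_def by (intro nn_integral_restrict_space) simp
  also have "\<dots> = (\<integral>\<^sup>+z. g (z /\<^sub>R norm z) * indicator (sphere 0 1) (z /\<^sub>R norm z)
        \<partial>uniform_measure lborel (ball 0 1))"
    using g' u by (intro nn_integral_distr) auto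
  also have "\<dots> = (\<integral>\<^sup>+z. g (z /\<^sub>R norm z) * indicator (sphere 0 1) (z /\<^sub>R norm z) * indicator (ball 0 1) z \<partial>lborel)
      / emeasure lborel (ball (0 :: complex ^ 'n) 1)"
    using measurable_compose[OF u g'] by (intro nn_integral_uniform_measure) auto
  finally show ?thesis .
qed

lemma nn_integral_sphere':
  fixes g :: "complex ^ 'n \<Rightarrow> ennreal"
  assumes g: "g \<in> borel_measurable sphere_measure"
  shows "(\<integral>\<^sup>+\<zeta>. g \<zeta> \<partial>sphere_measure) =
    (\<integral>\<^sup>+z. g (z /\<^sub>R norm z) * indicator (ball 0 1) z \<partial>lborel) / emeasure lborel (ball (0 :: complex ^ 'n) 1)"
proof -
  have "AE z in lborel. z \<noteq> (0 :: complex ^ 'n)" by (rule AE_lborel_singleton)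
  then have "(\<integral>\<^sup>+z. g (z /\<^sub>R norm z) * indicator (sphere 0 1) (z /\<^sub>R norm z) * indicator (ball 0 1) z \<partial>lborel)
     = (\<integral>\<^sup>+z. g (z /\<^sub>R norm z) * indicator (ball 0 1) z \<partial>lborel)"
    by (intro nn_integral_cong_AE) (auto elim!: eventually_mono)
  then show ?thesis by (simp add: nn_integral_sphere[OF g])
qed

lemma emeasure_sphere_measure: "emeasure sphere_measure (sphere 0 1 :: (complex ^ 'n) set) = 1"
proof -
  let ?M = "sphere_measure :: (complex ^ 'n) measure"
  have "emeasure ?M (sphere 0 1) = (\<integral>\<^sup>+\<zeta>. 1 \<partial>?M)" by simp
  also have "\<dots> = (\<integral>\<^sup>+z. 1 * indicator (ball 0 1) (z :: complex ^ 'n) \<partial>lborel) / emeasure lborel (ball (0 :: complex ^ 'n) 1)"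
    by (rule nn_integral_sphere') simp
  also have "\<dots> = 1"
    using emeasure_ball_pos[where 'a = "complex ^ 'n"] emeasure_ball_fin[where 'a = "complex ^ 'n"]
    by (simp add: ennreal_divide_self less_top)
  finally show ?thesis .
qed

interpretation sphere: finite_measure "sphere_measure :: (complex ^ 'n) measure"
  by (rule finite_measureI) (simp add: emeasure_sphere_measure)

lemma measure_sphere_measure: "measure sphere_measure (sphere 0 1 :: (complex ^ 'n) set) = 1"
  by (simp add: measure_def emeasure_sphere_measure)

lemma measurable_smult_sphere:
  assumes "cmod w = 1"
  shows "(\<lambda>z :: complex ^ 'n. w *s z) \<in> measurable sphere_measure sphere_measure"
proof -
  have "(\<lambda>z :: complex ^ 'n. w *s z) \<in> measurable (restrict_space borel (sphere 0 1)) (restrict_space borel (sphere 0 1))"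
    by (intro measurable_restrict_space3) (auto simp: assms dist_norm)
  then show ?thesis using measurable_cong_sets[OF sets_sphere_measure sets_sphere_measure] by blast
qed

text \<open>Multiplication by w commutes with z -> z / |z| and preserves the ball and Lebesgue
  measure, the three ingredients of the sphere measure.\<close>

lemma distr_sphere_smult:
  assumes w: "cmod w = 1"
  shows "distr sphere_measure sphere_measure (\<lambda>z :: complex ^ 'n. w *s z) = sphere_measure"
proof (rule measure_eqI)
  let ?M = "sphere_measure :: (complex ^ 'n) measure"
  fix A assume "A \<in> sets (distr ?M ?M (\<lambda>z. w *s z))"
  then have A: "A \<in> sets ?M" by simp
  note ms = measurable_smult_sphere[OF w, where 'n = 'n]
  have iA: "(indicator A :: complex ^ 'n \<Rightarrow> ennreal) \<in> borel_measurable ?M" using A by simp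
  have iA2: "(\<lambda>z. indicator A (w *s z) :: ennreal) \<in> borel_measurable ?M"
    by (rule measurable_compose[OF ms iA])
  have unit: "w *s (z /\<^sub>R norm z) = (w *s z) /\<^sub>R norm (w *s z)" for z :: "complex ^ 'n"
    by (simp add: w vec_eq_iff)
  have bor: "(\<lambda>z :: complex ^ 'n. indicator A (z /\<^sub>R norm z) * indicator (sphere 0 1) (z /\<^sub>R norm z) * indicator (ball 0 1) z :: ennreal)
     \<in> borel_measurable borel"
  proof -
    have "A \<in> sets borel"
    proof -
      have "A \<in> sets (restrict_space borel (sphere 0 1))" using A sets_sphere_measure by blast
      then show ?thesis by (simp add: sets_restrict_space_iff)
    qed
    moreover have "sphere (0 :: complex ^ 'n) 1 \<in> sets borel" "ball (0 :: complex ^ 'n) 1 \<in> sets borel"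
      by (auto intro: borel_closed)
    ultimately show ?thesis by measurable
  qed
  have "emeasure (distr ?M ?M (\<lambda>z. w *s z)) A = (\<integral>\<^sup>+z. indicator A z \<partial>distr ?M ?M (\<lambda>z. w *s z))"
    using A by simp
  also have "\<dots> = (\<integral>\<^sup>+z. indicator A (w *s z) \<partial>?M)"
    by (rule nn_integral_distr[OF ms]) (use iA in simp)
  also have "\<dots> = (\<integral>\<^sup>+z. indicator A ((w *s z) /\<^sub>R norm (w *s z)) * indicator (sphere 0 1) ((w *s z) /\<^sub>R norm (w *s z)) * indicator (ball 0 1) (w *s z) \<partial>lborel)
      / emeasure lborel (ball (0 :: complex ^ 'n) 1)"
    unfolding nn_integral_sphere[OF iA2] unit
    by (intro arg_cong2[where f = "(/)"] nn_integral_cong refl) (simp add: indicator_def w)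
  also have "\<dots> = (\<integral>\<^sup>+z. indicator A (z /\<^sub>R norm z) * indicator (sphere 0 1) (z /\<^sub>R norm z) * indicator (ball 0 1) z
       \<partial>distr lborel borel (\<lambda>z. w *s z)) / emeasure lborel (ball (0 :: complex ^ 'n) 1)"
    using bor by (subst nn_integral_distr) auto
  also have "\<dots> = emeasure ?M A"
    unfolding distr_lborel_smult[OF w] using nn_integral_sphere[OF iA] A by simp
  finally show "emeasure (distr ?M ?M (\<lambda>z. w *s z)) A = emeasure ?M A" .
qed simp

lemma integrable_sphere:
  fixes g :: "complex ^ 'n \<Rightarrow> 'b::{banach,second_countable_topology}"
  assumes g: "continuous_on (sphere 0 1) g"
  shows "integrable sphere_measure g"
proof -
  have "compact (g ` sphere 0 1)" by (intro compact_continuous_image g compact_sphere)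
  then obtain B where B: "\<forall>y\<in>g ` sphere 0 1. norm y \<le> B"
    using compact_imp_bounded bounded_iff by blast
  show ?thesis
    by (rule sphere.integrable_const_bound[of g B])
       (use B in \<open>auto intro!: AE_I2 borel_measurable_sphere g\<close>)
qed

section \<open>Square means on the sphere and Parseval's formula\<close>

definition sqnorm :: "(complex ^ 'n \<Rightarrow> complex) \<Rightarrow> real" where
  "sqnorm p = (\<integral>\<zeta>. (cmod (p \<zeta>))\<^sup>2 \<partial>sphere_measure)"

lemma sqnorm_nonneg [simp]: "sqnorm p \<ge> 0"
  by (simp add: sqnorm_def)

lemma sqnorm_integrable: "continuous_on (sphere 0 1) p \<Longrightarrow> integrable sphere_measure (\<lambda>\<zeta>. (cmod (p \<zeta>))\<^sup>2)"
  by (intro integrable_sphere continuous_intros)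

lemma sqnorm_mono:
  assumes "continuous_on (sphere 0 1) p" "continuous_on (sphere 0 1) q" "C \<ge> 0"
    and "\<And>\<zeta>. norm \<zeta> = 1 \<Longrightarrow> cmod (p \<zeta>) \<le> C * cmod (q \<zeta>)"
  shows "sqnorm p \<le> C\<^sup>2 * sqnorm q"
proof -
  have "sqnorm p \<le> (\<integral>\<zeta>. C\<^sup>2 * (cmod (q \<zeta>))\<^sup>2 \<partial>sphere_measure)"
    unfolding sqnorm_def
  proof (rule integral_mono)
    fix \<zeta> :: "complex ^ 'a" assume "\<zeta> \<in> space sphere_measure"
    then show "(cmod (p \<zeta>))\<^sup>2 \<le> C\<^sup>2 * (cmod (q \<zeta>))\<^sup>2"
      using power_mono[OF assms(4)[of \<zeta>], of 2] by (simp add: power_mult_distrib)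
  qed (use assms in \<open>auto intro!: sqnorm_integrable\<close>)
  then show ?thesis by (simp add: sqnorm_def)
qed

lemma sqnorm_const: "sqnorm (\<lambda>z :: complex ^ 'n. c) = (cmod c)\<^sup>2"
  by (simp add: sqnorm_def measure_sphere_measure)

lemma sqnorm_le:
  assumes "continuous_on (sphere 0 1) p" "\<And>\<zeta>. norm \<zeta> = 1 \<Longrightarrow> cmod (p \<zeta>) \<le> C"
  shows "sqnorm p \<le> C\<^sup>2"
proof -
  have "C \<ge> 0" using order_trans[OF norm_ge_zero assms(2)[of "axis undefined 1"]] by simp
  then show ?thesis using sqnorm_mono[OF assms(1), of "\<lambda>_. 1" C] assms(2) by (simp add: sqnorm_const)
qed

lemma sqnorm_scale: "sqnorm (\<lambda>z. c * p z) = (cmod c)\<^sup>2 * sqnorm p"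
  by (simp add: sqnorm_def norm_mult power_mult_distrib)

text \<open>The free parameter x matters: the best x recovers the triangle inequality without an
  inner product, and a degree-dependent x yields the lower bound of the K-functional in the
  interpolation argument.\<close>

lemma weighted_square_add_le:
  fixes a b x :: real
  assumes "x > 0"
  shows "(a + b)\<^sup>2 \<le> (1 + x) * a\<^sup>2 + (1 + 1 / x) * b\<^sup>2"
proof -
  have "0 \<le> x * (a - b / x)\<^sup>2" using assms by simp
  also have "x * (a - b / x)\<^sup>2 = x * a\<^sup>2 - 2 * a * b + b\<^sup>2 / x"
    using assms by (simp add: power2_eq_square field_simps)
  finally show ?thesis by (simp add: power2_sum algebra_simps)
qed

lemma sqnorm_add_le:
  assumes "continuous_on (sphere 0 1) p" "continuous_on (sphere 0 1) q" "x > 0"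
  shows "sqnorm (\<lambda>z. p z + q z) \<le> (1 + x) * sqnorm p + (1 + 1 / x) * sqnorm q"
proof -
  have "sqnorm (\<lambda>z. p z + q z) \<le>
      (\<integral>\<zeta>. (1 + x) * (cmod (p \<zeta>))\<^sup>2 + (1 + 1 / x) * (cmod (q \<zeta>))\<^sup>2 \<partial>sphere_measure)"
    unfolding sqnorm_def
  proof (rule integral_mono)
    fix \<zeta> :: "complex ^ 'a"
    have "(cmod (p \<zeta> + q \<zeta>))\<^sup>2 \<le> (cmod (p \<zeta>) + cmod (q \<zeta>))\<^sup>2"
      by (intro power_mono norm_triangle_ineq) simp
    also have "\<dots> \<le> (1 + x) * (cmod (p \<zeta>))\<^sup>2 + (1 + 1 / x) * (cmod (q \<zeta>))\<^sup>2"
      by (rule weighted_square_add_le[OF assms(3)])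
    finally show "(cmod (p \<zeta> + q \<zeta>))\<^sup>2 \<le> (1 + x) * (cmod (p \<zeta>))\<^sup>2 + (1 + 1 / x) * (cmod (q \<zeta>))\<^sup>2" .
  next
    show "integrable sphere_measure (\<lambda>\<zeta>. (cmod (p \<zeta> + q \<zeta>))\<^sup>2)"
      by (rule sqnorm_integrable) (intro continuous_on_add assms)
    show "integrable sphere_measure (\<lambda>\<zeta>. (1 + x) * (cmod (p \<zeta>))\<^sup>2 + (1 + 1 / x) * (cmod (q \<zeta>))\<^sup>2)"
      by (intro Bochner_Integration.integrable_add integrable_mult_right sqnorm_integrable assms)
  qed
  also have "\<dots> = (1 + x) * sqnorm p + (1 + 1 / x) * sqnorm q"
    unfolding sqnorm_def
    by (subst Bochner_Integration.integral_add)
       (auto intro!: sqnorm_integrable integrable_mult_right assms simp del: integrable_mult_left_iff)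
  finally show ?thesis .
qed

lemma homogeneous_polynomial_continuous: "homogeneous_polynomial k p \<Longrightarrow> continuous_on S p"
  using polys_line_holo[OF homogeneous_polynomial_polys, of k p S] by (simp add: line_holo_def)

text \<open>Rotation by w = exp(i pi / (j - k)) preserves the measure and multiplies the integrand
  by w^j times the conjugate of w^k, which is -1.\<close>

lemma homogeneous_orthogonal:
  fixes p q :: "complex ^ 'n \<Rightarrow> complex"
  assumes p: "homogeneous_polynomial j p" and q: "homogeneous_polynomial k q" and "j \<noteq> k"
  shows "(\<integral>\<zeta>. p \<zeta> * cnj (q \<zeta>) \<partial>sphere_measure) = 0"
proof -
  define w where "w = cis (pi / (real j - real k))"
  have w: "cmod w = 1" by (simp add: w_def)
  have "w ^ j * cnj (w ^ k) = cis (real j * (pi / (real j - real k)) - real k * (pi / (real j - real k)))"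
    by (simp only: w_def Complex.DeMoivre cis_cnj cis_mult diff_conv_add_uminus)
  also have "real j * (pi / (real j - real k)) - real k * (pi / (real j - real k)) = pi"
    using \<open>j \<noteq> k\<close> by (simp add: diff_divide_distrib[symmetric] left_diff_distrib[symmetric])
  finally have wjk: "w ^ j * cnj (w ^ k) = -1" by simp
  have c: "continuous_on (sphere 0 1) (\<lambda>\<zeta>. p \<zeta> * cnj (q \<zeta>))"
    by (intro continuous_intros homogeneous_polynomial_continuous[OF p] homogeneous_polynomial_continuous[OF q])
  have "(\<integral>\<zeta>. p \<zeta> * cnj (q \<zeta>) \<partial>sphere_measure) =
      (\<integral>\<zeta>. p \<zeta> * cnj (q \<zeta>) \<partial>distr sphere_measure sphere_measure (\<lambda>z. w *s z))"
    by (simp add: distr_sphere_smult[OF w])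
  also have "\<dots> = (\<integral>\<zeta>. p (w *s \<zeta>) * cnj (q (w *s \<zeta>)) \<partial>sphere_measure)"
    by (rule integral_distr[OF measurable_smult_sphere[OF w] borel_measurable_sphere[OF c]])
  also have "\<dots> = (\<integral>\<zeta>. - (p \<zeta> * cnj (q \<zeta>)) \<partial>sphere_measure)"
  proof (intro Bochner_Integration.integral_cong refl)
    fix \<zeta>
    have "p (w *s \<zeta>) * cnj (q (w *s \<zeta>)) = (w ^ j * cnj (w ^ k)) * (p \<zeta> * cnj (q \<zeta>))"
      by (simp add: homogeneous_polynomial_smult[OF p] homogeneous_polynomial_smult[OF q])
    then show "p (w *s \<zeta>) * cnj (q (w *s \<zeta>)) = - (p \<zeta> * cnj (q \<zeta>))" unfolding wjk by simp
  qed
  finally show ?thesis by simp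
qed

lemma sqnorm_sum_homogeneous:
  fixes F :: "nat \<Rightarrow> complex ^ 'n \<Rightarrow> complex"
  assumes F: "\<And>k. homogeneous_polynomial k (F k)"
  shows "sqnorm (\<lambda>z. \<Sum>k<m. F k z) = (\<Sum>k<m. sqnorm (F k))"
proof (induction m)
  case 0
  then show ?case using sqnorm_const[of 0] by simp
next
  case (Suc m)
  note c = homogeneous_polynomial_continuous[OF F]
  have cS: "continuous_on (sphere 0 1) (\<lambda>z. \<Sum>k<m. F k z)" by (intro continuous_on_sum c)
  have orth: "(\<integral>\<zeta>. (\<Sum>k<m. F k \<zeta>) * cnj (F m \<zeta>) \<partial>sphere_measure) = 0"
  proof -
    have "(\<integral>\<zeta>. (\<Sum>k<m. F k \<zeta>) * cnj (F m \<zeta>) \<partial>sphere_measure)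
       = (\<Sum>k<m. (\<integral>\<zeta>. F k \<zeta> * cnj (F m \<zeta>) \<partial>sphere_measure))"
      unfolding sum_distrib_right
      by (intro Bochner_Integration.integral_sum integrable_sphere continuous_on_mult c continuous_on_cnj)
    also have "\<dots> = 0" by (intro sum.neutral ballI homogeneous_orthogonal[OF F F]) auto
    finally show ?thesis .
  qed
  have ic: "integrable sphere_measure (\<lambda>\<zeta>. (\<Sum>k<m. F k \<zeta>) * cnj (F m \<zeta>))"
    by (intro integrable_sphere continuous_on_mult cS c continuous_on_cnj)
  have "(cmod (a + b))\<^sup>2 = ((cmod a)\<^sup>2 + (cmod b)\<^sup>2) + 2 * Re (a * cnj b)" for a b
    unfolding cmod_power2 by (simp add: power2_eq_square algebra_simps)
  then have "sqnorm (\<lambda>z. \<Sum>k<Suc m. F k z) =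
     (\<integral>\<zeta>. ((cmod (\<Sum>k<m. F k \<zeta>))\<^sup>2 + (cmod (F m \<zeta>))\<^sup>2) + 2 * Re ((\<Sum>k<m. F k \<zeta>) * cnj (F m \<zeta>)) \<partial>sphere_measure)"
    unfolding sqnorm_def by simp
  also have "\<dots> = (\<integral>\<zeta>. (cmod (\<Sum>k<m. F k \<zeta>))\<^sup>2 + (cmod (F m \<zeta>))\<^sup>2 \<partial>sphere_measure)
      + (\<integral>\<zeta>. 2 * Re ((\<Sum>k<m. F k \<zeta>) * cnj (F m \<zeta>)) \<partial>sphere_measure)"
    using ic
    by (intro Bochner_Integration.integral_add Bochner_Integration.integrable_add sqnorm_integrable cS c
        integrable_mult_right integrable_Re)
  also have "(\<integral>\<zeta>. 2 * Re ((\<Sum>k<m. F k \<zeta>) * cnj (F m \<zeta>)) \<partial>sphere_measure) = 0"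
    using ic orth integral_Re[OF ic] by (simp del: complex_cnj_mult times_complex.sel)
  also have "(\<integral>\<zeta>. (cmod (\<Sum>k<m. F k \<zeta>))\<^sup>2 + (cmod (F m \<zeta>))\<^sup>2 \<partial>sphere_measure)
     = sqnorm (\<lambda>z. \<Sum>k<m. F k z) + sqnorm (F m)"
    unfolding sqnorm_def by (intro Bochner_Integration.integral_add sqnorm_integrable cS c)
  finally show ?case using Suc.IH by simp
qed

text \<open>Parseval's formula on the sphere of radius r. Bounding the components on a slightly
  larger sphere of radius r' makes the partial sums geometrically dominated, so orthogonality passes
  to the limit by dominated convergence.\<close>

lemma hardy_mean_sums:
  fixes f :: "complex ^ 'n \<Rightarrow> complex"
  assumes f: "f \<in> holomorphic_ball" and r: "0 < r" "r < 1"
  shows "(\<lambda>k. r ^ (2 * k) * sqnorm (homogeneous_expansion f k)) sums hardy_mean f r"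
proof -
  define F where "F k z = of_real r ^ k * homogeneous_expansion f k z" for k z
  have F: "homogeneous_polynomial k (F k)" for k
    unfolding F_def by (intro homogeneous_polynomial_scale homogeneous_expansion_homogeneous f)
  obtain r' where r': "r < r'" "r' < 1" using r dense by blast
  obtain B where B: "B > 0" "\<And>k z. norm (homogeneous_expansion f k z) \<le> B * (norm z / r') ^ k"
    using homogeneous_expansion_bound[OF f, of r'] r r' by auto
  define q where "q = r / r'"
  have q: "0 < q" "q < 1" using r r' by (auto simp: q_def)
  have Fb: "norm (F k \<zeta>) \<le> B * q ^ k" if "norm \<zeta> = 1" for k \<zeta>
  proof -
    have "norm (F k \<zeta>) \<le> r ^ k * (B * (1 / r') ^ k)"
      unfolding F_def norm_mult using B(2)[of k \<zeta>] r that by (auto simp: norm_power intro!: mult_left_mono)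
    then show ?thesis by (simp add: q_def power_divide mult.commute)
  qed
  have Fs: "(\<lambda>k. F k \<zeta>) sums f (r *\<^sub>R \<zeta>)" if "norm \<zeta> = 1" for \<zeta>
  proof -
    have "(\<lambda>k. homogeneous_expansion f k (of_real r *s \<zeta>)) sums f (of_real r *s \<zeta>)"
      by (rule homogeneous_expansion_sums[OF f]) (use that r in auto)
    then show ?thesis
      unfolding scaleR_eq_smult F_def
      by (simp add: homogeneous_polynomial_smult[OF homogeneous_expansion_homogeneous[OF f]])
  qed
  have "(\<lambda>m. sqnorm (\<lambda>z. \<Sum>k<m. F k z)) \<longlonglongrightarrow> hardy_mean f r"
    unfolding sqnorm_def hardy_mean_def
  proof (rule integral_dominated_convergence[where w = "\<lambda>_. (B * (1 / (1 - q)))\<^sup>2"])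
    have "continuous_on (sphere 0 1) (\<lambda>\<zeta>. f (r *\<^sub>R \<zeta>))"
    proof (rule continuous_on_compose2[of "ball 0 1" f])
      show "continuous_on (ball 0 1) f" using f by (simp add: holomorphic_ball_iff line_holo_def)
    qed (use r in \<open>auto intro!: continuous_intros\<close>)
    then show "(\<lambda>\<zeta>. (cmod (f (r *\<^sub>R \<zeta>)))\<^sup>2) \<in> borel_measurable sphere_measure"
      by (intro borel_measurable_sphere continuous_intros)
    show "(\<lambda>\<zeta>. (cmod (\<Sum>k<m. F k \<zeta>))\<^sup>2) \<in> borel_measurable sphere_measure" for m
      by (intro borel_measurable_sphere continuous_intros homogeneous_polynomial_continuous[OF F])
    show "AE \<zeta> in sphere_measure. (\<lambda>m. (cmod (\<Sum>k<m. F k \<zeta>))\<^sup>2) \<longlonglongrightarrow> (cmod (f (r *\<^sub>R \<zeta>)))\<^sup>2"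
      using Fs by (intro AE_I2 tendsto_intros) (simp add: sums_def)
    show "AE \<zeta> in sphere_measure. norm ((cmod (\<Sum>k<m. F k \<zeta>))\<^sup>2) \<le> (B * (1 / (1 - q)))\<^sup>2" for m
    proof (rule AE_I2)
      fix \<zeta> :: "complex ^ 'n" assume "\<zeta> \<in> space sphere_measure"
      then have n: "norm \<zeta> = 1" by simp
      have "cmod (\<Sum>k<m. F k \<zeta>) \<le> (\<Sum>k<m. B * q ^ k)"
        by (rule sum_norm_le) (rule Fb[OF n])
      also have "\<dots> \<le> (\<Sum>k. B * q ^ k)"
        using q B by (intro sum_le_suminf summable_mult summable_geometric) auto
      also have "\<dots> = B * (1 / (1 - q))"
        using q by (subst suminf_mult) (auto simp: suminf_geometric)
      finally show "norm ((cmod (\<Sum>k<m. F k \<zeta>))\<^sup>2) \<le> (B * (1 / (1 - q)))\<^sup>2"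
        by (simp add: power_mono)
    qed
  qed simp
  moreover have "sqnorm (F k) = r ^ (2 * k) * sqnorm (homogeneous_expansion f k)" for k
    using r unfolding F_def sqnorm_scale by (simp add: norm_power power_mult[symmetric] mult.commute)
  ultimately show ?thesis
    unfolding sums_def sqnorm_sum_homogeneous[OF F] by simp
qed

section \<open>Point evaluations of homogeneous polynomials\<close>

lemma polys_translate: "p \<in> polys \<Longrightarrow> (\<lambda>w. p (a + w)) \<in> polys"
proof (induction rule: polys_induct)
  case zero
  show ?case by (rule polys_const)
next
  case (add c \<alpha> p)
  have "(\<lambda>w. \<Prod>i\<in>A. ((a + w) $ i) ^ \<alpha> i) \<in> polys" if "finite A" for A
    using that
  proof (induction A)
    case (insert i A)
    have "(\<lambda>w. (a $ i + w $ i) ^ \<alpha> i * (\<Prod>i\<in>A. ((a + w) $ i) ^ \<alpha> i)) \<in> polys"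
      by (intro polys_mult polys_power polys_add polys_const polys_nth insert.IH)
    then show ?case using insert.hyps by simp
  qed (use polys_const in simp)
  from polys_add[OF polys_scale[OF this[of UNIV], of c] add.IH] show ?case
    by (simp add: monomial_def)
qed

lemma polys_continuous: "p \<in> polys \<Longrightarrow> continuous_on S p"
  using polys_line_holo[of p S] by (simp add: line_holo_def)

text \<open>A monomial of degree K > 0 changes sign under rotation by exp(i pi / K), so its integral
  over a centred ball vanishes and only the constant term contributes.\<close>

lemma polys_mean_value:
  fixes q :: "complex ^ 'n \<Rightarrow> complex"
  assumes "q \<in> polys"
  shows "(\<integral>w. indicator (cball 0 s) w *\<^sub>R q w \<partial>lborel) = measure lborel (cball (0 :: complex ^ 'n) s) *\<^sub>R q 0"
  using assms
proof (induction rule: polys_induct)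
  case (add c \<alpha> p)
  have int: "integrable lborel (\<lambda>w. indicator (cball 0 s) w *\<^sub>R q w)" if "q \<in> polys" for q :: "complex ^ 'n \<Rightarrow> complex"
    by (rule borel_integrable_compact) (use polys_continuous[OF that] in auto)
  have mono: "(\<integral>w. indicator (cball 0 s) w *\<^sub>R monomial \<alpha> w \<partial>lborel)
     = measure lborel (cball (0 :: complex ^ 'n) s) *\<^sub>R monomial \<alpha> 0"
  proof (cases "(\<Sum>i\<in>UNIV. \<alpha> i) = 0")
    case True
    then have "monomial \<alpha> = (\<lambda>z :: complex ^ 'n. 1)" by (simp add: monomial_def fun_eq_iff)
    moreover have "emeasure lborel (cball (0 :: complex ^ 'n) s) < \<infinity>"
      by (rule emeasure_lborel_cball_finite)
    ultimately show ?thesis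
      using has_bochner_integral_integral_eq[OF has_bochner_integral_indicator[of "cball 0 s" lborel "1 :: complex"]]
      by simp
  next
    case False
    define K where "K = (\<Sum>i\<in>UNIV. \<alpha> i)"
    define w where "w = cis (pi / real K)"
    have w: "cmod w = 1" by (simp add: w_def)
    have "K > 0" using False unfolding K_def by blast
    then have wK: "w ^ K = -1" by (simp add: w_def Complex.DeMoivre)
    let ?h = "\<lambda>z :: complex ^ 'n. indicator (cball 0 s) z *\<^sub>R monomial \<alpha> z"
    have hm: "?h \<in> borel_measurable borel"
      using int[OF polys_monomial[of \<alpha>]] by (auto dest: borel_measurable_integrable)
    have "(\<integral>z. ?h z \<partial>lborel) = (\<integral>z. ?h z \<partial>distr lborel borel (\<lambda>z. w *s z))"
      by (simp add: distr_lborel_smult[OF w])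
    also have "\<dots> = (\<integral>z. ?h (w *s z) \<partial>lborel)"
      by (rule integral_distr) (use hm in auto)
    also have "\<dots> = (\<integral>z. - ?h z \<partial>lborel)"
      by (intro Bochner_Integration.integral_cong refl) (simp add: indicator_def w monomial_smult K_def[symmetric] wK)
    finally have 1: "(\<integral>z. ?h z \<partial>lborel) = 0" by simp
    have "monomial \<alpha> (0 *s 0 :: complex ^ 'n) = 0 ^ K * monomial \<alpha> 0"
      unfolding K_def by (rule monomial_smult)
    then have "monomial \<alpha> (0 :: complex ^ 'n) = 0" using \<open>K > 0\<close> by (simp add: power_0_left)
    then show ?thesis using 1 by simp
  qed
  have "(\<integral>w. indicator (cball 0 s) w *\<^sub>R (c * monomial \<alpha> w + p w) \<partial>lborel)
    = (\<integral>w. c * (indicator (cball 0 s) w *\<^sub>R monomial \<alpha> w) + indicator (cball 0 s) w *\<^sub>R p w \<partial>lborel)"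
    by (intro Bochner_Integration.integral_cong refl) (simp add: indicator_def)
  also have "\<dots> = c * (\<integral>w. indicator (cball 0 s) w *\<^sub>R monomial \<alpha> w \<partial>lborel) + (\<integral>w. indicator (cball 0 s) w *\<^sub>R p w \<partial>lborel)"
    using int[OF polys_monomial[of \<alpha>]] int[OF add.hyps(1)]
    by (subst Bochner_Integration.integral_add)
       (simp_all only: integrable_mult_right integral_mult_right_zero)
  finally show ?case unfolding mono add.IH by (simp add: scaleR_right_distrib)
qed simp

lemma nn_integral_ball_scale:
  fixes h :: "complex ^ 'n \<Rightarrow> ennreal"
  assumes h: "h \<in> borel_measurable borel" and R: "R > 0"
  shows "(\<integral>\<^sup>+y. h y \<partial>lborel) = ennreal (R ^ DIM(complex ^ 'n)) * (\<integral>\<^sup>+y. h (R *\<^sub>R y) \<partial>lborel)"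
proof -
  have m: "(\<lambda>x :: complex ^ 'n. R *\<^sub>R x) \<in> borel_measurable borel" by measurable
  have hm: "(\<lambda>x. h (R *\<^sub>R x)) \<in> borel_measurable borel" by (rule measurable_compose[OF m h])
  have "(\<integral>\<^sup>+y. h y \<partial>lborel) =
     (\<integral>\<^sup>+y. h y \<partial>density (distr lborel borel (\<lambda>x. 0 + R *\<^sub>R x)) (\<lambda>_. ennreal (\<bar>R\<bar> ^ DIM(complex ^ 'n))))"
    using lborel_affine[of R "0 :: complex ^ 'n"] R by simp
  also have "\<dots> = (\<integral>\<^sup>+y. ennreal (R ^ DIM(complex ^ 'n)) * h y \<partial>distr lborel borel (\<lambda>x. R *\<^sub>R x))"
    using R h by (subst nn_integral_density) (auto simp: abs_of_pos)
  also have "\<dots> = (\<integral>\<^sup>+y. ennreal (R ^ DIM(complex ^ 'n)) * h (R *\<^sub>R y) \<partial>lborel)"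
    using h m by (subst nn_integral_distr) auto
  also have "\<dots> = ennreal (R ^ DIM(complex ^ 'n)) * (\<integral>\<^sup>+y. h (R *\<^sub>R y) \<partial>lborel)"
    using hm by (intro nn_integral_cmult) auto
  finally show ?thesis .
qed

text \<open>The mean value property of \<open>p\<^sup>2\<close> on a small ball around a point of the sphere bounds point
  evaluations; polar coordinates compare the volume integral with the integral over the sphere.\<close>

lemma homogeneous_sphere_bound:
  fixes p :: "complex ^ 'n \<Rightarrow> complex"
  assumes p: "homogeneous_polynomial k p" and z: "norm z = 1" and s: "s > 0"
  shows "(cmod (p z))\<^sup>2 \<le> ((1 + 2 * s) ^ (DIM(complex ^ 'n) + 2 * k) / s ^ DIM(complex ^ 'n)) * sqnorm p"
proof -
  define d where "d = DIM(complex ^ 'n)"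
  \<comment> \<open>The closed ball of radius s around the unit vector z lies in the open ball of
    radius R, with room for strict inequality.\<close>
  define R where "R = 1 + 2 * s"
  define v where "v = measure lborel (ball (0 :: complex ^ 'n) 1)"
  define V where "V = measure lborel (cball (0 :: complex ^ 'n) s)"
  have R: "R > 0" using s by (simp add: R_def)
  have ev: "emeasure lborel (ball (0 :: complex ^ 'n) 1) = ennreal v"
    unfolding v_def by (rule emeasure_eq_ennreal_measure) (use emeasure_ball_fin in \<open>simp add: top_unique\<close>)
  have v: "v > 0"
    using ev emeasure_ball_pos[where 'a = "complex ^ 'n"] by (metis ennreal_0 measure_nonneg order_le_less v_def)
  have Vv: "V \<ge> s ^ d * v"
  proof -
    have "s ^ d * v = measure lborel (ball (0 :: complex ^ 'n) s)"
      using content_ball_conv_unit_ball[of s "0 :: complex ^ 'n"] s by (simp add: v_def d_def)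
    also have "\<dots> \<le> V"
      unfolding V_def
      using emeasure_lborel_cball_finite[of "0 :: complex ^ 'n" s]
      by (intro measure_mono_fmeasurable) (auto simp: fmeasurable_def)
    finally show ?thesis .
  qed
  have pp: "p \<in> polys" by (rule homogeneous_polynomial_polys[OF p])
  have q: "(\<lambda>w. p (z + w) ^ 2) \<in> polys" by (intro polys_power polys_translate pp)
  define h where "h y = indicator (ball 0 R) y * ennreal ((cmod (p y))\<^sup>2)" for y
  have pm: "(\<lambda>y. ennreal ((cmod (p y))\<^sup>2)) \<in> borel_measurable borel"
    using borel_measurable_continuous_onI[OF polys_continuous[OF pp]] by measurable
  have bm: "ball (0 :: complex ^ 'n) r \<in> sets borel" for r by simp
  have hm: "h \<in> borel_measurable borel"
    unfolding h_def using pm bm by (intro borel_measurable_times_ennreal borel_measurable_indicator)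
  have "ennreal (V * (cmod (p z))\<^sup>2) = ennreal (norm (\<integral>w. indicator (cball 0 s) w *\<^sub>R (p (z + w) ^ 2) \<partial>lborel))"
    unfolding polys_mean_value[OF q] by (simp add: V_def norm_power)
  also have "\<dots> \<le> (\<integral>\<^sup>+w. ennreal (norm (indicator (cball 0 s) w *\<^sub>R (p (z + w) ^ 2))) \<partial>lborel)"
    by (intro integral_norm_bound_ennreal borel_integrable_compact polys_continuous[OF q]) simp
  also have "\<dots> \<le> (\<integral>\<^sup>+w. h (z + w) \<partial>lborel)"
  proof (rule nn_integral_mono)
    fix w :: "complex ^ 'n"
    have "norm (z + w) < R" if "norm w \<le> s"
      using norm_triangle_ineq[of z w] that z s by (simp add: R_def)
    then show "ennreal (norm (indicator (cball 0 s) w *\<^sub>R (p (z + w) ^ 2))) \<le> h (z + w)"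
      by (auto simp: h_def indicator_def norm_power)
  qed
  also have "\<dots> = (\<integral>\<^sup>+w. h w \<partial>distr lborel borel (\<lambda>w. z + w))"
    using hm by (subst nn_integral_distr) auto
  also have "\<dots> = (\<integral>\<^sup>+w. h w \<partial>lborel)"
    using lborel_distr_plus[of z] by simp
  also have "\<dots> = ennreal (R ^ d) * (\<integral>\<^sup>+w. h (R *\<^sub>R w) \<partial>lborel)"
    unfolding d_def by (rule nn_integral_ball_scale[OF hm R])
  \<comment> \<open>Since |w|^k \<le> 1, homogeneity allows the value at w to be replaced by the
    value at w / |w|. The volume integral thereby turns into an integral over the sphere.\<close>
  also have "(\<integral>\<^sup>+w. h (R *\<^sub>R w) \<partial>lborel) \<le>
     (\<integral>\<^sup>+w. ennreal (R ^ (2 * k)) * (ennreal ((cmod (p (w /\<^sub>R norm w)))\<^sup>2) * indicator (ball 0 1) w) \<partial>lborel)"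
  proof (rule nn_integral_mono)
    fix w :: "complex ^ 'n"
    have "(cmod (p (R *\<^sub>R w)))\<^sup>2 \<le> R ^ (2 * k) * (cmod (p (w /\<^sub>R norm w)))\<^sup>2" if "norm w < 1"
    proof -
      have pR: "(cmod (p (R *\<^sub>R w)))\<^sup>2 = R ^ (2 * k) * (cmod (p w))\<^sup>2"
        unfolding scaleR_eq_smult homogeneous_polynomial_smult[OF p] using R
        by (simp add: norm_mult norm_power power_mult_distrib power_mult[symmetric] mult.commute)
      have "cmod (p w) \<le> cmod (p (w /\<^sub>R norm w))"
      proof (cases "w = 0")
        case False
        have "p w = p (of_real (norm w) *s (w /\<^sub>R norm w))"
          using False by (simp flip: scaleR_eq_smult)
        also have "\<dots> = of_real (norm w) ^ k * p (w /\<^sub>R norm w)"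
          by (rule homogeneous_polynomial_smult[OF p])
        finally have "cmod (p w) = norm w ^ k * cmod (p (w /\<^sub>R norm w))"
          by (simp add: norm_mult norm_power)
        also have "\<dots> \<le> 1 * cmod (p (w /\<^sub>R norm w))"
          using that by (intro mult_right_mono power_le_one) auto
        finally show ?thesis by simp
      qed simp
      then show ?thesis unfolding pR using R by (intro mult_left_mono power_mono) auto
    qed
    then show "h (R *\<^sub>R w) \<le> ennreal (R ^ (2 * k)) * (ennreal ((cmod (p (w /\<^sub>R norm w)))\<^sup>2) * indicator (ball 0 1) w)"
      using R by (auto simp: h_def indicator_def ennreal_mult[symmetric] intro!: ennreal_leI)
  qed
  also have "\<dots> = ennreal (R ^ (2 * k)) * (\<integral>\<^sup>+w. ennreal ((cmod (p (w /\<^sub>R norm w)))\<^sup>2) * indicator (ball 0 1) w \<partial>lborel)"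
  proof (rule nn_integral_cmult)
    have "(\<lambda>w :: complex ^ 'n. w /\<^sub>R norm w) \<in> borel_measurable borel" by measurable
    from measurable_compose[OF this pm]
    show "(\<lambda>w. ennreal ((cmod (p (w /\<^sub>R norm w)))\<^sup>2) * indicator (ball 0 1) w) \<in> borel_measurable lborel"
      using bm by (intro borel_measurable_times_ennreal borel_measurable_indicator) auto
  qed
  also have "(\<integral>\<^sup>+w. ennreal ((cmod (p (w /\<^sub>R norm w)))\<^sup>2) * indicator (ball 0 1) w \<partial>lborel) = ennreal (v * sqnorm p)"
  proof -
    have c: "continuous_on (sphere 0 1) p" by (rule polys_continuous[OF pp])
    have "(\<lambda>\<zeta>. ennreal ((cmod (p \<zeta>))\<^sup>2)) \<in> borel_measurable sphere_measure"
      using borel_measurable_sphere[OF c] by measurable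
    from nn_integral_sphere'[OF this]
    have "(\<integral>\<^sup>+w. ennreal ((cmod (p (w /\<^sub>R norm w)))\<^sup>2) * indicator (ball 0 1) w \<partial>lborel) / ennreal v
       = (\<integral>\<^sup>+\<zeta>. ennreal ((cmod (p \<zeta>))\<^sup>2) \<partial>sphere_measure)"
      unfolding ev by simp
    also have "\<dots> = ennreal (sqnorm p)"
      unfolding sqnorm_def by (intro nn_integral_eq_integral sqnorm_integrable c) simp
    finally have e: "(\<integral>\<^sup>+w. ennreal ((cmod (p (w /\<^sub>R norm w)))\<^sup>2) * indicator (ball 0 1) w \<partial>lborel) / ennreal v
       = ennreal (sqnorm p)" .
    have "(\<integral>\<^sup>+w. ennreal ((cmod (p (w /\<^sub>R norm w)))\<^sup>2) * indicator (ball 0 1) w \<partial>lborel)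
      = ennreal v * ((\<integral>\<^sup>+w. ennreal ((cmod (p (w /\<^sub>R norm w)))\<^sup>2) * indicator (ball 0 1) w \<partial>lborel) / ennreal v)"
      using v by (simp add: ennreal_times_divide mult.commute[of "ennreal v"] mult_divide_eq_ennreal)
    then show ?thesis unfolding e using v by (simp add: ennreal_mult)
  qed
  finally have "ennreal (V * (cmod (p z))\<^sup>2) \<le> ennreal (R ^ d * (R ^ (2 * k) * (v * sqnorm p)))"
    using R v by (simp add: ennreal_mult mult_left_mono)
  then have "V * (cmod (p z))\<^sup>2 \<le> R ^ d * (R ^ (2 * k) * (v * sqnorm p))"
    using R v by (subst (asm) ennreal_le_iff) auto
  moreover have "s ^ d * v * (cmod (p z))\<^sup>2 \<le> V * (cmod (p z))\<^sup>2"
    by (intro mult_right_mono Vv) simp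
  ultimately have "v * (s ^ d * (cmod (p z))\<^sup>2) \<le> v * (R ^ (d + 2 * k) * sqnorm p)"
    by (simp add: power_add mult_ac)
  then have "s ^ d * (cmod (p z))\<^sup>2 \<le> R ^ (d + 2 * k) * sqnorm p" using v by simp
  then show ?thesis using s unfolding d_def[symmetric] R_def[symmetric] by (simp add: field_simps)
qed

lemma homogeneous_bound:
  assumes "q > 1"
  obtains C where "C > 0"
    "\<And>k p (z :: complex ^ 'n). homogeneous_polynomial k p \<Longrightarrow> (cmod (p z))\<^sup>2 \<le> C * q ^ k * norm z ^ (2 * k) * sqnorm p"
proof -
  \<comment> \<open>The solution of (1 + 2 s)^2 = q: the degree-dependent factor in
    \<open>homogeneous_sphere_bound\<close> becomes exactly q^k, and the rest goes into C.\<close>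
  define s where "s = (sqrt q - 1) / 2"
  have s: "s > 0" using assms by (simp add: s_def)
  have s2: "1 + 2 * s = sqrt q" by (simp add: s_def field_simps)
  define d where "d = DIM(complex ^ 'n)"
  define C where "C = sqrt q ^ d / s ^ d"
  have C: "C > 0" using s assms by (simp add: C_def)
  have 1: "(cmod (p z))\<^sup>2 \<le> C * q ^ k * sqnorm p"
    if p: "homogeneous_polynomial k p" and z: "norm z = 1" for k p and z :: "complex ^ 'n"
  proof -
    have "(sqrt q) ^ (2 * k) = q ^ k" using assms by (simp add: power_mult)
    then show ?thesis
      using homogeneous_sphere_bound[OF p z s] unfolding s2 d_def[symmetric] by (simp add: C_def power_add)
  qed
  have "(cmod (p z))\<^sup>2 \<le> C * q ^ k * norm z ^ (2 * k) * sqnorm p"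
    if p: "homogeneous_polynomial k p" for k p and z :: "complex ^ 'n"
  proof (cases "z = 0")
    case True
    define e :: "complex ^ 'n" where "e = axis undefined 1"
    have "p (0 *s e) = 0 ^ k * p e" by (rule homogeneous_polynomial_smult[OF p])
    then have "p z = 0 ^ k * p e" using True by simp
    moreover have "norm e = 1" by (simp add: e_def)
    ultimately show ?thesis using 1[OF p, of e] True by (cases k) auto
  next
    case False
    have "p z = p (of_real (norm z) *s (z /\<^sub>R norm z))" using False by (simp flip: scaleR_eq_smult)
    also have "\<dots> = of_real (norm z) ^ k * p (z /\<^sub>R norm z)" by (rule homogeneous_polynomial_smult[OF p])
    finally have "(cmod (p z))\<^sup>2 = norm z ^ (2 * k) * (cmod (p (z /\<^sub>R norm z)))\<^sup>2"
      by (simp add: norm_mult norm_power power_mult_distrib power_mult[symmetric] mult.commute)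
    also have "\<dots> \<le> norm z ^ (2 * k) * (C * q ^ k * sqnorm p)"
      using False by (intro mult_left_mono 1[OF p]) auto
    finally show ?thesis by (simp add: mult_ac)
  qed
  then show ?thesis using that[OF C] by blast
qed

section \<open>Power weights against geometric growth\<close>

lemma powr_le_geometric:
  fixes b Q :: real
  assumes "Q > 1"
  obtains C where "C > 0" "\<And>k. k \<ge> 1 \<Longrightarrow> real k powr b \<le> C * Q ^ k"
proof -
  define c where "c = max b 1"
  \<comment> \<open>Chosen so that (1 + \<delta>) to the power c is Q: Bernoulli's inequality k
    \<delta> \<le> (1 + \<delta>)^k, raised to the power c, bounds k^c by a multiple of Q^k.\<close>
  define \<delta> where "\<delta> = Q powr (1 / c) - 1"
  have c: "c \<ge> 1" "c \<ge> b" by (auto simp: c_def)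
  have \<delta>: "\<delta> > 0" using assms c by (simp add: \<delta>_def)
  have Q: "(1 + \<delta>) powr c = Q" using assms c by (simp add: \<delta>_def powr_powr)
  have "real k powr b \<le> (1 / \<delta>) powr c * Q ^ k" if "k \<ge> 1" for k
  proof -
    have "1 + real k * \<delta> \<le> (1 + \<delta>) ^ k" using Bernoulli_inequality[of \<delta> k] \<delta> by simp
    then have "real k * \<delta> \<le> (1 + \<delta>) ^ k" by linarith
    then have "real k \<le> (1 / \<delta>) * (1 + \<delta>) ^ k" using \<delta> by (simp add: field_simps)
    then have "real k powr c \<le> ((1 / \<delta>) * (1 + \<delta>) ^ k) powr c" using c by (intro powr_mono2) auto
    also have "\<dots> = (1 / \<delta>) powr c * ((1 + \<delta>) powr c) ^ k"
    proof -
      have "((1 + \<delta>) ^ k) powr c = ((1 + \<delta>) powr c) ^ k"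
        using \<delta> by (simp add: powr_powr mult.commute flip: powr_realpow)
      then show ?thesis using \<delta> by (subst powr_mult) auto
    qed
    finally have "real k powr c \<le> (1 / \<delta>) powr c * Q ^ k" by (simp add: Q)
    moreover have "real k powr b \<le> real k powr c" using that c by (intro powr_mono) auto
    ultimately show ?thesis by linarith
  qed
  then show ?thesis using \<delta> by (intro that[of "(1 / \<delta>) powr c"]) auto
qed

text \<open>The value 1 at k = 0 accounts for the summand |f(0)|^2 of the norm, since the radial
  power annihilates the constant component.\<close>

definition weight :: "real \<Rightarrow> nat \<Rightarrow> real" where
  "weight \<beta> k = (if k = 0 then 1 else real k powr (2 * \<beta>))"

lemma weight_pos [simp]: "weight \<beta> k > 0"
  by (simp add: weight_def)

lemma weight_nonneg [simp]: "weight \<beta> k \<ge> 0"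
  by (rule less_imp_le) simp

lemma weight_le_geometric:
  assumes "Q > 1"
  obtains C where "C > 0" "\<And>k. weight \<beta> k \<le> C * Q ^ k"
proof -
  obtain C where C: "C > 0" "\<And>k. k \<ge> 1 \<Longrightarrow> real k powr (2 * \<beta>) \<le> C * Q ^ k"
    using powr_le_geometric[OF assms] by blast
  have "weight \<beta> k \<le> max C 1 * Q ^ k" for k
  proof (cases "k = 0")
    case False
    then have "weight \<beta> k \<le> C * Q ^ k" using C(2)[of k] by (simp add: weight_def)
    also have "\<dots> \<le> max C 1 * Q ^ k" using assms by (intro mult_right_mono) auto
    finally show ?thesis .
  qed (simp add: weight_def)
  then show ?thesis using C by (intro that[of "max C 1"]) auto
qed

lemma weight_uminus: "weight (- \<beta>) k = 1 / weight \<beta> k"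
  by (simp add: weight_def powr_minus field_simps)

text \<open>The constant absorbs the gap between \<open>\<rho>\<close> and the radius of the ball.\<close>

lemma component_bound:
  fixes \<rho> \<beta> :: real
  assumes \<rho>: "0 < \<rho>" "\<rho> < 1"
  obtains C q where "C > 0" "0 < q" "q < 1"
    "\<And>k p (z :: complex ^ 'n) S. \<lbrakk>homogeneous_polynomial k p; weight \<beta> k * sqnorm p \<le> S\<^sup>2; S \<ge> 0; norm z \<le> \<rho>\<rbrakk>
       \<Longrightarrow> cmod (p z) \<le> C * q ^ k * S"
proof -
  \<comment> \<open>Half of the growth Q^k is granted to point evaluations and half to the weight.
    Together with |z|^(2 k) \<le> \<rho>^(2 k) this leaves \<rho>^k for the square, hence the ratio
    sqrt \<rho>.\<close>
  define Q where "Q = 1 / \<rho>"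
  have Q: "Q > 1" using \<rho> by (simp add: Q_def)
  define R where "R = sqrt Q"
  have R: "R > 1" using Q by (simp add: R_def)
  have RR: "R * R = Q" using Q by (simp add: R_def)
  obtain C1 where C1: "C1 > 0" "\<And>k p (z :: complex ^ 'n). homogeneous_polynomial k p \<Longrightarrow> (cmod (p z))\<^sup>2 \<le> C1 * R ^ k * norm z ^ (2 * k) * sqnorm p"
    using homogeneous_bound[OF R] by blast
  obtain C2 where C2: "C2 > 0" "\<And>k. weight (- \<beta>) k \<le> C2 * R ^ k"
    using weight_le_geometric[OF R] by blast
  show thesis
  proof (rule that[of "sqrt (C1 * C2)" "sqrt \<rho>"])
    show "sqrt (C1 * C2) > 0" using C1 C2 by simp
    show "0 < sqrt \<rho>" "sqrt \<rho> < 1" using \<rho> by auto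
    fix k S and p :: "complex ^ 'n \<Rightarrow> complex" and z :: "complex ^ 'n"
    assume p: "homogeneous_polynomial k p" and S: "weight \<beta> k * sqnorm p \<le> S\<^sup>2" "S \<ge> 0" and z: "norm z \<le> \<rho>"
    have "sqnorm p \<le> weight (- \<beta>) k * S\<^sup>2"
      using S by (simp add: weight_uminus field_simps)
    also have "\<dots> \<le> (C2 * R ^ k) * S\<^sup>2" by (intro mult_right_mono C2) simp
    finally have sq: "sqnorm p \<le> (C2 * R ^ k) * S\<^sup>2" .
    have "(cmod (p z))\<^sup>2 \<le> C1 * R ^ k * norm z ^ (2 * k) * sqnorm p" by (rule C1(2)[OF p])
    also have "\<dots> \<le> C1 * R ^ k * \<rho> ^ (2 * k) * ((C2 * R ^ k) * S\<^sup>2)"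
      using C1 C2 R z \<rho> by (intro mult_mono sq power_mono) auto
    also have "\<dots> = C1 * C2 * (Q * \<rho> * \<rho>) ^ k * S\<^sup>2"
      by (simp add: RR[symmetric] power_mult_distrib power_mult power2_eq_square mult_ac)
    also have "Q * \<rho> * \<rho> = \<rho>" using \<rho> by (simp add: Q_def)
    also have "C1 * C2 * \<rho> ^ k * S\<^sup>2 = (sqrt (C1 * C2) * sqrt \<rho> ^ k * S)\<^sup>2"
    proof -
      have "(sqrt \<rho> ^ k)\<^sup>2 = ((sqrt \<rho>)\<^sup>2) ^ k" by (simp only: power_mult[symmetric] mult.commute)
      then have "(sqrt \<rho> ^ k)\<^sup>2 = \<rho> ^ k" using \<rho> by simp
      moreover have "(sqrt (C1 * C2))\<^sup>2 = C1 * C2" using C1(1) C2(1) by (intro real_sqrt_pow2) simp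
      ultimately show ?thesis by (simp only: power_mult_distrib)
    qed
    finally show "cmod (p z) \<le> sqrt (C1 * C2) * sqrt \<rho> ^ k * S"
      by (rule power2_le_imp_le) (use C1(1) C2(1) \<rho> S(2) in simp)
  qed
qed

section \<open>Hardy-Sobolev spaces as weighted sums over homogeneous components\<close>

text \<open>A finite partial sum is continuous at r = 1, so it inherits every upper bound of g from
  the left. Conversely r^(2 k) \<le> 1 bounds g by the full sum.\<close>

lemma power_series_sup:
  fixes a :: "nat \<Rightarrow> real"
  assumes a: "\<And>k. a k \<ge> 0" and g: "\<And>r. 0 < r \<Longrightarrow> r < 1 \<Longrightarrow> (\<lambda>k. r ^ (2 * k) * a k) sums g r"
  shows "bdd_above (g ` {0<..<1}) \<longleftrightarrow> summable a"
    and "summable a \<Longrightarrow> (SUP r\<in>{0<..<1}. g r) = suminf a"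
proof -
  have partial: "(\<Sum>k<m. a k) \<le> M" if M: "\<And>r. 0 < r \<Longrightarrow> r < 1 \<Longrightarrow> g r \<le> M" for m M
  proof (rule tendsto_upperbound)
    show "((\<lambda>r. \<Sum>k<m. r ^ (2 * k) * a k) \<longlongrightarrow> (\<Sum>k<m. a k)) (at_left 1)"
      by (auto intro!: tendsto_eq_intros)
    have "\<forall>\<^sub>F r in at_left (1::real). r \<in> {0<..<1}"
      by (rule eventually_at_left_real) simp
    then show "\<forall>\<^sub>F r in at_left 1. (\<Sum>k<m. r ^ (2 * k) * a k) \<le> M"
    proof eventually_elim
      case (elim r)
      then have s: "summable (\<lambda>k. r ^ (2 * k) * a k)" "(\<Sum>k. r ^ (2 * k) * a k) = g r"
        using g[of r] by (auto simp: sums_iff)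
      have "(\<Sum>k<m. r ^ (2 * k) * a k) \<le> g r"
        unfolding s(2)[symmetric] by (rule sum_le_suminf[OF s(1)]) (use a elim in auto)
      then show ?case using M[of r] elim by auto
    qed
  qed auto
  have upper: "g r \<le> suminf a" if "summable a" "0 < r" "r < 1" for r
  proof -
    have "r ^ (2 * k) * a k \<le> 1 * a k" for k
      using that a by (intro mult_right_mono power_le_one) auto
    then show ?thesis
      by (intro sums_le[OF _ g[OF that(2,3)] summable_sums[OF that(1)]]) simp
  qed
  show "bdd_above (g ` {0<..<1}) \<longleftrightarrow> summable a"
  proof
    assume "bdd_above (g ` {0<..<1})"
    then obtain M where "\<forall>y\<in>g ` {0<..<1}. y \<le> M" unfolding bdd_above_def by blast
    then have M: "\<And>r. 0 < r \<Longrightarrow> r < 1 \<Longrightarrow> g r \<le> M" by auto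
    have "(\<Sum>k\<le>m. a k) \<le> M" for m
      using partial[OF M, of "Suc m"] by (simp only: lessThan_Suc_atMost)
    then show "summable a" using a by (intro bounded_imp_summable[where B = M]) auto
  next
    assume "summable a"
    then show "bdd_above (g ` {0<..<1})" using upper by (auto intro!: bdd_aboveI2)
  qed
  assume s: "summable a"
  show "(SUP r\<in>{0<..<1}. g r) = suminf a"
  proof (rule antisym)
    have ne: "{0<..<1::real} \<noteq> {}" by simp
    show "(SUP r\<in>{0<..<1}. g r) \<le> suminf a"
      by (rule cSUP_least[OF ne]) (use upper[OF s] in auto)
    have "bdd_above (g ` {0<..<1})" using upper[OF s] by (auto intro!: bdd_aboveI2)
    then have "g r \<le> (SUP r\<in>{0<..<1}. g r)" if "0 < r" "r < 1" for r
      using that by (intro cSUP_upper) auto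
    then show "suminf a \<le> (SUP r\<in>{0<..<1}. g r)"
      by (intro suminf_le_const[OF s] partial)
  qed
qed

lemma hardy_space_iff:
  assumes "f \<in> holomorphic_ball"
  shows "f \<in> hardy_space \<longleftrightarrow> summable (\<lambda>k. sqnorm (homogeneous_expansion f k))"
    and "f \<in> hardy_space \<Longrightarrow> (hardy_norm f)\<^sup>2 = (\<Sum>k. sqnorm (homogeneous_expansion f k))"
proof -
  note p = power_series_sup[of "\<lambda>k. sqnorm (homogeneous_expansion f k)" "hardy_mean f",
      OF sqnorm_nonneg hardy_mean_sums[OF assms]]
  show 1: "f \<in> hardy_space \<longleftrightarrow> summable (\<lambda>k. sqnorm (homogeneous_expansion f k))"
    using p(1) assms by (simp add: hardy_space_def)
  assume "f \<in> hardy_space"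
  then have s: "summable (\<lambda>k. sqnorm (homogeneous_expansion f k))" using 1 by blast
  have "(SUP r\<in>{0<..<1}. hardy_mean f r) = (\<Sum>k. sqnorm (homogeneous_expansion f k))"
    by (rule p(2)) (use s in auto)
  then show "(hardy_norm f)\<^sup>2 = (\<Sum>k. sqnorm (homogeneous_expansion f k))"
    unfolding hardy_norm_def using s by (simp add: suminf_nonneg)
qed

lemma homogeneous_expansion_0:
  assumes "f \<in> holomorphic_ball"
  shows "homogeneous_expansion f 0 z = f 0"
proof -
  note h = homogeneous_polynomial_smult[OF homogeneous_expansion_homogeneous[OF assms]]
  have z0: "homogeneous_expansion f k 0 = 0 ^ k * homogeneous_expansion f k z" for k
    using h[of k 0 z] by simp
  have "(\<lambda>k. homogeneous_expansion f k 0) sums homogeneous_expansion f 0 0"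
    using sums_single[of 0 "\<lambda>k. homogeneous_expansion f k 0"] z0
    by (elim sums_cong[THEN iffD1, rotated]) (auto simp: z0[of "Suc _"] gr0_conv_Suc)
  then have "homogeneous_expansion f 0 0 = f 0"
    using homogeneous_expansion_sums[OF assms, of 0] sums_unique2 by fastforce
  then show ?thesis using z0[of 0] by simp
qed

lemma radial_power_holomorphic:
  assumes f: "f \<in> holomorphic_ball"
  shows "radial_power \<beta> f \<in> holomorphic_ball"
    and "homogeneous_expansion (radial_power \<beta> f) =
      (\<lambda>k z. (if k = 0 then 0 else of_real (real k powr \<beta>)) * homogeneous_expansion f k z)"
proof -
  define F where "F k z = (if k = 0 then 0 else of_real (real k powr \<beta>)) * homogeneous_expansion f k z" for k z
  have F: "homogeneous_polynomial k (F k)" for k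
    unfolding F_def by (intro homogeneous_polynomial_scale homogeneous_expansion_homogeneous f)
  have S: "\<exists>A. summable A \<and> (\<forall>k z. norm z \<le> \<rho> \<longrightarrow> norm (F k z) \<le> A k)" if \<rho>: "0 < \<rho>" "\<rho> < 1" for \<rho> :: real
  proof -
    obtain r where r: "\<rho> < r" "r < 1" using \<rho> dense by blast
    obtain B where B: "B > 0" "\<And>k z. norm (homogeneous_expansion f k z) \<le> B * (norm z / r) ^ k"
      using homogeneous_expansion_bound[OF f, of r] r \<rho> by auto
    define q where "q = \<rho> / r"
    have q: "0 < q" "q < 1" using r \<rho> by (auto simp: q_def)
    \<comment> \<open>The power k^\<beta> grows more slowly than Q^k, and Q q < 1 keeps the majorant
      summable.\<close>
    obtain Q where Q: "1 < Q" "Q < 1 / q" using dense[of 1 "1 / q"] q by auto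
    obtain C where C: "C > 0" "\<And>k. k \<ge> 1 \<Longrightarrow> real k powr \<beta> \<le> C * Q ^ k"
      using powr_le_geometric[OF Q(1)] by blast
    have Qq: "0 < Q * q" "Q * q < 1" using Q q by (auto simp: field_simps)
    have "norm (F k z) \<le> C * B * (Q * q) ^ k" if z: "norm z \<le> \<rho>" for k z
    proof (cases "k = 0")
      case True
      then show ?thesis using C B by (simp add: F_def)
    next
      case False
      have "norm (F k z) = real k powr \<beta> * norm (homogeneous_expansion f k z)"
        using False by (simp add: F_def norm_mult)
      also have "\<dots> \<le> (C * Q ^ k) * (B * (norm z / r) ^ k)"
        using False C(1) Q by (intro mult_mono C(2) B(2)) auto
      also have "\<dots> \<le> (C * Q ^ k) * (B * q ^ k)"
        using C B Q z r \<rho> unfolding q_def by (intro mult_left_mono power_mono divide_right_mono) auto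
      finally show ?thesis by (simp add: power_mult_distrib mult_ac)
    qed
    moreover have "summable (\<lambda>k. C * B * (Q * q) ^ k)"
      using Qq by (intro summable_mult summable_geometric) auto
    ultimately show ?thesis by blast
  qed
  note H = homogeneous_series_holomorphic[OF F S]
  have "radial_power \<beta> f = on_ball (\<lambda>z. \<Sum>k. F k z)"
  proof
    fix z
    show "radial_power \<beta> f z = on_ball (\<lambda>z. \<Sum>k. F k z) z"
    proof (cases "z \<in> ball 0 1")
      case True
      have sm: "summable (\<lambda>k. F k z)" by (rule summable_norm_cancel, rule H(3), assumption+, rule True)
      have "(\<Sum>k. F k z) = (\<Sum>k. F (Suc k) z) + F 0 z"
        using suminf_split_head[OF sm] by simp
      then show ?thesis using True by (simp add: radial_power_def on_ball_def F_def)
    qed (auto simp: radial_power_def on_ball_def)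
  qed
  then show "radial_power \<beta> f \<in> holomorphic_ball" "homogeneous_expansion (radial_power \<beta> f) =
      (\<lambda>k z. (if k = 0 then 0 else of_real (real k powr \<beta>)) * homogeneous_expansion f k z)"
    using H(1,2) by (simp_all add: F_def[abs_def])
qed

lemma sqnorm_radial_power:
  assumes "f \<in> holomorphic_ball"
  shows "sqnorm (homogeneous_expansion (radial_power \<beta> f) k) =
     (if k = 0 then 0 else weight \<beta> k * sqnorm (homogeneous_expansion f k))"
  unfolding radial_power_holomorphic(2)[OF assms] sqnorm_scale
  by (simp add: weight_def power2_eq_square flip: powr_add)

lemma hardy_sobolev_space_iff:
  "f \<in> hardy_sobolev_space \<beta> \<longleftrightarrow> f \<in> holomorphic_ball \<and> summable (\<lambda>k. weight \<beta> k * sqnorm (homogeneous_expansion f k))"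
proof (cases "f \<in> holomorphic_ball")
  case True
  have "radial_power \<beta> f \<in> hardy_space \<longleftrightarrow>
      summable (\<lambda>k. if k = 0 then 0 else weight \<beta> k * sqnorm (homogeneous_expansion f k))"
    unfolding hardy_space_iff(1)[OF radial_power_holomorphic(1)[OF True]] sqnorm_radial_power[OF True] ..
  also have "\<dots> \<longleftrightarrow> summable (\<lambda>k. weight \<beta> k * sqnorm (homogeneous_expansion f k))"
    by (rule summable_cong, rule eventually_mono[OF eventually_gt_at_top[of 0]]) auto
  finally show ?thesis using True by (simp add: hardy_sobolev_space_def)
qed (simp add: hardy_sobolev_space_def)

lemma hardy_sobolev_norm_nonneg [simp]: "hardy_sobolev_norm \<beta> f \<ge> 0"
  by (simp add: hardy_sobolev_norm_def)

lemma hardy_sobolev_norm_sums: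
  assumes "f \<in> hardy_sobolev_space \<beta>"
  shows "(\<lambda>k. weight \<beta> k * sqnorm (homogeneous_expansion f k)) sums (hardy_sobolev_norm \<beta> f)\<^sup>2"
proof -
  have f: "f \<in> holomorphic_ball" and s: "summable (\<lambda>k. weight \<beta> k * sqnorm (homogeneous_expansion f k))"
    using assms by (auto simp: hardy_sobolev_space_iff)
  have R: "radial_power \<beta> f \<in> hardy_space" using assms by (simp add: hardy_sobolev_space_def)
  have "(\<Sum>k. if k = 0 then 0 else weight \<beta> k * sqnorm (homogeneous_expansion f k)) = (hardy_norm (radial_power \<beta> f))\<^sup>2"
    using hardy_space_iff(2)[OF radial_power_holomorphic(1)[OF f] R] by (simp add: sqnorm_radial_power[OF f])
  moreover have "summable (\<lambda>k. if k = 0 then 0 else weight \<beta> k * sqnorm (homogeneous_expansion f k))"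
    using s by (rule summable_cong[THEN iffD1, rotated], intro eventually_mono[OF eventually_gt_at_top[of 0]]) auto
  ultimately have 1: "(\<lambda>k. if k = 0 then 0 else weight \<beta> k * sqnorm (homogeneous_expansion f k)) sums (hardy_norm (radial_power \<beta> f))\<^sup>2"
    by (simp add: sums_iff)
  have 2: "(\<lambda>k. if k = 0 then (cmod (f 0))\<^sup>2 else 0) sums (cmod (f 0))\<^sup>2"
    using sums_single[of 0 "\<lambda>_. (cmod (f 0))\<^sup>2"] by simp
  have "homogeneous_expansion f 0 = (\<lambda>z. f 0)" by (rule ext) (rule homogeneous_expansion_0[OF f])
  then have "sqnorm (homogeneous_expansion f 0) = (cmod (f 0))\<^sup>2" by (simp add: sqnorm_const)
  then have "(\<lambda>k. (if k = 0 then (cmod (f 0))\<^sup>2 else 0) + (if k = 0 then 0 else weight \<beta> k * sqnorm (homogeneous_expansion f k)))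
      = (\<lambda>k. weight \<beta> k * sqnorm (homogeneous_expansion f k))"
    by (auto simp: weight_def)
  then show ?thesis
    using sums_add[OF 2 1] by (simp add: hardy_sobolev_norm_def)
qed

lemma hardy_sobolev_component_le:
  assumes "f \<in> hardy_sobolev_space \<beta>"
  shows "weight \<beta> k * sqnorm (homogeneous_expansion f k) \<le> (hardy_sobolev_norm \<beta> f)\<^sup>2"
  using sum_le_suminf[of "\<lambda>k. weight \<beta> k * sqnorm (homogeneous_expansion f k)" "{k}"]
    hardy_sobolev_norm_sums[OF assms] by (auto simp: sums_iff)

text \<open>Converse of the description by weighted sums: every admissible sequence of homogeneous
  polynomials comes from an element of the space. The splitting of a function in the interpolation
  argument and the limit in the completeness proof are obtained in this way.\<close>

lemma hardy_sobolev_of_components: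
  assumes F: "\<And>k. homogeneous_polynomial k (F k)" and S: "summable (\<lambda>k. weight \<beta> k * sqnorm (F k))"
  shows "on_ball (\<lambda>z. \<Sum>k. F k z) \<in> hardy_sobolev_space \<beta>"
    and "homogeneous_expansion (on_ball (\<lambda>z. \<Sum>k. F k z)) = F"
proof -
  define M where "M = sqrt (\<Sum>k. weight \<beta> k * sqnorm (F k))"
  have M0: "(\<Sum>k. weight \<beta> k * sqnorm (F k)) \<ge> 0" by (intro suminf_nonneg S) simp
  have M: "weight \<beta> k * sqnorm (F k) \<le> M\<^sup>2" for k
    using sum_le_suminf[OF S, of "{k}"] M0 by (simp add: M_def)
  have "M \<ge> 0" using M0 by (simp add: M_def)
  have *: "\<exists>A. summable A \<and> (\<forall>k z. norm z \<le> \<rho> \<longrightarrow> norm (F k z) \<le> A k)" if \<rho>: "0 < \<rho>" "\<rho> < 1" for \<rho> :: real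
  proof -
    obtain C q where Cq: "C > 0" "0 < q" "q < 1"
      "\<And>k p (z :: complex ^ 'a) S. \<lbrakk>homogeneous_polynomial k p; weight \<beta> k * sqnorm p \<le> S\<^sup>2; S \<ge> 0; norm z \<le> \<rho>\<rbrakk>
       \<Longrightarrow> cmod (p z) \<le> C * q ^ k * S"
      using component_bound[OF \<rho>, where \<beta> = \<beta>] by metis
    have "summable (\<lambda>k. C * q ^ k * M)"
      using Cq by (intro summable_mult summable_mult2 summable_geometric) auto
    moreover have "norm (F k z) \<le> C * q ^ k * M" if "norm z \<le> \<rho>" for k z
      by (rule Cq(4)[OF F M \<open>M \<ge> 0\<close> that])
    ultimately show ?thesis by blast
  qed
  note H = homogeneous_series_holomorphic[OF F *]
  show "homogeneous_expansion (on_ball (\<lambda>z. \<Sum>k. F k z)) = F" by (rule H(2))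
  then show "on_ball (\<lambda>z. \<Sum>k. F k z) \<in> hardy_sobolev_space \<beta>"
    using H(1) S by (simp add: hardy_sobolev_space_iff)
qed

section \<open>Bounded point evaluations and the triangle inequality\<close>

lemma hardy_sobolev_holomorphic: "f \<in> hardy_sobolev_space \<beta> \<Longrightarrow> f \<in> holomorphic_ball"
  by (simp add: hardy_sobolev_space_iff)

text \<open>The componentwise bounds form a geometric series. Uniformity on the ball of radius
  \<rho> makes norm convergence imply uniform convergence on smaller balls, which later identifies
  limits in closed graph arguments.\<close>

lemma hardy_sobolev_eval:
  fixes \<rho> \<beta> :: real
  assumes \<rho>: "0 < \<rho>" "\<rho> < 1"
  obtains C where "C > 0" "\<And>f (z :: complex ^ 'n). f \<in> hardy_sobolev_space \<beta> \<Longrightarrow> norm z \<le> \<rho> \<Longrightarrow> cmod (f z) \<le> C * hardy_sobolev_norm \<beta> f"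
proof -
  obtain C q where Cq: "C > 0" "0 < q" "q < 1"
    "\<And>k p (z :: complex ^ 'n) S. \<lbrakk>homogeneous_polynomial k p; weight \<beta> k * sqnorm p \<le> S\<^sup>2; S \<ge> 0; norm z \<le> \<rho>\<rbrakk>
     \<Longrightarrow> cmod (p z) \<le> C * q ^ k * S"
    using component_bound[OF \<rho>, where \<beta> = \<beta>] by metis
  have "cmod (f z) \<le> C * (1 / (1 - q)) * hardy_sobolev_norm \<beta> f"
    if f: "f \<in> hardy_sobolev_space \<beta>" and z: "norm z \<le> \<rho>" for f and z :: "complex ^ 'n"
  proof -
    have fh: "f \<in> holomorphic_ball" by (rule hardy_sobolev_holomorphic[OF f])
    have s: "(\<lambda>k. C * q ^ k * hardy_sobolev_norm \<beta> f) sums (C * (1 / (1 - q)) * hardy_sobolev_norm \<beta> f)"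
      using Cq by (intro sums_mult sums_mult2 geometric_sums) auto
    show ?thesis
      by (rule norm_sums_le[OF homogeneous_expansion_sums[OF fh] s])
         (use z \<rho> Cq(4)[OF homogeneous_expansion_homogeneous[OF fh] hardy_sobolev_component_le[OF f] hardy_sobolev_norm_nonneg z]
          in auto)
  qed
  then show ?thesis using Cq by (intro that[of "C * (1 / (1 - q))"]) auto
qed

lemma hardy_sobolev_0: "(\<lambda>z :: complex ^ 'n. 0) \<in> hardy_sobolev_space \<beta>"
proof -
  have "homogeneous_expansion (\<lambda>z :: complex ^ 'n. 0) = (\<lambda>k z. 0)"
    using homogeneous_expansion_scale[OF holomorphic_ball_0, of 0] by simp
  moreover have "sqnorm (\<lambda>z :: complex ^ 'n. 0) = 0" using sqnorm_const[of 0] by simp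
  ultimately show ?thesis by (simp add: hardy_sobolev_space_iff holomorphic_ball_0)
qed

lemma hardy_sobolev_scale:
  assumes "f \<in> hardy_sobolev_space \<beta>"
  shows "(\<lambda>z. c * f z) \<in> hardy_sobolev_space \<beta>"
    and "hardy_sobolev_norm \<beta> (\<lambda>z. c * f z) = cmod c * hardy_sobolev_norm \<beta> f"
proof -
  have f: "f \<in> holomorphic_ball" by (rule hardy_sobolev_holomorphic[OF assms])
  have e: "weight \<beta> k * sqnorm (homogeneous_expansion (\<lambda>z. c * f z) k) = (cmod c)\<^sup>2 * (weight \<beta> k * sqnorm (homogeneous_expansion f k))" for k
    by (simp add: homogeneous_expansion_scale[OF f] sqnorm_scale)
  have s: "(\<lambda>k. weight \<beta> k * sqnorm (homogeneous_expansion (\<lambda>z. c * f z) k)) sums ((cmod c)\<^sup>2 * (hardy_sobolev_norm \<beta> f)\<^sup>2)"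
    unfolding e by (rule sums_mult[OF hardy_sobolev_norm_sums[OF assms]])
  then show 1: "(\<lambda>z. c * f z) \<in> hardy_sobolev_space \<beta>"
    using holomorphic_ball_scale[OF f] by (auto simp: hardy_sobolev_space_iff sums_iff)
  have "(hardy_sobolev_norm \<beta> (\<lambda>z. c * f z))\<^sup>2 = (cmod c * hardy_sobolev_norm \<beta> f)\<^sup>2"
    using sums_unique2[OF hardy_sobolev_norm_sums[OF 1] s] by (simp add: power_mult_distrib)
  then show "hardy_sobolev_norm \<beta> (\<lambda>z. c * f z) = cmod c * hardy_sobolev_norm \<beta> f"
    by (simp add: power2_eq_iff_nonneg)
qed

text \<open>The choice x = b / a turns the right-hand side into (a + b)^2. Replacing a and b by a +
  e and b + e avoids division by zero, and then e tends to 0.\<close>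

lemma le_square_add_if_weighted:
  fixes a b c :: real
  assumes "a \<ge> 0" "b \<ge> 0" and le: "\<And>x. x > 0 \<Longrightarrow> c \<le> (1 + x) * a\<^sup>2 + (1 + 1 / x) * b\<^sup>2"
  shows "c \<le> (a + b)\<^sup>2"
proof -
  have *: "c \<le> (1 + (b + e) / (a + e)) * (a + e)\<^sup>2 + (1 + (a + e) / (b + e)) * (b + e)\<^sup>2" if "e > 0" for e
  proof -
    have "c \<le> (1 + (b + e) / (a + e)) * a\<^sup>2 + (1 + 1 / ((b + e) / (a + e))) * b\<^sup>2"
      using assms that by (intro le) auto
    also have "\<dots> \<le> (1 + (b + e) / (a + e)) * (a + e)\<^sup>2 + (1 + 1 / ((b + e) / (a + e))) * (b + e)\<^sup>2"
      using assms that by (intro add_mono mult_left_mono power_mono) auto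
    finally show ?thesis by simp
  qed
  have **: "c \<le> (a + b + 2 * e)\<^sup>2" if "e > 0" for e
  proof -
    have "(1 + y / x) * x\<^sup>2 + (1 + x / y) * y\<^sup>2 = (x + y)\<^sup>2" if "x > 0" "y > 0" for x y :: real
      using that by (simp add: power2_eq_square field_simps)
    from this[of "a + e" "b + e"]
    have "(1 + (b + e) / (a + e)) * (a + e)\<^sup>2 + (1 + (a + e) / (b + e)) * (b + e)\<^sup>2 = ((a + e) + (b + e))\<^sup>2"
      using assms(1,2) that by linarith
    then show ?thesis using *[OF that] by (simp add: algebra_simps)
  qed
  show ?thesis
  proof (rule tendsto_lowerbound)
    show "((\<lambda>e. (a + b + 2 * e)\<^sup>2) \<longlongrightarrow> (a + b)\<^sup>2) (at_right 0)"
      by (auto intro!: tendsto_eq_intros)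
    show "\<forall>\<^sub>F e in at_right 0. c \<le> (a + b + 2 * e)\<^sup>2"
      using ** by (simp add: eventually_at_right_less eventually_mono[OF eventually_at_right_less])
  qed auto
qed

lemma component_continuous: "f \<in> holomorphic_ball \<Longrightarrow> continuous_on S (homogeneous_expansion f k)"
  by (rule homogeneous_polynomial_continuous[OF homogeneous_expansion_homogeneous])

lemma hardy_sobolev_add:
  assumes "f \<in> hardy_sobolev_space \<beta>" "g \<in> hardy_sobolev_space \<beta>"
  shows "(\<lambda>z. f z + g z) \<in> hardy_sobolev_space \<beta>"
    and "hardy_sobolev_norm \<beta> (\<lambda>z. f z + g z) \<le> hardy_sobolev_norm \<beta> f + hardy_sobolev_norm \<beta> g"
proof -
  have f: "f \<in> holomorphic_ball" and g: "g \<in> holomorphic_ball"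
    using assms by (auto intro: hardy_sobolev_holomorphic)
  have e: "weight \<beta> k * sqnorm (homogeneous_expansion (\<lambda>z. f z + g z) k) \<le>
    (1 + x) * (weight \<beta> k * sqnorm (homogeneous_expansion f k)) + (1 + 1 / x) * (weight \<beta> k * sqnorm (homogeneous_expansion g k))"
    if "x > 0" for k x
  proof -
    have "sqnorm (homogeneous_expansion (\<lambda>z. f z + g z) k)
      \<le> (1 + x) * sqnorm (homogeneous_expansion f k) + (1 + 1 / x) * sqnorm (homogeneous_expansion g k)"
      unfolding homogeneous_expansion_add[OF f g]
      by (rule sqnorm_add_le[OF component_continuous[OF f] component_continuous[OF g] that])
    from mult_left_mono[OF this weight_nonneg[of \<beta> k]] show ?thesis by (simp add: algebra_simps)
  qed
  have S: "(\<lambda>k. (1 + x) * (weight \<beta> k * sqnorm (homogeneous_expansion f k)) + (1 + 1 / x) * (weight \<beta> k * sqnorm (homogeneous_expansion g k)))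
     sums ((1 + x) * (hardy_sobolev_norm \<beta> f)\<^sup>2 + (1 + 1 / x) * (hardy_sobolev_norm \<beta> g)\<^sup>2)" for x
    by (intro sums_add sums_mult hardy_sobolev_norm_sums assms)
  have "summable (\<lambda>k. weight \<beta> k * sqnorm (homogeneous_expansion (\<lambda>z. f z + g z) k))"
    by (rule summable_comparison_test'[OF sums_summable[OF S[of 1]], of 0]) (use e[of 1] in auto)
  then show 1: "(\<lambda>z. f z + g z) \<in> hardy_sobolev_space \<beta>"
    using holomorphic_ball_add[OF f g] by (simp add: hardy_sobolev_space_iff)
  have "(hardy_sobolev_norm \<beta> (\<lambda>z. f z + g z))\<^sup>2 \<le> (hardy_sobolev_norm \<beta> f + hardy_sobolev_norm \<beta> g)\<^sup>2"
    by (rule le_square_add_if_weighted) (use sums_le[OF e hardy_sobolev_norm_sums[OF 1] S] in auto)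
  then show "hardy_sobolev_norm \<beta> (\<lambda>z. f z + g z) \<le> hardy_sobolev_norm \<beta> f + hardy_sobolev_norm \<beta> g"
    by (rule power2_le_imp_le) simp
qed

lemma hardy_sobolev_diff:
  assumes "f \<in> hardy_sobolev_space \<beta>" "g \<in> hardy_sobolev_space \<beta>"
  shows "(\<lambda>z. f z - g z) \<in> hardy_sobolev_space \<beta>"
    and "hardy_sobolev_norm \<beta> (\<lambda>z. f z - g z) \<le> hardy_sobolev_norm \<beta> f + hardy_sobolev_norm \<beta> g"
  using hardy_sobolev_add[OF assms(1) hardy_sobolev_scale(1)[OF assms(2), of "-1"]]
    hardy_sobolev_scale(2)[OF assms(2), of "-1"] by auto

lemma hardy_sobolev_norm_eq_0:
  fixes f :: "complex ^ 'n \<Rightarrow> complex"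
  assumes f: "f \<in> hardy_sobolev_space \<beta>" and "hardy_sobolev_norm \<beta> f = 0"
  shows "f = (\<lambda>z. 0)"
proof
  fix z
  show "f z = 0"
  proof (cases "norm z < 1")
    case True
    then obtain \<rho> where \<rho>: "norm z < \<rho>" "\<rho> < 1" using dense by blast
    then have "\<rho> > 0" using norm_ge_zero[of z] by linarith
    from hardy_sobolev_eval[OF this \<rho>(2), where \<beta> = \<beta>] obtain C where
      "\<And>f (z :: complex ^ 'n). f \<in> hardy_sobolev_space \<beta> \<Longrightarrow> norm z \<le> \<rho> \<Longrightarrow> cmod (f z) \<le> C * hardy_sobolev_norm \<beta> f"
      by metis
    from this[OF f, of z] show ?thesis using \<rho> assms(2) by simp
  next
    case False
    then show ?thesis using hardy_sobolev_holomorphic[OF f] by (simp add: holomorphic_ball_iff)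
  qed
qed

section \<open>The closed graph theorem for spaces of functions\<close>

text \<open>\<open>norm_nonneg\<close> and \<open>norm_minus\<close> are not restricted to V,
  because \<open>Metric_space\<close> asks for a nonnegative symmetric distance on the whole type,
  whereas its other axioms concern the carrier only.\<close>

locale banach_function_space =
  fixes V :: "('a \<Rightarrow> complex) set" and N :: "('a \<Rightarrow> complex) \<Rightarrow> real"
  assumes zero_mem: "0 \<in> V"
    and add_mem: "\<And>f g. f \<in> V \<Longrightarrow> g \<in> V \<Longrightarrow> f + g \<in> V"
    and scale_mem: "\<And>c f. f \<in> V \<Longrightarrow> scale_fun c f \<in> V"
    and norm_nonneg [simp]: "\<And>f. N f \<ge> 0"
    and norm_minus [simp]: "\<And>f. N (- f) = N f"
    and norm_add: "\<And>f g. f \<in> V \<Longrightarrow> g \<in> V \<Longrightarrow> N (f + g) \<le> N f + N g"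
    and norm_scale: "\<And>c f. f \<in> V \<Longrightarrow> N (scale_fun c f) = cmod c * N f"
    and norm_eq_0: "\<And>f. f \<in> V \<Longrightarrow> N f = 0 \<Longrightarrow> f = 0"
    and complete: "\<And>f. (\<And>m. f m \<in> V) \<Longrightarrow> (\<And>e. e > 0 \<Longrightarrow> \<exists>M. \<forall>m\<ge>M. \<forall>n\<ge>M. N (f m - f n) < e) \<Longrightarrow>
       \<exists>g\<in>V. (\<lambda>m. N (f m - g)) \<longlonglongrightarrow> 0"
begin

lemma uminus_mem: "f \<in> V \<Longrightarrow> - f \<in> V"
  using scale_mem[of f "-1"] by (simp add: scale_fun_def fun_Compl_def)

lemma diff_mem: "f \<in> V \<Longrightarrow> g \<in> V \<Longrightarrow> f - g \<in> V"
  using add_mem[of f "- g"] uminus_mem by simp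

lemma norm_diff: "f \<in> V \<Longrightarrow> g \<in> V \<Longrightarrow> N (f - g) \<le> N f + N g"
  using norm_add[of f "- g"] uminus_mem by simp

lemma norm_zero [simp]: "N 0 = 0"
  using norm_scale[OF zero_mem, of 0] by (simp add: scale_fun_def zero_fun_def)

lemma norm_zero' [simp]: "N (\<lambda>a. 0) = 0"
  using norm_zero by (simp add: zero_fun_def)

lemma norm_commute: "N (f - g) = N (g - f)"
  using norm_minus[of "f - g"] by simp

lemma norm_triangle: "f \<in> V \<Longrightarrow> g \<in> V \<Longrightarrow> h \<in> V \<Longrightarrow> N (f - h) \<le> N (f - g) + N (g - h)"
  using norm_add[of "f - g" "g - h"] diff_mem by simp

lemma norm_le_add: "f \<in> V \<Longrightarrow> g \<in> V \<Longrightarrow> N f \<le> N g + N (f - g)"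
  using norm_add[of g "f - g"] diff_mem by simp

sublocale metric: Metric_space V "\<lambda>f g. N (f - g)"
proof
  show "N (f - g) = 0 \<longleftrightarrow> f = g" if "f \<in> V" "g \<in> V" for f g
    using norm_eq_0[OF diff_mem[OF that]] by auto
qed (auto simp: norm_commute intro: norm_triangle)

lemma limitin_iff:
  "limitin metric.mtopology f g sequentially \<longleftrightarrow>
     g \<in> V \<and> (\<forall>\<^sub>F n in sequentially. f n \<in> V) \<and> (\<lambda>n. N (f n - g)) \<longlonglongrightarrow> 0"
  unfolding metric.limitin_metric_dist_null by simp

lemma closedin_iff:
  "closedin metric.mtopology S \<longleftrightarrow>
     S \<subseteq> V \<and> (\<forall>f g. (\<forall>n. f n \<in> S) \<longrightarrow> g \<in> V \<longrightarrow> (\<lambda>n. N (f n - g)) \<longlonglongrightarrow> 0 \<longrightarrow> g \<in> S)"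
proof
  assume L: "closedin metric.mtopology S"
  show "S \<subseteq> V \<and> (\<forall>f g. (\<forall>n. f n \<in> S) \<longrightarrow> g \<in> V \<longrightarrow> (\<lambda>n. N (f n - g)) \<longlonglongrightarrow> 0 \<longrightarrow> g \<in> S)"
  proof (intro conjI allI impI)
    show S: "S \<subseteq> V" using L metric.metric_closedin_iff_sequentially_closed by blast
    fix f :: "nat \<Rightarrow> 'a \<Rightarrow> complex" and g
    assume f: "\<forall>n. f n \<in> S" and g: "g \<in> V" "(\<lambda>n. N (f n - g)) \<longlonglongrightarrow> 0"
    have "limitin metric.mtopology f g sequentially"
      unfolding limitin_iff using f g S by (intro conjI always_eventually) blast+
    moreover have "range f \<subseteq> S" using f by blast
    ultimately show "g \<in> S" using L metric.metric_closedin_iff_sequentially_closed by blast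
  qed
next
  assume R: "S \<subseteq> V \<and> (\<forall>f g. (\<forall>n. f n \<in> S) \<longrightarrow> g \<in> V \<longrightarrow> (\<lambda>n. N (f n - g)) \<longlonglongrightarrow> 0 \<longrightarrow> g \<in> S)"
  show "closedin metric.mtopology S"
    unfolding metric.metric_closedin_iff_sequentially_closed limitin_iff
  proof (intro conjI allI impI)
    fix f g assume *: "range f \<subseteq> S \<and> g \<in> V \<and> (\<forall>\<^sub>F n in sequentially. f n \<in> V) \<and> (\<lambda>n. N (f n - g)) \<longlonglongrightarrow> 0"
    then have "\<forall>n. f n \<in> S" by blast
    with R * show "g \<in> S" by blast
  qed (use R in blast)
qed

lemma mcomplete: "metric.mcomplete"
  unfolding metric.mcomplete_def metric.MCauchy_def limitin_iff
proof (intro allI impI)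
  fix f :: "nat \<Rightarrow> 'a \<Rightarrow> complex" assume f: "range f \<subseteq> V \<and> (\<forall>e>0. \<exists>M. \<forall>n n'. M \<le> n \<longrightarrow> M \<le> n' \<longrightarrow> N (f n - f n') < e)"
  then have fV: "f m \<in> V" for m by blast
  have "\<exists>g\<in>V. (\<lambda>m. N (f m - g)) \<longlonglongrightarrow> 0"
  proof (rule complete[OF fV])
    fix e :: real assume "e > 0"
    then obtain M where "\<forall>n n'. M \<le> n \<longrightarrow> M \<le> n' \<longrightarrow> N (f n - f n') < e" using f by meson
    then show "\<exists>M. \<forall>m\<ge>M. \<forall>n\<ge>M. N (f m - f n) < e" by auto
  qed
  then obtain g where "g \<in> V" "(\<lambda>m. N (f m - g)) \<longlonglongrightarrow> 0" by blast
  then show "\<exists>g. g \<in> V \<and> (\<forall>\<^sub>F n in sequentially. f n \<in> V) \<and> (\<lambda>n. N (f n - g)) \<longlonglongrightarrow> 0"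
    using fV by (intro exI[of _ g] conjI always_eventually allI)
qed

lemma cauchy_if_geometric:
  assumes f: "\<And>m. f m \<in> V" and le: "\<And>m. N (f m - f (Suc m)) \<le> K * (1/2) ^ m"
  shows "\<exists>g\<in>V. (\<lambda>m. N (f m - g)) \<longlonglongrightarrow> 0"
proof (rule complete[OF f])
  fix e :: real assume e: "e > 0"
  have K: "K \<ge> 0" using order_trans[OF norm_nonneg le[of 0]] by simp
  have *: "N (f m - f (m + j)) \<le> K * (1/2) ^ m * 2 * (1 - (1/2) ^ j)" for m j
  proof (induction j)
    case (Suc j)
    have "N (f m - f (m + Suc j)) \<le> N (f m - f (m + j)) + N (f (m + j) - f (Suc (m + j)))"
      using norm_triangle[OF f f f] by simp
    also have "\<dots> \<le> K * (1/2) ^ m * 2 * (1 - (1/2) ^ j) + K * (1/2) ^ (m + j)"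
      by (intro add_mono Suc le)
    also have "\<dots> = K * (1/2) ^ m * 2 * (1 - (1/2) ^ Suc j)" by (simp add: power_add algebra_simps)
    finally show ?case .
  qed simp
  have "(\<lambda>m. K * 2 * (1/2) ^ m) \<longlonglongrightarrow> 0"
    by (intro tendsto_mult_right_zero LIMSEQ_power_zero) simp
  then have "\<forall>\<^sub>F m in sequentially. K * 2 * (1/2) ^ m < e" using e by (rule order_tendstoD)
  then obtain M where M: "\<And>m. m \<ge> M \<Longrightarrow> K * 2 * (1/2) ^ m < e" by (auto simp: eventually_sequentially)
  have **: "N (f m - f n) < e" if "M \<le> m" "m \<le> n" for m n
  proof -
    have "N (f m - f n) \<le> K * (1/2) ^ m * 2 * (1 - (1/2) ^ (n - m))" using *[of m "n - m"] that by simp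
    also have "\<dots> \<le> K * (1/2) ^ m * 2 * 1" using K by (intro mult_left_mono) auto
    also have "\<dots> < e" using M[OF that(1)] by (simp add: mult_ac)
    finally show ?thesis .
  qed
  have "N (f m - f n) < e" if "M \<le> m" "M \<le> n" for m n
    using **[of m n] **[of n m] that norm_commute[of "f m" "f n"] by (cases "m \<le> n") auto
  then show "\<exists>M. \<forall>m\<ge>M. \<forall>n\<ge>M. N (f m - f n) < e" by blast
qed

lemma closed_subspace:
  assumes "S \<subseteq> V" "0 \<in> S" "\<And>f g. f \<in> S \<Longrightarrow> g \<in> S \<Longrightarrow> f + g \<in> S" "\<And>c f. f \<in> S \<Longrightarrow> scale_fun c f \<in> S"
    and cl: "closedin metric.mtopology S"
  shows "banach_function_space S N"
proof
  fix f :: "nat \<Rightarrow> 'a \<Rightarrow> complex"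
  assume f: "\<And>m. f m \<in> S" and "\<And>e. e > 0 \<Longrightarrow> \<exists>M. \<forall>m\<ge>M. \<forall>n\<ge>M. N (f m - f n) < e"
  then obtain g where "g \<in> V" "(\<lambda>m. N (f m - g)) \<longlonglongrightarrow> 0"
    using complete[of f] assms(1) by blast
  moreover from this have "g \<in> S" using cl f unfolding closedin_iff by blast
  ultimately show "\<exists>g\<in>S. (\<lambda>m. N (f m - g)) \<longlonglongrightarrow> 0" by blast
qed (use assms in \<open>auto intro: norm_add norm_scale norm_eq_0\<close>)

end

text \<open>First half of the closed graph theorem. By Baire's theorem the closure of some set
  \<open>A n\<close> contains a ball around a point f0. Differences of approximations of f0 + f1 and
  of f0 approximate f1, which moves the ball to the origin, and scaling reaches every f.\<close>

lemma (in banach_function_space) approx_by_bounded_image: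
  assumes W: "banach_function_space W M"
    and T: "\<And>f. f \<in> V \<Longrightarrow> T f \<in> W" "\<And>f g. f \<in> V \<Longrightarrow> g \<in> V \<Longrightarrow> T (f - g) = T f - T g"
      "\<And>c f. f \<in> V \<Longrightarrow> T (scale_fun c f) = scale_fun c (T f)"
  obtains K where "K \<ge> 0"
    "\<And>f e. f \<in> V \<Longrightarrow> e > 0 \<Longrightarrow> \<exists>g\<in>V. N (f - g) < e \<and> M (T g) \<le> K * N f"
proof -
  interpret W: banach_function_space W M by (rule W)
  define A where "A n = {f \<in> V. M (T f) \<le> real n}" for n
  have "\<exists>n. metric.mtopology interior_of (metric.mtopology closure_of (A n)) \<noteq> {}"
  proof (rule ccontr)
    assume no: "\<not> ?thesis"
    have "metric.mtopology interior_of \<Union>(range (\<lambda>n. metric.mtopology closure_of (A n))) = {}"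
      by (rule metric.metric_Baire_category_alt[OF mcomplete]) (use no in auto)
    moreover have "\<Union>(range (\<lambda>n. metric.mtopology closure_of (A n))) = V"
    proof (intro equalityI subsetI)
      fix f assume "f \<in> V"
      moreover obtain n where "M (T f) \<le> real n" using real_arch_simple by blast
      ultimately have "f \<in> A n" by (simp add: A_def)
      moreover have "A n \<subseteq> metric.mtopology closure_of (A n)"
        by (rule closure_of_subset) (auto simp: A_def)
      ultimately show "f \<in> \<Union>(range (\<lambda>n. metric.mtopology closure_of (A n)))" by blast
    next
      fix f assume "f \<in> \<Union>(range (\<lambda>n. metric.mtopology closure_of (A n)))"
      then show "f \<in> V" using closure_of_subset_topspace[of metric.mtopology] by fastforce
    qed
    ultimately have "metric.mtopology interior_of V = {}" by simp
    then show False using interior_of_topspace[of metric.mtopology] zero_mem by auto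
  qed
  then obtain n f0 where "f0 \<in> metric.mtopology interior_of (metric.mtopology closure_of (A n))" by blast
  then obtain r where f0: "f0 \<in> V" and r: "r > 0" "metric.mball f0 r \<subseteq> metric.mtopology closure_of (A n)"
    unfolding metric.metric_interior_of by blast
  have near: "\<exists>g\<in>A n. N (h - g) < e" if h: "h \<in> V" "N (f0 - h) < r" and "e > 0" for h e
  proof -
    have "h \<in> metric.mball f0 r" using f0 h by simp
    then have "h \<in> metric.mtopology closure_of (A n)" using r by blast
    then show ?thesis using \<open>e > 0\<close> unfolding metric.metric_closure_of by auto
  qed
  \<comment> \<open>The image of a difference of two elements of \<open>A n\<close> has norm at most
    2 n, and scaling back from norm r / 2 to norm N f multiplies it by 2 N f / r.\<close>
  define K where "K = 4 * real n / r"
  show thesis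
  proof (rule that[of K])
    show "K \<ge> 0" using r by (simp add: K_def)
    fix f :: "'a \<Rightarrow> complex" and e :: real assume f: "f \<in> V" and e: "e > 0"
    show "\<exists>g\<in>V. N (f - g) < e \<and> M (T g) \<le> K * N f"
    proof (cases "N f = 0")
      case True
      then have "f = 0" by (rule norm_eq_0[OF f])
      moreover have "T 0 = 0" using T(2)[OF zero_mem zero_mem] by simp
      ultimately show ?thesis using zero_mem e by (intro bexI[of _ 0]) auto
    next
      case False
      then have Nf: "N f > 0" using norm_nonneg[of f] by linarith
      define s where "s = r / (2 * N f)"
      have s: "s > 0" using r Nf by (simp add: s_def)
      define f1 where "f1 = scale_fun (of_real s) f"
      have f1V: "f1 \<in> V" unfolding f1_def by (rule scale_mem[OF f])
      have "N f1 = s * N f" unfolding f1_def norm_scale[OF f] using s by simp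
      also have "\<dots> = r / 2" using Nf by (simp add: s_def)
      finally have f1: "f1 \<in> V" "N f1 = r / 2" using f1V by auto
      define e1 where "e1 = s * e / 2"
      have e1: "e1 > 0" using s e by (simp add: e1_def)
      obtain g1 where g1: "g1 \<in> A n" "N ((f0 + f1) - g1) < e1"
        using near[of "f0 + f1" e1] f0 f1 add_mem r e1 by auto
      obtain g2 where g2: "g2 \<in> A n" "N (f0 - g2) < e1"
        using near[of f0 e1] f0 r e1 by auto
      have gV: "g1 \<in> V" "g2 \<in> V" using g1 g2 by (auto simp: A_def)
      have "N (f1 - (g1 - g2)) = N (((f0 + f1) - g1) - (f0 - g2))" by (simp add: algebra_simps)
      also have "\<dots> \<le> N ((f0 + f1) - g1) + N (f0 - g2)"
        by (intro norm_diff diff_mem add_mem f0 f1 gV)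
      also have "\<dots> < s * e" using g1 g2 by (simp add: e1_def)
      finally have c: "N (f1 - (g1 - g2)) < s * e" .
      have "M (T (g1 - g2)) \<le> M (T g1) + M (T g2)"
        unfolding T(2)[OF gV] by (intro W.norm_diff T(1) gV)
      also have "\<dots> \<le> 2 * real n" using g1 g2 by (simp add: A_def)
      finally have c2: "M (T (g1 - g2)) \<le> 2 * real n" .
      define g where "g = scale_fun (of_real (1 / s)) (g1 - g2)"
      have gV': "g \<in> V" unfolding g_def by (intro scale_mem diff_mem gV)
      have "f - g = scale_fun (of_real (1 / s)) (f1 - (g1 - g2))"
        using s by (auto simp: g_def f1_def scale_fun_def fun_eq_iff algebra_simps)
      then have "N (f - g) = (1 / s) * N (f1 - (g1 - g2))"
        using s norm_scale[of "f1 - (g1 - g2)" "of_real (1 / s)"] f1 gV diff_mem by (simp add: norm_divide)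
      also have "\<dots> < (1 / s) * (s * e)" using c s by (intro mult_strict_left_mono) auto
      finally have 1: "N (f - g) < e" using s by simp
      have "M (T g) = (1 / s) * M (T (g1 - g2))"
        unfolding g_def T(3)[OF diff_mem[OF gV]] using s W.norm_scale[OF T(1)[OF diff_mem[OF gV]], of "of_real (1 / s)"]
        by (simp add: norm_divide)
      also have "\<dots> \<le> (1 / s) * (2 * real n)" using c2 s by (intro mult_left_mono) auto
      also have "\<dots> = K * N f" using Nf r by (simp add: K_def s_def field_simps)
      finally show ?thesis using 1 gV' by blast
    qed
  qed
qed

text \<open>The approximation is repeated on the remainder, whose norm is halved each time. The
  images of the remainders form a Cauchy sequence, and closedness of the graph forces their limit to
  be T 0 = 0. Summing the steps gives the constant 2 K, increased by 1 to be positive.\<close>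

lemma (in banach_function_space) closed_graph:
  assumes W: "banach_function_space W M"
    and T: "\<And>f. f \<in> V \<Longrightarrow> T f \<in> W" "\<And>f g. f \<in> V \<Longrightarrow> g \<in> V \<Longrightarrow> T (f - g) = T f - T g"
      "\<And>c f. f \<in> V \<Longrightarrow> T (scale_fun c f) = scale_fun c (T f)"
    and graph: "\<And>f g h. (\<And>m. f m \<in> V) \<Longrightarrow> g \<in> V \<Longrightarrow> h \<in> W \<Longrightarrow> (\<lambda>m. N (f m - g)) \<longlonglongrightarrow> 0 \<Longrightarrow>
       (\<lambda>m. M (T (f m) - h)) \<longlonglongrightarrow> 0 \<Longrightarrow> T g = h"
  obtains C where "C > 0" "\<And>f. f \<in> V \<Longrightarrow> M (T f) \<le> C * N f"
proof -
  interpret W: banach_function_space W M by (rule W)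
  obtain K where K: "K \<ge> 0" "\<And>f e. f \<in> V \<Longrightarrow> e > 0 \<Longrightarrow> \<exists>g\<in>V. N (f - g) < e \<and> M (T g) \<le> K * N f"
    using approx_by_bounded_image[OF W T] by blast
  have T0: "T 0 = 0" using T(2)[OF zero_mem zero_mem] by simp
  have "\<exists>g\<in>V. N (f - g) \<le> N f / 2 \<and> M (T g) \<le> K * N f" if f: "f \<in> V" for f
  proof (cases "N f = 0")
    case True
    then have "f = 0" by (rule norm_eq_0[OF f])
    then show ?thesis using T0 zero_mem by (intro bexI[of _ 0]) auto
  next
    case False
    then have "N f / 2 > 0" using norm_nonneg[of f] by linarith
    from K(2)[OF f this] show ?thesis by (auto intro: less_imp_le)
  qed
  then obtain G where G: "\<And>f. f \<in> V \<Longrightarrow> G f \<in> V" "\<And>f. f \<in> V \<Longrightarrow> N (f - G f) \<le> N f / 2"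
    "\<And>f. f \<in> V \<Longrightarrow> M (T (G f)) \<le> K * N f"
    by metis
  have "M (T f) \<le> (2 * K + 1) * N f" if f: "f \<in> V" for f
  proof -
    \<comment> \<open>\<open>H m\<close> is what is left of f after m approximations, each removing
      an element with controlled image.\<close>
    define H where "H = rec_nat f (\<lambda>_ h. h - G h)"
    have H0: "H 0 = f" and HS: "H (Suc m) = H m - G (H m)" for m by (simp_all add: H_def)
    have HV: "H m \<in> V" for m
    proof (induction m)
      case (Suc m)
      show ?case unfolding HS by (intro diff_mem Suc G(1))
    qed (simp add: H0 f)
    have HN: "N (H m) \<le> N f * (1/2) ^ m" for m
    proof (induction m)
      case (Suc m)
      have "N (H (Suc m)) \<le> N (H m) / 2" unfolding HS by (rule G(2)[OF HV])
      then show ?case using Suc by simp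
    qed (simp add: H0)
    have step: "M (T (H m) - T (H (Suc m))) \<le> K * N f * (1/2) ^ m" for m
    proof -
      have "T (H m) - T (H (Suc m)) = T (G (H m))"
        using T(2)[OF HV[of m] HV[of "Suc m"]] by (simp add: HS)
      then have "M (T (H m) - T (H (Suc m))) \<le> K * N (H m)" using G(3)[OF HV] by simp
      also have "\<dots> \<le> K * (N f * (1/2) ^ m)" by (intro mult_left_mono HN K)
      finally show ?thesis by simp
    qed
    obtain h where h: "h \<in> W" "(\<lambda>m. M (T (H m) - h)) \<longlonglongrightarrow> 0"
      using W.cauchy_if_geometric[OF T(1)[OF HV] step] by blast
    have Hlim: "(\<lambda>m. N (H m - 0)) \<longlonglongrightarrow> 0"
    proof (rule tendsto_sandwich[of "\<lambda>_. 0"])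
      show "(\<lambda>m. N f * (1/2) ^ m) \<longlonglongrightarrow> 0"
        by (intro tendsto_mult_right_zero LIMSEQ_power_zero) simp
    qed (use HN in \<open>auto intro!: always_eventually\<close>)
    have "T 0 = h" by (rule graph[OF HV zero_mem h(1) Hlim h(2)])
    then have lim: "(\<lambda>m. M (T (H m))) \<longlonglongrightarrow> 0" using h(2) T0 by simp
    have "M (T f) \<le> M (T (H m)) + 2 * K * N f * (1 - (1/2) ^ m)" for m
    proof (induction m)
      case (Suc m)
      have "M (T (H m)) \<le> M (T (H (Suc m))) + M (T (H m) - T (H (Suc m)))"
        by (intro W.norm_le_add T HV)
      also have "\<dots> \<le> M (T (H (Suc m))) + K * N f * (1/2) ^ m" using step by simp
      finally show ?case using Suc by (simp add: algebra_simps)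
    qed (simp add: H0)
    note a = this
    have b: "2 * K * N f * (1 - (1/2) ^ m) \<le> 2 * K * N f" for m
      using K(1) by (intro mult_left_le) auto
    have "M (T f) - 2 * K * N f \<le> M (T (H m))" for m using a[of m] b[of m] by linarith
    then have "M (T f) - 2 * K * N f \<le> 0" by (intro LIMSEQ_le_const[OF lim]) auto
    then have "M (T f) \<le> 2 * K * N f" by simp
    also have "\<dots> \<le> (2 * K + 1) * N f" by (intro mult_right_mono) auto
    finally show ?thesis .
  qed
  then show ?thesis using K(1) that[of "2 * K + 1"] by auto
qed

section \<open>Completeness of the Hardy-Sobolev spaces\<close>

lemma homogeneous_expansion_uminus_exists:
  assumes "\<forall>k. homogeneous_polynomial k (F k)" "\<forall>z\<in>ball 0 1. (\<lambda>k. F k z) sums f z"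
  shows "homogeneous_expansion (- f) = (\<lambda>k z. - F k z)"
proof (rule homogeneous_expansion_eqI)
  show "homogeneous_polynomial k (\<lambda>z. - F k z)" for k
    using homogeneous_polynomial_scale[of k "F k" "-1"] assms(1) by simp
  show "(\<lambda>k. - F k z) sums (- f) z" if "z \<in> ball 0 1" for z
    using sums_minus[of "\<lambda>k. F k z" "f z"] assms(2) that by (simp add: fun_Compl_def)
qed

text \<open>Both sides also agree on functions without a homogeneous expansion, where they are given by the
  same junk value; the metric of the Fredholm property lives on all functions.\<close>

lemma hardy_sobolev_norm_uminus: "hardy_sobolev_norm \<beta> (- f) = hardy_sobolev_norm \<beta> f"
proof -
  define P where "P f F \<longleftrightarrow> (\<forall>k. homogeneous_polynomial k (F k)) \<and> (\<forall>z\<in>ball 0 1. (\<lambda>k. F k z) sums f z)"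
    for f :: "complex ^ 'a \<Rightarrow> complex" and F
  have hP: "homogeneous_expansion f = (THE F. P f F)" for f :: "complex ^ 'a \<Rightarrow> complex"
    unfolding homogeneous_expansion_def P_def ..
  have Pm: "P (- f) (\<lambda>k z. - F k z)" if "P f F" for f :: "complex ^ 'a \<Rightarrow> complex" and F
    using that homogeneous_polynomial_scale[of _ "F _" "-1"]
    by (auto simp: P_def fun_Compl_def intro: sums_minus)
  have "cmod (radial_power \<beta> (- f) z) = cmod (radial_power \<beta> f z)" for z
  proof (cases "\<exists>F. P f F")
    case False
    then have "\<not> (\<exists>F. P (- f) F)" using Pm[of "- f"] by auto
    with False have "P f = P (- f)" by (auto simp: fun_eq_iff)
    then have "homogeneous_expansion (- f) = homogeneous_expansion f" by (simp add: hP)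
    then show ?thesis by (simp add: radial_power_def)
  next
    case True
    then obtain F where F: "P f F" by blast
    have h: "homogeneous_expansion f = F" using F by (intro homogeneous_expansion_eqI) (auto simp: P_def)
    have hm: "homogeneous_expansion (- f) = (\<lambda>k z. - F k z)"
      using F by (intro homogeneous_expansion_uminus_exists) (auto simp: P_def)
    define a where "a k = complex_of_real (real (Suc k) powr \<beta>) * F (Suc k) z" for k
    have "cmod (\<Sum>k. - a k) = cmod (\<Sum>k. a k)"
    proof (cases "summable a")
      case True
      then show ?thesis by (simp add: suminf_minus)
    next
      case False
      then have "(\<lambda>s. (\<lambda>k. - a k) sums s) = (\<lambda>s. a sums s)"
        using summable_minus_iff[of a] by (auto simp: fun_eq_iff summable_def)
      then show ?thesis by (simp add: suminf_def)
    qed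
    then show ?thesis by (simp add: radial_power_def h hm a_def)
  qed
  then have "hardy_norm (radial_power \<beta> (- f)) = hardy_norm (radial_power \<beta> f)"
    by (simp add: hardy_norm_def hardy_mean_def)
  then show ?thesis by (simp add: hardy_sobolev_norm_def)
qed

text \<open>For fixed degree k the norm controls component k locally uniformly, so the components
  converge to entire homogeneous functions, which are polynomials. The norm estimates pass to the
  limit on finitely many degrees at a time.\<close>

lemma hardy_sobolev_complete:
  fixes f :: "nat \<Rightarrow> complex ^ 'n \<Rightarrow> complex"
  assumes f: "\<And>m. f m \<in> hardy_sobolev_space \<beta>"
    and cauchy: "\<And>e. e > 0 \<Longrightarrow> \<exists>M. \<forall>m\<ge>M. \<forall>n\<ge>M. hardy_sobolev_norm \<beta> (f m - f n) < e"
  shows "\<exists>g\<in>hardy_sobolev_space \<beta>. (\<lambda>m. hardy_sobolev_norm \<beta> (f m - g)) \<longlonglongrightarrow> 0"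
proof -
  let ?N = "hardy_sobolev_norm \<beta>"
  define c where "c m = homogeneous_expansion (f m)" for m
  have fh: "f m \<in> holomorphic_ball" for m by (rule hardy_sobolev_holomorphic[OF f])
  have ch: "homogeneous_polynomial k (c m k)" for m k
    unfolding c_def by (rule homogeneous_expansion_homogeneous[OF fh])
  have fd: "f m - f n \<in> hardy_sobolev_space \<beta>" for m n
    using hardy_sobolev_diff(1)[OF f f, of m n] by (simp add: fun_diff_def)
  have cd: "homogeneous_expansion (f m - f n) = (\<lambda>k z. c m k z - c n k z)" for m n
    using homogeneous_expansion_diff[OF fh fh, of m n] by (simp add: fun_diff_def c_def)
  obtain C where C: "C > 0" "\<And>k p (z :: complex ^ 'n). homogeneous_polynomial k p \<Longrightarrow>
      (cmod (p z))\<^sup>2 \<le> C * 2 ^ k * norm z ^ (2 * k) * sqnorm p"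
    using homogeneous_bound[of 2] by auto
  define A where "A k = sqrt (C * 2 ^ k / weight \<beta> k)" for k
  have A: "A k \<ge> 0" for k using C by (simp add: A_def)
  have est: "cmod (c m k z - c n k z) \<le> A k * norm z ^ k * ?N (f m - f n)" for m n k z
  proof (rule power2_le_imp_le)
    have "sqnorm (\<lambda>z. c m k z - c n k z) \<le> (?N (f m - f n))\<^sup>2 / weight \<beta> k"
      using hardy_sobolev_component_le[OF fd[of m n], of k] unfolding cd by (simp add: field_simps)
    then have "C * 2 ^ k * norm z ^ (2 * k) * sqnorm (\<lambda>z. c m k z - c n k z)
        \<le> C * 2 ^ k * norm z ^ (2 * k) * ((?N (f m - f n))\<^sup>2 / weight \<beta> k)"
      using C(1) by (intro mult_left_mono) auto
    moreover have "homogeneous_polynomial k (\<lambda>z. c m k z - c n k z)"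
      using homogeneous_expansion_homogeneous[OF hardy_sobolev_holomorphic[OF fd[of m n]], of k] unfolding cd .
    ultimately have "(cmod (c m k z - c n k z))\<^sup>2 \<le> C * 2 ^ k * norm z ^ (2 * k) * ((?N (f m - f n))\<^sup>2 / weight \<beta> k)"
      using C(2) by (meson order_trans)
    also have "\<dots> = (C * 2 ^ k / weight \<beta> k) * (norm z ^ k)\<^sup>2 * (?N (f m - f n))\<^sup>2"
      by (simp add: power_mult[symmetric] mult.commute)
    also have "C * 2 ^ k / weight \<beta> k = (A k)\<^sup>2" using C(1) by (simp add: A_def)
    finally show "(cmod (c m k z - c n k z))\<^sup>2 \<le> (A k * norm z ^ k * ?N (f m - f n))\<^sup>2"
      by (simp only: power_mult_distrib)
  qed (use A in auto)
  have "\<exists>g. (\<lambda>m. c m k z) \<longlonglongrightarrow> g" for k z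
  proof -
    have "Cauchy (\<lambda>m. c m k z)"
    proof (rule metric_CauchyI)
      fix e :: real assume e: "e > 0"
      have pos: "A k * norm z ^ k + 1 > 0" using A[of k] by (simp add: add_nonneg_pos)
      obtain M where M: "\<And>m n. m \<ge> M \<Longrightarrow> n \<ge> M \<Longrightarrow> ?N (f m - f n) < e / (A k * norm z ^ k + 1)"
        using cauchy[of "e / (A k * norm z ^ k + 1)"] e pos by auto
      have "dist (c m k z) (c n k z) < e" if "m \<ge> M" "n \<ge> M" for m n
      proof -
        have "cmod (c m k z - c n k z) \<le> (A k * norm z ^ k + 1) * ?N (f m - f n)"
          using est[of m k z n] by (simp add: distrib_right add_increasing2)
        also have "\<dots> < (A k * norm z ^ k + 1) * (e / (A k * norm z ^ k + 1))"
          using M[OF that] pos by (intro mult_strict_left_mono)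
        finally show ?thesis using pos by (simp add: dist_norm)
      qed
      then show "\<exists>M. \<forall>m\<ge>M. \<forall>n\<ge>M. dist (c m k z) (c n k z) < e" by blast
    qed
    then show ?thesis by (simp add: Cauchy_convergent_iff convergent_def)
  qed
  then obtain G where G: "\<And>k z. (\<lambda>m. c m k z) \<longlonglongrightarrow> G k z" by metis
  have est2: "cmod (c m k z - G k z) \<le> A k * norm z ^ k * e"
    if M: "\<forall>m\<ge>M. \<forall>n\<ge>M. ?N (f m - f n) < e" and m: "m \<ge> M" for M m e k z
  proof (rule LIMSEQ_le_const2)
    show "(\<lambda>n. cmod (c m k z - c n k z)) \<longlonglongrightarrow> cmod (c m k z - G k z)"
      by (intro tendsto_intros G)
    have "cmod (c m k z - c n k z) \<le> A k * norm z ^ k * e" if "n \<ge> M" for n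
    proof -
      have "A k * norm z ^ k * ?N (f m - f n) \<le> A k * norm z ^ k * e"
        using M m that A[of k] by (intro mult_left_mono) (auto intro: less_imp_le)
      with est[of m k z n] show ?thesis by linarith
    qed
    then show "\<exists>M. \<forall>n\<ge>M. cmod (c m k z - c n k z) \<le> A k * norm z ^ k * e" by blast
  qed
  have Ghom: "homogeneous_polynomial k (G k)" for k
  proof (rule entire_homogeneous_polynomial)
    show "G k (s *s z) = s ^ k * G k z" for s z
    proof (rule LIMSEQ_unique[OF G])
      show "(\<lambda>m. c m k (s *s z)) \<longlonglongrightarrow> s ^ k * G k z"
        unfolding homogeneous_polynomial_smult[OF ch] by (intro tendsto_intros G)
    qed
    show "line_holo UNIV (G k)"
    proof (rule line_holo_uniform_limit)
      show "line_holo UNIV (c n k)" for n by (rule polys_line_holo[OF homogeneous_polynomial_polys[OF ch]])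
      fix z :: "complex ^ 'n"
      have "uniform_limit (ball z 1) (\<lambda>n. c n k) (G k) sequentially"
      proof (rule uniform_limitI)
        fix e :: real assume e: "e > 0"
        define B where "B = A k * (norm z + 1) ^ k + 1"
        have B: "B > 0" using A[of k] by (simp add: B_def add_nonneg_pos)
        obtain M where M: "\<forall>m\<ge>M. \<forall>n\<ge>M. ?N (f m - f n) < e / (2 * B)"
          using cauchy[of "e / (2 * B)"] e B by auto
        have "dist (c m k w) (G k w) < e" if "m \<ge> M" "w \<in> ball z 1" for m w
        proof -
          have "norm w \<le> norm z + 1"
            using that norm_triangle_ineq2[of w z] by (simp add: dist_norm norm_minus_commute)
          then have "A k * norm w ^ k \<le> B"
            using mult_left_mono[OF power_mono[of "norm w" "norm z + 1" k] A[of k]] by (simp add: B_def)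
          then have "A k * norm w ^ k * (e / (2 * B)) \<le> B * (e / (2 * B))"
            using e B by (intro mult_right_mono) auto
          also have "\<dots> < e" using B e by simp
          finally show ?thesis using est2[OF M that(1), of k w] by (simp add: dist_norm)
        qed
        then show "\<forall>\<^sub>F n in sequentially. \<forall>x\<in>ball z 1. dist (c n k x) (G k x) < e"
          unfolding eventually_sequentially by blast
      qed
      then show "\<exists>d>0. uniform_limit (ball z d) (\<lambda>n. c n k) (G k) sequentially" by (intro exI[of _ 1]) auto
    qed simp
  qed
  define D where "D m k = (\<lambda>z. c m k z - G k z)" for m k
  have cc: "continuous_on S (c m k)" for S m k by (rule homogeneous_polynomial_continuous[OF ch])
  have Gc: "continuous_on S (G k)" for S k by (rule homogeneous_polynomial_continuous[OF Ghom])
  have Dc: "continuous_on S (D m k)" for S m k unfolding D_def by (intro continuous_on_diff cc Gc)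
  have Dlim: "(\<lambda>n. sqnorm (D n k)) \<longlonglongrightarrow> 0" for k
  proof (rule LIMSEQ_I)
    fix e :: real assume e: "e > 0"
    define e' where "e' = sqrt e / (2 * (A k + 1))"
    have e': "e' > 0" using e A[of k] by (simp add: e'_def)
    obtain M where M: "\<forall>m\<ge>M. \<forall>n\<ge>M. ?N (f m - f n) < e'" using cauchy[OF e'] by blast
    have "sqnorm (D n k) < e" if "n \<ge> M" for n
    proof -
      have "sqnorm (D n k) \<le> (A k * e')\<^sup>2"
      proof (rule sqnorm_le[OF Dc])
        show "cmod (D n k \<zeta>) \<le> A k * e'" if "norm \<zeta> = 1" for \<zeta>
          using est2[OF M \<open>n \<ge> M\<close>, of k \<zeta>] that by (simp add: D_def)
      qed
      also have "\<dots> \<le> (sqrt e / 2)\<^sup>2"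
        using A[of k] e by (intro power_mono) (auto simp: e'_def field_simps)
      also have "\<dots> < e" using e by (simp add: power_divide)
      finally show ?thesis .
    qed
    then show "\<exists>no. \<forall>n\<ge>no. norm (sqnorm (D n k) - 0) < e" by auto
  qed
  \<comment> \<open>With K fixed, n tends to infinity in the distance of f m from f n. The factor 2
    comes from (a + b)^2 \<le> 2 a^2 + 2 b^2; it is harmless, since the final estimate uses e / 2 in
    place of e.\<close>
  have sumD: "(\<Sum>k<K. weight \<beta> k * sqnorm (D m k)) \<le> 2 * e\<^sup>2"
    if M: "\<forall>m\<ge>M. \<forall>n\<ge>M. ?N (f m - f n) < e" and m: "m \<ge> M" for M m e K
  proof (rule LIMSEQ_le_const)
    show "(\<lambda>n. 2 * e\<^sup>2 + 2 * (\<Sum>k<K. weight \<beta> k * sqnorm (D n k))) \<longlonglongrightarrow> 2 * e\<^sup>2"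
      by (auto intro!: tendsto_eq_intros Dlim)
    have "(\<Sum>k<K. weight \<beta> k * sqnorm (D m k)) \<le> 2 * e\<^sup>2 + 2 * (\<Sum>k<K. weight \<beta> k * sqnorm (D n k))" if n: "n \<ge> M" for n
    proof -
      have "sqnorm (D m k) \<le> 2 * sqnorm (\<lambda>z. c m k z - c n k z) + 2 * sqnorm (D n k)" for k
      proof -
        have "D m k = (\<lambda>z. (c m k z - c n k z) + D n k z)" by (simp add: D_def)
        then have "sqnorm (D m k) = sqnorm (\<lambda>z. (c m k z - c n k z) + D n k z)" by simp
        also have "\<dots> \<le> (1 + 1) * sqnorm (\<lambda>z. c m k z - c n k z) + (1 + 1 / 1) * sqnorm (D n k)"
          by (intro sqnorm_add_le Dc continuous_on_diff cc) simp
        finally show ?thesis by simp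
      qed
      then have "(\<Sum>k<K. weight \<beta> k * sqnorm (D m k)) \<le> (\<Sum>k<K. weight \<beta> k * (2 * sqnorm (\<lambda>z. c m k z - c n k z) + 2 * sqnorm (D n k)))"
        by (intro sum_mono mult_left_mono) auto
      also have "\<dots> = 2 * (\<Sum>k<K. weight \<beta> k * sqnorm (\<lambda>z. c m k z - c n k z)) + 2 * (\<Sum>k<K. weight \<beta> k * sqnorm (D n k))"
        by (simp add: sum_distrib_left sum.distrib distrib_left mult_ac)
      also have "(\<Sum>k<K. weight \<beta> k * sqnorm (\<lambda>z. c m k z - c n k z)) \<le> (?N (f m - f n))\<^sup>2"
      proof -
        have s: "summable (\<lambda>k. weight \<beta> k * sqnorm (\<lambda>z. c m k z - c n k z))"
          "(\<Sum>k. weight \<beta> k * sqnorm (\<lambda>z. c m k z - c n k z)) = (?N (f m - f n))\<^sup>2"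
          using hardy_sobolev_norm_sums[OF fd[of m n]] unfolding cd sums_iff by auto
        show ?thesis unfolding s(2)[symmetric] by (rule sum_le_suminf[OF s(1)]) auto
      qed
      also have "\<dots> \<le> e\<^sup>2" using M m n by (intro power_mono) (auto intro: less_imp_le)
      finally show ?thesis by simp
    qed
    then show "\<exists>M. \<forall>n\<ge>M. (\<Sum>k<K. weight \<beta> k * sqnorm (D m k)) \<le> 2 * e\<^sup>2 + 2 * (\<Sum>k<K. weight \<beta> k * sqnorm (D n k))"
      by blast
  qed
  have summD: "summable (\<lambda>k. weight \<beta> k * sqnorm (D m k))" "(\<Sum>k. weight \<beta> k * sqnorm (D m k)) \<le> 2 * e\<^sup>2"
    if "\<forall>m\<ge>M. \<forall>n\<ge>M. ?N (f m - f n) < e" "m \<ge> M" for M m e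
  proof -
    show s: "summable (\<lambda>k. weight \<beta> k * sqnorm (D m k))"
    proof (rule bounded_imp_summable[where B = "2 * e\<^sup>2"])
      show "(\<Sum>k\<le>n. weight \<beta> k * sqnorm (D m k)) \<le> 2 * e\<^sup>2" for n
        using sumD[OF that, of "Suc n"] by (simp only: lessThan_Suc_atMost)
    qed simp
    show "(\<Sum>k. weight \<beta> k * sqnorm (D m k)) \<le> 2 * e\<^sup>2"
      by (rule suminf_le_const[OF s sumD[OF that]])
  qed
  have "summable (\<lambda>k. weight \<beta> k * sqnorm (G k))"
  proof -
    obtain M where M: "\<forall>m\<ge>M. \<forall>n\<ge>M. ?N (f m - f n) < 1" using cauchy[of 1] by auto
    have "summable (\<lambda>k. 2 * (weight \<beta> k * sqnorm (c M k)) + 2 * (weight \<beta> k * sqnorm (D M k)))"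
      using summD(1)[OF M order_refl] f[of M]
      by (intro summable_add summable_mult) (auto simp: hardy_sobolev_space_iff c_def)
    then show ?thesis
    proof (rule summable_comparison_test'[where N = 0])
      fix k
      have "G k = (\<lambda>z. c M k z + (-1) * D M k z)" by (simp add: D_def)
      then have "sqnorm (G k) = sqnorm (\<lambda>z. c M k z + (-1) * D M k z)" by simp
      also have "\<dots> \<le> (1 + 1) * sqnorm (c M k) + (1 + 1 / 1) * sqnorm (\<lambda>z. (-1) * D M k z)"
        by (intro sqnorm_add_le cc continuous_on_mult continuous_on_const Dc) simp
      finally have "sqnorm (G k) \<le> 2 * sqnorm (c M k) + 2 * sqnorm (D M k)" unfolding sqnorm_scale by simp
      then have "weight \<beta> k * sqnorm (G k) \<le> weight \<beta> k * (2 * sqnorm (c M k) + 2 * sqnorm (D M k))"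
        by (intro mult_left_mono) auto
      then show "norm (weight \<beta> k * sqnorm (G k)) \<le> 2 * (weight \<beta> k * sqnorm (c M k)) + 2 * (weight \<beta> k * sqnorm (D M k))"
        by (simp add: algebra_simps)
    qed
  qed
  note g = hardy_sobolev_of_components[OF Ghom this]
  define g where "g = on_ball (\<lambda>z. \<Sum>k. G k z)"
  have gV: "g \<in> hardy_sobolev_space \<beta>" and hg: "homogeneous_expansion g = G" using g by (auto simp: g_def)
  have fg: "f m - g \<in> hardy_sobolev_space \<beta>" for m
    using hardy_sobolev_diff(1)[OF f gV, of m] by (simp add: fun_diff_def)
  have hfg: "homogeneous_expansion (f m - g) k = D m k" for m k
    using homogeneous_expansion_diff[OF fh hardy_sobolev_holomorphic[OF gV], of m] by (simp add: fun_diff_def hg D_def c_def)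
  have "(\<lambda>m. ?N (f m - g)) \<longlonglongrightarrow> 0"
  proof (rule LIMSEQ_I)
    fix e :: real assume e: "e > 0"
    obtain M where M: "\<forall>m\<ge>M. \<forall>n\<ge>M. ?N (f m - f n) < e / 2" using cauchy[of "e / 2"] e by auto
    have "?N (f m - g) < e" if "m \<ge> M" for m
    proof (rule power2_less_imp_less)
      have "(?N (f m - g))\<^sup>2 = (\<Sum>k. weight \<beta> k * sqnorm (D m k))"
        using sums_unique[OF hardy_sobolev_norm_sums[OF fg[of m]]] by (simp add: hfg)
      also have "\<dots> \<le> 2 * (e / 2)\<^sup>2" by (rule summD(2)[OF M that])
      also have "\<dots> < e\<^sup>2" using e by (simp add: power_divide)
      finally show "(?N (f m - g))\<^sup>2 < e\<^sup>2" .
    qed (use e in auto)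
    then show "\<exists>no. \<forall>n\<ge>no. norm (?N (f n - g) - 0) < e" by auto
  qed
  with gV show ?thesis by blast
qed

lemma banach_hardy_sobolev: "banach_function_space (hardy_sobolev_space \<beta>) (hardy_sobolev_norm \<beta>)"
proof
  show "0 \<in> hardy_sobolev_space \<beta>" using hardy_sobolev_0 by (simp add: zero_fun_def)
  show "f + g \<in> hardy_sobolev_space \<beta>" if "f \<in> hardy_sobolev_space \<beta>" "g \<in> hardy_sobolev_space \<beta>" for f g :: "complex ^ 'a \<Rightarrow> complex"
    using hardy_sobolev_add(1)[OF that] by (simp add: plus_fun_def)
  show "hardy_sobolev_norm \<beta> (f + g) \<le> hardy_sobolev_norm \<beta> f + hardy_sobolev_norm \<beta> g"
    if "f \<in> hardy_sobolev_space \<beta>" "g \<in> hardy_sobolev_space \<beta>" for f g :: "complex ^ 'a \<Rightarrow> complex"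
    using hardy_sobolev_add(2)[OF that] by (simp add: plus_fun_def)
  show "f = 0" if "f \<in> hardy_sobolev_space \<beta>" "hardy_sobolev_norm \<beta> f = 0" for f :: "complex ^ 'a \<Rightarrow> complex"
    using hardy_sobolev_norm_eq_0[OF that] by (simp add: zero_fun_def)
qed (auto simp: scale_fun_def hardy_sobolev_scale hardy_sobolev_norm_uminus intro: hardy_sobolev_complete)

interpretation hs: banach_function_space "hardy_sobolev_space \<beta> :: (complex ^ 'n \<Rightarrow> complex) set" "hardy_sobolev_norm \<beta>" for \<beta>
  by (rule banach_hardy_sobolev)

section \<open>Multipliers\<close>

lemma hardy_sobolev_tendsto:
  fixes g :: "complex ^ 'n \<Rightarrow> complex"
  assumes f: "\<And>m. f m \<in> hardy_sobolev_space \<beta>" and g: "g \<in> hardy_sobolev_space \<beta>"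
    and lim: "(\<lambda>m. hardy_sobolev_norm \<beta> (f m - g)) \<longlonglongrightarrow> 0"
  shows "(\<lambda>m. f m z) \<longlonglongrightarrow> g z"
    and "\<rho> < 1 \<Longrightarrow> uniform_limit (cball 0 \<rho>) f g sequentially"
proof -
  have u: "uniform_limit (cball 0 \<rho>) f g sequentially" if \<rho>: "0 < \<rho>" "\<rho> < 1" for \<rho> :: real
  proof (rule uniform_limitI)
    fix e :: real assume e: "e > 0"
    obtain C where C: "C > 0" "\<And>f (z :: complex ^ 'n). f \<in> hardy_sobolev_space \<beta> \<Longrightarrow> norm z \<le> \<rho> \<Longrightarrow> cmod (f z) \<le> C * hardy_sobolev_norm \<beta> f"
      using hardy_sobolev_eval[OF \<rho>, where \<beta> = \<beta>] by metis
    have "\<forall>\<^sub>F m in sequentially. hardy_sobolev_norm \<beta> (f m - g) < e / C"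
      using lim e C(1) by (intro order_tendstoD) auto
    then show "\<forall>\<^sub>F m in sequentially. \<forall>z\<in>cball 0 \<rho>. dist (f m z) (g z) < e"
    proof eventually_elim
      case (elim m)
      show ?case
      proof
        fix z :: "complex ^ 'n" assume "z \<in> cball 0 \<rho>"
        then have "cmod ((f m - g) z) \<le> C * hardy_sobolev_norm \<beta> (f m - g)"
          by (intro C(2) hs.diff_mem f g) simp
        also have "\<dots> < C * (e / C)" using elim C(1) by (intro mult_strict_left_mono)
        finally show "dist (f m z) (g z) < e" using C(1) by (simp add: dist_norm)
      qed
    qed
  qed
  show "uniform_limit (cball 0 \<rho>) f g sequentially" if "\<rho> < 1" for \<rho>
  proof -
    have "uniform_limit (cball 0 (max \<rho> (1/2))) f g sequentially" using that by (intro u) auto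
    then show ?thesis by (rule uniform_limit_on_subset) auto
  qed
  show "(\<lambda>m. f m z) \<longlonglongrightarrow> g z"
  proof (cases "norm z < 1")
    case True
    define \<rho> where "\<rho> = max (norm z) (1/2)"
    have "0 < \<rho>" "\<rho> < 1" "norm z \<le> \<rho>" using True by (auto simp: \<rho>_def)
    then show ?thesis using tendsto_uniform_limitI[OF u[of \<rho>], of z] by simp
  next
    case False
    then have "f m z = 0" "g z = 0" for m
      using hardy_sobolev_holomorphic[OF f[of m]] hardy_sobolev_holomorphic[OF g] by (auto simp: holomorphic_ball_iff)
    then show ?thesis by simp
  qed
qed

section \<open>Polynomials as elements and as multipliers\<close>

lemma homogeneous_expansion_on_ball_poly:
  assumes "homogeneous_polynomial j p"
  shows "homogeneous_expansion (on_ball p) = (\<lambda>k. if k = j then p else (\<lambda>z. 0))"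
proof (rule homogeneous_expansion_eqI)
  show "homogeneous_polynomial k (if k = j then p else (\<lambda>z. 0))" for k
    using assms homogeneous_polynomial_0 by auto
  show "(\<lambda>k. (if k = j then p else (\<lambda>z. 0)) z) sums on_ball p z" if "z \<in> ball 0 1" for z
    using sums_single[of j "\<lambda>_. p z"] that by (simp add: on_ball_def if_distrib[of "\<lambda>f. f z"] cong: if_cong)
qed

lemma on_ball_add: "on_ball (\<lambda>z. p z + q z) = (\<lambda>z. on_ball p z + on_ball q z)"
  and on_ball_scale: "on_ball (\<lambda>z. c * p z) = (\<lambda>z. c * on_ball p z)"
  by (auto simp: on_ball_def)

lemma on_ball_homogeneous_mem:
  assumes "homogeneous_polynomial j p"
  shows "on_ball p \<in> hardy_sobolev_space \<beta>"
proof -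
  have "summable (\<lambda>k. weight \<beta> k * sqnorm (homogeneous_expansion (on_ball p) k))"
    by (rule summable_finite[of "{j}"])
       (auto simp: homogeneous_expansion_on_ball_poly[OF assms] sqnorm_const[of 0, simplified])
  moreover have "on_ball p \<in> holomorphic_ball"
    by (intro on_ball_holomorphic polys_line_holo homogeneous_polynomial_polys[OF assms])
  ultimately show ?thesis by (simp add: hardy_sobolev_space_iff)
qed

lemma homogeneous_monomial: "homogeneous_polynomial (\<Sum>i\<in>UNIV. \<alpha> i) (monomial \<alpha>)"
  by (rule polys_homogeneous) (auto simp: polys_monomial monomial_smult)

lemma polys_hardy_sobolev:
  fixes p :: "complex ^ 'n \<Rightarrow> complex"
  assumes "p \<in> polys"
  shows "on_ball p \<in> hardy_sobolev_space \<beta>"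
  using assms
proof (induction rule: polys_induct)
  case zero
  have "on_ball (\<lambda>z :: complex ^ 'n. 0) = (\<lambda>z. 0)" by (auto simp: on_ball_def)
  then show ?case using hardy_sobolev_0 by simp
next
  case (add c \<alpha> p)
  then show ?case unfolding on_ball_add on_ball_scale
    by (intro hardy_sobolev_add hardy_sobolev_scale on_ball_homogeneous_mem[OF homogeneous_monomial])
qed

text \<open>Truncation of the expansion: the squared error is the tail of the series for the squared
  norm.\<close>

lemma polys_dense:
  fixes f :: "complex ^ 'n \<Rightarrow> complex"
  assumes f: "f \<in> hardy_sobolev_space \<beta>" and e: "e > 0"
  obtains p where "p \<in> polys" "hardy_sobolev_norm \<beta> (f - on_ball p) < e"
proof -
  let ?N = "hardy_sobolev_norm \<beta>"
  have fh: "f \<in> holomorphic_ball" by (rule hardy_sobolev_holomorphic[OF f])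
  define a where "a k = weight \<beta> k * sqnorm (homogeneous_expansion f k)" for k
  have a: "a sums (?N f)\<^sup>2" using hardy_sobolev_norm_sums[OF f] by (simp add: a_def[abs_def])
  then have "(\<lambda>m. \<Sum>k<m. a k) \<longlonglongrightarrow> (?N f)\<^sup>2" by (simp add: sums_def)
  moreover have "(?N f)\<^sup>2 - e\<^sup>2 < (?N f)\<^sup>2" using e by simp
  ultimately have "\<forall>\<^sub>F m in sequentially. (?N f)\<^sup>2 - e\<^sup>2 < (\<Sum>k<m. a k)" by (rule order_tendstoD)
  then obtain m where m: "(?N f)\<^sup>2 - e\<^sup>2 < (\<Sum>k<m. a k)" by (auto simp: eventually_sequentially)
  define p where "p z = (\<Sum>k<m. homogeneous_expansion f k z)" for z
  have p: "p \<in> polys"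
    unfolding p_def[abs_def]
    by (intro polys_sum homogeneous_polynomial_polys[OF homogeneous_expansion_homogeneous[OF fh]])
  have hp: "homogeneous_expansion (on_ball p) = (\<lambda>k z. if k < m then homogeneous_expansion f k z else 0)"
  proof (rule homogeneous_expansion_eqI)
    show "homogeneous_polynomial k (\<lambda>z. if k < m then homogeneous_expansion f k z else 0)" for k
      using homogeneous_expansion_homogeneous[OF fh, of k] homogeneous_polynomial_0[of k] by (cases "k < m") auto
    fix z :: "complex ^ 'n" assume "z \<in> ball 0 1"
    then show "(\<lambda>k. if k < m then homogeneous_expansion f k z else 0) sums on_ball p z"
      using sums_If_finite[of "\<lambda>k. k < m" "\<lambda>k. homogeneous_expansion f k z"]
      by (simp add: on_ball_def p_def lessThan_def)
  qed
  have pV: "on_ball p \<in> hardy_sobolev_space \<beta>" by (rule polys_hardy_sobolev[OF p])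
  have fp: "f - on_ball p \<in> hardy_sobolev_space \<beta>" by (intro hs.diff_mem f pV)
  have "homogeneous_expansion (f - on_ball p) = (\<lambda>k z. if k < m then 0 else homogeneous_expansion f k z)"
    using homogeneous_expansion_diff[OF fh hardy_sobolev_holomorphic[OF pV]]
    by (simp add: fun_diff_def hp) (auto simp: fun_eq_iff)
  then have "weight \<beta> k * sqnorm (homogeneous_expansion (f - on_ball p) k) = a k - (if k < m then a k else 0)" for k
  proof -
    have "sqnorm (\<lambda>z :: complex ^ 'n. 0) = 0" using sqnorm_const[of 0] by simp
    then show ?thesis using \<open>homogeneous_expansion (f - on_ball p) = _\<close> by (simp add: a_def)
  qed
  moreover have "(\<lambda>k. a k - (if k < m then a k else 0)) sums ((?N f)\<^sup>2 - (\<Sum>k<m. a k))"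
    using sums_If_finite[of "\<lambda>k. k < m" a] by (intro sums_diff a) (simp add: lessThan_def)
  ultimately have "(?N (f - on_ball p))\<^sup>2 = (?N f)\<^sup>2 - (\<Sum>k<m. a k)"
    using hardy_sobolev_norm_sums[OF fp] by (auto intro: sums_unique2)
  then have "(?N (f - on_ball p))\<^sup>2 < e\<^sup>2" using m by simp
  then have "?N (f - on_ball p) < e" by (rule power2_less_imp_less) (use e in simp)
  with p show ?thesis by (rule that)
qed

lemma weight_Suc_le: "weight \<beta> (Suc k) \<le> 2 powr \<bar>2 * \<beta>\<bar> * weight \<beta> k"
proof (cases "k = 0")
  case True
  then show ?thesis by (simp add: weight_def ge_one_powr_ge_zero)
next
  case False
  then have k: "k \<ge> 1" by simp
  show ?thesis
  proof (cases "\<beta> \<ge> 0")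
    case True
    have "real (Suc k) powr (2 * \<beta>) \<le> (2 * real k) powr (2 * \<beta>)"
      using k True by (intro powr_mono2) auto
    also have "\<dots> = 2 powr (2 * \<beta>) * real k powr (2 * \<beta>)" by (simp add: powr_mult)
    finally show ?thesis using True k by (simp add: weight_def abs_mult)
  next
    case False
    have "real (Suc k) powr (2 * \<beta>) \<le> real k powr (2 * \<beta>)"
      using k False by (intro powr_mono2') auto
    also have "\<dots> \<le> 2 powr \<bar>2 * \<beta>\<bar> * real k powr (2 * \<beta>)"
      using mult_right_mono[of 1 "2 powr \<bar>2 * \<beta>\<bar>" "real k powr (2 * \<beta>)"] by (simp add: ge_one_powr_ge_zero)
    finally show ?thesis using k by (simp add: weight_def)
  qed
qed

text \<open>Multiplication by a coordinate shifts the degree by one. This changes the weight by a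
  bounded factor and does not increase the mean over the sphere, where the coordinate is at most 1
  in modulus.\<close>

lemma hardy_sobolev_nth_mult:
  fixes f :: "complex ^ 'n \<Rightarrow> complex"
  assumes f: "f \<in> hardy_sobolev_space \<beta>"
  shows "(\<lambda>z. z $ i * f z) \<in> hardy_sobolev_space \<beta>"
proof -
  have fh: "f \<in> holomorphic_ball" by (rule hardy_sobolev_holomorphic[OF f])
  have h: "(\<lambda>z. z $ i * f z) \<in> holomorphic_ball"
    using fh by (auto simp: holomorphic_ball_iff intro: line_holo_mult line_holo_nth)
  define F where "F k = (case k of 0 \<Rightarrow> (\<lambda>z. 0) | Suc j \<Rightarrow> (\<lambda>z. z $ i * homogeneous_expansion f j z))" for k
  have he: "homogeneous_expansion (\<lambda>z. z $ i * f z) = F"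
  proof (rule homogeneous_expansion_eqI)
    show "homogeneous_polynomial k (F k)" for k
    proof (cases k)
      case (Suc j)
      note hj = homogeneous_expansion_homogeneous[OF fh, of j]
      show ?thesis unfolding Suc F_def
        by (simp, rule polys_homogeneous)
           (auto intro: polys_nth_mult homogeneous_polynomial_polys[OF hj] simp: homogeneous_polynomial_smult[OF hj])
    qed (simp add: F_def homogeneous_polynomial_0)
    fix z :: "complex ^ 'n" assume "z \<in> ball 0 1"
    then have "(\<lambda>k. F (Suc k) z) sums (z $ i * f z)"
      unfolding F_def by (simp, intro sums_mult homogeneous_expansion_sums[OF fh]) simp
    then show "(\<lambda>k. F k z) sums (z $ i * f z)"
      by (subst (asm) sums_Suc_iff) (simp add: F_def)
  qed
  have "summable (\<lambda>k. weight \<beta> (Suc k) * sqnorm (F (Suc k)))"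
  proof (rule summable_comparison_test'[where N = 0])
    show "summable (\<lambda>k. 2 powr \<bar>2 * \<beta>\<bar> * (weight \<beta> k * sqnorm (homogeneous_expansion f k)))"
      using f by (intro summable_mult) (simp add: hardy_sobolev_space_iff)
    fix k
    have "sqnorm (F (Suc k)) \<le> 1\<^sup>2 * sqnorm (homogeneous_expansion f k)"
    proof (rule sqnorm_mono)
      show "continuous_on (sphere 0 1) (F (Suc k))"
        unfolding F_def by (simp, intro continuous_intros component_continuous[OF fh])
      fix z :: "complex ^ 'n" assume "norm z = 1"
      then have "cmod (z $ i) \<le> 1" using Finite_Cartesian_Product.norm_nth_le[of z i] by simp
      then show "cmod (F (Suc k) z) \<le> 1 * cmod (homogeneous_expansion f k z)"
        by (simp add: F_def norm_mult mult_left_le_one_le)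
    qed (use component_continuous[OF fh] in auto)
    then have "weight \<beta> (Suc k) * sqnorm (F (Suc k)) \<le> (2 powr \<bar>2 * \<beta>\<bar> * weight \<beta> k) * sqnorm (homogeneous_expansion f k)"
      by (intro mult_mono weight_Suc_le) auto
    then show "norm (weight \<beta> (Suc k) * sqnorm (F (Suc k))) \<le> 2 powr \<bar>2 * \<beta>\<bar> * (weight \<beta> k * sqnorm (homogeneous_expansion f k))"
      by simp
  qed
  then have "summable (\<lambda>k. weight \<beta> k * sqnorm (F k))"
    by (subst (asm) summable_Suc_iff)
  then show ?thesis using h by (simp add: hardy_sobolev_space_iff he)
qed

lemma hardy_sobolev_polys_mult:
  assumes f: "f \<in> hardy_sobolev_space \<beta>" and p: "p \<in> polys"
  shows "(\<lambda>z. p z * f z) \<in> hardy_sobolev_space \<beta>"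
  using p
proof (induction rule: polys_induct)
  case zero
  show ?case using hardy_sobolev_0 by simp
next
  case (add c \<alpha> p)
  have pw: "(\<lambda>z. (z $ i) ^ k * g z) \<in> hardy_sobolev_space \<beta>" if "g \<in> hardy_sobolev_space \<beta>" for g i k
  proof (induction k)
    case (Suc k)
    from hardy_sobolev_nth_mult[OF Suc, of i] show ?case by (simp add: mult_ac)
  qed (use that in simp)
  have "(\<lambda>z. (\<Prod>i\<in>A. (z $ i) ^ \<alpha> i) * f z) \<in> hardy_sobolev_space \<beta>" if "finite A" for A
    using that
  proof (induction A)
    case (insert i A)
    from pw[OF insert.IH, of i "\<alpha> i"] show ?case using insert.hyps by (simp add: mult_ac)
  qed (use f in simp)
  from hardy_sobolev_add(1)[OF hardy_sobolev_scale(1)[OF this[of UNIV], of c] add.IH]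
  show ?case by (simp add: monomial_def algebra_simps)
qed

section \<open>Boundedness and cancellation of multipliers\<close>

lemma pointwise_multiplierD:
  assumes "pointwise_multiplier \<beta> \<phi>"
  shows "\<phi> \<in> holomorphic_ball"
    and "f \<in> hardy_sobolev_space \<beta> \<Longrightarrow> (\<lambda>z. \<phi> z * f z) \<in> hardy_sobolev_space \<beta>"
  using assms by (auto simp: pointwise_multiplier_def)

lemma pointwise_multiplier_polys:
  fixes p :: "complex ^ 'n \<Rightarrow> complex"
  assumes "p \<in> polys"
  shows "pointwise_multiplier \<beta> (on_ball p)"
  unfolding pointwise_multiplier_def
proof (intro conjI ballI)
  show "on_ball p \<in> holomorphic_ball" by (intro on_ball_holomorphic polys_line_holo assms)
  fix f :: "complex ^ 'n \<Rightarrow> complex" assume f: "f \<in> hardy_sobolev_space \<beta>"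
  have "(\<lambda>z. on_ball p z * f z) = (\<lambda>z. p z * f z)"
    using hardy_sobolev_holomorphic[OF f] by (auto simp: on_ball_def holomorphic_ball_iff fun_eq_iff)
  then show "(\<lambda>z. on_ball p z * f z) \<in> hardy_sobolev_space \<beta>"
    using hardy_sobolev_polys_mult[OF f assms] by simp
qed

lemma pointwise_multiplier_const: "pointwise_multiplier \<beta> (on_ball (\<lambda>z. c))"
  by (rule pointwise_multiplier_polys[OF polys_const])

lemma pointwise_multiplier_add:
  assumes "pointwise_multiplier \<beta> \<phi>" "pointwise_multiplier \<beta> \<psi>"
  shows "pointwise_multiplier \<beta> (\<lambda>z. \<phi> z + \<psi> z)"
  unfolding pointwise_multiplier_def distrib_right
  by (intro conjI ballI holomorphic_ball_add hardy_sobolev_add(1) pointwise_multiplierD assms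
      pointwise_multiplierD(2)[OF assms(1)] pointwise_multiplierD(2)[OF assms(2)]
      pointwise_multiplierD(1)[OF assms(1)] pointwise_multiplierD(1)[OF assms(2)])

lemma pointwise_multiplier_scale:
  assumes "pointwise_multiplier \<beta> \<phi>"
  shows "pointwise_multiplier \<beta> (\<lambda>z. c * \<phi> z)"
  using assms hardy_sobolev_scale(1)[where c = c] holomorphic_ball_scale[where c = c]
  by (auto simp: pointwise_multiplier_def mult.assoc)

text \<open>The graph is closed because norm convergence implies pointwise convergence, so both
  limits are determined at every point.\<close>

lemma pointwise_multiplier_operator_bound:
  assumes \<phi>: "pointwise_multiplier \<beta> \<phi>"
  obtains C where "C > 0" "\<And>f. f \<in> hardy_sobolev_space \<beta> \<Longrightarrow> hardy_sobolev_norm \<beta> (\<lambda>z. \<phi> z * f z) \<le> C * hardy_sobolev_norm \<beta> f"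
proof (rule hs.closed_graph[OF banach_hardy_sobolev, of \<beta> "\<lambda>f z. \<phi> z * f z"])
  show "(\<lambda>z. \<phi> z * g z) = h"
    if f: "\<And>m. f m \<in> hardy_sobolev_space \<beta>" and g: "g \<in> hardy_sobolev_space \<beta>" and h: "h \<in> hardy_sobolev_space \<beta>"
      and 1: "(\<lambda>m. hardy_sobolev_norm \<beta> (f m - g)) \<longlonglongrightarrow> 0"
      and 2: "(\<lambda>m. hardy_sobolev_norm \<beta> ((\<lambda>z. \<phi> z * f m z) - h)) \<longlonglongrightarrow> 0" for f g h
  proof
    fix z
    have "(\<lambda>m. \<phi> z * f m z) \<longlonglongrightarrow> \<phi> z * g z"
      by (intro tendsto_mult_left hardy_sobolev_tendsto(1)[OF f g 1])
    moreover have "(\<lambda>m. \<phi> z * f m z) \<longlonglongrightarrow> h z"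
      by (rule hardy_sobolev_tendsto(1)[OF pointwise_multiplierD(2)[OF \<phi> f] h 2])
    ultimately show "\<phi> z * g z = h z" by (rule LIMSEQ_unique)
  qed
qed (use pointwise_multiplierD(2)[OF \<phi>] that in \<open>auto simp: fun_diff_def scale_fun_def algebra_simps\<close>)

text \<open>The norms of \<phi>^k applied to the constant 1 grow at most like C^k for an operator
  bound C. Point evaluation turns this into |\<phi>(z)|^k \<le> const C^k for all k, which is
  possible only if |\<phi>(z)| \<le> C.\<close>

lemma pointwise_multiplier_bounded:
  fixes \<phi> :: "complex ^ 'n \<Rightarrow> complex"
  assumes \<phi>: "pointwise_multiplier \<beta> \<phi>"
  obtains C where "C > 0" "\<And>z. cmod (\<phi> z) \<le> C"
proof -
  let ?N = "hardy_sobolev_norm \<beta>"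
  obtain C where C: "C > 0" "\<And>f. f \<in> hardy_sobolev_space \<beta> \<Longrightarrow> ?N (\<lambda>z. \<phi> z * f z) \<le> C * ?N f"
    using pointwise_multiplier_operator_bound[OF \<phi>] by blast
  define one :: "complex ^ 'n \<Rightarrow> complex" where "one = on_ball (\<lambda>z. 1)"
  have one: "one \<in> hardy_sobolev_space \<beta>" unfolding one_def by (rule polys_hardy_sobolev[OF polys_const])
  have pw: "(\<lambda>z. \<phi> z ^ k * one z) \<in> hardy_sobolev_space \<beta> \<and> ?N (\<lambda>z. \<phi> z ^ k * one z) \<le> C ^ k * ?N one" for k
  proof (induction k)
    case (Suc k)
    have e: "(\<lambda>z. \<phi> z ^ Suc k * one z) = (\<lambda>z. \<phi> z * (\<phi> z ^ k * one z))" by (simp add: mult_ac)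
    have "?N (\<lambda>z. \<phi> z * (\<phi> z ^ k * one z)) \<le> C * ?N (\<lambda>z. \<phi> z ^ k * one z)" using Suc by (intro C(2)) simp
    also have "\<dots> \<le> C * (C ^ k * ?N one)" using Suc C(1) by (intro mult_left_mono) auto
    finally show ?case unfolding e using pointwise_multiplierD(2)[OF \<phi>, of "\<lambda>z. \<phi> z ^ k * one z"] Suc by (simp add: mult_ac)
  qed (use one in simp)
  have "cmod (\<phi> z) \<le> C" for z
  proof (cases "norm z < 1")
    case True
    define \<rho> where "\<rho> = max (norm z) (1/2)"
    have \<rho>: "0 < \<rho>" "\<rho> < 1" "norm z \<le> \<rho>" using True by (auto simp: \<rho>_def)
    obtain E where E: "E > 0" "\<And>f (z :: complex ^ 'n). f \<in> hardy_sobolev_space \<beta> \<Longrightarrow> norm z \<le> \<rho> \<Longrightarrow> cmod (f z) \<le> E * ?N f"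
      using hardy_sobolev_eval[OF \<rho>(1,2), where \<beta> = \<beta>] by metis
    have le: "cmod (\<phi> z) ^ k \<le> (E * ?N one) * C ^ k" for k
    proof -
      have "cmod (\<phi> z) ^ k = cmod (\<phi> z ^ k * one z)" using True by (simp add: one_def on_ball_def norm_power)
      also have "\<dots> \<le> E * ?N (\<lambda>z. \<phi> z ^ k * one z)" using E(2)[OF conjunct1[OF pw] \<rho>(3)] by simp
      also have "\<dots> \<le> E * (C ^ k * ?N one)" using pw E(1) by (intro mult_left_mono) auto
      finally show ?thesis by (simp add: mult_ac)
    qed
    show ?thesis
    proof (rule ccontr)
      assume "\<not> cmod (\<phi> z) \<le> C"
      then have "cmod (\<phi> z) / C > 1" using C(1) by (simp add: field_simps)
      then obtain k where "(E * ?N one) < (cmod (\<phi> z) / C) ^ k" using real_arch_pow by blast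
      then have "(E * ?N one) * C ^ k < cmod (\<phi> z) ^ k" using C(1) by (simp add: power_divide field_simps)
      with le[of k] show False by simp
    qed
  next
    case False
    then show ?thesis using pointwise_multiplierD(1)[OF \<phi>] C(1) by (simp add: holomorphic_ball_iff)
  qed
  with C(1) show ?thesis by (rule that)
qed

text \<open>The identity theorem on the line joining z0 to z: f vanishes near z0, where \<psi> is
  nonzero, and the part of the line inside the ball is convex, hence connected.\<close>

lemma holomorphic_ball_cancel:
  fixes f :: "complex ^ 'n \<Rightarrow> complex"
  assumes \<psi>: "\<psi> \<in> holomorphic_ball" and z0: "\<psi> z0 \<noteq> 0" and f: "f \<in> holomorphic_ball"
    and eq: "\<And>z. \<psi> z * f z = 0"
  shows "f z = 0"
proof (cases "z \<in> ball 0 1")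
  case True
  have z0b: "z0 \<in> ball 0 1" using \<psi> z0 by (auto simp: holomorphic_ball_iff)
  define v where "v = z - z0"
  define S where "S = {t. z0 + t *s v \<in> ball 0 1}"
  have oS: "open S" unfolding S_def by (rule open_line) simp
  have "convex S"
  proof -
    show ?thesis
    proof (rule convexI)
      fix x y :: complex and a b :: real
      assume xy: "x \<in> S" "y \<in> S" and uv: "0 \<le> a" "0 \<le> b" "a + b = 1"
      have uv': "complex_of_real a + complex_of_real b = 1" using uv(3) by (metis of_real_1 of_real_add)
      have "z0 + (a *\<^sub>R x + b *\<^sub>R y) *s v = a *\<^sub>R (z0 + x *s v) + b *\<^sub>R (z0 + y *s v)"
      proof -
        have "z0 = (complex_of_real a + complex_of_real b) *s z0" by (simp add: uv')
        then have "z0 = complex_of_real a *s z0 + complex_of_real b *s z0" by (simp add: vec_eq_iff algebra_simps)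
        moreover have "(a *\<^sub>R x + b *\<^sub>R y) *s v = complex_of_real a *s (x *s v) + complex_of_real b *s (y *s v)"
          by (simp add: vec_eq_iff scaleR_conv_of_real algebra_simps)
        ultimately show ?thesis
          unfolding scaleR_eq_smult vector_add_ldistrib by (metis (no_types, lifting) add.assoc add.left_commute)
      qed
      moreover have "z0 + x *s v \<in> ball 0 1" "z0 + y *s v \<in> ball 0 1" using xy by (simp_all add: S_def)
      note convexD[OF convex_ball this uv]
      ultimately show "a *\<^sub>R x + b *\<^sub>R y \<in> S" by (simp add: S_def)
    qed
  qed
  then have cS: "connected S" by (rule convex_connected)
  have S01: "0 \<in> S" "1 \<in> S" using True z0b by (auto simp: S_def v_def)
  have hf: "(\<lambda>t. f (z0 + t *s v)) holomorphic_on S"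
    and h\<psi>: "(\<lambda>t. \<psi> (z0 + t *s v)) holomorphic_on S"
    using f \<psi> by (auto simp: holomorphic_ball_iff line_holo_def S_def)
  have "isCont (\<lambda>t. \<psi> (z0 + t *s v)) 0"
    using holomorphic_on_imp_continuous_on[OF h\<psi>] oS S01(1) by (simp add: continuous_on_eq_continuous_at)
  then have "\<forall>\<^sub>F t in at 0. \<psi> (z0 + t *s v) \<noteq> 0"
    unfolding isCont_def using z0 by (intro tendsto_imp_eventually_ne) auto
  then have ev: "\<forall>\<^sub>F t in at 0. f (z0 + t *s v) = 0"
    by eventually_elim (use eq in auto)
  have "(\<lambda>t. f (z0 + t *s v)) 1 = 0"
  proof (rule ccontr)
    assume ne: "f (z0 + 1 *s v) \<noteq> 0"
    have "\<forall>\<^sub>F t in at 0. f (z0 + t *s v) \<noteq> 0"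
      by (rule non_zero_neighbour_alt[OF hf oS cS S01(1) S01(2) ne, THEN eventually_mono]) simp
    with ev have "\<forall>\<^sub>F t in at (0::complex). False" by eventually_elim simp
    then show False by simp
  qed
  then show ?thesis by (simp add: v_def)
next
  case False
  then show ?thesis using f by (simp add: holomorphic_ball_iff)
qed

section \<open>Interpolation between weighted spaces\<close>

lemma mellin_scale:
  fixes \<kappa> :: "real \<Rightarrow> real"
  assumes \<kappa>: "\<kappa> \<in> borel_measurable borel" and w: "w > 0"
  shows "(\<integral>\<^sup>+s. ennreal (s powr e * \<kappa> (s * w)) * indicator {0<..} s \<partial>lborel) =
    ennreal (w powr (- e - 1)) * (\<integral>\<^sup>+s. ennreal (s powr e * \<kappa> s) * indicator {0<..} s \<partial>lborel)"
proof -
  note [measurable] = \<kappa>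
  have "(\<integral>\<^sup>+s. ennreal (s powr e * \<kappa> (s * w)) * indicator {0<..} s \<partial>lborel)
     = ennreal \<bar>1 / w\<bar> * (\<integral>\<^sup>+x. ennreal ((0 + 1 / w * x) powr e * \<kappa> ((0 + 1 / w * x) * w)) * indicator {0<..} (0 + 1 / w * x) \<partial>lborel)"
    by (rule nn_integral_real_affine) (use w in auto)
  also have "\<dots> = ennreal (1 / w) * (\<integral>\<^sup>+x. ennreal (w powr (- e)) * (ennreal (x powr e * \<kappa> x) * indicator {0<..} x) \<partial>lborel)"
  proof -
    have "ennreal ((0 + 1 / w * x) powr e * \<kappa> ((0 + 1 / w * x) * w)) * indicator {0<..} (0 + 1 / w * x)
       = ennreal (w powr (- e)) * (ennreal (x powr e * \<kappa> x) * indicator {0<..} x)" for x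
    proof (cases "x > 0")
      case True
      have "(x / w) powr e = w powr (- e) * x powr e"
        using w True by (simp add: powr_divide powr_minus field_simps)
      then have "ennreal ((0 + 1 / w * x) powr e * \<kappa> ((0 + 1 / w * x) * w)) = ennreal (w powr (- e) * (x powr e * \<kappa> x))"
        using w by (simp add: mult_ac)
      also have "\<dots> = ennreal (w powr (- e)) * ennreal (x powr e * \<kappa> x)" by (rule ennreal_mult') simp
      finally show ?thesis using True w by simp
    next
      case False
      then show ?thesis using w by (simp add: indicator_def zero_less_divide_iff)
    qed
    then show ?thesis using w by simp
  qed
  also have "\<dots> = ennreal (1 / w) * (ennreal (w powr (- e)) * (\<integral>\<^sup>+x. ennreal (x powr e * \<kappa> x) * indicator {0<..} x \<partial>lborel))"
    by (subst nn_integral_cmult) auto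
  also have "\<dots> = ennreal (1 / w * w powr (- e)) * (\<integral>\<^sup>+x. ennreal (x powr e * \<kappa> x) * indicator {0<..} x \<partial>lborel)"
    using w by (subst ennreal_mult) (auto simp: mult.assoc)
  also have "1 / w * w powr (- e) = w powr (- e - 1)"
    using w by (simp add: powr_diff)
  finally show ?thesis .
qed

text \<open>Since \<open>\<integral> s\<^sup>e \<kappa>(s w) ds\<close> is a multiple of \<open>w\<^sup>-\<^sup>e\<^sup>-\<^sup>1\<close>, estimates for the kernels \<open>\<kappa>(s w)\<close> for all
  \<open>s\<close> integrate to estimates for power weights.\<close>

lemma mellin_summable:
  fixes \<kappa> :: "real \<Rightarrow> real" and w a b :: "nat \<Rightarrow> real"
  assumes \<kappa>: "\<kappa> \<in> borel_measurable borel" "\<And>x. x > 0 \<Longrightarrow> \<kappa> x \<ge> 0" and w: "\<And>i. w i > 0"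
    and a: "\<And>i. a i \<ge> 0" and b: "\<And>i. b i \<ge> 0"
    and fin: "(\<integral>\<^sup>+s. ennreal (s powr e * \<kappa> s) * indicator {0<..} s \<partial>lborel) \<noteq> top"
    and pos: "(\<integral>\<^sup>+s. ennreal (s powr e * \<kappa> s) * indicator {0<..} s \<partial>lborel) \<noteq> 0"
    and h: "h \<in> borel_measurable borel" "(\<integral>\<^sup>+s. ennreal (s powr e) * h s * indicator {0<..} s \<partial>lborel) \<noteq> top"
    and le: "\<And>s. s > 0 \<Longrightarrow> (\<Sum>i. ennreal (\<kappa> (s * w i) * b i)) \<le> ennreal A * (\<Sum>i. ennreal (\<kappa> (s * w i) * a i)) + h s"
    and s: "summable (\<lambda>i. w i powr (- e - 1) * a i)"
  shows "summable (\<lambda>i. w i powr (- e - 1) * b i)"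
proof -
  note [measurable] = \<kappa>(1) h(1)
  define c where "c = (\<integral>\<^sup>+s. ennreal (s powr e * \<kappa> s) * indicator {0<..} s \<partial>lborel)"
  have key: "(\<integral>\<^sup>+s. ennreal (s powr e) * (\<Sum>i. ennreal (\<kappa> (s * w i) * d i)) * indicator {0<..} s \<partial>lborel)
     = c * (\<Sum>i. ennreal (w i powr (- e - 1) * d i))" if d: "\<And>i. d i \<ge> 0" for d :: "nat \<Rightarrow> real"
  proof -
    have "(\<integral>\<^sup>+s. ennreal (s powr e) * (\<Sum>i. ennreal (\<kappa> (s * w i) * d i)) * indicator {0<..} s \<partial>lborel)
      = (\<integral>\<^sup>+s. (\<Sum>i. ennreal (d i) * (ennreal (s powr e * \<kappa> (s * w i)) * indicator {0<..} s)) \<partial>lborel)"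
    proof (intro nn_integral_cong)
      fix s :: real
      show "ennreal (s powr e) * (\<Sum>i. ennreal (\<kappa> (s * w i) * d i)) * indicator {0<..} s
         = (\<Sum>i. ennreal (d i) * (ennreal (s powr e * \<kappa> (s * w i)) * indicator {0<..} s))"
      proof (cases "s > 0")
        case True
        have "ennreal (s powr e) * ennreal (\<kappa> (s * w i) * d i) = ennreal (d i) * ennreal (s powr e * \<kappa> (s * w i))" for i
        proof -
          have "\<kappa> (s * w i) \<ge> 0" using True w by (intro \<kappa>(2)) simp
          then show ?thesis using d[of i] by (simp add: ennreal_mult[symmetric] mult_ac)
        qed
        then show ?thesis using True by (simp flip: ennreal_suminf_cmult)
      qed simp
    qed
    also have "\<dots> = (\<Sum>i. \<integral>\<^sup>+s. ennreal (d i) * (ennreal (s powr e * \<kappa> (s * w i)) * indicator {0<..} s) \<partial>lborel)"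
      by (rule nn_integral_suminf) measurable
    also have "\<dots> = (\<Sum>i. ennreal (d i) * (ennreal (w i powr (- e - 1)) * c))"
    proof (rule suminf_cong)
      fix i
      have "(\<integral>\<^sup>+s. ennreal (d i) * (ennreal (s powr e * \<kappa> (s * w i)) * indicator {0<..} s) \<partial>lborel)
         = ennreal (d i) * (\<integral>\<^sup>+s. ennreal (s powr e * \<kappa> (s * w i)) * indicator {0<..} s \<partial>lborel)"
        by (rule nn_integral_cmult) measurable
      then show "(\<integral>\<^sup>+s. ennreal (d i) * (ennreal (s powr e * \<kappa> (s * w i)) * indicator {0<..} s) \<partial>lborel)
         = ennreal (d i) * (ennreal (w i powr (- e - 1)) * c)"
        unfolding mellin_scale[OF \<kappa>(1) w] c_def .
    qed
    also have "\<dots> = (\<Sum>i. c * ennreal (w i powr (- e - 1) * d i))"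
      using d by (simp add: ennreal_mult mult_ac)
    also have "\<dots> = c * (\<Sum>i. ennreal (w i powr (- e - 1) * d i))" by (rule ennreal_suminf_cmult)
    finally show ?thesis .
  qed
  have "c * (\<Sum>i. ennreal (w i powr (- e - 1) * b i))
     \<le> (\<integral>\<^sup>+s. ennreal A * (ennreal (s powr e) * (\<Sum>i. ennreal (\<kappa> (s * w i) * a i)) * indicator {0<..} s)
          + ennreal (s powr e) * h s * indicator {0<..} s \<partial>lborel)"
    unfolding key[OF b, symmetric]
  proof (rule nn_integral_mono)
    fix s :: real
    show "ennreal (s powr e) * (\<Sum>i. ennreal (\<kappa> (s * w i) * b i)) * indicator {0<..} s \<le>
      ennreal A * (ennreal (s powr e) * (\<Sum>i. ennreal (\<kappa> (s * w i) * a i)) * indicator {0<..} s)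
          + ennreal (s powr e) * h s * indicator {0<..} s"
      using mult_left_mono[OF le[of s], of "ennreal (s powr e)"]
      by (cases "s > 0") (auto simp: distrib_left mult_ac)
  qed
  also have "\<dots> = ennreal A * (c * (\<Sum>i. ennreal (w i powr (- e - 1) * a i))) +
      (\<integral>\<^sup>+s. ennreal (s powr e) * h s * indicator {0<..} s \<partial>lborel)"
    unfolding key[OF a, symmetric] by (subst nn_integral_add) (auto simp: nn_integral_cmult)
  also have "\<dots> < top"
  proof -
    have "(\<Sum>i. ennreal (w i powr (- e - 1) * a i)) \<noteq> top"
      by (rule ennreal_suminf_neq_top[OF s]) (use a in simp)
    moreover have "c \<noteq> top" using fin by (simp add: c_def)
    ultimately show ?thesis using h(2) by (simp add: less_top[symmetric] ennreal_mult_eq_top_iff)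
  qed
  finally have "(\<Sum>i. ennreal (w i powr (- e - 1) * b i)) \<noteq> top"
    using pos by (auto simp: c_def ennreal_mult_eq_top_iff)
  then show ?thesis using b by (intro summable_suminf_not_top) auto
qed

lemma exp_kernel_nn_integral:
  assumes "a > 0"
  shows "(\<integral>\<^sup>+s. ennreal (s powr (a - 1) * exp (- s)) * indicator {0<..} s \<partial>lborel) = ennreal (Gamma a)"
proof -
  have "(\<integral>\<^sup>+s. ennreal (s powr (a - 1) * exp (- s)) * indicator {0<..} s \<partial>lborel)
     = (\<integral>\<^sup>+t. ennreal (indicator {0..} t * t powr (a - 1) / exp t) \<partial>lborel)"
    by (intro nn_integral_cong) (auto simp: indicator_def exp_minus field_simps)
  then show ?thesis using Gamma_conv_nn_integral_real[OF assms] by simp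
qed

text \<open>The integrand is s^(-\<theta>) / (1 + s). Convergence at 0 uses \<theta> < 1 and
  convergence at infinity uses \<theta> > 0; the interval from 1 to 2 already gives a positive
  contribution.\<close>

lemma rational_kernel_nn_integral:
  assumes \<theta>: "0 < \<theta>" "\<theta> < 1"
  shows "(\<integral>\<^sup>+s. ennreal (s powr (- \<theta> - 1) * (s / (1 + s))) * indicator {0<..} s \<partial>lborel) \<noteq> top" (is "?I \<noteq> _")
    and "(\<integral>\<^sup>+s. ennreal (s powr (- \<theta> - 1) * (s / (1 + s))) * indicator {0<..} s \<partial>lborel) \<noteq> 0"
proof -
  have eq: "s powr (- \<theta> - 1) * (s / (1 + s)) = s powr (- \<theta>) / (1 + s)" if "s > 0" for s
    using that by (simp add: powr_diff)
  have "?I \<le> (\<integral>\<^sup>+s. ennreal (s powr (- \<theta>)) * indicator {0..1} s + ennreal (s powr (- \<theta> - 1)) * indicator {1..} s \<partial>lborel)"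
  proof (rule nn_integral_mono)
    fix s :: real
    have 1: "s powr (- \<theta>) / (1 + s) \<le> s powr (- \<theta>)" if "s > 0"
      using that by (simp add: divide_le_eq mult_left_mono[of 1])
    have 2: "s powr (- \<theta>) / (1 + s) \<le> s powr (- \<theta> - 1)" if "s > 0"
      using that by (simp add: powr_diff frac_le)
    show "ennreal (s powr (- \<theta> - 1) * (s / (1 + s))) * indicator {0<..} s
       \<le> ennreal (s powr (- \<theta>)) * indicator {0..1} s + ennreal (s powr (- \<theta> - 1)) * indicator {1..} s"
    proof (cases "s > 0")
      case True
      show ?thesis
      proof (cases "s \<le> 1")
        case True
        have "ennreal (s powr (- \<theta> - 1) * (s / (1 + s))) \<le> ennreal (s powr (- \<theta>))"
          unfolding eq[OF \<open>s > 0\<close>] by (intro ennreal_leI 1 \<open>s > 0\<close>)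
        then have "ennreal (s powr (- \<theta> - 1) * (s / (1 + s))) * indicator {0<..} s \<le> ennreal (s powr (- \<theta>)) * indicator {0..1} s"
          using True \<open>s > 0\<close> by simp
        then show ?thesis by (intro add_increasing2) auto
      next
        case False
        have "ennreal (s powr (- \<theta> - 1) * (s / (1 + s))) \<le> ennreal (s powr (- \<theta> - 1))"
          unfolding eq[OF \<open>s > 0\<close>] by (intro ennreal_leI 2 \<open>s > 0\<close>)
        then have "ennreal (s powr (- \<theta> - 1) * (s / (1 + s))) * indicator {0<..} s \<le> ennreal (s powr (- \<theta> - 1)) * indicator {1..} s"
          using False \<open>s > 0\<close> by simp
        then show ?thesis by (intro add_increasing) auto
      qed
    qed simp
  qed
  also have "\<dots> = (\<integral>\<^sup>+s. ennreal (s powr (- \<theta>)) * indicator {0..1} s \<partial>lborel) + (\<integral>\<^sup>+s. ennreal (s powr (- \<theta> - 1)) * indicator {1..} s \<partial>lborel)"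
    by (rule nn_integral_add) auto
  also have "(\<integral>\<^sup>+s. ennreal (s powr (- \<theta>)) * indicator {0..1} s \<partial>lborel) = ennreal (1 powr (- \<theta> + 1) / (- \<theta> + 1))"
    using \<theta> by (intro nn_integral_has_integral_lebesgue' has_integral_powr_from_0) auto
  also have "(\<integral>\<^sup>+s. ennreal (s powr (- \<theta> - 1)) * indicator {1..} s \<partial>lborel) = ennreal (- (1 powr (- \<theta> - 1 + 1)) / (- \<theta> - 1 + 1))"
    using \<theta> by (intro nn_integral_has_integral_lebesgue' has_integral_powr_to_inf) auto
  also have "ennreal (1 powr (- \<theta> + 1) / (- \<theta> + 1)) + ennreal (- (1 powr (- \<theta> - 1 + 1)) / (- \<theta> - 1 + 1)) < top"
    by simp
  finally show "?I \<noteq> top" by (simp add: less_top)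
  have "(\<integral>\<^sup>+s. ennreal (2 powr (- \<theta>) / 3) * indicator {1..2} (s :: real) \<partial>lborel) \<le> ?I"
  proof (rule nn_integral_mono)
    fix s :: real
    have "2 powr (- \<theta>) / 3 \<le> s powr (- \<theta>) / (1 + s)" if "1 \<le> s" "s \<le> 2"
      using that \<theta> by (intro frac_le powr_mono2') auto
    then show "ennreal (2 powr (- \<theta>) / 3) * indicator {1..2} s \<le> ennreal (s powr (- \<theta> - 1) * (s / (1 + s))) * indicator {0<..} s"
      using eq[of s] by (auto simp: indicator_def intro!: ennreal_leI)
  qed
  moreover have "(\<integral>\<^sup>+s. ennreal (2 powr (- \<theta>) / 3) * indicator {1..2} s \<partial>(lborel :: real measure)) = ennreal (2 powr (- \<theta>) / 3)"
    by (subst nn_integral_cmult_indicator) auto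
  ultimately show "?I \<noteq> 0" by (auto simp: not_le)
qed

section \<open>Comparison of means for nonpositive exponents\<close>

lemma hardy_mean_mono:
  assumes f: "f \<in> holomorphic_ball" and "0 < r" "r \<le> s" "s < 1"
  shows "hardy_mean f r \<le> hardy_mean f s"
  by (rule sums_le[OF _ hardy_mean_sums[OF f] hardy_mean_sums[OF f]])
     (use assms in \<open>auto intro!: mult_right_mono power_mono\<close>)

lemma hardy_mean_nonneg: "hardy_mean f r \<ge> 0"
  by (simp add: hardy_mean_def)

lemma hardy_mean_le:
  assumes f: "f \<in> holomorphic_ball" and u: "u \<in> holomorphic_ball" and s: "0 < s" "s < 1" and C: "C \<ge> 0"
    and le: "\<And>z. norm z = s \<Longrightarrow> cmod (f z) \<le> C * cmod (u z)"
  shows "hardy_mean f s \<le> C\<^sup>2 * hardy_mean u s"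
proof -
  have c: "continuous_on (sphere 0 1) (\<lambda>\<zeta>. g (s *\<^sub>R \<zeta>))" if "g \<in> holomorphic_ball" for g :: "complex ^ 'a \<Rightarrow> complex"
  proof (rule continuous_on_compose2[of "ball 0 1" g])
    show "continuous_on (ball 0 1) g" using that by (simp add: holomorphic_ball_iff line_holo_def)
  qed (use s in \<open>auto intro!: continuous_intros\<close>)
  have m: "hardy_mean g s = sqnorm (\<lambda>\<zeta>. g (s *\<^sub>R \<zeta>))" for g :: "complex ^ 'a \<Rightarrow> complex"
    by (simp add: hardy_mean_def sqnorm_def)
  show ?thesis unfolding m
    by (rule sqnorm_mono[OF c[OF f] c[OF u] C]) (use le s in auto)
qed

lemma weight_zero [simp]: "weight 0 k = 1"
  by (simp add: weight_def)

text \<open>For \<beta> < 0 the squared norm is comparable to the integral over s > 0 of s^(-2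
  \<beta> - 1) e^(-2 s) times the mean over the sphere of radius e^(-s), so it only sees means. For
  \<beta> = 0 this integral is replaced by the supremum of the means.\<close>

lemma hardy_sobolev_nonpos_comparison:
  fixes f u :: "complex ^ 'n \<Rightarrow> complex"
  assumes \<beta>: "\<beta> \<le> 0" and u: "u \<in> hardy_sobolev_space \<beta>" and f: "f \<in> holomorphic_ball"
    and r: "0 < r" "r < 1" and C: "C \<ge> 0"
    and le: "\<And>z. r \<le> norm z \<Longrightarrow> norm z < 1 \<Longrightarrow> cmod (f z) \<le> C * cmod (u z)"
  shows "f \<in> hardy_sobolev_space \<beta>"
proof -
  have uh: "u \<in> holomorphic_ball" by (rule hardy_sobolev_holomorphic[OF u])
  define a where "a k = sqnorm (homogeneous_expansion u k)" for k
  define b where "b k = sqnorm (homogeneous_expansion f k)" for k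
  have a: "(\<lambda>k. s ^ (2 * k) * a k) sums hardy_mean u s" and b: "(\<lambda>k. s ^ (2 * k) * b k) sums hardy_mean f s"
    if "0 < s" "s < 1" for s
    using hardy_mean_sums[OF uh that] hardy_mean_sums[OF f that] by (simp_all add: a_def b_def)
  \<comment> \<open>For radii up to r nothing is assumed about u, and monotonicity of the means
    supplies the additive constant. It is the source of the function h in
    \<open>mellin_summable\<close>.\<close>
  have mean: "hardy_mean f s \<le> C\<^sup>2 * hardy_mean u s + hardy_mean f r" if s: "0 < s" "s < 1" for s
  proof (cases "s \<le> r")
    case True
    have "0 \<le> C\<^sup>2 * hardy_mean u s" by (simp add: hardy_mean_nonneg)
    then show ?thesis using hardy_mean_mono[OF f s(1) True r(2)] by linarith
  next
    case False
    have "hardy_mean f s \<le> C\<^sup>2 * hardy_mean u s"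
      by (rule hardy_mean_le[OF f uh s C]) (use le False s in auto)
    then show ?thesis using hardy_mean_nonneg[of f r] by linarith
  qed
  have "summable (\<lambda>k. weight \<beta> k * b k)"
  proof (cases "\<beta> = 0")
    case True
    have sa: "summable a" using u True by (simp add: hardy_sobolev_space_iff a_def[abs_def])
    have "bdd_above (hardy_mean u ` {0<..<1})"
      using power_series_sup(1)[of a "hardy_mean u"] a sa by (simp add: a_def)
    then obtain M where "\<forall>y\<in>hardy_mean u ` {0<..<1}. y \<le> M" unfolding bdd_above_def by blast
    then have M: "\<And>s. 0 < s \<Longrightarrow> s < 1 \<Longrightarrow> hardy_mean u s \<le> M" by auto
    have "hardy_mean f s \<le> C\<^sup>2 * M + hardy_mean f r" if "0 < s" "s < 1" for s
      using mean[OF that] mult_left_mono[OF M[OF that], of "C\<^sup>2"] by simp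
    then have "bdd_above (hardy_mean f ` {0<..<1})" by (auto intro!: bdd_aboveI2)
    then have "summable b" using power_series_sup(1)[of b "hardy_mean f"] b by (simp add: b_def)
    then show ?thesis using True by simp
  next
    case False
    \<comment> \<open>The Mellin exponent for which - e - 1 is the exponent 2 \<beta> of the
      weight.\<close>
    define e where "e = - 2 * \<beta> - 1"
    have e: "- e - 1 = 2 * \<beta>" by (simp add: e_def)
    \<comment> \<open>The kernel exp(- s w k) equals e^(-2 s) (e^(-s))^(2 k), which matches the
      power series of the means. The shift by one keeps w positive at k = 0 and changes the weights
      only by bounded factors.\<close>
    define w where "w k = 2 * real (Suc k)" for k
    have w: "w k > 0" for k by (simp add: w_def)
    have w1: "w k powr (2 * \<beta>) = 2 powr (2 * \<beta>) * real (Suc k) powr (2 * \<beta>)" for k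
      unfolding w_def by (subst powr_mult) auto
    have up: "w k powr (2 * \<beta>) \<le> 2 powr (2 * \<beta>) * weight \<beta> k" for k
    proof (cases "k = 0")
      case False
      then have "real (Suc k) powr (2 * \<beta>) \<le> real k powr (2 * \<beta>)" using \<beta> by (intro powr_mono2') auto
      then show ?thesis unfolding w1 using False by (simp add: weight_def)
    qed (simp add: w_def weight_def)
    have low: "weight \<beta> k \<le> 2 powr (- 4 * \<beta>) * w k powr (2 * \<beta>)" for k
    proof -
      have "(2 * real k) powr (2 * \<beta>) \<le> real (Suc k) powr (2 * \<beta>)" if "k \<noteq> 0"
        using that \<beta> by (intro powr_mono2') auto
      then have "2 powr (2 * \<beta>) * weight \<beta> k \<le> real (Suc k) powr (2 * \<beta>)"
        using powr_mono2'[of "2 * \<beta>" 1 2] \<beta> by (cases "k = 0") (auto simp: weight_def powr_mult)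
      then have "2 powr (- 2 * \<beta>) * (2 powr (2 * \<beta>) * weight \<beta> k) \<le> 2 powr (- 2 * \<beta>) * real (Suc k) powr (2 * \<beta>)"
        by (intro mult_left_mono) auto
      also have "2 powr (- 2 * \<beta>) * (2 powr (2 * \<beta>) * weight \<beta> k) = weight \<beta> k"
        by (simp add: mult.assoc[symmetric] powr_add[symmetric])
      also have "2 powr (- 2 * \<beta>) * real (Suc k) powr (2 * \<beta>) = 2 powr (- 4 * \<beta>) * w k powr (2 * \<beta>)"
        unfolding w1 by (simp add: mult.assoc[symmetric] powr_add[symmetric])
      finally show ?thesis .
    qed
    have series: "(\<Sum>i. ennreal (exp (- (s * w i)) * d i)) = ennreal (exp (- 2 * s) * m)"
      if s: "s > 0" and d: "\<And>i. d i \<ge> 0" and sm: "(\<lambda>k. exp (- s) ^ (2 * k) * d k) sums m" for s d m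
    proof (rule suminf_ennreal_eq)
      show "(\<lambda>i. exp (- (s * w i)) * d i) sums (exp (- 2 * s) * m)"
      proof -
        have "exp (- (s * w i)) = exp (- 2 * s) * exp (- s) ^ (2 * i)" for i
          unfolding exp_of_nat_mult[symmetric] exp_add[symmetric] by (simp add: w_def algebra_simps)
        then show ?thesis using sums_mult[OF sm, of "exp (- 2 * s)"] by (simp add: mult.assoc)
      qed
    qed (use d in auto)
    have "summable (\<lambda>i. w i powr (- e - 1) * b i)"
    proof (rule mellin_summable[where \<kappa> = "\<lambda>x. exp (- x)" and A = "C\<^sup>2" and a = a
          and h = "\<lambda>s. ennreal (hardy_mean f r) * ennreal (exp (- (s * 2)))"])
      show "(\<lambda>x :: real. exp (- x)) \<in> borel_measurable borel" by measurable
      have "(\<integral>\<^sup>+s. ennreal (s powr e * exp (- s)) * indicator {0<..} s \<partial>lborel) = ennreal (Gamma (- 2 * \<beta>))"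
        using exp_kernel_nn_integral[of "- 2 * \<beta>"] False \<beta> by (simp add: e_def)
      then show fin: "(\<integral>\<^sup>+s. ennreal (s powr e * exp (- s)) * indicator {0<..} s \<partial>lborel) \<noteq> top"
        and "(\<integral>\<^sup>+s. ennreal (s powr e * exp (- s)) * indicator {0<..} s \<partial>lborel) \<noteq> 0"
        using Gamma_real_pos[of "- 2 * \<beta>"] False \<beta> by (auto simp: ennreal_eq_0_iff not_le)
      have "(\<integral>\<^sup>+s. ennreal (s powr e) * (ennreal (hardy_mean f r) * ennreal (exp (- (s * 2)))) * indicator {0<..} s \<partial>lborel)
         = (\<integral>\<^sup>+s. ennreal (hardy_mean f r) * (ennreal (s powr e * exp (- (s * 2))) * indicator {0<..} s) \<partial>lborel)"
        by (intro nn_integral_cong) (simp add: ennreal_mult mult_ac)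
      also have "\<dots> = ennreal (hardy_mean f r) * (\<integral>\<^sup>+s. ennreal (s powr e * exp (- (s * 2))) * indicator {0<..} s \<partial>lborel)"
        by (rule nn_integral_cmult) measurable
      also have "(\<integral>\<^sup>+s. ennreal (s powr e * exp (- (s * 2))) * indicator {0<..} s \<partial>lborel) \<noteq> top"
        using mellin_scale[of "\<lambda>x. exp (- x)" 2 e] fin by (simp add: ennreal_mult_eq_top_iff)
      then have "ennreal (hardy_mean f r) * (\<integral>\<^sup>+s. ennreal (s powr e * exp (- (s * 2))) * indicator {0<..} s \<partial>lborel) \<noteq> top"
        by (simp add: ennreal_mult_eq_top_iff)
      finally show "(\<integral>\<^sup>+s. ennreal (s powr e) * (ennreal (hardy_mean f r) * ennreal (exp (- (s * 2)))) * indicator {0<..} s \<partial>lborel) \<noteq> top" .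
      show "summable (\<lambda>i. w i powr (- e - 1) * a i)"
        unfolding e
      proof (rule summable_comparison_test'[where N = 0])
        show "summable (\<lambda>k. 2 powr (2 * \<beta>) * (weight \<beta> k * a k))"
          using u by (intro summable_mult) (simp add: hardy_sobolev_space_iff a_def)
        show "norm (w k powr (2 * \<beta>) * a k) \<le> 2 powr (2 * \<beta>) * (weight \<beta> k * a k)" for k
          using mult_right_mono[OF up[of k], of "a k"] by (simp add: a_def)
      qed
      fix s :: real assume s: "s > 0"
      have ex: "0 < exp (- s)" "exp (- s) < 1" using s by auto
      have "ennreal (exp (- 2 * s) * hardy_mean f (exp (- s)))
         \<le> ennreal (exp (- 2 * s) * (C\<^sup>2 * hardy_mean u (exp (- s)) + hardy_mean f r))"
        by (intro ennreal_leI mult_left_mono mean ex) auto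
      also have "\<dots> = ennreal (C\<^sup>2) * ennreal (exp (- 2 * s) * hardy_mean u (exp (- s))) + ennreal (hardy_mean f r) * ennreal (exp (- (s * 2)))"
        using hardy_mean_nonneg[of u] hardy_mean_nonneg[of f]
        by (simp add: ennreal_mult[symmetric] ennreal_plus[symmetric] distrib_left mult_ac del: ennreal_plus)
      finally show "(\<Sum>i. ennreal (exp (- (s * w i)) * b i)) \<le> ennreal (C\<^sup>2) * (\<Sum>i. ennreal (exp (- (s * w i)) * a i))
          + ennreal (hardy_mean f r) * ennreal (exp (- (s * 2)))"
        using C by (subst (1 2) series[OF s]) (use a[OF ex] b[OF ex] in \<open>auto simp: a_def b_def ennreal_power\<close>)
    qed (use w in \<open>auto simp: a_def b_def\<close>)
    then have "summable (\<lambda>k. 2 powr (- 4 * \<beta>) * (w k powr (2 * \<beta>) * b k))" unfolding e by (rule summable_mult)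
    then show ?thesis
    proof (rule summable_comparison_test'[where N = 0])
      show "norm (weight \<beta> k * b k) \<le> 2 powr (- 4 * \<beta>) * (w k powr (2 * \<beta>) * b k)" for k
        using mult_right_mono[OF low[of k], of "b k"] by (simp add: b_def)
    qed
  qed
  then show ?thesis using f by (simp add: hardy_sobolev_space_iff b_def)
qed

lemma pointwise_multiplier_nonpos:
  assumes "\<phi> \<in> holomorphic_ball" "\<And>z. cmod (\<phi> z) \<le> C" "\<beta> \<le> 0"
  shows "pointwise_multiplier \<beta> \<phi>"
  unfolding pointwise_multiplier_def
proof (intro conjI ballI assms(1))
  fix f :: "complex ^ 'a \<Rightarrow> complex" assume f: "f \<in> hardy_sobolev_space \<beta>"
  have "C \<ge> 0" using order_trans[OF norm_ge_zero assms(2)[of 0]] .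
  show "(\<lambda>z. \<phi> z * f z) \<in> hardy_sobolev_space \<beta>"
    by (rule hardy_sobolev_nonpos_comparison[OF assms(3) f _ _ _ \<open>C \<ge> 0\<close>, where r = "1/2"])
       (auto simp: norm_mult intro!: mult_right_mono assms holomorphic_ball_mult hardy_sobolev_holomorphic[OF f])
qed

text \<open>The splitting below is the optimal one in the quadratic K-functional of the couple
  \<open>(H\<^sup>2\<^sub>0, H\<^sup>2\<^sub>\<beta>)\<close>.\<close>

lemma pointwise_multiplier_interpolate:
  fixes \<psi> :: "complex ^ 'n \<Rightarrow> complex"
  assumes \<psi>: "pointwise_multiplier \<beta> \<psi>" and \<psi>0: "pointwise_multiplier 0 \<psi>" and \<gamma>: "0 < \<gamma>" "\<gamma> < \<beta>"
  shows "pointwise_multiplier \<gamma> \<psi>"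
  unfolding pointwise_multiplier_def
proof (intro conjI ballI pointwise_multiplierD(1)[OF \<psi>])
  fix f :: "complex ^ 'n \<Rightarrow> complex" assume f: "f \<in> hardy_sobolev_space \<gamma>"
  have fh: "f \<in> holomorphic_ball" by (rule hardy_sobolev_holomorphic[OF f])
  have \<psi>h: "\<psi> \<in> holomorphic_ball" by (rule pointwise_multiplierD(1)[OF \<psi>])
  obtain C1 where C1: "C1 > 0" "\<And>f. f \<in> hardy_sobolev_space \<beta> \<Longrightarrow> hardy_sobolev_norm \<beta> (\<lambda>z. \<psi> z * f z) \<le> C1 * hardy_sobolev_norm \<beta> f"
    using pointwise_multiplier_operator_bound[OF \<psi>] by blast
  obtain C2 where C2: "C2 > 0" "\<And>f. f \<in> hardy_sobolev_space 0 \<Longrightarrow> hardy_sobolev_norm 0 (\<lambda>z. \<psi> z * f z) \<le> C2 * hardy_sobolev_norm 0 f"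
    using pointwise_multiplier_operator_bound[OF \<psi>0] by blast
  define C where "C = max C1 C2"
  have C: "C > 0" "C1 \<le> C" "C2 \<le> C" using C1(1) by (auto simp: C_def)
  define G where "G = (\<lambda>z. \<psi> z * f z)"
  have Gh: "G \<in> holomorphic_ball" unfolding G_def by (rule holomorphic_ball_mult[OF \<psi>h fh])
  define F where "F = homogeneous_expansion f"
  define a where "a k = sqnorm (F k)" for k
  define b where "b k = sqnorm (homogeneous_expansion G k)" for k
  define w where "w = weight \<beta>"
  have w: "w k > 0" for k by (simp add: w_def)
  have a0: "a k \<ge> 0" and b0: "b k \<ge> 0" for k by (simp_all add: a_def b_def)
  have sa: "summable a"
  proof (rule summable_comparison_test'[where N = 0])
    show "summable (\<lambda>k. weight \<gamma> k * a k)" using f by (simp add: hardy_sobolev_space_iff a_def F_def)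
    fix k
    have "1 \<le> weight \<gamma> k" using \<gamma> by (simp add: weight_def ge_one_powr_ge_zero)
    then show "norm (a k) \<le> weight \<gamma> k * a k" using a0[of k] mult_right_mono[of 1 "weight \<gamma> k" "a k"] by simp
  qed
  have kf: "(\<Sum>i. ennreal ((s * w i) / (1 + s * w i) * b i)) \<le> ennreal (C\<^sup>2) * (\<Sum>i. ennreal ((s * w i) / (1 + s * w i) * a i)) + 0"
    if s: "s > 0" for s
  proof -
    \<comment> \<open>The minimizer over t of t^2 + s w (1 - t)^2; the minimum has the same value s
      w / (1 + s w). The cost of the splitting f = f0 + f1 in degree k is therefore exactly t k
      times the square mean of component k.\<close>
    define t where "t k = (s * w k) / (1 + s * w k)" for k
    have sw: "s * w k > 0" for k using s w by simp
    have t: "0 < t k" "t k < 1" and t1: "1 - t k = 1 / (1 + s * w k)" for k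
      using sw[of k] by (auto simp: t_def field_simps)
    define F0 where "F0 k z = of_real (t k) * F k z" for k z
    define F1 where "F1 k z = of_real (1 - t k) * F k z" for k z
    have Fk: "homogeneous_polynomial k (F k)" for k unfolding F_def by (rule homogeneous_expansion_homogeneous[OF fh])
    have F0h: "homogeneous_polynomial k (F0 k)" and F1h: "homogeneous_polynomial k (F1 k)" for k
      unfolding F0_def F1_def by (intro homogeneous_polynomial_scale Fk)+
    have sq0: "sqnorm (F0 k) = (t k)\<^sup>2 * a k" and sq1: "sqnorm (F1 k) = (1 - t k)\<^sup>2 * a k" for k
      unfolding F0_def F1_def sqnorm_scale a_def by (simp_all only: norm_of_real power2_abs)
    have s0: "summable (\<lambda>k. weight 0 k * sqnorm (F0 k))"
    proof (rule summable_comparison_test'[OF sa, of 0])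
      fix k
      have "(t k)\<^sup>2 \<le> 1" using t[of k] by (simp add: power_le_one)
      then show "norm (weight 0 k * sqnorm (F0 k)) \<le> a k"
        using mult_right_mono[of "(t k)\<^sup>2" 1 "a k"] a0[of k] by (simp add: sq0 abs_mult)
    qed
    have s1: "summable (\<lambda>k. w k * sqnorm (F1 k))"
    proof (rule summable_comparison_test'[where N = 0])
      show "summable (\<lambda>k. 1 / s * a k)" by (rule summable_mult[OF sa])
      fix k
      have "w k * (1 - t k)\<^sup>2 \<le> 1 / s"
      proof -
        have "s * (w k * (1 - t k)\<^sup>2) = t k * (1 - t k)"
          using sw[of k] unfolding t1 by (simp add: t_def power2_eq_square)
        also have "\<dots> \<le> 1 * 1" using t[of k] by (intro mult_mono) auto
        finally show ?thesis using s by (simp add: field_simps)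
      qed
      then show "norm (w k * sqnorm (F1 k)) \<le> 1 / s * a k"
        using mult_right_mono[of "w k * (1 - t k)\<^sup>2" "1 / s" "a k"] a0[of k] w[of k] by (simp add: sq1 abs_mult mult.assoc)
    qed
    define f0 where "f0 = on_ball (\<lambda>z. \<Sum>k. F0 k z)"
    define f1 where "f1 = on_ball (\<lambda>z. \<Sum>k. F1 k z)"
    have f0: "f0 \<in> hardy_sobolev_space 0" "homogeneous_expansion f0 = F0"
      unfolding f0_def by (rule hardy_sobolev_of_components[OF F0h s0])+
    have f1: "f1 \<in> hardy_sobolev_space \<beta>" "homogeneous_expansion f1 = F1"
      unfolding f1_def by (rule hardy_sobolev_of_components[OF F1h s1[unfolded w_def]])+
    have f0h: "f0 \<in> holomorphic_ball" and f1h: "f1 \<in> holomorphic_ball"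
      using f0 f1 by (auto intro: hardy_sobolev_holomorphic)
    have "f = (\<lambda>z. f0 z + f1 z)"
    proof
      fix z
      show "f z = f0 z + f1 z"
      proof (cases "z \<in> ball 0 1")
        case True
        have "(\<lambda>k. F0 k z + F1 k z) sums (f0 z + f1 z)"
          using sums_add[OF homogeneous_expansion_sums[OF f0h True] homogeneous_expansion_sums[OF f1h True]]
          by (simp add: f0 f1)
        moreover have "F0 k z + F1 k z = F k z" for k by (simp add: F0_def F1_def algebra_simps)
        ultimately show ?thesis using homogeneous_expansion_sums[OF fh True] by (auto simp: F_def intro: sums_unique2)
      qed (use fh f0h f1h in \<open>auto simp: holomorphic_ball_iff\<close>)
    qed
    then have Gsum: "G = (\<lambda>z. \<psi> z * f0 z + \<psi> z * f1 z)" by (simp add: G_def distrib_left)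
    define g0 where "g0 = (\<lambda>z. \<psi> z * f0 z)"
    define g1 where "g1 = (\<lambda>z. \<psi> z * f1 z)"
    have g0: "g0 \<in> hardy_sobolev_space 0" and g1: "g1 \<in> hardy_sobolev_space \<beta>"
      unfolding g0_def g1_def using f0 f1 pointwise_multiplierD(2)[OF \<psi>] pointwise_multiplierD(2)[OF \<psi>0] by auto
    have g0h: "g0 \<in> holomorphic_ball" and g1h: "g1 \<in> holomorphic_ball"
      using g0 g1 by (auto intro: hardy_sobolev_holomorphic)
    have hG: "homogeneous_expansion G = (\<lambda>k z. homogeneous_expansion g0 k z + homogeneous_expansion g1 k z)"
      unfolding Gsum using homogeneous_expansion_add[OF g0h g1h] by (simp add: g0_def g1_def)
    \<comment> \<open>No splitting of G can cost less than the optimal one. The weighted inequality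
      with parameter 1 / (s w) produces precisely the coefficients 1 and s w after multiplication by
      t k.\<close>
    have le: "t k * b k \<le> sqnorm (homogeneous_expansion g0 k) + s * (w k * sqnorm (homogeneous_expansion g1 k))" for k
    proof -
      have "b k \<le> (1 + 1 / (s * w k)) * sqnorm (homogeneous_expansion g0 k) + (1 + 1 / (1 / (s * w k))) * sqnorm (homogeneous_expansion g1 k)"
        unfolding b_def hG using sw[of k]
        by (intro sqnorm_add_le component_continuous g0h g1h) auto
      then have "t k * b k \<le> t k * ((1 + 1 / (s * w k)) * sqnorm (homogeneous_expansion g0 k) + (1 + s * w k) * sqnorm (homogeneous_expansion g1 k))"
        using t[of k] by (intro mult_left_mono) auto
      also have "\<dots> = (t k * (1 + 1 / (s * w k))) * sqnorm (homogeneous_expansion g0 k) + (t k * (1 + s * w k)) * sqnorm (homogeneous_expansion g1 k)"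
        unfolding mult.assoc by (rule distrib_left)
      also have "t k * (1 + 1 / (s * w k)) = 1"
      proof -
        have "x / (1 + x) * (1 + 1 / x) = 1" if "x > 0" for x :: real
          using that by (simp add: divide_simps)
        then show ?thesis using sw[of k] unfolding t_def by blast
      qed
      also have "t k * (1 + s * w k) = s * w k" using sw[of k] by (simp add: t_def)
      finally show ?thesis by simp
    qed
    have S0: "(\<lambda>k. sqnorm (homogeneous_expansion g0 k)) sums (hardy_sobolev_norm 0 g0)\<^sup>2"
      using hardy_sobolev_norm_sums[OF g0] by simp
    have S1: "(\<lambda>k. w k * sqnorm (homogeneous_expansion g1 k)) sums (hardy_sobolev_norm \<beta> g1)\<^sup>2"
      using hardy_sobolev_norm_sums[OF g1] by (simp add: w_def)
    have SG: "(\<lambda>k. sqnorm (homogeneous_expansion g0 k) + s * (w k * sqnorm (homogeneous_expansion g1 k)))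
        sums ((hardy_sobolev_norm 0 g0)\<^sup>2 + s * (hardy_sobolev_norm \<beta> g1)\<^sup>2)"
      by (intro sums_add sums_mult S0 S1)
    have SF: "(\<lambda>k. t k * a k) sums ((hardy_sobolev_norm 0 f0)\<^sup>2 + s * (hardy_sobolev_norm \<beta> f1)\<^sup>2)"
    proof -
      have "(\<lambda>k. weight 0 k * sqnorm (homogeneous_expansion f0 k) + s * (weight \<beta> k * sqnorm (homogeneous_expansion f1 k)))
        sums ((hardy_sobolev_norm 0 f0)\<^sup>2 + s * (hardy_sobolev_norm \<beta> f1)\<^sup>2)"
        by (intro sums_add sums_mult hardy_sobolev_norm_sums f0 f1)
      moreover have "weight 0 k * sqnorm (homogeneous_expansion f0 k) + s * (weight \<beta> k * sqnorm (homogeneous_expansion f1 k)) = t k * a k" for k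
      proof -
        have "s * (w k * (1 - t k)\<^sup>2) = t k * (1 - t k)"
          using sw[of k] unfolding t1 by (simp add: t_def power2_eq_square)
        then have "s * (w k * ((1 - t k)\<^sup>2 * a k)) = t k * (1 - t k) * a k" by (metis mult.assoc)
        then show ?thesis by (simp add: f0 f1 sq0 sq1 w_def[symmetric] power2_eq_square algebra_simps)
      qed
      ultimately show ?thesis by simp
    qed
    have bound: "(hardy_sobolev_norm 0 g0)\<^sup>2 + s * (hardy_sobolev_norm \<beta> g1)\<^sup>2
        \<le> C\<^sup>2 * ((hardy_sobolev_norm 0 f0)\<^sup>2 + s * (hardy_sobolev_norm \<beta> f1)\<^sup>2)"
    proof -
      have "hardy_sobolev_norm 0 g0 \<le> C2 * hardy_sobolev_norm 0 f0" unfolding g0_def by (rule C2(2)[OF f0(1)])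
      also have "\<dots> \<le> C * hardy_sobolev_norm 0 f0" using C by (intro mult_right_mono) auto
      finally have 1: "(hardy_sobolev_norm 0 g0)\<^sup>2 \<le> (C * hardy_sobolev_norm 0 f0)\<^sup>2" by (intro power_mono) auto
      have "hardy_sobolev_norm \<beta> g1 \<le> C1 * hardy_sobolev_norm \<beta> f1" unfolding g1_def by (rule C1(2)[OF f1(1)])
      also have "\<dots> \<le> C * hardy_sobolev_norm \<beta> f1" using C by (intro mult_right_mono) auto
      finally have 2: "(hardy_sobolev_norm \<beta> g1)\<^sup>2 \<le> (C * hardy_sobolev_norm \<beta> f1)\<^sup>2" by (intro power_mono) auto
      have "s * (hardy_sobolev_norm \<beta> g1)\<^sup>2 \<le> s * (C * hardy_sobolev_norm \<beta> f1)\<^sup>2"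
        using 2 s by (intro mult_left_mono) auto
      also have "\<dots> = C\<^sup>2 * (s * (hardy_sobolev_norm \<beta> f1)\<^sup>2)" by (simp add: power_mult_distrib)
      finally show ?thesis using 1 unfolding distrib_left power_mult_distrib by linarith
    qed
    have stb: "summable (\<lambda>k. t k * b k)"
      by (rule summable_comparison_test'[OF sums_summable[OF SG], of 0]) (use le b0 t in \<open>auto simp: abs_mult abs_of_pos\<close>)
    have "(\<Sum>k. t k * b k) \<le> (hardy_sobolev_norm 0 g0)\<^sup>2 + s * (hardy_sobolev_norm \<beta> g1)\<^sup>2"
      by (rule sums_le[OF le summable_sums[OF stb] SG])
    with bound have "(\<Sum>k. t k * b k) \<le> C\<^sup>2 * (\<Sum>k. t k * a k)" using sums_unique[OF SF] by simp
    then have "ennreal (\<Sum>k. t k * b k) \<le> ennreal (C\<^sup>2) * ennreal (\<Sum>k. t k * a k)"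
      by (subst ennreal_mult'[symmetric]) (auto intro: ennreal_leI)
    moreover have "(\<Sum>k. ennreal (t k * b k)) = ennreal (\<Sum>k. t k * b k)"
      by (intro suminf_ennreal2 stb mult_nonneg_nonneg less_imp_le[OF t(1)] b0)
    moreover have "(\<Sum>k. ennreal (t k * a k)) = ennreal (\<Sum>k. t k * a k)"
      by (intro suminf_ennreal2 sums_summable[OF SF] mult_nonneg_nonneg less_imp_le[OF t(1)] a0)
    ultimately show ?thesis by (simp add: t_def)
  qed
  \<comment> \<open>Then the \<theta>-th power of the weight for \<beta> is the weight for \<gamma>,
    and \<open>mellin_summable\<close> is applied with exponent - \<theta> - 1.\<close>
  define \<theta> where "\<theta> = \<gamma> / \<beta>"
  have \<theta>: "0 < \<theta>" "\<theta> < 1" using \<gamma> by (auto simp: \<theta>_def)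
  have w\<theta>: "w k powr \<theta> = weight \<gamma> k" for k
    using \<gamma> by (simp add: w_def weight_def powr_powr \<theta>_def)
  have "summable (\<lambda>i. w i powr (- (- \<theta> - 1) - 1) * b i)"
  proof (rule mellin_summable[where \<kappa> = "\<lambda>x. x / (1 + x)" and A = "C\<^sup>2" and a = a and h = "\<lambda>_. 0"])
    show "(\<lambda>x :: real. x / (1 + x)) \<in> borel_measurable borel" by measurable
    show "summable (\<lambda>i. w i powr (- (- \<theta> - 1) - 1) * a i)"
      using f by (simp add: w\<theta> hardy_sobolev_space_iff a_def F_def)
  qed (use w a0 b0 kf rational_kernel_nn_integral[OF \<theta>] in auto)
  then show "G \<in> hardy_sobolev_space \<gamma>" using Gh by (simp add: w\<theta> hardy_sobolev_space_iff b_def)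
qed

text \<open>A multiplier is bounded, hence a multiplier for every nonpositive exponent. If \<beta> -
  1 is positive, it lies strictly between 0 and \<beta> and interpolation applies.\<close>

lemma pointwise_multiplier_pred:
  assumes \<psi>: "pointwise_multiplier \<beta> \<psi>"
  shows "pointwise_multiplier (\<beta> - 1) \<psi>"
proof -
  have h: "\<psi> \<in> holomorphic_ball" by (rule pointwise_multiplierD(1)[OF \<psi>])
  obtain C where C: "\<And>z. cmod (\<psi> z) \<le> C" using pointwise_multiplier_bounded[OF \<psi>] by metis
  show ?thesis
  proof (cases "\<beta> - 1 \<le> 0")
    case True
    then show ?thesis by (rule pointwise_multiplier_nonpos[OF h C])
  next
    case False
    then show ?thesis
      by (intro pointwise_multiplier_interpolate[OF \<psi> pointwise_multiplier_nonpos[OF h C]]) auto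
  qed
qed

section \<open>The radial derivative\<close>

text \<open>Identifies \<open>radial_power 1\<close> with the derivative of t -> f(t z) at t = 1.
  This makes the product rule available, which is invisible in the definition by components.\<close>

lemma radial_derivative:
  fixes f :: "complex ^ 'n \<Rightarrow> complex"
  assumes f: "f \<in> holomorphic_ball" and z: "z \<in> ball 0 1"
  shows "((\<lambda>t. f (t *s z)) has_field_derivative radial_power 1 f z) (at 1)"
proof -
  have fl: "line_holo (ball 0 1) f" using f by (simp add: holomorphic_ball_iff)
  define c where "c k = homogeneous_expansion f k z" for k
  define S where "S = {t. t *s z \<in> ball 0 1}"
  have oS: "open S" using open_line[of "ball 0 1" 0 z] by (simp add: S_def)
  have S1: "1 \<in> S" using z by (simp add: S_def)
  have sums: "(\<lambda>k. c k * t ^ k) sums f (t *s z)" if "t \<in> S" for t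
    using taylor_part_sums[OF fl, of t z] that by (simp add: c_def S_def homogeneous_expansion_taylor[OF fl])
  obtain e where e: "e > 0" "ball 1 e \<subseteq> S" using oS S1 by (meson open_contains_ball)
  \<comment> \<open>Termwise differentiation at 1 needs convergence at a point of larger modulus; K
    lies slightly beyond 1 with K z still in the ball.\<close>
  define K where "K = complex_of_real (1 + e / 2)"
  have "dist 1 K = e / 2" using e by (simp add: K_def dist_norm)
  then have "K \<in> S" using e by auto
  then have sK: "summable (\<lambda>k. c k * K ^ k)" using sums by (blast intro: sums_summable)
  have "norm (1 :: complex) < norm K"
  proof -
    have "norm K = \<bar>1 + e / 2\<bar>" unfolding K_def by (rule norm_of_real)
    then show ?thesis using e by simp
  qed
  from termdiffs_strong[OF sK this]
  have "((\<lambda>t. \<Sum>k. c k * t ^ k) has_field_derivative (\<Sum>k. diffs c k * 1 ^ k)) (at 1)" .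
  moreover have "(\<Sum>k. diffs c k * 1 ^ k) = radial_power 1 f z"
    using z by (simp add: radial_power_def diffs_def c_def)
  ultimately have "((\<lambda>t. \<Sum>k. c k * t ^ k) has_field_derivative radial_power 1 f z) (at 1)" by simp
  then show ?thesis
    by (rule has_field_derivative_transform_within_open[OF _ oS S1]) (use sums in \<open>simp add: sums_unique[symmetric]\<close>)
qed

lemma radial_power_mult:
  assumes f: "f \<in> holomorphic_ball" and g: "g \<in> holomorphic_ball"
  shows "radial_power 1 (\<lambda>z. f z * g z) = (\<lambda>z. f z * radial_power 1 g z + g z * radial_power 1 f z)"
proof
  fix z
  show "radial_power 1 (\<lambda>z. f z * g z) z = f z * radial_power 1 g z + g z * radial_power 1 f z"
  proof (cases "z \<in> ball 0 1")
    case True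
    have "((\<lambda>t. f (t *s z) * g (t *s z)) has_field_derivative
        radial_power 1 f z * g (1 *s z) + radial_power 1 g z * f (1 *s z)) (at 1)"
      by (rule DERIV_mult[OF radial_derivative[OF f True] radial_derivative[OF g True]])
    from DERIV_unique[OF radial_derivative[OF holomorphic_ball_mult[OF f g] True] this]
    show ?thesis by (simp add: mult.commute)
  next
    case False
    then show ?thesis by (simp add: radial_power_def)
  qed
qed

text \<open>Lowering the exponent by one compensates the factor k from the derivative. Only the
  constant component is lost, and a single term does not affect summability.\<close>

lemma radial_power_mem_iff:
  assumes f: "f \<in> holomorphic_ball"
  shows "radial_power 1 f \<in> hardy_sobolev_space (\<beta> - 1) \<longleftrightarrow> f \<in> hardy_sobolev_space \<beta>"
proof -
  have e: "weight (\<beta> - 1) k * sqnorm (homogeneous_expansion (radial_power 1 f) k)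
     = weight \<beta> k * sqnorm (homogeneous_expansion f k)" if "k > 0" for k
  proof -
    have "2 * (\<beta> - 1) + 2 * 1 = 2 * \<beta>" by simp
    then have "weight (\<beta> - 1) k * weight 1 k = weight \<beta> k"
      using that by (simp only: weight_def powr_add[symmetric] neq0_conv[symmetric] if_False)
    then show ?thesis using that by (simp add: sqnorm_radial_power[OF f] mult.assoc[symmetric])
  qed
  have "summable (\<lambda>k. weight (\<beta> - 1) k * sqnorm (homogeneous_expansion (radial_power 1 f) k))
    \<longleftrightarrow> summable (\<lambda>k. weight \<beta> k * sqnorm (homogeneous_expansion f k))"
    by (rule summable_cong, rule eventually_mono[OF eventually_gt_at_top[of 0]]) (rule e)
  then show ?thesis using f radial_power_holomorphic(1)[OF f] by (simp add: hardy_sobolev_space_iff)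
qed

text \<open>With \<open>g = \<psi> f\<close> and the radial derivative \<open>R\<close> one has
  \<open>\<psi>\<^sup>2 R f = 2 \<psi> R g - R (\<psi> g)\<close>, which lowers the exponent by one.\<close>

lemma hardy_sobolev_divide:
  fixes f :: "complex ^ 'n \<Rightarrow> complex"
  assumes \<psi>: "pointwise_multiplier \<beta> \<psi>" and f: "f \<in> holomorphic_ball"
    and \<psi>f: "(\<lambda>z. \<psi> z * f z) \<in> hardy_sobolev_space \<beta>"
    and r: "0 < r" "r < 1" and \<delta>: "\<delta> > 0"
    and low: "\<And>z. r \<le> norm z \<Longrightarrow> norm z < 1 \<Longrightarrow> \<delta> \<le> cmod (\<psi> z)"
  shows "f \<in> hardy_sobolev_space \<beta>"
proof -
  have nonpos: "f \<in> hardy_sobolev_space \<beta>"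
    if "\<beta> \<le> 0" "f \<in> holomorphic_ball" "(\<lambda>z. \<psi> z * f z) \<in> hardy_sobolev_space \<beta>" for \<beta> f
  proof (rule hardy_sobolev_nonpos_comparison[OF that(1) that(3) that(2) r])
    show "0 \<le> 1 / \<delta>" using \<delta> by simp
    fix z :: "complex ^ 'n" assume "r \<le> norm z" "norm z < 1"
    from mult_right_mono[OF low[OF this], of "cmod (f z)"]
    show "cmod (f z) \<le> 1 / \<delta> * cmod (\<psi> z * f z)" using \<delta> by (simp add: norm_mult field_simps)
  qed
  \<comment> \<open>The induction is on an integer bound m for the exponent, with the exponent and
    the function general: a step lowers the exponent by one and passes to two other
    functions.\<close>
  have "f \<in> hardy_sobolev_space \<beta>"
    if "\<beta> \<le> real m" "pointwise_multiplier \<beta> \<psi>" "f \<in> holomorphic_ball" "(\<lambda>z. \<psi> z * f z) \<in> hardy_sobolev_space \<beta>" for m \<beta> f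
    using that
  proof (induction m arbitrary: \<beta> f)
    case 0
    then show ?case using nonpos by simp
  next
    case (Suc m)
    show ?case
    proof (cases "\<beta> \<le> 0")
      case True
      then show ?thesis using nonpos Suc.prems by blast
    next
      case False
      note \<psi> = Suc.prems(2) and f = Suc.prems(3)
      define R where "R = (radial_power 1 :: (complex ^ 'n \<Rightarrow> complex) \<Rightarrow> _)"
      define g where "g = (\<lambda>z. \<psi> z * f z)"
      have \<psi>h: "\<psi> \<in> holomorphic_ball" by (rule pointwise_multiplierD(1)[OF \<psi>])
      have g: "g \<in> hardy_sobolev_space \<beta>" using Suc.prems(4) by (simp add: g_def)
      have gh: "g \<in> holomorphic_ball" by (rule hardy_sobolev_holomorphic[OF g])
      have \<psi>': "pointwise_multiplier (\<beta> - 1) \<psi>" by (rule pointwise_multiplier_pred[OF \<psi>])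
      have Rf: "R f \<in> holomorphic_ball" unfolding R_def by (rule radial_power_holomorphic(1)[OF f])
      have \<psi>g: "(\<lambda>z. \<psi> z * g z) \<in> hardy_sobolev_space \<beta>" by (rule pointwise_multiplierD(2)[OF \<psi> g])
      have Rg: "R g \<in> hardy_sobolev_space (\<beta> - 1)"
        unfolding R_def using g by (simp add: radial_power_mem_iff[OF gh])
      have R\<psi>g: "R (\<lambda>z. \<psi> z * g z) \<in> hardy_sobolev_space (\<beta> - 1)"
        unfolding R_def using \<psi>g by (simp add: radial_power_mem_iff[OF holomorphic_ball_mult[OF \<psi>h gh]])
      \<comment> \<open>This combination removes the terms containing R \<psi>, which is not known
        to be a multiplier; both summands lie in the space with exponent \<beta> - 1.\<close>
      have "(\<lambda>z. 2 * (\<psi> z * R g z) - R (\<lambda>z. \<psi> z * g z) z) \<in> hardy_sobolev_space (\<beta> - 1)"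
        by (intro hardy_sobolev_diff(1) hardy_sobolev_scale(1) pointwise_multiplierD(2)[OF \<psi>'] Rg R\<psi>g)
      moreover have "(\<lambda>z. 2 * (\<psi> z * R g z) - R (\<lambda>z. \<psi> z * g z) z) = (\<lambda>z. \<psi> z * (\<psi> z * R f z))"
      proof -
        have "R g = (\<lambda>z. \<psi> z * R f z + f z * R \<psi> z)" unfolding R_def g_def by (rule radial_power_mult[OF \<psi>h f])
        moreover have "R (\<lambda>z. \<psi> z * g z) = (\<lambda>z. \<psi> z * R g z + g z * R \<psi> z)"
          unfolding R_def by (rule radial_power_mult[OF \<psi>h gh])
        ultimately show ?thesis by (simp add: g_def fun_eq_iff algebra_simps)
      qed
      ultimately have 2: "(\<lambda>z. \<psi> z * (\<psi> z * R f z)) \<in> hardy_sobolev_space (\<beta> - 1)" by simp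
      have m: "\<beta> - 1 \<le> real m" using Suc.prems(1) by simp
      \<comment> \<open>The induction hypothesis is applied twice, once for each factor \<psi> in
        \<psi>^2 R f.\<close>
      have "(\<lambda>z. \<psi> z * R f z) \<in> hardy_sobolev_space (\<beta> - 1)"
        by (rule Suc.IH[OF m \<psi>' holomorphic_ball_mult[OF \<psi>h Rf] 2])
      then have "R f \<in> hardy_sobolev_space (\<beta> - 1)" by (rule Suc.IH[OF m \<psi>' Rf])
      then show ?thesis unfolding R_def by (simp add: radial_power_mem_iff[OF f])
    qed
  qed
  moreover obtain m where "\<beta> \<le> real m" using real_arch_simple by blast
  ultimately show ?thesis using assms by blast
qed

section \<open>Functions bounded below near the boundary induce Fredholm operators\<close>

lemma holomorphic_ball_max_modulus:
  fixes h :: "complex ^ 'n \<Rightarrow> complex"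
  assumes h: "h \<in> holomorphic_ball" and \<rho>: "0 < \<rho>" "\<rho> < 1"
    and B: "\<And>z. norm z = \<rho> \<Longrightarrow> cmod (h z) \<le> B" and z: "norm z \<le> \<rho>"
  shows "cmod (h z) \<le> B"
proof -
  obtain v :: "complex ^ 'n" and s :: complex where v: "norm v = 1" and s: "z = s *s v"
  proof (cases "z = 0")
    case True
    show ?thesis by (rule that[of "axis undefined 1" 0]) (use True in auto)
  next
    case False
    show ?thesis
      by (rule that[of "of_real (1 / norm z) *s z" "of_real (norm z)"]) (use False in \<open>auto simp: norm_divide vec_eq_iff\<close>)
  qed
  have hl: "(\<lambda>t. h (t *s v)) holomorphic_on {t. t *s v \<in> ball 0 1}"
    using h by (intro line_holo_line0) (simp add: holomorphic_ball_iff)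
  have hol: "(\<lambda>t. h (t *s v)) holomorphic_on ball 0 1"
    by (rule holomorphic_on_subset[OF hl]) (simp add: v subset_iff)
  have "cmod ((\<lambda>t. h (t *s v)) s) \<le> B"
  proof (rule maximum_modulus_frontier[where f = "\<lambda>t. h (t *s v)" and S = "cball 0 \<rho>" and \<xi> = s])
    show "(\<lambda>t. h (t *s v)) holomorphic_on interior (cball 0 \<rho>)"
      by (rule holomorphic_on_subset[OF hol]) (use \<rho> in auto)
    show "continuous_on (closure (cball 0 \<rho>)) (\<lambda>t. h (t *s v))"
      using \<rho> by (intro continuous_on_subset[OF holomorphic_on_imp_continuous_on[OF hol]]) auto
    show "cmod (h (w *s v)) \<le> B" if "w \<in> frontier (cball 0 \<rho>)" for w
      using that \<rho> by (intro B) (simp add: v frontier_cball)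
    show "s \<in> cball 0 \<rho>" using z by (simp add: s v)
  qed simp
  then show ?thesis by (simp add: s)
qed

text \<open>On a sphere of radius \<rho> \<ge> r the quotients f n are controlled by \<psi> f n. The
  maximum principle for differences of the f n carries this inside, across possible zeros of \<psi>,
  so the quotients converge locally uniformly; \<open>hardy_sobolev_divide\<close> puts the limit
  into the space.\<close>

lemma closed_range_multiplier:
  fixes \<psi> :: "complex ^ 'n \<Rightarrow> complex"
  assumes \<psi>: "pointwise_multiplier \<beta> \<psi>" and r: "0 < r" "r < 1" and \<delta>: "\<delta> > 0"
    and low: "\<And>z. r \<le> norm z \<Longrightarrow> norm z < 1 \<Longrightarrow> \<delta> \<le> cmod (\<psi> z)"
  shows "closedin (hs.metric.mtopology \<beta>) ((\<lambda>f z. \<psi> z * f z) ` hardy_sobolev_space \<beta>)"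
  unfolding hs.closedin_iff
proof (intro conjI allI impI)
  show "(\<lambda>f z. \<psi> z * f z) ` hardy_sobolev_space \<beta> \<subseteq> hardy_sobolev_space \<beta>"
    using pointwise_multiplierD(2)[OF \<psi>] by auto
  fix g :: "nat \<Rightarrow> complex ^ 'n \<Rightarrow> complex" and G :: "complex ^ 'n \<Rightarrow> complex"
  assume g: "\<forall>n. g n \<in> (\<lambda>f z. \<psi> z * f z) ` hardy_sobolev_space \<beta>" and G: "G \<in> hardy_sobolev_space \<beta>"
    and lim: "(\<lambda>n. hardy_sobolev_norm \<beta> (g n - G)) \<longlonglongrightarrow> 0"
  have "\<forall>n. \<exists>f. f \<in> hardy_sobolev_space \<beta> \<and> g n = (\<lambda>z. \<psi> z * f z)" using g by blast
  then obtain f where f: "\<And>n. f n \<in> hardy_sobolev_space \<beta>" "\<And>n. g n = (\<lambda>z. \<psi> z * f n z)" by metis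
  have gV: "g n \<in> hardy_sobolev_space \<beta>" for n unfolding f(2) by (rule pointwise_multiplierD(2)[OF \<psi> f(1)])
  have fh: "f n \<in> holomorphic_ball" for n by (rule hardy_sobolev_holomorphic[OF f(1)])
  define F where "F z = lim (\<lambda>n. f n z)" for z
  have unif: "uniform_limit (cball 0 \<rho>) f F sequentially" if \<rho>: "r \<le> \<rho>" "\<rho> < 1" for \<rho>
  proof -
    have \<rho>0: "\<rho> > 0" using \<rho> r by simp
    have "uniform_limit (cball 0 \<rho>) g G sequentially" by (rule hardy_sobolev_tendsto(2)[OF gV G lim \<rho>(2)])
    then have gC: "uniformly_Cauchy_on (cball 0 \<rho>) g"
      by (intro uniformly_convergent_Cauchy) (auto simp: uniformly_convergent_on_def)
    have "uniformly_Cauchy_on (cball 0 \<rho>) f"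
      unfolding uniformly_Cauchy_on_def
    proof (intro allI impI)
      fix e :: real assume e: "e > 0"
      then have "e * \<delta> / 2 > 0" using \<delta> by simp
      then obtain M where M: "\<And>x m n. x \<in> cball 0 \<rho> \<Longrightarrow> m \<ge> M \<Longrightarrow> n \<ge> M \<Longrightarrow> dist (g m x) (g n x) < e * \<delta> / 2"
        using gC unfolding uniformly_Cauchy_on_def by meson
      have "dist (f m x) (f n x) < e" if "x \<in> cball 0 \<rho>" "m \<ge> M" "n \<ge> M" for x m n
      proof -
        have "cmod ((\<lambda>z. f m z - f n z) x) \<le> e / 2"
        proof (rule holomorphic_ball_max_modulus[OF holomorphic_ball_diff[OF fh fh] \<rho>0 \<rho>(2)])
          fix z :: "complex ^ 'n" assume z: "norm z = \<rho>"
          have "\<delta> * cmod (f m z - f n z) \<le> cmod (\<psi> z) * cmod (f m z - f n z)"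
            using low[of z] z \<rho> by (intro mult_right_mono) auto
          also have "\<dots> = dist (g m z) (g n z)"
            by (simp add: f(2) dist_norm norm_mult[symmetric] right_diff_distrib)
          also have "\<dots> < e * \<delta> / 2" using M[of z m n] z that by simp
          finally show "cmod (f m z - f n z) \<le> e / 2" using \<delta> by (simp add: field_simps)
        qed (use that in auto)
        then show ?thesis using e by (simp add: dist_norm)
      qed
      then show "\<exists>M. \<forall>x\<in>cball 0 \<rho>. \<forall>m\<ge>M. \<forall>n\<ge>M. dist (f m x) (f n x) < e" by blast
    qed
    then show ?thesis
      using Cauchy_uniformly_convergent uniformly_convergent_uniform_limit_iff unfolding F_def by blast
  qed
  have Fl: "line_holo (ball 0 1) F"
  proof (rule line_holo_uniform_limit)
    show "line_holo (ball 0 1) (f n)" for n using fh by (simp add: holomorphic_ball_iff)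
    fix z :: "complex ^ 'n" assume "z \<in> ball 0 1"
    then have "max r (norm z) < 1" using r by simp
    then obtain \<rho> where \<rho>: "max r (norm z) < \<rho>" "\<rho> < 1" using dense by blast
    have "ball z (\<rho> - norm z) \<subseteq> cball 0 \<rho>"
    proof
      fix x assume "x \<in> ball z (\<rho> - norm z)"
      moreover have "norm x \<le> norm z + dist z x"
        using norm_triangle_ineq[of z "x - z"] by (simp add: dist_norm norm_minus_commute)
      ultimately show "x \<in> cball 0 \<rho>" by simp
    qed
    moreover have "uniform_limit (cball 0 \<rho>) f F sequentially" using \<rho> by (intro unif) auto
    ultimately show "\<exists>d>0. uniform_limit (ball z d) f F sequentially"
      using \<rho> by (intro exI[of _ "\<rho> - norm z"]) (auto intro: uniform_limit_on_subset)
  qed simp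
  have Fh: "on_ball F \<in> holomorphic_ball" by (rule on_ball_holomorphic[OF Fl])
  have eq: "\<psi> z * on_ball F z = G z" for z
  proof (cases "z \<in> ball 0 1")
    case True
    have "(\<lambda>n. f n z) \<longlonglongrightarrow> F z"
      by (rule tendsto_uniform_limitI[OF unif[of "max r (norm z)"]]) (use True r in auto)
    then have "(\<lambda>n. g n z) \<longlonglongrightarrow> \<psi> z * F z" unfolding f(2) by (intro tendsto_mult_left)
    then show ?thesis using hardy_sobolev_tendsto(1)[OF gV G lim, of z] True
      by (simp add: on_ball_def) (rule LIMSEQ_unique)
  next
    case False
    then show ?thesis using hardy_sobolev_holomorphic[OF G] by (simp add: on_ball_def holomorphic_ball_iff)
  qed
  then have "(\<lambda>z. \<psi> z * on_ball F z) = G" by blast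
  moreover from this have "on_ball F \<in> hardy_sobolev_space \<beta>"
    using G by (intro hardy_sobolev_divide[OF \<psi> Fh _ r \<delta> low]) auto
  ultimately show "G \<in> (\<lambda>f z. \<psi> z * f z) ` hardy_sobolev_space \<beta>" by blast
qed

section \<open>Zeros in more than one variable\<close>

lemma norm_add_orthogonal:
  fixes x y :: "complex ^ 'n"
  assumes "(\<Sum>k\<in>UNIV. x $ k * cnj (y $ k)) = 0"
  shows "(norm (x + y))\<^sup>2 = (norm x)\<^sup>2 + (norm y)\<^sup>2"
proof -
  have n: "(norm v)\<^sup>2 = (\<Sum>k\<in>UNIV. (cmod (v $ k))\<^sup>2)" for v :: "complex ^ 'n"
    by (simp add: norm_vec_def L2_set_def sum_nonneg)
  have "(cmod (a + b))\<^sup>2 = (cmod a)\<^sup>2 + (cmod b)\<^sup>2 + 2 * Re (a * cnj b)" for a b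
    unfolding cmod_power2 by (simp add: power2_eq_square algebra_simps)
  then have "(norm (x + y))\<^sup>2 = (norm x)\<^sup>2 + (norm y)\<^sup>2 + 2 * (\<Sum>k\<in>UNIV. Re (x $ k * cnj (y $ k)))"
    unfolding n by (simp add: sum.distrib sum_distrib_left)
  also have "(\<Sum>k\<in>UNIV. Re (x $ k * cnj (y $ k))) = Re (\<Sum>k\<in>UNIV. x $ k * cnj (y $ k))"
    by (rule Re_sum[symmetric])
  finally show ?thesis using assms by simp
qed

text \<open>At a zero of maximal norm, a disc orthogonal to it can be pushed off the zero set in the
  direction of the zero; the maximum principle for \<open>1 / \<psi>\<close> on these discs gives a contradiction.\<close>

lemma holomorphic_ball_nonzero:
  fixes \<psi> :: "complex ^ 'n \<Rightarrow> complex"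
  assumes \<psi>: "\<psi> \<in> holomorphic_ball" and card: "CARD('n) \<noteq> 1" and r: "0 < r" "r < 1"
    and nz: "\<And>z. r \<le> norm z \<Longrightarrow> norm z < 1 \<Longrightarrow> \<psi> z \<noteq> 0" and z: "norm z < 1"
  shows "\<psi> z \<noteq> 0"
proof
  assume z0: "\<psi> z = 0"
  have cont: "continuous_on (ball 0 1) \<psi>" using \<psi> by (simp add: holomorphic_ball_iff line_holo_def)
  define Z where "Z = cball 0 r \<inter> \<psi> -` {0}"
  have "closed Z"
    unfolding Z_def by (rule continuous_closed_preimage) (use r in \<open>auto intro: continuous_on_subset[OF cont]\<close>)
  then have cZ: "compact Z" unfolding Z_def by (metis compact_Int_closed compact_cball inf.left_idem)
  have zZ: "w \<in> Z" if "\<psi> w = 0" "norm w < 1" for w using nz[of w] that by (force simp: Z_def)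
  then have "Z \<noteq> {}" using z0 z by blast
  then obtain a where a: "a \<in> Z" and amax: "\<And>w. w \<in> Z \<Longrightarrow> norm w \<le> norm a"
    using continuous_attains_sup[OF cZ _ continuous_on_norm_id] by blast
  have an: "norm a \<le> r" "\<psi> a = 0" using a by (auto simp: Z_def)
  have "CARD('n) > 1" using card zero_less_card_finite[where 'a = 'n] by linarith
  then have "\<not> (\<forall>i j :: 'n. i = j)" using card_le_Suc0_iff_eq[of "UNIV :: 'n set"] by auto
  then obtain i j :: 'n where ij: "i \<noteq> j" by blast
  \<comment> \<open>The disc runs in the direction v, which is orthogonal to a and to u; moving
    along u increases the norm. For a nonzero, u is a itself; for a = 0 two coordinate axes serve.
    The existence of v requires a second dimension.\<close>
  obtain u v :: "complex ^ 'n" where v: "v \<noteq> 0"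
    and av: "(\<Sum>k\<in>UNIV. a $ k * cnj (v $ k)) = 0" and uv: "(\<Sum>k\<in>UNIV. u $ k * cnj (v $ k)) = 0"
    and au: "\<And>s. s > 0 \<Longrightarrow> norm a < norm (a + of_real s *s u)"
  proof (cases "a = 0")
    case True
    have "(\<Sum>k\<in>UNIV. (axis j 1 :: complex ^ 'n) $ k * cnj ((axis i 1 :: complex ^ 'n) $ k)) = 0"
      using ij by (intro sum.neutral) (auto simp: axis_def)
    then show ?thesis using True by (intro that[of "axis i 1" "axis j 1"]) (auto simp: axis_eq_0_iff)
  next
    case False
    have pos: "norm a < norm (a + of_real s *s a)" if "s > 0" for s
    proof -
      have "a + of_real s *s a = of_real (1 + s) *s a" by (simp add: vec_eq_iff algebra_simps)
      then have "norm (a + of_real s *s a) = (1 + s) * norm a" using that by (simp del: of_real_add)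
      then show ?thesis using that False by (simp add: algebra_simps)
    qed
    show ?thesis
    proof (cases "a $ i = 0")
      case True
      have "(\<Sum>k\<in>UNIV. a $ k * cnj ((axis i 1 :: complex ^ 'n) $ k)) = 0"
        using True by (intro sum.neutral) (auto simp: axis_def)
      then show ?thesis using pos by (intro that[of "axis i 1" a]) (auto simp: axis_eq_0_iff)
    next
      case False
      define v :: "complex ^ 'n" where "v = (\<chi> k. if k = i then cnj (a $ j) else if k = j then - cnj (a $ i) else 0)"
      have "(\<Sum>k\<in>UNIV. a $ k * cnj (v $ k)) = (\<Sum>k\<in>{i, j}. a $ k * cnj (v $ k))"
        by (intro sum.mono_neutral_right) (auto simp: v_def)
      also have "\<dots> = 0" using ij by (simp add: v_def)
      finally have o: "(\<Sum>k\<in>UNIV. a $ k * cnj (v $ k)) = 0" .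
      have "v $ j \<noteq> 0" using False ij by (simp add: v_def)
      then have "v \<noteq> 0" by auto
      then show ?thesis using pos o by (intro that[of v a]) auto
    qed
  qed
  have orth: "(norm (a + of_real s *s u + t *s v))\<^sup>2 = (norm (a + of_real s *s u))\<^sup>2 + (cmod t * norm v)\<^sup>2" for s t
  proof -
    have "(\<Sum>k\<in>UNIV. (a + of_real s *s u) $ k * cnj ((t *s v) $ k)) =
      cnj t * ((\<Sum>k\<in>UNIV. a $ k * cnj (v $ k)) + of_real s * (\<Sum>k\<in>UNIV. u $ k * cnj (v $ k)))"
      by (simp add: sum_distrib_left sum.distrib[symmetric] algebra_simps)
    then show ?thesis using norm_add_orthogonal[of "a + of_real s *s u" "t *s v"] av uv by simp
  qed
  define m where "m = 1 - norm a"
  have m: "m > 0" using an r by (simp add: m_def)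
  \<comment> \<open>The moves along u and along v each use up at most a third of the distance m from
    a to the sphere, so all displaced points stay in the ball.\<close>
  define \<epsilon> where "\<epsilon> = m / (3 * norm v)"
  have \<epsilon>: "\<epsilon> > 0" "\<epsilon> * norm v = m / 3" using m v by (auto simp: \<epsilon>_def)
  define s0 where "s0 = m / (3 * (norm u + 1))"
  have s0: "s0 > 0" using m by (simp add: s0_def add_nonneg_pos)
  have "s0 * norm u \<le> s0 * (norm u + 1)" using s0 by (intro mult_left_mono) auto
  also have "\<dots> = m / 3" using norm_ge_zero[of u] by (simp add: s0_def field_simps add_nonneg_eq_0_iff)
  finally have s0u: "s0 * norm u \<le> m / 3" .
  have inb: "norm (a + of_real s *s u + t *s v) < 1" if "0 \<le> s" "s \<le> s0" "cmod t \<le> \<epsilon>" for s t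
  proof -
    have "norm (a + of_real s *s u + t *s v) \<le> norm a + norm (of_real s *s u) + norm (t *s v)"
      by (meson add_mono norm_triangle_ineq order_refl order_trans)
    moreover have "norm (of_real s *s u) \<le> s0 * norm u" using that by (auto intro!: mult_right_mono)
    moreover have "norm (t *s v) \<le> \<epsilon> * norm v" using that by (auto intro!: mult_right_mono)
    moreover have "N < 1" if "N \<le> norm a + X + Y" "X \<le> p" "Y \<le> q" "p \<le> m / 3" "q = m / 3" for N X Y p q :: real
    proof -
      have "N \<le> norm a + m / 3 + m / 3" using that by linarith
      also have "\<dots> < norm a + m" using m by simp
      finally show ?thesis by (simp add: m_def)
    qed
    ultimately show ?thesis using s0u \<epsilon>(2) by blast
  qed
  \<comment> \<open>Every displaced point other than a itself has norm larger than a and hence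
    cannot be a zero, by maximality of a.\<close>
  have big: "norm a < norm (a + of_real s *s u + t *s v)" if "0 \<le> s" "s > 0 \<or> t \<noteq> 0" for s t
  proof (rule power2_less_imp_less)
    show "(norm a)\<^sup>2 < (norm (a + of_real s *s u + t *s v))\<^sup>2"
    proof (cases "s > 0")
      case True
      then have "(norm a)\<^sup>2 < (norm (a + of_real s *s u))\<^sup>2" using au by (intro power_strict_mono) auto
      then show ?thesis unfolding orth by (simp add: add_strict_increasing2 add.commute)
    next
      case False
      then have "s = 0" "t \<noteq> 0" using that by auto
      then show ?thesis unfolding orth using v by simp
    qed
  qed simp
  have nzero: "\<psi> (a + of_real s *s u + t *s v) \<noteq> 0" if "0 \<le> s" "s \<le> s0" "cmod t \<le> \<epsilon>" "s > 0 \<or> t \<noteq> 0" for s t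
  proof
    assume "\<psi> (a + of_real s *s u + t *s v) = 0"
    then have "norm (a + of_real s *s u + t *s v) \<le> norm a" using inb that by (intro amax zZ) auto
    then show False using big[of s t] that by linarith
  qed
  \<comment> \<open>The boundaries of all the discs, including the undisplaced one at s = 0: they
    avoid the zero set and form a compact set, so |\<psi>| has a positive minimum \<mu> on them,
    uniformly in s.\<close>
  define K where "K = {0..s0} \<times> sphere (0 :: complex) \<epsilon>"
  define P where "P = (\<lambda>(s, t). a + of_real s *s u + t *s v)"
  have cK: "compact K" unfolding K_def by (intro compact_Times) auto
  have Kne: "K \<noteq> {}" using s0 \<epsilon> by (auto simp: K_def)
  have "continuous_on K P"
    unfolding P_def case_prod_unfold
    by (intro continuous_on_add continuous_on_smult continuous_on_const continuous_on_of_real continuous_on_fst continuous_on_snd continuous_on_id)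
  then have "continuous_on K (\<lambda>x. cmod (\<psi> (P x)))"
    by (intro continuous_on_norm continuous_on_compose2[OF cont]) (use inb in \<open>auto simp: K_def P_def\<close>)
  then obtain x0 where x0: "x0 \<in> K" "\<And>x. x \<in> K \<Longrightarrow> cmod (\<psi> (P x0)) \<le> cmod (\<psi> (P x))"
    using continuous_attains_inf[OF cK Kne] by blast
  define \<mu> where "\<mu> = cmod (\<psi> (P x0))"
  have \<mu>: "\<mu> > 0"
  proof -
    obtain s t where st: "x0 = (s, t)" by (cases x0)
    have "\<psi> (a + of_real s *s u + t *s v) \<noteq> 0"
      using x0(1) \<epsilon>(1) unfolding st K_def by (intro nzero) auto
    then show ?thesis by (simp add: \<mu>_def st P_def)
  qed
  have low: "\<mu> \<le> cmod (\<psi> (a + of_real s *s u))" if s: "0 < s" "s \<le> s0" for s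
  proof -
    define S where "S = {t. (a + of_real s *s u) + t *s v \<in> ball 0 1}"
    have hol: "(\<lambda>t. \<psi> ((a + of_real s *s u) + t *s v)) holomorphic_on S"
      using \<psi> unfolding holomorphic_ball_iff line_holo_def S_def by blast
    have sub: "cball 0 \<epsilon> \<subseteq> S" using inb s by (auto simp: S_def)
    have hol2: "(\<lambda>t. 1 / \<psi> ((a + of_real s *s u) + t *s v)) holomorphic_on cball 0 \<epsilon>"
      by (intro holomorphic_intros holomorphic_on_subset[OF hol sub]) (use nzero s in auto)
    have "cmod ((\<lambda>t. 1 / \<psi> ((a + of_real s *s u) + t *s v)) 0) \<le> 1 / \<mu>"
    proof (rule maximum_modulus_frontier[where f = "\<lambda>t. 1 / \<psi> ((a + of_real s *s u) + t *s v)" and S = "cball 0 \<epsilon>" and \<xi> = 0])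
      show "(\<lambda>t. 1 / \<psi> ((a + of_real s *s u) + t *s v)) holomorphic_on interior (cball 0 \<epsilon>)"
        by (rule holomorphic_on_subset[OF hol2]) (rule interior_subset)
      show "continuous_on (closure (cball 0 \<epsilon>)) (\<lambda>t. 1 / \<psi> ((a + of_real s *s u) + t *s v))"
        using holomorphic_on_imp_continuous_on[OF hol2] by simp
      show "cmod (1 / \<psi> ((a + of_real s *s u) + t *s v)) \<le> 1 / \<mu>" if "t \<in> frontier (cball 0 \<epsilon>)" for t
      proof -
        have "(s, t) \<in> K" using that s \<epsilon> by (simp add: K_def frontier_cball)
        from x0(2)[OF this] have "\<mu> \<le> cmod (\<psi> ((a + of_real s *s u) + t *s v))" by (simp add: \<mu>_def P_def)
        then show ?thesis using \<mu> by (simp add: norm_divide frac_le)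
      qed
      show "0 \<in> cball (0 :: complex) \<epsilon>" using \<epsilon> by simp
    qed simp
    moreover have "\<psi> (a + of_real s *s u) \<noteq> 0" using nzero[of s 0] s \<epsilon> by simp
    ultimately show ?thesis using \<mu> by (simp add: norm_divide field_simps)
  qed
  \<comment> \<open>At the centres of the displaced discs |\<psi>| is at least \<mu>. Letting s tend
    to 0 gives the same bound at the zero a.\<close>
  have "((\<lambda>s. cmod (\<psi> (a + of_real s *s u))) \<longlongrightarrow> cmod (\<psi> (a + of_real 0 *s u))) (at_right 0)"
  proof -
    have 1: "isCont \<psi> a" using cont an r by (simp add: continuous_on_eq_continuous_at)
    have 2: "((\<lambda>s :: real. a + of_real s *s u) \<longlongrightarrow> a) (at_right 0)"
    proof -
      have "continuous_on UNIV (\<lambda>s :: real. a + of_real s *s u)"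
        by (intro continuous_on_add continuous_on_smult continuous_on_const continuous_on_of_real continuous_on_id)
      then have "isCont (\<lambda>s :: real. a + of_real s *s u) 0" by (simp add: continuous_on_eq_continuous_at)
      then show ?thesis by (simp add: isCont_def filterlim_at_split)
    qed
    show ?thesis using tendsto_norm[OF isCont_tendsto_compose[OF 1 2]] by simp
  qed
  moreover have "\<forall>\<^sub>F s in at_right 0. \<mu> \<le> cmod (\<psi> (a + of_real s *s u))"
    using eventually_at_right_real[OF s0] by eventually_elim (auto intro: low)
  ultimately have "\<mu> \<le> cmod (\<psi> (a + of_real 0 *s u))"
    by (rule tendsto_lowerbound) simp
  then show False using an \<mu> by simp
qed

section \<open>Division with remainder in the unit disc\<close>

definition divides_with_remainder :: "(complex \<Rightarrow> complex) \<Rightarrow> nat \<Rightarrow> bool" where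
  "divides_with_remainder h m \<longleftrightarrow> (\<forall>g. g holomorphic_on ball 0 1 \<longrightarrow>
     (\<exists>q p. q holomorphic_on ball 0 1 \<and> degree p \<le> m \<and> (\<forall>t\<in>ball 0 1. g t = h t * q t + poly p t)))"

text \<open>For each factor t - a, the function (g - g(a)) / (t - a) is holomorphic, and the
  constant g(a) joins the remainder, whose degree bound grows by one independently of g.\<close>

lemma divides_with_remainder_linear_power:
  assumes "divides_with_remainder k m" "a \<in> ball 0 1"
  shows "\<exists>m'. divides_with_remainder (\<lambda>t. (t - a) ^ n * k t) m'"
proof (induction n)
  case 0
  then show ?case using assms(1) by auto
next
  case (Suc n)
  then obtain m' where m': "divides_with_remainder (\<lambda>t. (t - a) ^ n * k t) m'" by blast
  have "divides_with_remainder (\<lambda>t. (t - a) ^ Suc n * k t) (Suc m')"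
    unfolding divides_with_remainder_def
  proof (intro allI impI)
    fix g :: "complex \<Rightarrow> complex" assume g: "g holomorphic_on ball 0 1"
    define g1 where "g1 t = (if t = a then deriv g a else (g t - g a) / (t - a))" for t
    have "g1 holomorphic_on ball 0 1" unfolding g1_def by (rule pole_lemma_open[OF g open_ball])
    then obtain q p where q: "q holomorphic_on ball 0 1" "degree p \<le> m'"
      "\<And>t. t \<in> ball 0 1 \<Longrightarrow> g1 t = (t - a) ^ n * k t * q t + poly p t"
      using m' unfolding divides_with_remainder_def by blast
    define p' where "p' = [:g a:] + [:- a, 1:] * p"
    have "degree ([:- a, 1:] * p) \<le> Suc m'"
      using degree_mult_le[of "[:- a, 1:]" p] q(2) by (simp add: degree_pCons_eq_if)
    then have "degree p' \<le> Suc m'" unfolding p'_def by (intro degree_add_le) auto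
    moreover have "g t = (t - a) ^ Suc n * k t * q t + poly p' t" if "t \<in> ball 0 1" for t
    proof -
      have "g t = g a + (t - a) * g1 t" by (simp add: g1_def)
      then show ?thesis unfolding q(3)[OF that] by (simp add: p'_def algebra_simps)
    qed
    ultimately show "\<exists>q p. q holomorphic_on ball 0 1 \<and> degree p \<le> Suc m' \<and>
        (\<forall>t\<in>ball 0 1. g t = (t - a) ^ Suc n * k t * q t + poly p t)"
      using q(1) by blast
  qed
  then show ?case by blast
qed

text \<open>Induction on the number of distinct zeros: one zero is factored out with its full
  multiplicity. Without zeros division is exact.\<close>

lemma divides_with_remainder_finite_zeros:
  assumes "h holomorphic_on ball 0 1" "finite {t \<in> ball 0 1. h t = 0}" "\<exists>t\<in>ball 0 1. h t \<noteq> 0"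
  shows "\<exists>m. divides_with_remainder h m"
  using assms
proof (induction "card {t \<in> ball 0 1. h t = 0}" arbitrary: h)
  case 0
  then have nz: "\<And>t. t \<in> ball 0 1 \<Longrightarrow> h t \<noteq> 0" by auto
  have "divides_with_remainder h 0"
    unfolding divides_with_remainder_def
  proof (intro allI impI)
    fix g :: "complex \<Rightarrow> complex" assume "g holomorphic_on ball 0 1"
    then have "(\<lambda>t. g t / h t) holomorphic_on ball 0 1" using 0 nz by (intro holomorphic_intros) auto
    then show "\<exists>q p. q holomorphic_on ball 0 1 \<and> degree p \<le> 0 \<and> (\<forall>t\<in>ball 0 1. g t = h t * q t + poly p t)"
      using nz by (intro exI[of _ "\<lambda>t. g t / h t"] exI[of _ 0]) auto
  qed
  then show ?case by blast
next
  case (Suc c)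
  have "{t \<in> ball 0 1. h t = 0} \<noteq> {}"
  proof
    assume "{t \<in> ball 0 1. h t = 0} = {}"
    with Suc.hyps(2) show False by (metis card.empty nat.distinct(1))
  qed
  then obtain a where a: "a \<in> ball 0 1" "h a = 0" by blast
  have "\<not> h constant_on ball 0 1"
    using a Suc.prems(3) unfolding constant_on_def by metis
  from holomorphic_factor_zero_nonconstant[OF Suc.prems(1) open_ball connected_ball a this]
  obtain g r n where n: "0 < n" "0 < r" "ball a r \<subseteq> ball 0 1" "g holomorphic_on ball a r"
    "\<And>w. w \<in> ball a r \<Longrightarrow> h w = (w - a) ^ n * g w" "\<And>w. w \<in> ball a r \<Longrightarrow> g w \<noteq> 0" by metis
  define k where "k t = (if t = a then g a else h t / (t - a) ^ n)" for t
  have kg: "k t = g t" if "t \<in> ball a r" for t using n(5)[OF that] by (simp add: k_def)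
  have "k holomorphic_on ball a r" using n(4) by (rule holomorphic_transform) (simp add: kg)
  moreover have "k holomorphic_on ball 0 1 - {a}"
  proof (rule holomorphic_transform)
    show "(\<lambda>t. h t / (t - a) ^ n) holomorphic_on ball 0 1 - {a}"
      using holomorphic_on_subset[OF Suc.prems(1)] by (intro holomorphic_intros) auto
  qed (simp add: k_def)
  ultimately have "k holomorphic_on (ball a r \<union> (ball 0 1 - {a}))"
    by (intro holomorphic_on_Un) auto
  moreover have "ball a r \<union> (ball 0 1 - {a}) = ball 0 1" using n(2,3) by auto
  ultimately have k: "k holomorphic_on ball 0 1" by simp
  have hk: "h t = (t - a) ^ n * k t" for t
    using a n(1) by (simp add: k_def)
  have ka: "k a \<noteq> 0" using kg[of a] n(2) n(6)[of a] by simp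
  have Z: "{t \<in> ball 0 1. k t = 0} = {t \<in> ball 0 1. h t = 0} - {a}"
    using ka n(1) by (auto simp: hk)
  have "\<exists>m. divides_with_remainder k m"
  proof (rule Suc.hyps(1)[OF _ k])
    show "c = card {t \<in> ball 0 1. k t = 0}" using Suc.hyps(2) Suc.prems(2) a unfolding Z by simp
    show "finite {t \<in> ball 0 1. k t = 0}" using Suc.prems(2) unfolding Z by simp
    show "\<exists>t\<in>ball 0 1. k t \<noteq> 0" using ka a by blast
  qed
  then obtain m where "divides_with_remainder k m" by blast
  from divides_with_remainder_linear_power[OF this a(1), of n] show ?case by (simp add: hk[abs_def, symmetric])
qed

lemma line_holo_nth_compose:
  assumes q: "q holomorphic_on ball 0 1"
  shows "line_holo (ball 0 1) (\<lambda>z :: complex ^ 'n. q (z $ i))"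
proof (rule line_holoI)
  have b: "z $ i \<in> ball 0 1" if "norm z < 1" for z :: "complex ^ 'n"
    using Finite_Cartesian_Product.norm_nth_le[of z i] that by simp
  show "continuous_on (ball 0 1) (\<lambda>z :: complex ^ 'n. q (z $ i))"
    by (rule continuous_on_compose2[OF holomorphic_on_imp_continuous_on[OF q]])
       (use b in \<open>auto intro!: continuous_intros\<close>)
  fix a c :: "complex ^ 'n"
  have "(q \<circ> (\<lambda>t. (a + t *s c) $ i)) holomorphic_on {t. a + t *s c \<in> ball 0 1}"
  proof (rule holomorphic_on_compose_gen[OF _ q])
    show "(\<lambda>t. (a + t *s c) $ i) holomorphic_on {t. a + t *s c \<in> ball 0 1}"
      by (simp, intro holomorphic_intros)
    show "(\<lambda>t. (a + t *s c) $ i) ` {t. a + t *s c \<in> ball 0 1} \<subseteq> ball 0 1"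
      using b by (auto simp del: vector_add_component vector_smult_component)
  qed
  then show "(\<lambda>t. q ((a + t *s c) $ i)) holomorphic_on {t. a + t *s c \<in> ball 0 1}" by (simp add: o_def)
qed

text \<open>Division takes place among holomorphic functions; only afterwards does
  \<open>hardy_sobolev_divide\<close> place the quotient in the space. This is possible because the
  remainder is a polynomial and so belongs to the space.\<close>

lemma finite_codimension_multiplier:
  fixes \<psi> :: "complex ^ 'n \<Rightarrow> complex"
  assumes \<psi>: "pointwise_multiplier \<beta> \<psi>" and r: "0 < r" "r < 1" and \<delta>: "\<delta> > 0"
    and low: "\<And>z. r \<le> norm z \<Longrightarrow> norm z < 1 \<Longrightarrow> \<delta> \<le> cmod (\<psi> z)"
  shows "\<exists>B. finite B \<and> B \<subseteq> hardy_sobolev_space \<beta> \<and>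
     (\<forall>g\<in>hardy_sobolev_space \<beta>. \<exists>f\<in>hardy_sobolev_space \<beta>. g - (\<lambda>z. \<psi> z * f z) \<in> cfun.span B)"
proof (cases "CARD('n) = 1")
  case False
  have \<psi>h: "\<psi> \<in> holomorphic_ball" by (rule pointwise_multiplierD(1)[OF \<psi>])
  have nz: "\<psi> z \<noteq> 0" if "z \<in> ball 0 1" for z
    by (rule holomorphic_ball_nonzero[OF \<psi>h False r]) (use low \<delta> that in force)+
  have "\<exists>f\<in>hardy_sobolev_space \<beta>. g - (\<lambda>z. \<psi> z * f z) \<in> cfun.span {}" if g: "g \<in> hardy_sobolev_space \<beta>" for g
  proof -
    have gh: "g \<in> holomorphic_ball" by (rule hardy_sobolev_holomorphic[OF g])
    define f where "f = on_ball (\<lambda>z. g z / \<psi> z)"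
    have f: "f \<in> holomorphic_ball"
      unfolding f_def using gh \<psi>h nz by (intro on_ball_holomorphic line_holo_divide) (auto simp: holomorphic_ball_iff)
    have e: "(\<lambda>z. \<psi> z * f z) = g"
      using gh nz by (auto simp: f_def on_ball_def holomorphic_ball_iff fun_eq_iff)
    then have "f \<in> hardy_sobolev_space \<beta>" using g by (intro hardy_sobolev_divide[OF \<psi> f _ r \<delta> low]) auto
    then show ?thesis using e by (intro bexI[of _ f]) (auto simp: cfun.span_zero)
  qed
  then show ?thesis by (intro exI[of _ "{}"]) auto
next
  case True
  then obtain i :: 'n where U: "UNIV = {i}" by (metis card_1_singletonE)
  have \<psi>h: "\<psi> \<in> holomorphic_ball" by (rule pointwise_multiplierD(1)[OF \<psi>])
  define e :: "complex ^ 'n" where "e = axis i 1"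
  have e: "norm e = 1" by (simp add: e_def)
  have z: "z = (z $ i) *s e" for z :: "complex ^ 'n"
    using U by (auto simp: vec_eq_iff e_def axis_def)
  have nz: "norm z = cmod (z $ i)" for z :: "complex ^ 'n"
    using arg_cong[OF z[of z], of norm] e by simp
  have hol: "(\<lambda>t. f (t *s e)) holomorphic_on ball 0 1" if "f \<in> holomorphic_ball" for f
    using that line_holo_line0[of f e] by (auto simp: holomorphic_ball_iff e elim!: holomorphic_on_subset)
  define h where "h t = \<psi> (t *s e)" for t
  have h: "h holomorphic_on ball 0 1" unfolding h_def by (rule hol[OF \<psi>h])
  have hlow: "h t \<noteq> 0" if "r \<le> cmod t" "cmod t < 1" for t
    using low[of "t *s e"] that \<delta> by (auto simp: h_def e)
  have ex: "\<exists>t\<in>ball 0 1. h t \<noteq> 0" using hlow[of "of_real r"] r by (intro bexI[of _ "of_real r"]) auto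
  have "finite {t \<in> ball 0 1. h t = 0}"
  proof (cases "h constant_on ball 0 1")
    case True
    then have E: "{t \<in> ball 0 1. h t = 0} = {}" using ex unfolding constant_on_def by force
    show ?thesis unfolding E by (rule finite.emptyI)
  next
    case False
    \<comment> \<open>All zeros lie in this compact disc, since \<psi> is bounded away from 0
      outside it; they cannot accumulate at the circle.\<close>
    have "finite {t \<in> cball 0 r. h t = 0}"
      by (rule holomorphic_compact_finite_zeros[OF h open_ball connected_ball compact_cball _ False]) (use r in auto)
    then show ?thesis by (rule finite_subset[rotated]) (use hlow in force)
  qed
  from divides_with_remainder_finite_zeros[OF h this ex] obtain m where m: "divides_with_remainder h m" by blast
  define B where "B = (\<lambda>j. on_ball (\<lambda>z :: complex ^ 'n. (z $ i) ^ j)) ` {..m}"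
  have BV: "B \<subseteq> hardy_sobolev_space \<beta>"
    unfolding B_def by (auto intro!: polys_hardy_sobolev polys_power polys_nth)
  have "\<exists>f\<in>hardy_sobolev_space \<beta>. g - (\<lambda>z. \<psi> z * f z) \<in> cfun.span B" if g: "g \<in> hardy_sobolev_space \<beta>" for g
  proof -
    have gh: "g \<in> holomorphic_ball" by (rule hardy_sobolev_holomorphic[OF g])
    obtain q p where q: "q holomorphic_on ball 0 1" "degree p \<le> m"
      "\<And>t. t \<in> ball 0 1 \<Longrightarrow> g (t *s e) = h t * q t + poly p t"
      using m hol[OF gh] unfolding divides_with_remainder_def by blast
    define f where "f = on_ball (\<lambda>z. q (z $ i))"
    have f: "f \<in> holomorphic_ball" unfolding f_def by (intro on_ball_holomorphic line_holo_nth_compose q)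
    define P where "P = on_ball (\<lambda>z :: complex ^ 'n. poly p (z $ i))"
    have gP: "\<psi> z * f z = g z - P z" for z
    proof (cases "z \<in> ball 0 1")
      case True
      then have t: "z $ i \<in> ball 0 1" by (simp add: nz)
      have "g z = \<psi> z * q (z $ i) + poly p (z $ i)"
        using q(3)[OF t] by (simp add: h_def flip: z)
      then show ?thesis using True by (simp add: f_def P_def on_ball_def)
    next
      case False
      then show ?thesis using gh by (simp add: f_def P_def on_ball_def holomorphic_ball_iff)
    qed
    have Psum: "P = (\<Sum>j\<le>m. scale_fun (coeff p j) (on_ball (\<lambda>z :: complex ^ 'n. (z $ i) ^ j)))"
    proof
      fix z :: "complex ^ 'n"
      have "poly p t = (\<Sum>j\<le>m. coeff p j * t ^ j)" for t
        unfolding poly_altdef by (rule sum.mono_neutral_left) (use q(2) in \<open>auto simp: coeff_eq_0\<close>)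
      moreover have "(\<Sum>j\<in>A. scale_fun (coeff p j) (on_ball (\<lambda>z :: complex ^ 'n. (z $ i) ^ j))) z
         = (\<Sum>j\<in>A. coeff p j * on_ball (\<lambda>z :: complex ^ 'n. (z $ i) ^ j) z)" for A
        by (induction A rule: infinite_finite_induct) (auto simp: scale_fun_def)
      ultimately show "P z = (\<Sum>j\<le>m. scale_fun (coeff p j) (on_ball (\<lambda>z :: complex ^ 'n. (z $ i) ^ j))) z"
        by (simp add: P_def on_ball_def)
    qed
    then have Pspan: "P \<in> cfun.span B"
      unfolding Psum by (intro cfun.span_sum cfun.span_scale cfun.span_base) (auto simp: B_def)
    have PV: "P \<in> hardy_sobolev_space \<beta>"
      unfolding Psum using BV by (intro cfun.subspace_sum[of "hardy_sobolev_space \<beta>"] cfun.subspaceI hs.zero_mem hs.add_mem hs.scale_mem) (auto simp: B_def)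
    have "(\<lambda>z. \<psi> z * f z) = g - P" by (simp add: gP fun_eq_iff)
    moreover from this have "f \<in> hardy_sobolev_space \<beta>"
      using hs.diff_mem[OF g PV] by (intro hardy_sobolev_divide[OF \<psi> f _ r \<delta> low]) auto
    ultimately show ?thesis using Pspan by (intro bexI[of _ f]) auto
  qed
  moreover have "finite B" by (simp add: B_def)
  ultimately show ?thesis using BV by (intro exI[of _ B]) auto
qed

lemma fredholm_if_bounded_below:
  fixes \<psi> :: "complex ^ 'n \<Rightarrow> complex"
  assumes \<psi>: "pointwise_multiplier \<beta> \<psi>" and r: "0 < r" "r < 1" and \<delta>: "\<delta> > 0"
    and low: "\<And>z. r \<le> norm z \<Longrightarrow> norm z < 1 \<Longrightarrow> \<delta> \<le> cmod (\<psi> z)"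
  shows "fredholm_on (hardy_sobolev_space \<beta>) (hardy_sobolev_norm \<beta>) (\<lambda>f z. \<psi> z * f z)"
  unfolding fredholm_on_def
proof (intro conjI)
  show "bounded_operator_on (hardy_sobolev_space \<beta>) (hardy_sobolev_norm \<beta>) (\<lambda>f z. \<psi> z * f z)"
    unfolding bounded_operator_on_def
  proof (intro conjI)
    obtain C where "\<And>f. f \<in> hardy_sobolev_space \<beta> \<Longrightarrow> hardy_sobolev_norm \<beta> (\<lambda>z. \<psi> z * f z) \<le> C * hardy_sobolev_norm \<beta> f"
      using pointwise_multiplier_operator_bound[OF \<psi>] by blast
    then show "\<exists>C. \<forall>f\<in>hardy_sobolev_space \<beta>. hardy_sobolev_norm \<beta> (\<lambda>z. \<psi> z * f z) \<le> C * hardy_sobolev_norm \<beta> f"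
      by blast
  qed (use pointwise_multiplierD(2)[OF \<psi>] in \<open>auto simp: scale_fun_def fun_eq_iff algebra_simps\<close>)
  show "closedin (hs.metric.mtopology \<beta>) ((\<lambda>f z. \<psi> z * f z) ` hardy_sobolev_space \<beta>)"
    by (rule closed_range_multiplier[OF \<psi> r \<delta> low])
  have "f = 0" if "f \<in> hardy_sobolev_space \<beta>" "(\<lambda>z. \<psi> z * f z) = 0" for f
  proof -
    define z0 :: "complex ^ 'n" where "z0 = of_real r *s axis undefined 1"
    have "norm z0 = r" using r by (simp add: z0_def)
    then have "\<psi> z0 \<noteq> 0" using low[of z0] r \<delta> by auto
    moreover have "\<psi> z * f z = 0" for z using fun_cong[OF that(2), of z] by simp
    ultimately have "f z = 0" for z
      by (intro holomorphic_ball_cancel[OF pointwise_multiplierD(1)[OF \<psi>] _ hardy_sobolev_holomorphic[OF that(1)]])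
    then show ?thesis by (simp add: fun_eq_iff)
  qed
  then have "{f \<in> hardy_sobolev_space \<beta>. (\<lambda>z. \<psi> z * f z) = 0} \<subseteq> cfun.span {}" by auto
  then show "\<exists>B. finite B \<and> B \<subseteq> hardy_sobolev_space \<beta> \<and> {f \<in> hardy_sobolev_space \<beta>. (\<lambda>z. \<psi> z * f z) = 0} \<subseteq> cfun.span B"
    by (intro exI[of _ "{}"]) auto
  show "\<exists>B. finite B \<and> B \<subseteq> hardy_sobolev_space \<beta> \<and>
     (\<forall>g\<in>hardy_sobolev_space \<beta>. \<exists>f\<in>hardy_sobolev_space \<beta>. g - (\<lambda>z. \<psi> z * f z) \<in> cfun.span B)"
    by (rule finite_codimension_multiplier[OF \<psi> r \<delta> low])
qed

section \<open>Closures and annihilating polynomials\<close>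

context banach_function_space
begin

definition cl :: "('a \<Rightarrow> complex) set \<Rightarrow> ('a \<Rightarrow> complex) set" where
  "cl X = {f \<in> V. \<forall>e>0. \<exists>x\<in>X. N (f - x) < e}"

lemma subspace_V: "cfun.subspace V"
  by (intro cfun.subspaceI zero_mem add_mem scale_mem)

lemma clD: "f \<in> cl X \<Longrightarrow> f \<in> V" "f \<in> cl X \<Longrightarrow> e > 0 \<Longrightarrow> \<exists>x\<in>X. N (f - x) < e"
  by (auto simp: cl_def)

lemma subset_cl: "X \<subseteq> V \<Longrightarrow> X \<subseteq> cl X"
  by (force simp: cl_def)

lemma cl_subset_V: "cl X \<subseteq> V"
  by (auto simp: cl_def)

lemma cl_approx:
  assumes f: "f \<in> V" and Y: "Y \<subseteq> V" and ap: "\<And>e. e > 0 \<Longrightarrow> \<exists>x\<in>cl Y. N (f - x) < e"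
  shows "f \<in> cl Y"
  unfolding cl_def
proof (intro CollectI conjI f allI impI)
  fix e :: real assume "e > 0"
  then have e2: "e / 2 > 0" by simp
  obtain x where x: "x \<in> cl Y" "N (f - x) < e / 2" using ap[OF e2] by blast
  obtain y where y: "y \<in> Y" "N (x - y) < e / 2" using clD(2)[OF x(1) e2] by blast
  have "N (f - y) \<le> N (f - x) + N (x - y)" using f x(1) y(1) Y clD(1) by (intro norm_triangle) auto
  then show "\<exists>y\<in>Y. N (f - y) < e" using x y by (intro bexI[of _ y]) auto
qed

lemma cl_trans: "X \<subseteq> cl Y \<Longrightarrow> Y \<subseteq> V \<Longrightarrow> cl X \<subseteq> cl Y"
proof
  fix f assume X: "X \<subseteq> cl Y" and Y: "Y \<subseteq> V" and f: "f \<in> cl X"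
  show "f \<in> cl Y"
    by (rule cl_approx[OF clD(1)[OF f] Y]) (use clD(2)[OF f] X in blast)
qed

lemma closedin_cl:
  assumes "X \<subseteq> V"
  shows "closedin metric.mtopology (cl X)"
  unfolding closedin_iff
proof (intro conjI allI impI cl_subset_V)
  fix f :: "nat \<Rightarrow> 'a \<Rightarrow> complex" and g
  assume f: "\<forall>n. f n \<in> cl X" and g: "g \<in> V" and lim: "(\<lambda>n. N (f n - g)) \<longlonglongrightarrow> 0"
  show "g \<in> cl X"
  proof (rule cl_approx[OF g assms])
    fix e :: real assume "e > 0"
    then have "\<forall>\<^sub>F n in sequentially. N (f n - g) < e" using lim by (intro order_tendstoD) auto
    then obtain n where "N (f n - g) < e" by (auto simp: eventually_sequentially)
    then show "\<exists>x\<in>cl X. N (g - x) < e" using f norm_commute[of g "f n"] by (intro bexI[of _ "f n"]) auto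
  qed
qed

lemma cl_closedin:
  assumes S: "closedin metric.mtopology S"
  shows "cl S = S"
proof
  have SV: "S \<subseteq> V" using S by (simp add: closedin_iff)
  then show "S \<subseteq> cl S" by (rule subset_cl)
  show "cl S \<subseteq> S"
  proof
    fix f assume f: "f \<in> cl S"
    have "\<exists>x. x \<in> S \<and> N (f - x) < 1 / real (Suc n)" for n using clD(2)[OF f, of "1 / real (Suc n)"] by auto
    then obtain x where x: "\<And>n. x n \<in> S" "\<And>n. N (f - x n) < 1 / real (Suc n)" by metis
    have "(\<lambda>n. N (x n - f)) \<longlonglongrightarrow> 0"
    proof (rule tendsto_sandwich[of "\<lambda>_. 0"])
      show "(\<lambda>n. 1 / real (Suc n)) \<longlonglongrightarrow> 0" using LIMSEQ_inverse_real_of_nat by (simp add: inverse_eq_divide)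
      show "\<forall>\<^sub>F n in sequentially. N (x n - f) \<le> 1 / real (Suc n)"
        using x(2) by (intro always_eventually allI) (metis less_imp_le norm_commute)
    qed auto
    then show "f \<in> S" using S x(1) clD(1)[OF f] unfolding closedin_iff by blast
  qed
qed

lemma subspace_cl:
  assumes X: "cfun.subspace X" "X \<subseteq> V"
  shows "cfun.subspace (cl X)"
proof (rule cfun.subspaceI)
  show "0 \<in> cl X" using subset_cl[OF X(2)] cfun.subspace_0[OF X(1)] by blast
  show "f + g \<in> cl X" if fg: "f \<in> cl X" "g \<in> cl X" for f g
    unfolding cl_def
  proof (intro CollectI conjI allI impI add_mem clD(1)[OF fg(1)] clD(1)[OF fg(2)])
    fix e :: real assume "e > 0"
    then have e2: "e / 2 > 0" by simp
    obtain x y where x: "x \<in> X" "N (f - x) < e / 2" and y: "y \<in> X" "N (g - y) < e / 2"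
      using clD(2)[OF fg(1) e2] clD(2)[OF fg(2) e2] by blast
    have "N ((f + g) - (x + y)) = N ((f - x) + (g - y))" by (simp add: algebra_simps)
    also have "\<dots> \<le> N (f - x) + N (g - y)" using x y X(2) clD(1)[OF fg(1)] clD(1)[OF fg(2)] by (intro norm_add diff_mem) auto
    finally show "\<exists>z\<in>X. N ((f + g) - z) < e" using x y cfun.subspace_add[OF X(1) x(1) y(1)] by (intro bexI[of _ "x + y"]) auto
  qed
  show "scale_fun c f \<in> cl X" if f: "f \<in> cl X" for c f
    unfolding cl_def
  proof (intro CollectI conjI allI impI scale_mem clD(1)[OF f])
    fix e :: real assume e: "e > 0"
    have pos: "cmod c + 1 > 0" by (simp add: add_nonneg_pos)
    then have "e / (cmod c + 1) > 0" using e by simp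
    from clD(2)[OF f this] obtain x where x: "x \<in> X" "N (f - x) < e / (cmod c + 1)" by blast
    have "scale_fun c f - scale_fun c x = scale_fun c (f - x)" by (simp add: scale_fun_def fun_eq_iff algebra_simps)
    then have "N (scale_fun c f - scale_fun c x) = cmod c * N (f - x)"
      using norm_scale[OF diff_mem[OF clD(1)[OF f]], of x c] x X(2) by auto
    also have "\<dots> \<le> (cmod c + 1) * N (f - x)" by (intro mult_right_mono) auto
    also have "\<dots> < (cmod c + 1) * (e / (cmod c + 1))" using x pos by (intro mult_strict_left_mono) auto
    finally show "\<exists>z\<in>X. N (scale_fun c f - z) < e"
      using pos cfun.subspace_scale[OF X(1) x(1), of c] by (intro bexI[of _ "scale_fun c x"]) auto
  qed
qed

lemma cl_image:
  assumes lip: "\<And>f g. f \<in> V \<Longrightarrow> g \<in> V \<Longrightarrow> N (M f - M g) \<le> C * N (f - g)" and M: "\<And>f. f \<in> V \<Longrightarrow> M f \<in> V"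
    and XY: "\<And>x. x \<in> X \<Longrightarrow> M x \<in> Y" and X: "X \<subseteq> V" and f: "f \<in> cl X"
  shows "M f \<in> cl Y"
  unfolding cl_def
proof (intro CollectI conjI allI impI M clD(1)[OF f])
  fix e :: real assume e: "e > 0"
  have pos: "\<bar>C\<bar> + 1 > 0" by simp
  then have "e / (\<bar>C\<bar> + 1) > 0" using e by simp
  from clD(2)[OF f this] obtain x where x: "x \<in> X" "N (f - x) < e / (\<bar>C\<bar> + 1)" by blast
  have "N (M f - M x) \<le> C * N (f - x)" using x X clD(1)[OF f] by (intro lip) auto
  also have "\<dots> \<le> (\<bar>C\<bar> + 1) * N (f - x)" by (intro mult_right_mono) auto
  also have "\<dots> < (\<bar>C\<bar> + 1) * (e / (\<bar>C\<bar> + 1))" using x pos by (intro mult_strict_left_mono) auto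
  finally show "\<exists>y\<in>Y. N (M f - y) < e" using pos XY[OF x(1)] by (intro bexI[of _ "M x"]) auto
qed

text \<open>If b is not in Z, it has a positive distance \<delta> from Z, so the coefficient c is
  controlled by the norm. Along a convergent sequence the coefficients are Cauchy, and the
  components in Z converge as well.\<close>

lemma closedin_add_line:
  assumes Z: "closedin metric.mtopology Z" "cfun.subspace Z" and b: "b \<in> V"
  shows "closedin metric.mtopology {f \<in> V. \<exists>c. f - scale_fun c b \<in> Z}" (is "closedin _ ?S")
proof (cases "b \<in> Z")
  case True
  have ZV: "Z \<subseteq> V" using Z(1) by (simp add: closedin_iff)
  have "?S = Z"
  proof (intro equalityI subsetI)
    fix f assume "f \<in> ?S"
    then obtain c where "f - scale_fun c b \<in> Z" by blast
    from cfun.subspace_add[OF Z(2) this cfun.subspace_scale[OF Z(2) True, of c]] show "f \<in> Z" by simp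
  next
    fix f assume "f \<in> Z"
    then show "f \<in> ?S" using ZV by (auto intro!: exI[of _ 0] simp: scale_fun_def fun_diff_def)
  qed
  then show ?thesis using Z(1) by simp
next
  case False
  have ZV: "Z \<subseteq> V" using Z(1) by (simp add: closedin_iff)
  have "b \<notin> cl Z" using False cl_closedin[OF Z(1)] by simp
  then obtain \<delta> where \<delta>: "\<delta> > 0" "\<And>z. z \<in> Z \<Longrightarrow> \<delta> \<le> N (b - z)" using b unfolding cl_def by force
  have low: "cmod c * \<delta> \<le> N (z + scale_fun c b)" if z: "z \<in> Z" for c z
  proof (cases "c = 0")
    case False
    have "z + scale_fun c b = scale_fun c (b - scale_fun (- 1 / c) z)"
      using False by (simp add: scale_fun_def fun_eq_iff algebra_simps)
    then have "N (z + scale_fun c b) = cmod c * N (b - scale_fun (- 1 / c) z)"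
      using norm_scale[OF diff_mem[OF b scale_mem[OF subsetD[OF ZV z]]], of c "- 1 / c"] by (simp only:)
    then show ?thesis using \<delta>(2)[OF cfun.subspace_scale[OF Z(2) z, of "- 1 / c"]] by (simp add: mult_left_mono)
  qed simp
  show ?thesis
    unfolding closedin_iff
  proof (intro conjI allI impI)
    show "?S \<subseteq> V" by blast
    fix f :: "nat \<Rightarrow> 'a \<Rightarrow> complex" and g
    assume f: "\<forall>n. f n \<in> ?S" and g: "g \<in> V" and lim: "(\<lambda>n. N (f n - g)) \<longlonglongrightarrow> 0"
    from f obtain c where c: "\<And>n. f n - scale_fun (c n) b \<in> Z" by (simp, metis)
    have fV: "f n \<in> V" for n using f by blast
    have step: "cmod (c m - c n) * \<delta> \<le> N (f m - f n)" for m n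
    proof -
      have "f m - f n = ((f m - scale_fun (c m) b) - (f n - scale_fun (c n) b)) + scale_fun (c m - c n) b"
        by (simp add: scale_fun_def fun_eq_iff algebra_simps)
      then show ?thesis using low[OF cfun.subspace_diff[OF Z(2) c[of m] c[of n]], of "c m - c n"] by (simp only:)
    qed
    have "Cauchy c"
    proof (rule metric_CauchyI)
      fix e :: real assume e: "e > 0"
      then have "e * \<delta> / 2 > 0" using \<delta> by simp
      then have "\<forall>\<^sub>F n in sequentially. N (f n - g) < e * \<delta> / 2" using lim by (intro order_tendstoD) auto
      then obtain M where M: "\<And>n. n \<ge> M \<Longrightarrow> N (f n - g) < e * \<delta> / 2" by (auto simp: eventually_sequentially)
      have "dist (c m) (c n) < e" if "m \<ge> M" "n \<ge> M" for m n
      proof -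
        have "cmod (c m - c n) * \<delta> \<le> N (f m - g) + N (f n - g)"
          using step[of m n] norm_triangle[OF fV[of m] g fV[of n]] norm_commute[of g "f n"] by simp
        also have "\<dots> < e * \<delta>" using M[OF that(1)] M[OF that(2)] by simp
        finally show ?thesis using \<delta> by (simp add: dist_norm)
      qed
      then show "\<exists>M. \<forall>m\<ge>M. \<forall>n\<ge>M. dist (c m) (c n) < e" by blast
    qed
    then obtain c0 where c0: "c \<longlonglongrightarrow> c0" by (auto simp: Cauchy_convergent_iff convergent_def)
    have "(\<lambda>n. N ((f n - scale_fun (c n) b) - (g - scale_fun c0 b))) \<longlonglongrightarrow> 0"
    proof (rule tendsto_sandwich[of "\<lambda>_. 0"])
      have "(\<lambda>n. cmod (c n - c0)) \<longlonglongrightarrow> 0" using c0 by (simp add: LIM_zero tendsto_norm_zero)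
      from tendsto_add[OF lim tendsto_mult_left_zero[OF this, of "N b"]]
      show "(\<lambda>n. N (f n - g) + cmod (c n - c0) * N b) \<longlonglongrightarrow> 0" by (simp only: add_0_left)
      have "N ((f n - scale_fun (c n) b) - (g - scale_fun c0 b)) \<le> N (f n - g) + cmod (c n - c0) * N b" for n
      proof -
        have "(f n - scale_fun (c n) b) - (g - scale_fun c0 b) = (f n - g) - scale_fun (c n - c0) b"
          by (simp add: scale_fun_def fun_eq_iff algebra_simps)
        then show ?thesis
          using norm_diff[OF diff_mem[OF fV[of n] g] scale_mem[OF b, of "c n - c0"]] norm_scale[OF b, of "c n - c0"] by (simp only:)
      qed
      then show "\<forall>\<^sub>F n in sequentially. N ((f n - scale_fun (c n) b) - (g - scale_fun c0 b)) \<le> N (f n - g) + cmod (c n - c0) * N b"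
        by (intro always_eventually allI)
    qed auto
    moreover have "\<forall>n. f n - scale_fun (c n) b \<in> Z" using c by blast
    moreover have "g - scale_fun c0 b \<in> V" by (intro diff_mem g scale_mem b)
    ultimately have "g - scale_fun c0 b \<in> Z"
      using Z(1)[unfolded closedin_iff, THEN conjunct2, rule_format, of "\<lambda>n. f n - scale_fun (c n) b"] by blast
    then show "g \<in> ?S" using g by blast
  qed
qed

text \<open>One line is added at a time. This later turns a decomposition known for polynomials,
  which are dense, into a decomposition of every element.\<close>

lemma closedin_add_span:
  assumes "finite B" "B \<subseteq> V" and Z: "closedin metric.mtopology Z" "cfun.subspace Z"
  shows "closedin metric.mtopology {f \<in> V. \<exists>s\<in>cfun.span B. f - s \<in> Z}"
  using assms(1,2)
proof (induction B)
  case empty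
  have "Z \<subseteq> V" using Z(1) by (simp add: closedin_iff)
  then have "{f \<in> V. \<exists>s\<in>cfun.span {}. f - s \<in> Z} = Z" by auto
  then show ?case using Z(1) by (simp only:)
next
  case (insert b B)
  define Y where "Y = {f \<in> V. \<exists>s\<in>cfun.span B. f - s \<in> Z}"
  have BV: "cfun.span B \<subseteq> V" using insert.prems by (intro cfun.span_minimal subspace_V) auto
  have Y: "closedin metric.mtopology Y" unfolding Y_def by (rule insert.IH) (use insert.prems in blast)
  have "cfun.subspace Y"
  proof (rule cfun.subspaceI)
    show "0 \<in> Y" unfolding Y_def using zero_mem cfun.subspace_0[OF Z(2)] cfun.span_zero[of B] by (auto intro!: bexI[of _ 0])
    show "f + g \<in> Y" if fg: "f \<in> Y" "g \<in> Y" for f g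
    proof -
      obtain s t where s: "s \<in> cfun.span B" "f - s \<in> Z" and t: "t \<in> cfun.span B" "g - t \<in> Z" using fg by (auto simp: Y_def)
      have "(f + g) - (s + t) = (f - s) + (g - t)" by simp
      also have "\<dots> \<in> Z" by (rule cfun.subspace_add[OF Z(2) s(2) t(2)])
      finally show ?thesis using fg add_mem cfun.span_add[OF s(1) t(1)] by (auto simp: Y_def)
    qed
    show "scale_fun c f \<in> Y" if f: "f \<in> Y" for c f
    proof -
      obtain s where s: "s \<in> cfun.span B" "f - s \<in> Z" using f by (auto simp: Y_def)
      have "scale_fun c f - scale_fun c s = scale_fun c (f - s)" by (simp add: scale_fun_def fun_eq_iff algebra_simps)
      also have "\<dots> \<in> Z" by (rule cfun.subspace_scale[OF Z(2) s(2)])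
      finally show ?thesis using f scale_mem cfun.span_scale[OF s(1), of c] by (auto simp: Y_def)
    qed
  qed
  from closedin_add_line[OF Y this, of b]
  have "closedin metric.mtopology {f \<in> V. \<exists>c. f - scale_fun c b \<in> Y}" using insert.prems by simp
  also have "{f \<in> V. \<exists>c. f - scale_fun c b \<in> Y} = {f \<in> V. \<exists>s\<in>cfun.span (insert b B). f - s \<in> Z}"
  proof (intro Collect_cong conj_cong refl iffI)
    fix f assume "\<exists>c. f - scale_fun c b \<in> Y"
    then obtain c s where s: "s \<in> cfun.span B" "f - scale_fun c b - s \<in> Z" by (auto simp: Y_def)
    have "scale_fun c b + s \<in> cfun.span (insert b B)"
      using s(1) cfun.span_mono[of B "insert b B"] by (intro cfun.span_add cfun.span_scale) (auto intro: cfun.span_base)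
    moreover have "f - (scale_fun c b + s) \<in> Z" using s(2) by (simp add: algebra_simps)
    ultimately show "\<exists>s\<in>cfun.span (insert b B). f - s \<in> Z" by blast
  next
    fix f assume f: "f \<in> V" "\<exists>s\<in>cfun.span (insert b B). f - s \<in> Z"
    then obtain s where s: "s \<in> cfun.span (insert b B)" "f - s \<in> Z" by blast
    from s(1) obtain c where c: "s - scale_fun c b \<in> cfun.span B" by (auto simp: cfun.span_insert)
    have "(f - scale_fun c b) - (s - scale_fun c b) \<in> Z" using s(2) by simp
    moreover have "f - scale_fun c b \<in> V" using f(1) insert.prems by (intro diff_mem scale_mem) auto
    ultimately have "f - scale_fun c b \<in> Y" unfolding Y_def using c by blast
    then show "\<exists>c. f - scale_fun c b \<in> Y" ..
  qed
  finally show ?case .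
qed

end

section \<open>Polynomials annihilating finite dimensional quotients\<close>

lemma sum_fun_apply: "(\<Sum>i\<in>A. f i) x = (\<Sum>i\<in>A. f i x)" for f :: "'i \<Rightarrow> 'a \<Rightarrow> complex"
  by (induction A rule: infinite_finite_induct) auto

lemma poly_mult_mem:
  fixes a :: "'a \<Rightarrow> complex"
  assumes U: "cfun.subspace U" and a: "\<And>u. u \<in> U \<Longrightarrow> (\<lambda>x. a x * u x) \<in> U" and u: "u \<in> U"
  shows "(\<lambda>x. poly p (a x) * u x) \<in> U"
proof (induction p)
  case 0
  then show ?case using cfun.subspace_0[OF U] by (simp add: zero_fun_def)
next
  case (pCons c p)
  have "(\<lambda>x. poly (pCons c p) (a x) * u x) = scale_fun c u + (\<lambda>x. a x * (poly p (a x) * u x))"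
    by (simp add: fun_eq_iff scale_fun_def algebra_simps)
  also have "\<dots> \<in> U" by (intro cfun.subspace_add[OF U] cfun.subspace_scale[OF U] u a pCons.IH)
  finally show ?case .
qed

text \<open>With m = card B, the m + 1 elements a^j b, j \<le> m, reduce modulo U to vectors in the
  span of B and are therefore linearly dependent there. The coefficients of a dependence are those
  of p.\<close>

lemma annihilating_polynomial_vector:
  fixes a :: "'a \<Rightarrow> complex"
  assumes U: "cfun.subspace U" and B: "finite B"
    and dec: "\<And>v. v \<in> V \<Longrightarrow> \<exists>u\<in>U. v - u \<in> cfun.span B"
    and aV: "\<And>v. v \<in> V \<Longrightarrow> (\<lambda>x. a x * v x) \<in> V" and b: "b \<in> V"
  shows "\<exists>p. p \<noteq> 0 \<and> (\<lambda>x. poly p (a x) * b x) \<in> U"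
proof -
  define y where "y j = (\<lambda>x. a x ^ j * b x)" for j :: nat
  have yV: "y j \<in> V" for j
  proof (induction j)
    case (Suc j)
    from aV[OF Suc] show ?case by (simp add: y_def mult.assoc)
  qed (simp add: y_def b)
  obtain u where u: "\<And>j. u j \<in> U" "\<And>j. y j - u j \<in> cfun.span B" using dec[OF yV] by metis
  define s where "s j = y j - u j" for j
  define m where "m = card B"
  \<comment> \<open>Dependence of a set does not see repetitions. If two of the reduced vectors
    coincide, their difference is the dependence.\<close>
  have "\<exists>c. (\<exists>j\<le>m. c j \<noteq> 0) \<and> (\<Sum>j\<le>m. scale_fun (c j) (s j)) = 0"
  proof (cases "inj_on s {..m}")
    case True
    have "cfun.dependent (s ` {..m})"
    proof (rule ccontr)
      assume "\<not> cfun.dependent (s ` {..m})"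
      then have "card (s ` {..m}) \<le> card B"
        using cfun.independent_span_bound[OF B, of "s ` {..m}"] u(2) by (auto simp: s_def)
      then show False using card_image[OF True] by (simp add: m_def)
    qed
    then obtain d where d: "\<exists>v\<in>s ` {..m}. d v \<noteq> 0" "(\<Sum>v\<in>s ` {..m}. scale_fun (d v) v) = 0"
      using cfun.dependent_finite[of "s ` {..m}"] by auto
    have "(\<Sum>j\<le>m. scale_fun (d (s j)) (s j)) = 0" using d(2) by (simp add: sum.reindex[OF True])
    then show ?thesis using d(1) by (intro exI[of _ "\<lambda>j. d (s j)"]) auto
  next
    case False
    then obtain i j where ij: "i \<le> m" "j \<le> m" "i \<noteq> j" "s i = s j" by (auto simp: inj_on_def)
    define c where "c l = (if l = i then 1 else if l = j then -1 else 0 :: complex)" for l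
    have "(\<Sum>l\<le>m. scale_fun (c l) (s l)) = (\<Sum>l\<in>{i, j}. scale_fun (c l) (s l))"
      using ij by (intro sum.mono_neutral_right) (auto simp: c_def scale_fun_def zero_fun_def)
    also have "\<dots> = 0" using ij by (simp add: c_def scale_fun_def fun_eq_iff)
    finally show ?thesis using ij by (intro exI[of _ c]) (auto simp: c_def)
  qed
  then obtain c where c: "\<exists>j\<le>m. c j \<noteq> 0" "(\<Sum>j\<le>m. scale_fun (c j) (s j)) = 0" by blast
  define p where "p = (\<Sum>j\<le>m. monom (c j) j)"
  obtain j where j: "j \<le> m" "c j \<noteq> 0" using c(1) by blast
  have "coeff p j = c j" using j by (simp add: p_def coeff_sum)
  then have "p \<noteq> 0" using j by auto
  moreover have "(\<lambda>x. poly p (a x) * b x) = (\<Sum>j\<le>m. scale_fun (c j) (u j))"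
  proof
    fix x
    have "(\<Sum>j\<le>m. c j * s j x) = 0" using fun_cong[OF c(2), of x] by (simp add: sum_fun_apply scale_fun_def)
    then have "(\<Sum>j\<le>m. c j * y j x) = (\<Sum>j\<le>m. c j * u j x)"
      by (simp add: s_def right_diff_distrib sum_subtractf)
    then show "poly p (a x) * b x = (\<Sum>j\<le>m. scale_fun (c j) (u j)) x"
      by (simp add: p_def poly_sum poly_monom sum_fun_apply scale_fun_def y_def sum_distrib_right mult.assoc)
  qed
  moreover have "(\<Sum>j\<le>m. scale_fun (c j) (u j)) \<in> U"
    using u(1) by (intro cfun.subspace_sum[OF U] cfun.subspace_scale[OF U])
  ultimately show ?thesis by auto
qed

text \<open>The product of the polynomials belonging to the elements of B works for all of them at
  once, since U is invariant under the remaining factors.\<close>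

lemma annihilating_polynomial:
  fixes a :: "'a \<Rightarrow> complex"
  assumes U: "cfun.subspace U" and B: "finite B" "B \<subseteq> V"
    and dec: "\<And>v. v \<in> V \<Longrightarrow> \<exists>u\<in>U. v - u \<in> cfun.span B"
    and aV: "\<And>v. v \<in> V \<Longrightarrow> (\<lambda>x. a x * v x) \<in> V" and aU: "\<And>u. u \<in> U \<Longrightarrow> (\<lambda>x. a x * u x) \<in> U"
  shows "\<exists>p. p \<noteq> 0 \<and> (\<forall>v\<in>V. (\<lambda>x. poly p (a x) * v x) \<in> U)"
proof -
  have "\<forall>b\<in>B. \<exists>p. p \<noteq> 0 \<and> (\<lambda>x. poly p (a x) * b x) \<in> U"
    using annihilating_polynomial_vector[OF U B(1) dec aV] B(2) by blast
  then obtain P where P: "\<And>b. b \<in> B \<Longrightarrow> P b \<noteq> 0" "\<And>b. b \<in> B \<Longrightarrow> (\<lambda>x. poly (P b) (a x) * b x) \<in> U" by metis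
  define p where "p = (\<Prod>b\<in>B. P b)"
  have pB: "(\<lambda>x. poly p (a x) * b x) \<in> U" if b: "b \<in> B" for b
  proof -
    have "p = (\<Prod>b\<in>B - {b}. P b) * P b" using B(1) b by (simp add: p_def prod.remove mult.commute)
    then have "(\<lambda>x. poly p (a x) * b x) = (\<lambda>x. poly (\<Prod>b\<in>B - {b}. P b) (a x) * (poly (P b) (a x) * b x))"
      by (simp add: mult.assoc)
    then show ?thesis using poly_mult_mem[OF U aU P(2)[OF b]] by simp
  qed
  have pspan: "(\<lambda>x. poly p (a x) * s x) \<in> U" if "s \<in> cfun.span B" for s
    using that
  proof (induction rule: cfun.span_induct_alt)
    case base
    then show ?case using cfun.subspace_0[OF U] by (simp add: zero_fun_def)
  next
    case (step c x y)
    have "(\<lambda>z. poly p (a z) * (scale_fun c x + y) z) = scale_fun c (\<lambda>z. poly p (a z) * x z) + (\<lambda>z. poly p (a z) * y z)"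
      by (simp add: fun_eq_iff scale_fun_def algebra_simps)
    also have "\<dots> \<in> U" by (intro cfun.subspace_add[OF U] cfun.subspace_scale[OF U] pB step)
    finally show ?case .
  qed
  have "(\<lambda>x. poly p (a x) * v x) \<in> U" if v: "v \<in> V" for v
  proof -
    obtain u where u: "u \<in> U" "v - u \<in> cfun.span B" using dec[OF v] by blast
    have "(\<lambda>x. poly p (a x) * v x) = (\<lambda>x. poly p (a x) * u x) + (\<lambda>x. poly p (a x) * (v - u) x)"
      by (simp add: fun_eq_iff algebra_simps)
    also have "\<dots> \<in> U" by (intro cfun.subspace_add[OF U] poly_mult_mem[OF U aU u(1)] pspan u(2))
    finally show ?thesis .
  qed
  moreover have "p \<noteq> 0" using P(1) B(1) by (simp add: p_def)
  ultimately show ?thesis by blast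
qed

section \<open>Rational functions with a pole near a boundary point\<close>

lemma bounded_holomorphic_sqnorm:
  fixes g :: "complex ^ 'n \<Rightarrow> complex"
  assumes g: "g \<in> holomorphic_ball" and A: "\<And>z. norm z < 1 \<Longrightarrow> cmod (g z) \<le> A"
  shows "summable (\<lambda>k. sqnorm (homogeneous_expansion g k))"
    and "(\<Sum>k. sqnorm (homogeneous_expansion g k)) \<le> A\<^sup>2"
proof -
  have le: "hardy_mean g r \<le> A\<^sup>2" if r: "0 < r" "r < 1" for r
  proof -
    have c: "continuous_on (ball 0 1) g" using g by (simp add: holomorphic_ball_iff line_holo_def)
    have "continuous_on (sphere 0 1) (\<lambda>\<zeta>. g (r *\<^sub>R \<zeta>))"
      by (rule continuous_on_compose2[OF c]) (use r in \<open>auto intro!: continuous_intros\<close>)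
    then have "sqnorm (\<lambda>\<zeta>. g (r *\<^sub>R \<zeta>)) \<le> A\<^sup>2" by (rule sqnorm_le) (use r in \<open>auto intro!: A\<close>)
    then show ?thesis by (simp add: hardy_mean_def sqnorm_def)
  qed
  have sums: "(\<lambda>k. r ^ (2 * k) * sqnorm (homogeneous_expansion g k)) sums hardy_mean g r" if "0 < r" "r < 1" for r
    by (rule hardy_mean_sums[OF g that])
  have bdd: "bdd_above (hardy_mean g ` {0<..<1})"
    using le by (intro bdd_aboveI[of _ "A\<^sup>2"]) auto
  then show s: "summable (\<lambda>k. sqnorm (homogeneous_expansion g k))"
    using power_series_sup(1)[OF sqnorm_nonneg sums] by blast
  have "(SUP r\<in>{0<..<1}. hardy_mean g r) \<le> A\<^sup>2"
  proof (rule cSUP_least)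
    show "{0<..<1::real} \<noteq> {}" by simp
    show "hardy_mean g r \<le> A\<^sup>2" if "r \<in> {0<..<1}" for r using le that by simp
  qed
  then show "(\<Sum>k. sqnorm (homogeneous_expansion g k)) \<le> A\<^sup>2"
    using power_series_sup(2)[OF sqnorm_nonneg sums s] by simp
qed

lemma iterated_radial_power:
  fixes f :: "complex ^ 'n \<Rightarrow> complex"
  assumes f: "f \<in> holomorphic_ball"
  shows "(radial_power 1 ^^ D) f \<in> holomorphic_ball"
    and "k > 0 \<Longrightarrow> sqnorm (homogeneous_expansion ((radial_power 1 ^^ D) f) k) = weight 1 k ^ D * sqnorm (homogeneous_expansion f k)"
proof -
  show h: "(radial_power 1 ^^ D) f \<in> holomorphic_ball" for D
    by (induction D) (auto simp: f intro: radial_power_holomorphic(1))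
  show "sqnorm (homogeneous_expansion ((radial_power 1 ^^ D) f) k) = weight 1 k ^ D * sqnorm (homogeneous_expansion f k)"
    if "k > 0"
    using that by (induction D) (simp_all add: sqnorm_radial_power[OF h])
qed

text \<open>In positive degree k the weight k^(2 \<beta>) is at most k^(2 D), so the D-th radial
  derivative dominates. The constant term can be lost in it and is bounded separately through f,
  which accounts for the factor 2.\<close>

lemma hardy_sobolev_norm_le_sup:
  fixes f :: "complex ^ 'n \<Rightarrow> complex"
  assumes f: "f \<in> holomorphic_ball" and \<beta>: "\<beta> \<le> real D"
    and A: "\<And>z. norm z < 1 \<Longrightarrow> cmod (f z) \<le> A" "\<And>z. norm z < 1 \<Longrightarrow> cmod ((radial_power 1 ^^ D) f z) \<le> A"
  shows "f \<in> hardy_sobolev_space \<beta>" and "hardy_sobolev_norm \<beta> f \<le> 2 * A"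
proof -
  define g where "g = (radial_power 1 ^^ D) f"
  have g: "g \<in> holomorphic_ball" unfolding g_def by (rule iterated_radial_power(1)[OF f])
  have A0: "A \<ge> 0" by (rule order_trans[OF norm_ge_zero A(1)[of 0]]) simp
  note s = bounded_holomorphic_sqnorm[OF g A(2)[folded g_def]]
  have f0: "sqnorm (homogeneous_expansion f 0) \<le> A\<^sup>2"
  proof -
    have "homogeneous_expansion f 0 = (\<lambda>z. f 0)" using homogeneous_expansion_0[OF f] by (simp add: fun_eq_iff)
    then show ?thesis using A(1)[of 0] by (simp add: sqnorm_const power_mono)
  qed
  have le: "weight \<beta> k * sqnorm (homogeneous_expansion f k)
      \<le> sqnorm (homogeneous_expansion g k) + (if k = 0 then A\<^sup>2 else 0)" for k
  proof (cases "k = 0")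
    case True
    then show ?thesis using add_increasing[OF sqnorm_nonneg[of "homogeneous_expansion g 0"] f0] by (simp add: weight_def)
  next
    case False
    have "weight \<beta> k \<le> real k powr (2 * real D)" using False \<beta> by (simp add: weight_def powr_mono)
    also have "\<dots> = (real k powr 2) powr real D" by (rule powr_powr[symmetric])
    also have "\<dots> = (real k powr 2) ^ D" using False by (intro powr_realpow) simp
    also have "\<dots> = weight 1 k ^ D" using False by (simp only: weight_def if_False mult_1_right)
    finally have "weight \<beta> k \<le> weight 1 k ^ D" .
    then show ?thesis
      using False iterated_radial_power(2)[OF f, of k D] by (simp add: g_def mult_right_mono)
  qed
  have s0: "(\<lambda>k. if k = 0 then A\<^sup>2 else 0) sums A\<^sup>2" using sums_single[of 0 "\<lambda>_. A\<^sup>2"] by simp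
  have s1: "summable (\<lambda>k. sqnorm (homogeneous_expansion g k) + (if k = 0 then A\<^sup>2 else 0))"
    by (rule summable_add[OF s(1) sums_summable[OF s0]])
  have sm: "summable (\<lambda>k. weight \<beta> k * sqnorm (homogeneous_expansion f k))"
    by (rule summable_comparison_test'[OF s1, of 0]) (use le in simp)
  then show fm: "f \<in> hardy_sobolev_space \<beta>" using f by (simp add: hardy_sobolev_space_iff)
  have "(hardy_sobolev_norm \<beta> f)\<^sup>2 = (\<Sum>k. weight \<beta> k * sqnorm (homogeneous_expansion f k))"
    by (rule sums_unique[OF hardy_sobolev_norm_sums[OF fm]])
  also have "\<dots> \<le> (\<Sum>k. sqnorm (homogeneous_expansion g k) + (if k = 0 then A\<^sup>2 else 0))"
    by (rule suminf_le[OF le sm s1])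
  also have "\<dots> = (\<Sum>k. sqnorm (homogeneous_expansion g k)) + A\<^sup>2"
    using suminf_add[OF s(1) sums_summable[OF s0]] sums_unique[OF s0] by simp
  also have "\<dots> \<le> A\<^sup>2 + A\<^sup>2" using s(2) by simp
  also have "\<dots> \<le> (2 * A)\<^sup>2" by (simp add: power2_eq_square)
  finally show "hardy_sobolev_norm \<beta> f \<le> 2 * A" by (rule power2_le_imp_le) (use A0 in simp)
qed

section \<open>The function chi at a boundary point, called \<open>gap\<close>\<close>

definition gap :: "complex ^ 'n \<Rightarrow> complex ^ 'n \<Rightarrow> complex" where
  "gap \<zeta> z = 1 - (\<Sum>i\<in>UNIV. z $ i * cnj (\<zeta> $ i))"

lemma polys_gap: "gap \<zeta> \<in> polys"
proof -
  have "(\<lambda>z. 1 + (\<Sum>i\<in>UNIV. (- cnj (\<zeta> $ i)) * z $ i)) \<in> polys"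
    by (intro polys_add polys_const polys_sum polys_scale polys_nth)
  also have "(\<lambda>z. 1 + (\<Sum>i\<in>UNIV. (- cnj (\<zeta> $ i)) * z $ i)) = gap \<zeta>"
    by (simp add: gap_def fun_eq_iff sum_negf mult.commute)
  finally show ?thesis .
qed

lemma gap_smult: "gap \<zeta> (t *s z) = 1 + t * (gap \<zeta> z - 1)"
  by (simp add: gap_def sum_distrib_left mult.assoc)

lemma gap_self: "norm \<zeta> = 1 \<Longrightarrow> gap \<zeta> \<zeta> = 0"
proof -
  assume "norm \<zeta> = 1"
  then have "(\<Sum>i\<in>UNIV. (cmod (\<zeta> $ i))\<^sup>2) = 1" by (simp add: norm_vec_def L2_set_def)
  then have "(\<Sum>i\<in>UNIV. complex_of_real ((cmod (\<zeta> $ i))\<^sup>2)) = 1" by (metis of_real_1 of_real_sum)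
  then show ?thesis unfolding complex_norm_square by (simp add: gap_def)
qed

text \<open>Expanding the square gives |z|^2 + 1 - 2 Re <z, \<zeta>>, and |z| \<le> 1. A factor
  \<open>z $ i - \<zeta> $ i\<close> therefore counts as half a power of
  \<open>gap \<zeta> z\<close>.\<close>

lemma norm_diff_le_gap:
  fixes z :: "complex ^ 'n"
  assumes "norm \<zeta> = 1" "norm z < 1"
  shows "(norm (z - \<zeta>))\<^sup>2 \<le> 2 * Re (gap \<zeta> z)"
proof -
  have "Re (gap \<zeta> z) = 1 - inner z \<zeta>"
    by (simp add: gap_def inner_vec_def inner_complex_def)
  moreover have "(norm (z - \<zeta>))\<^sup>2 = (norm z)\<^sup>2 + (norm \<zeta>)\<^sup>2 - 2 * inner z \<zeta>"
    by (simp add: power2_norm_eq_inner inner_diff inner_commute)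
  moreover have "(norm z)\<^sup>2 \<le> 1" using assms(2) by (simp add: power_le_one)
  ultimately show ?thesis using assms(1) by simp
qed

lemma Re_gap_pos:
  fixes z :: "complex ^ 'n"
  assumes "norm \<zeta> = 1" "norm z < 1"
  shows "Re (gap \<zeta> z) > 0"
proof -
  have "z \<noteq> \<zeta>" using assms by auto
  then have "(norm (z - \<zeta>))\<^sup>2 > 0" by simp
  then show ?thesis using norm_diff_le_gap[OF assms] by linarith
qed

lemma gap_add_nonzero:
  fixes z :: "complex ^ 'n"
  assumes "norm \<zeta> = 1" "norm z < 1" "\<epsilon> > 0"
  shows "gap \<zeta> z + of_real \<epsilon> \<noteq> 0" "\<epsilon> \<le> cmod (gap \<zeta> z + of_real \<epsilon>)" "cmod (gap \<zeta> z) \<le> cmod (gap \<zeta> z + of_real \<epsilon>)"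
proof -
  note R = Re_gap_pos[OF assms(1,2)]
  have "\<epsilon> \<le> Re (gap \<zeta> z + of_real \<epsilon>)" using R by simp
  also have "\<dots> \<le> cmod (gap \<zeta> z + of_real \<epsilon>)" by (rule complex_Re_le_cmod)
  finally show e: "\<epsilon> \<le> cmod (gap \<zeta> z + of_real \<epsilon>)" .
  then show "gap \<zeta> z + of_real \<epsilon> \<noteq> 0" using assms(3) by auto
  have "(Re (gap \<zeta> z))\<^sup>2 \<le> (Re (gap \<zeta> z) + \<epsilon>)\<^sup>2" using R assms(3) by (intro power_mono) auto
  then show "cmod (gap \<zeta> z) \<le> cmod (gap \<zeta> z + of_real \<epsilon>)" by (simp add: cmod_def)
qed

lemma polys_bounded:
  fixes p :: "complex ^ 'n \<Rightarrow> complex"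
  assumes "p \<in> polys"
  obtains M where "M > 0" "\<And>z. norm z < 1 \<Longrightarrow> cmod (p z) \<le> M"
proof -
  have "bounded (p ` cball 0 1)"
    by (intro compact_imp_bounded compact_continuous_image polys_continuous[OF assms]) simp
  then obtain M where "M > 0" "\<And>z. z \<in> cball 0 1 \<Longrightarrow> cmod (p z) \<le> M" unfolding bounded_pos by blast
  then show thesis using that[of M] by simp
qed

lemma polys_radial_derivative:
  fixes p :: "complex ^ 'n \<Rightarrow> complex"
  assumes "p \<in> polys"
  shows "\<exists>q\<in>polys. \<forall>z. ((\<lambda>t. p (t *s z)) has_field_derivative q z) (at 1)"
  using assms
proof (induction rule: polys_induct)
  case zero
  show ?case by (intro bexI[of _ "\<lambda>z. 0"] polys_const allI) (auto intro!: derivative_eq_intros)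
next
  case (add c \<alpha> p)
  then obtain q where q: "q \<in> polys" "\<And>z. ((\<lambda>t. p (t *s z)) has_field_derivative q z) (at 1)" by blast
  have "((\<lambda>t. c * monomial \<alpha> (t *s z) + p (t *s z)) has_field_derivative
      (c * of_nat (\<Sum>i\<in>UNIV. \<alpha> i)) * monomial \<alpha> z + q z) (at 1)" for z
    unfolding monomial_smult by (auto intro!: derivative_eq_intros q(2))
  moreover have "(\<lambda>z. (c * of_nat (\<Sum>i\<in>UNIV. \<alpha> i)) * monomial \<alpha> z + q z) \<in> polys"
    by (intro polys_add polys_scale polys_monomial q(1))
  ultimately show ?case by (intro bexI) auto
qed

text \<open>
  Every radial derivative costs one power of \<open>gap \<zeta> z + \<epsilon>\<close>, and \<open>\<bar>z\<^sub>i - \<zeta>\<^sub>i\<bar>\<^sup>2\<close> is dominated by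
  \<open>\<bar>gap \<zeta> z\<bar>\<close>. The families in \<open>kernels \<zeta> i j\<close> are thus \<open>O(\<epsilon>)\<close>, uniformly on the ball, together
  with their radial derivatives up to order \<open>j\<close>.
\<close>

inductive kernels :: "complex ^ 'n \<Rightarrow> 'n \<Rightarrow> nat \<Rightarrow> (real \<Rightarrow> complex ^ 'n \<Rightarrow> complex) \<Rightarrow> bool"
  for \<zeta> i j where
  kernel: "p \<in> polys \<Longrightarrow> 2 * b + 2 * j \<le> c + 2 * a \<Longrightarrow> kernels \<zeta> i j (\<lambda>\<epsilon> z. of_real \<epsilon> * p z *
    (z $ i - \<zeta> $ i) ^ c * gap \<zeta> z ^ a * inverse (gap \<zeta> z + of_real \<epsilon>) ^ b)"
| add: "kernels \<zeta> i j F \<Longrightarrow> kernels \<zeta> i j G \<Longrightarrow> kernels \<zeta> i j (\<lambda>\<epsilon> z. F \<epsilon> z + G \<epsilon> z)"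

lemma kernels_line_holo:
  assumes "kernels \<zeta> i j F" "norm \<zeta> = 1" "\<epsilon> > 0"
  shows "line_holo (ball 0 1) (F \<epsilon>)"
  using assms(1)
proof induction
  case (kernel p b c a)
  have g: "line_holo (ball 0 1) (gap \<zeta>)" by (rule polys_line_holo[OF polys_gap])
  have "line_holo (ball 0 1) (\<lambda>z. 1 / (gap \<zeta> z + of_real \<epsilon>))"
    by (intro line_holo_divide line_holo_const line_holo_add g) (use gap_add_nonzero(1)[OF assms(2) _ assms(3)] in simp)
  then show ?case
    unfolding inverse_eq_divide
    by (intro line_holo_mult line_holo_power line_holo_const line_holo_diff line_holo_nth g polys_line_holo[OF kernel(1)])
next
  case (add F G)
  then show ?case by (intro line_holo_add)
qed

lemma kernels_bound:
  assumes "kernels \<zeta> i j F" "norm \<zeta> = 1"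
  shows "\<exists>C. \<forall>\<epsilon> z. 0 < \<epsilon> \<longrightarrow> \<epsilon> \<le> 1 \<longrightarrow> norm z < 1 \<longrightarrow> cmod (F \<epsilon> z) \<le> C * \<epsilon>"
  using assms(1)
proof induction
  case (kernel p b c a)
  obtain M where M: "M > 0" "\<And>z. norm z < 1 \<Longrightarrow> cmod (p z) \<le> M" using polys_bounded[OF kernel(1)] by blast
  obtain K where K: "K > 0" "\<And>z. norm z < 1 \<Longrightarrow> cmod (gap \<zeta> z) \<le> K" using polys_bounded[OF polys_gap] by blast
  define e where "e = c + 2 * a - 2 * b"
  have e: "c + 2 * a = e + 2 * b" using kernel(2) by (simp add: e_def)
  have "cmod (of_real \<epsilon> * p z * (z $ i - \<zeta> $ i) ^ c * gap \<zeta> z ^ a * inverse (gap \<zeta> z + of_real \<epsilon>) ^ b)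
      \<le> (M * sqrt (2 * (K + 1)) ^ e * 2 ^ b) * \<epsilon>" if \<epsilon>: "0 < \<epsilon>" "\<epsilon> \<le> 1" and z: "norm z < 1" for \<epsilon> z
  proof -
    define y where "y = cmod (gap \<zeta> z + of_real \<epsilon>)"
    \<comment> \<open>Everything is measured in \<tau>: the coordinate difference is at most \<tau>,
      the gap at most \<tau>^2, and each inverse factor equals 2 / \<tau>^2 in modulus. The total
      exponent e of \<tau> is nonnegative by the side condition of \<open>kernels\<close>, and
      \<tau> is bounded.\<close>
    define \<tau> where "\<tau> = sqrt (2 * y)"
    have y: "y > 0" "cmod (gap \<zeta> z) \<le> y" using gap_add_nonzero[OF assms(2) z \<epsilon>(1)] \<epsilon> by (auto simp: y_def)
    have "y \<le> cmod (gap \<zeta> z) + cmod (of_real \<epsilon>)" unfolding y_def by (rule norm_triangle_ineq)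
    then have yK: "y \<le> K + 1" using K(2)[OF z] \<epsilon> by simp
    have \<tau>: "\<tau> > 0" "\<tau>\<^sup>2 = 2 * y" "\<tau> \<le> sqrt (2 * (K + 1))" using y yK by (auto simp: \<tau>_def)
    have "cmod (z $ i - \<zeta> $ i) \<le> norm (z - \<zeta>)" using Finite_Cartesian_Product.norm_nth_le[of "z - \<zeta>" i] by simp
    then have "(cmod (z $ i - \<zeta> $ i))\<^sup>2 \<le> (norm (z - \<zeta>))\<^sup>2" by (intro power_mono) auto
    also have "\<dots> \<le> 2 * cmod (gap \<zeta> z)"
      using norm_diff_le_gap[OF assms(2) z] complex_Re_le_cmod[of "gap \<zeta> z"] by linarith
    also have "\<dots> \<le> \<tau>\<^sup>2" using y \<tau> by simp
    finally have s: "cmod (z $ i - \<zeta> $ i) \<le> \<tau>" by (rule power2_le_imp_le) (use \<tau>(1) in simp)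
    have g: "cmod (gap \<zeta> z) \<le> \<tau>\<^sup>2" using y \<tau>(2) by simp
    have u: "cmod (inverse (gap \<zeta> z + of_real \<epsilon>)) = 2 / \<tau>\<^sup>2" unfolding \<tau>(2) y_def by (simp only: norm_inverse) (simp add: field_simps)
    have "cmod (of_real \<epsilon> * p z * (z $ i - \<zeta> $ i) ^ c * gap \<zeta> z ^ a * inverse (gap \<zeta> z + of_real \<epsilon>) ^ b)
        = \<epsilon> * cmod (p z) * cmod (z $ i - \<zeta> $ i) ^ c * cmod (gap \<zeta> z) ^ a * (2 / \<tau>\<^sup>2) ^ b"
      using \<epsilon> by (simp only: norm_mult norm_power u norm_of_real abs_of_pos)
    also have "\<dots> \<le> \<epsilon> * M * \<tau> ^ c * (\<tau>\<^sup>2) ^ a * (2 / \<tau>\<^sup>2) ^ b"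
      using \<epsilon> M(1) M(2)[OF z] \<tau>(1) by (intro mult_mono power_mono s g) auto
    also have "\<dots> = \<epsilon> * M * (\<tau> ^ (c + 2 * a) / \<tau> ^ (2 * b)) * 2 ^ b"
      by (simp add: power_add power_mult power_divide)
    also have "\<tau> ^ (c + 2 * a) / \<tau> ^ (2 * b) = \<tau> ^ e" unfolding e power_add using \<tau>(1) by simp
    also have "\<epsilon> * M * \<tau> ^ e * 2 ^ b \<le> \<epsilon> * M * sqrt (2 * (K + 1)) ^ e * 2 ^ b"
      using \<epsilon> M(1) K(1) \<tau> by (intro mult_mono power_mono) auto
    finally show ?thesis by (simp add: mult_ac)
  qed
  then show ?case by blast
next
  case (add F G)
  then obtain C C' where C: "\<And>\<epsilon> z. 0 < \<epsilon> \<Longrightarrow> \<epsilon> \<le> 1 \<Longrightarrow> norm z < 1 \<Longrightarrow> cmod (F \<epsilon> z) \<le> C * \<epsilon>"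
    "\<And>\<epsilon> z. 0 < \<epsilon> \<Longrightarrow> \<epsilon> \<le> 1 \<Longrightarrow> norm z < 1 \<Longrightarrow> cmod (G \<epsilon> z) \<le> C' * \<epsilon>" by blast
  have "cmod (F \<epsilon> z + G \<epsilon> z) \<le> (C + C') * \<epsilon>" if "0 < \<epsilon>" "\<epsilon> \<le> 1" "norm z < 1" for \<epsilon> z
    using norm_triangle_ineq[of "F \<epsilon> z" "G \<epsilon> z"] C(1)[OF that] C(2)[OF that] by (simp add: distrib_right)
  then show ?case by blast
qed

text \<open>By the product rule a derivative hits p, lowers c or a by one, or raises b by one. Each
  change costs at most 2 in the inequality between the exponents, which is the difference between
  \<open>Suc j\<close> and j.\<close>

lemma kernels_radial_derivative:
  assumes "kernels \<zeta> i (Suc j) F" "norm \<zeta> = 1"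
  shows "\<exists>G. kernels \<zeta> i j G \<and> (\<forall>\<epsilon>>0. \<forall>z. norm z < 1 \<longrightarrow> ((\<lambda>t. F \<epsilon> (t *s z)) has_field_derivative G \<epsilon> z) (at 1))"
  using assms(1)
proof induction
  case (kernel p b c a)
  obtain q where q: "q \<in> polys" "\<And>z. ((\<lambda>t. p (t *s z)) has_field_derivative q z) (at 1)"
    using polys_radial_derivative[OF kernel(1)] by blast
  define T where "T r c' a' b' = (\<lambda>\<epsilon> z. of_real \<epsilon> * r z * (z $ i - \<zeta> $ i) ^ c' * gap \<zeta> z ^ a' * inverse (gap \<zeta> z + of_real \<epsilon>) ^ b')"
    for r :: "complex ^ 'a \<Rightarrow> complex" and a' b' c' :: nat
  define p1 where "p1 z = of_nat c * (z $ i * p z)" for z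
  define p2 where "p2 z = of_nat a * ((gap \<zeta> z + (-1)) * p z)" for z
  define p3 where "p3 z = - of_nat b * ((gap \<zeta> z + (-1)) * p z)" for z
  have pp: "p1 \<in> polys" "p2 \<in> polys" "p3 \<in> polys"
    unfolding p1_def p2_def p3_def
    by (intro polys_scale polys_mult polys_add polys_gap polys_const polys_nth kernel(1))+
  \<comment> \<open>For c = 0 or a = 0 the truncated exponents c - 1 and a - 1 are harmless: the
    factors c and a inside p1 and p2 make those terms vanish.\<close>
  define G where "G = (\<lambda>\<epsilon> z. (T q c a b \<epsilon> z + T p1 (c - 1) a b \<epsilon> z) + (T p2 c (a - 1) b \<epsilon> z + T p3 c a (Suc b) \<epsilon> z))"
  have "kernels \<zeta> i j G"
    unfolding G_def T_def using kernel(2) by (intro kernels.intros q pp) auto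
  moreover have "((\<lambda>t. T p c a b \<epsilon> (t *s z)) has_field_derivative G \<epsilon> z) (at 1)" if \<epsilon>: "\<epsilon> > 0" and z: "norm z < 1" for \<epsilon> z
  proof -
    have nz: "gap \<zeta> z + of_real \<epsilon> \<noteq> 0" by (rule gap_add_nonzero(1)[OF assms(2) z \<epsilon>])
    define u where "u = inverse (gap \<zeta> z + of_real \<epsilon>)"
    have d1: "((\<lambda>t. ((t *s z) $ i - \<zeta> $ i) ^ c) has_field_derivative of_nat c * (z $ i - \<zeta> $ i) ^ (c - 1) * z $ i) (at 1)"
      by (auto intro!: derivative_eq_intros)
    have d2: "((\<lambda>t. gap \<zeta> (t *s z) ^ a) has_field_derivative of_nat a * gap \<zeta> z ^ (a - 1) * (gap \<zeta> z - 1)) (at 1)"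
      unfolding gap_smult by (auto intro!: derivative_eq_intros)
    have d3: "((\<lambda>t. inverse (gap \<zeta> (t *s z) + of_real \<epsilon>)) has_field_derivative - (u * u * (gap \<zeta> z - 1))) (at 1)"
      unfolding gap_smult u_def using nz by (auto intro!: derivative_eq_intros)
    have d4: "((\<lambda>t. inverse (gap \<zeta> (t *s z) + of_real \<epsilon>) ^ b) has_field_derivative - of_nat b * u ^ Suc b * (gap \<zeta> z - 1)) (at 1)"
    proof (cases b)
      case (Suc b')
      from DERIV_power[OF d3, of b] show ?thesis by (rule DERIV_cong) (simp add: u_def Suc algebra_simps)
    qed simp
    note d = DERIV_mult'[OF DERIV_mult'[OF DERIV_mult'[OF DERIV_cmult[OF q(2)[of z], of "of_real \<epsilon>"] d1] d2] d4]
    show ?thesis unfolding T_def G_def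
      by (rule DERIV_cong[OF d], simp only: vector_smult_lid u_def[symmetric]) (simp add: p1_def p2_def p3_def algebra_simps)
  qed
  ultimately show ?case unfolding T_def by blast
next
  case (add F1 F2)
  then obtain G1 G2 where G: "kernels \<zeta> i j G1" "kernels \<zeta> i j G2"
    "\<And>\<epsilon> z. \<epsilon> > 0 \<Longrightarrow> norm z < 1 \<Longrightarrow> ((\<lambda>t. F1 \<epsilon> (t *s z)) has_field_derivative G1 \<epsilon> z) (at 1)"
    "\<And>\<epsilon> z. \<epsilon> > 0 \<Longrightarrow> norm z < 1 \<Longrightarrow> ((\<lambda>t. F2 \<epsilon> (t *s z)) has_field_derivative G2 \<epsilon> z) (at 1)" by blast
  have "\<forall>\<epsilon>>0. \<forall>z. norm z < 1 \<longrightarrow> ((\<lambda>t. F1 \<epsilon> (t *s z) + F2 \<epsilon> (t *s z)) has_field_derivative G1 \<epsilon> z + G2 \<epsilon> z) (at 1)"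
    by (intro allI impI DERIV_add G)
  then show ?case using kernels.add[OF G(1,2)] by (intro exI[of _ "\<lambda>\<epsilon> z. G1 \<epsilon> z + G2 \<epsilon> z"] conjI)
qed

lemma kernels_iterated_bound:
  assumes "kernels \<zeta> i D F" "norm \<zeta> = 1"
  shows "\<exists>C. \<forall>\<epsilon> z. 0 < \<epsilon> \<longrightarrow> \<epsilon> \<le> 1 \<longrightarrow> norm z < 1 \<longrightarrow> cmod ((radial_power 1 ^^ D) (on_ball (F \<epsilon>)) z) \<le> C * \<epsilon>"
  using assms(1)
proof (induction D arbitrary: F)
  case 0
  then show ?case using kernels_bound[OF 0 assms(2)] by (simp add: on_ball_def)
next
  case (Suc D)
  obtain G where G: "kernels \<zeta> i D G"
    "\<And>\<epsilon> z. \<epsilon> > 0 \<Longrightarrow> norm z < 1 \<Longrightarrow> ((\<lambda>t. F \<epsilon> (t *s z)) has_field_derivative G \<epsilon> z) (at 1)"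
    using kernels_radial_derivative[OF Suc.prems assms(2)] by blast
  have eq: "radial_power 1 (on_ball (F \<epsilon>)) = on_ball (G \<epsilon>)" if \<epsilon>: "\<epsilon> > 0" for \<epsilon>
  proof
    fix z
    show "radial_power 1 (on_ball (F \<epsilon>)) z = on_ball (G \<epsilon>) z"
    proof (cases "z \<in> ball 0 1")
      case True
      have h: "on_ball (F \<epsilon>) \<in> holomorphic_ball" by (intro on_ball_holomorphic kernels_line_holo[OF Suc.prems assms(2) \<epsilon>])
      have op: "open {t. 0 + t *s z \<in> ball 0 1}" by (intro open_line open_ball)
      have "((\<lambda>t. on_ball (F \<epsilon>) (t *s z)) has_field_derivative G \<epsilon> z) (at 1)"
        by (rule has_field_derivative_transform_within_open[OF G(2)[OF \<epsilon>, of z] op]) (use True in \<open>auto simp: on_ball_def\<close>)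
      from DERIV_unique[OF radial_derivative[OF h True] this] show ?thesis using True by (simp add: on_ball_def)
    qed (simp add: radial_power_def on_ball_def)
  qed
  obtain C where "\<forall>\<epsilon> z. 0 < \<epsilon> \<longrightarrow> \<epsilon> \<le> 1 \<longrightarrow> norm z < 1 \<longrightarrow> cmod ((radial_power 1 ^^ D) (on_ball (G \<epsilon>)) z) \<le> C * \<epsilon>"
    using Suc.IH[OF G(1)] by blast
  then have "\<forall>\<epsilon> z. 0 < \<epsilon> \<longrightarrow> \<epsilon> \<le> 1 \<longrightarrow> norm z < 1 \<longrightarrow> cmod ((radial_power 1 ^^ Suc D) (on_ball (F \<epsilon>)) z) \<le> C * \<epsilon>"
    by (simp add: funpow_Suc_right eq del: funpow.simps)
  then show ?case by blast
qed

text \<open>The inequality on c and a pays for one pole and D radial derivatives: a coordinate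
  factor counts 1, a factor \<open>gap \<zeta> z\<close> counts 2, and the pole and every derivative
  cost 2 each.\<close>

lemma kernel_norm_bound:
  fixes \<zeta> :: "complex ^ 'n"
  assumes \<zeta>: "norm \<zeta> = 1" and \<beta>: "\<beta> \<le> real D" and ca: "2 + 2 * D \<le> c + 2 * a"
  obtains C where "C > 0" "\<And>\<epsilon>. 0 < \<epsilon> \<Longrightarrow> \<epsilon> \<le> 1 \<Longrightarrow>
    on_ball (\<lambda>z. of_real \<epsilon> * (z $ i - \<zeta> $ i) ^ c * gap \<zeta> z ^ a / (gap \<zeta> z + of_real \<epsilon>)) \<in> hardy_sobolev_space \<beta> \<and>
    hardy_sobolev_norm \<beta> (on_ball (\<lambda>z. of_real \<epsilon> * (z $ i - \<zeta> $ i) ^ c * gap \<zeta> z ^ a / (gap \<zeta> z + of_real \<epsilon>))) \<le> C * \<epsilon>"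
proof -
  define F where "F = (\<lambda>\<epsilon> z. of_real \<epsilon> * 1 * (z $ i - \<zeta> $ i) ^ c * gap \<zeta> z ^ a * inverse (gap \<zeta> z + of_real \<epsilon>) ^ 1)"
  have k: "kernels \<zeta> i D F" unfolding F_def using ca by (intro kernels.kernel polys_const) simp
  have k0: "kernels \<zeta> i 0 F" unfolding F_def using ca by (intro kernels.kernel polys_const) simp
  have F: "F \<epsilon> = (\<lambda>z. of_real \<epsilon> * (z $ i - \<zeta> $ i) ^ c * gap \<zeta> z ^ a / (gap \<zeta> z + of_real \<epsilon>))" for \<epsilon>
    by (simp add: F_def divide_inverse)
  obtain C0 where C0: "\<And>\<epsilon> z. 0 < \<epsilon> \<Longrightarrow> \<epsilon> \<le> 1 \<Longrightarrow> norm z < 1 \<Longrightarrow> cmod (F \<epsilon> z) \<le> C0 * \<epsilon>"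
    using kernels_bound[OF k0 \<zeta>] by blast
  obtain C1 where C1: "\<And>\<epsilon> z. 0 < \<epsilon> \<Longrightarrow> \<epsilon> \<le> 1 \<Longrightarrow> norm z < 1 \<Longrightarrow> cmod ((radial_power 1 ^^ D) (on_ball (F \<epsilon>)) z) \<le> C1 * \<epsilon>"
    using kernels_iterated_bound[OF k \<zeta>] by blast
  define C where "C = max 1 (max C0 C1)"
  have "on_ball (F \<epsilon>) \<in> hardy_sobolev_space \<beta> \<and> hardy_sobolev_norm \<beta> (on_ball (F \<epsilon>)) \<le> (2 * C) * \<epsilon>" if \<epsilon>: "0 < \<epsilon>" "\<epsilon> \<le> 1" for \<epsilon>
  proof -
    have h: "on_ball (F \<epsilon>) \<in> holomorphic_ball" by (intro on_ball_holomorphic kernels_line_holo[OF k \<zeta> \<epsilon>(1)])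
    have le: "C0 * \<epsilon> \<le> C * \<epsilon>" "C1 * \<epsilon> \<le> C * \<epsilon>" using \<epsilon> by (auto simp: C_def intro!: mult_right_mono)
    have a: "cmod (on_ball (F \<epsilon>) z) \<le> C * \<epsilon>" if "norm z < 1" for z
      using order_trans[OF C0[OF \<epsilon> that] le(1)] that by (simp add: on_ball_def)
    have b: "cmod ((radial_power 1 ^^ D) (on_ball (F \<epsilon>)) z) \<le> C * \<epsilon>" if "norm z < 1" for z
      by (rule order_trans[OF C1[OF \<epsilon> that] le(2)])
    show ?thesis using hardy_sobolev_norm_le_sup[OF h \<beta> a b] by (simp add: mult.assoc)
  qed
  then show thesis unfolding F by (intro that[of "2 * C"]) (auto simp: C_def)
qed

section \<open>Multipliers tending to zero at the boundary\<close>

definition multiples :: "real \<Rightarrow> (complex ^ 'n \<Rightarrow> complex) \<Rightarrow> (complex ^ 'n \<Rightarrow> complex) set" where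
  "multiples \<beta> h = (\<lambda>f z. h z * f z) ` hardy_sobolev_space \<beta>"

text \<open>Allows multiplication by functions that do not vanish outside the ball, such as
  polynomials; these are not in \<open>holomorphic_ball\<close> and so are not covered by
  \<open>pointwise_multiplier\<close>.\<close>

definition bounded_multiplication :: "real \<Rightarrow> (complex ^ 'n \<Rightarrow> complex) \<Rightarrow> bool" where
  "bounded_multiplication \<beta> h \<longleftrightarrow> (\<exists>C. \<forall>f\<in>hardy_sobolev_space \<beta>. (\<lambda>z. h z * f z) \<in> hardy_sobolev_space \<beta> \<and>
     hardy_sobolev_norm \<beta> (\<lambda>z. h z * f z) \<le> C * hardy_sobolev_norm \<beta> f)"

lemma bounded_multiplicationD:
  "bounded_multiplication \<beta> h \<Longrightarrow> f \<in> hardy_sobolev_space \<beta> \<Longrightarrow> (\<lambda>z. h z * f z) \<in> hardy_sobolev_space \<beta>"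
  by (auto simp: bounded_multiplication_def)

lemma on_ball_mult:
  assumes "f \<in> hardy_sobolev_space \<beta>"
  shows "on_ball p z * f z = p z * f z"
  using hardy_sobolev_holomorphic[OF assms] by (auto simp: on_ball_def holomorphic_ball_iff)

lemma bounded_multiplication_multiplier:
  assumes "pointwise_multiplier \<beta> \<psi>"
  shows "bounded_multiplication \<beta> \<psi>"
proof -
  obtain C where C: "\<And>f. f \<in> hardy_sobolev_space \<beta> \<Longrightarrow> hardy_sobolev_norm \<beta> (\<lambda>z. \<psi> z * f z) \<le> C * hardy_sobolev_norm \<beta> f"
    using pointwise_multiplier_operator_bound[OF assms] by blast
  show ?thesis unfolding bounded_multiplication_def
    by (intro exI[of _ C] ballI conjI C pointwise_multiplierD(2)[OF assms])
qed

lemma bounded_multiplication_polys: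
  assumes "p \<in> polys"
  shows "bounded_multiplication \<beta> p"
  using bounded_multiplication_multiplier[OF pointwise_multiplier_polys[OF assms], of \<beta>]
  by (simp add: bounded_multiplication_def on_ball_mult cong: ball_cong)

lemma multiples_subset: "bounded_multiplication \<beta> h \<Longrightarrow> multiples \<beta> h \<subseteq> hardy_sobolev_space \<beta>"
  by (auto simp: multiples_def intro: bounded_multiplicationD)

lemma multiplesI: "f \<in> hardy_sobolev_space \<beta> \<Longrightarrow> (\<lambda>z. h z * f z) \<in> multiples \<beta> h"
  by (auto simp: multiples_def)

lemma multiplesE:
  assumes "g \<in> multiples \<beta> h"
  obtains f where "f \<in> hardy_sobolev_space \<beta>" "g = (\<lambda>z. h z * f z)"
  using assms by (auto simp: multiples_def)

lemma subspace_multiples: "cfun.subspace (multiples \<beta> h)"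
proof (rule cfun.subspaceI)
  show "0 \<in> multiples \<beta> h" using multiplesI[OF hs.zero_mem, of h \<beta>] by (simp add: zero_fun_def)
  show "f + g \<in> multiples \<beta> h" if fg: "f \<in> multiples \<beta> h" "g \<in> multiples \<beta> h" for f g
  proof -
    from fg(1) obtain f' where f': "f' \<in> hardy_sobolev_space \<beta>" "f = (\<lambda>z. h z * f' z)" by (rule multiplesE)
    from fg(2) obtain g' where g': "g' \<in> hardy_sobolev_space \<beta>" "g = (\<lambda>z. h z * g' z)" by (rule multiplesE)
    have "f + g = (\<lambda>z. h z * (f' + g') z)" by (simp add: f' g' fun_eq_iff distrib_left)
    then show ?thesis using multiplesI[OF hs.add_mem[OF f'(1) g'(1)], of h] by (simp only:)
  qed
  show "scale_fun c f \<in> multiples \<beta> h" if "f \<in> multiples \<beta> h" for c f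
  proof -
    from that obtain f' where f': "f' \<in> hardy_sobolev_space \<beta>" "f = (\<lambda>z. h z * f' z)" by (rule multiplesE)
    have "scale_fun c f = (\<lambda>z. h z * (scale_fun c f') z)" by (simp add: f' scale_fun_def fun_eq_iff)
    then show ?thesis using multiplesI[OF hs.scale_mem[OF f'(1)], of h] by (simp only:)
  qed
qed

lemma bounded_multiplication_cl:
  fixes h f :: "complex ^ 'n \<Rightarrow> complex"
  assumes h: "bounded_multiplication \<beta> h" and X: "X \<subseteq> hardy_sobolev_space \<beta>"
    and XY: "\<And>x. x \<in> X \<Longrightarrow> (\<lambda>z. h z * x z) \<in> Y" and f: "f \<in> hs.cl \<beta> X"
  shows "(\<lambda>z. h z * f z) \<in> hs.cl \<beta> Y"
proof -
  obtain C where C: "\<And>f. f \<in> hardy_sobolev_space \<beta> \<Longrightarrow> hardy_sobolev_norm \<beta> (\<lambda>z. h z * f z) \<le> C * hardy_sobolev_norm \<beta> f"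
    using h unfolding bounded_multiplication_def by blast
  show ?thesis
  proof (rule hs.cl_image[where M = "\<lambda>f z. h z * f z", OF _ bounded_multiplicationD[OF h] XY X f])
    fix f g :: "complex ^ 'n \<Rightarrow> complex" assume fg: "f \<in> hardy_sobolev_space \<beta>" "g \<in> hardy_sobolev_space \<beta>"
    have "(\<lambda>z. h z * f z) - (\<lambda>z. h z * g z) = (\<lambda>z. h z * (f - g) z)" by (simp add: fun_eq_iff right_diff_distrib)
    then show "hardy_sobolev_norm \<beta> ((\<lambda>z. h z * f z) - (\<lambda>z. h z * g z)) \<le> C * hardy_sobolev_norm \<beta> (f - g)"
      using C[OF hs.diff_mem[OF fg]] by (simp only:)
  qed
qed

text \<open>Rests on h - h gap / (gap + \<epsilon>) = \<epsilon> h / (gap + \<epsilon>), whose norm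
  is O(\<epsilon>): multiplied by a polynomial, h is approximated by multiples of h gap. Density of
  the polynomials extends this to all multiples of h.\<close>

lemma kernel_multiples_step:
  fixes \<zeta> :: "complex ^ 'n"
  assumes \<zeta>: "norm \<zeta> = 1" and \<beta>: "\<beta> \<le> real D" and ca: "2 + 2 * D \<le> c + 2 * a"
  shows "multiples \<beta> (\<lambda>z. (z $ i - \<zeta> $ i) ^ c * gap \<zeta> z ^ a)
    \<subseteq> hs.cl \<beta> (multiples \<beta> (\<lambda>z. (z $ i - \<zeta> $ i) ^ c * gap \<zeta> z ^ Suc a))"
proof -
  define h where "h = (\<lambda>z. (z $ i - \<zeta> $ i) ^ c * gap \<zeta> z ^ a)"
  define h' where "h' = (\<lambda>z. (z $ i - \<zeta> $ i) ^ c * gap \<zeta> z ^ Suc a)"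
  have sp: "(\<lambda>z. z $ i - \<zeta> $ i) \<in> polys"
    using polys_add[OF polys_nth polys_const[of "- \<zeta> $ i"], of i] by simp
  have hp: "h \<in> polys" "h' \<in> polys" unfolding h_def h'_def by (intro polys_mult polys_power sp polys_gap)+
  have h'V: "multiples \<beta> h' \<subseteq> hardy_sobolev_space \<beta>" by (intro multiples_subset bounded_multiplication_polys hp)
  obtain C where C: "C > 0" "\<And>\<epsilon>. 0 < \<epsilon> \<Longrightarrow> \<epsilon> \<le> 1 \<Longrightarrow>
    on_ball (\<lambda>z. of_real \<epsilon> * (z $ i - \<zeta> $ i) ^ c * gap \<zeta> z ^ a / (gap \<zeta> z + of_real \<epsilon>)) \<in> hardy_sobolev_space \<beta> \<and>
    hardy_sobolev_norm \<beta> (on_ball (\<lambda>z. of_real \<epsilon> * (z $ i - \<zeta> $ i) ^ c * gap \<zeta> z ^ a / (gap \<zeta> z + of_real \<epsilon>))) \<le> C * \<epsilon>"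
    using kernel_norm_bound[OF \<zeta> \<beta> ca, of i] by blast
  have poly_case: "(\<lambda>z. h z * on_ball q z) \<in> hs.cl \<beta> (multiples \<beta> h')" if q: "q \<in> polys" for q
  proof -
    \<comment> \<open>Multiplication by q costs only a constant, so the estimate O(\<epsilon>)
      survives.\<close>
    obtain Q where Q: "\<And>f. f \<in> hardy_sobolev_space \<beta> \<Longrightarrow> (\<lambda>z. q z * f z) \<in> hardy_sobolev_space \<beta> \<and>
     hardy_sobolev_norm \<beta> (\<lambda>z. q z * f z) \<le> Q * hardy_sobolev_norm \<beta> f"
      using bounded_multiplication_polys[OF q, of \<beta>] unfolding bounded_multiplication_def by blast
    have hq: "(\<lambda>z. h z * on_ball q z) \<in> hardy_sobolev_space \<beta>"
      by (intro hardy_sobolev_polys_mult polys_hardy_sobolev q hp)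
    show ?thesis unfolding hs.cl_def
    proof (intro CollectI conjI hq allI impI)
      fix e :: real assume e: "e > 0"
      define K where "K = (\<bar>Q\<bar> + 1) * C"
      have "\<bar>Q\<bar> + 1 > 0" by linarith
      then have K: "K > 0" using C(1) by (simp add: K_def)
      define \<epsilon> where "\<epsilon> = min 1 (e / (2 * K))"
      have \<epsilon>: "0 < \<epsilon>" "\<epsilon> \<le> 1" "\<epsilon> \<le> e / (2 * K)" using e K by (auto simp: \<epsilon>_def)
      have "K * \<epsilon> \<le> K * (e / (2 * K))" using \<epsilon>(3) K by (intro mult_left_mono) auto
      also have "\<dots> = e / 2" using K by simp
      finally have small: "(\<bar>Q\<bar> + 1) * (C * \<epsilon>) < e" using e unfolding K_def mult.assoc by linarith
      define k where "k = on_ball (\<lambda>z. of_real \<epsilon> * (z $ i - \<zeta> $ i) ^ c * gap \<zeta> z ^ a / (gap \<zeta> z + of_real \<epsilon>))"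
      have k: "k \<in> hardy_sobolev_space \<beta>" "hardy_sobolev_norm \<beta> k \<le> C * \<epsilon>" using C(2)[OF \<epsilon>(1,2)] by (auto simp: k_def)
      define u where "u = on_ball (\<lambda>z. 1 / (gap \<zeta> z + of_real \<epsilon>))"
      have nz: "z \<in> ball 0 1 \<Longrightarrow> gap \<zeta> z + of_real \<epsilon> \<noteq> 0" for z
        using gap_add_nonzero(1)[OF \<zeta> _ \<epsilon>(1), of z] by simp
      have gp: "(\<lambda>z. gap \<zeta> z + of_real \<epsilon>) \<in> polys" by (intro polys_add polys_gap polys_const)
      \<comment> \<open>The reciprocal belongs to the space for each fixed \<epsilon>, because gap +
        \<epsilon> is a polynomial of modulus at least \<epsilon> on the ball. No bound uniform in
        \<epsilon> is claimed for u.\<close>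
      have u: "u \<in> hardy_sobolev_space \<beta>"
      proof (rule hardy_sobolev_divide[OF pointwise_multiplier_polys[OF gp]])
        show "u \<in> holomorphic_ball"
          unfolding u_def by (intro on_ball_holomorphic line_holo_divide line_holo_const polys_line_holo[OF gp] nz)
        have "(\<lambda>z. on_ball (\<lambda>z. gap \<zeta> z + of_real \<epsilon>) z * u z) = on_ball (\<lambda>z. 1)"
          using nz by (auto simp: u_def on_ball_def fun_eq_iff)
        then show "(\<lambda>z. on_ball (\<lambda>z. gap \<zeta> z + of_real \<epsilon>) z * u z) \<in> hardy_sobolev_space \<beta>"
          using polys_hardy_sobolev[OF polys_const[of 1], of \<beta>] by (simp only:)
        show "(0::real) < 1/2" "(1/2::real) < 1" "\<epsilon> > 0" using \<epsilon> by auto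
        show "\<epsilon> \<le> cmod (on_ball (\<lambda>z. gap \<zeta> z + of_real \<epsilon>) z)" if "norm z < 1" for z
          using gap_add_nonzero(2)[OF \<zeta> that \<epsilon>(1)] that by (simp add: on_ball_def)
      qed
      define y where "y = (\<lambda>z. h' z * (q z * u z))"
      have y: "y \<in> multiples \<beta> h'" unfolding y_def by (intro multiplesI hardy_sobolev_polys_mult[OF u q])
      have "h z * on_ball q z - y z = q z * k z" for z
      proof (cases "z \<in> ball 0 1")
        case True
        define g where "g = gap \<zeta> z"
        have "g + of_real \<epsilon> \<noteq> 0" using nz[OF True] by (simp add: g_def)
        then have "1 - g / (g + of_real \<epsilon>) = of_real \<epsilon> / (g + of_real \<epsilon>)" by (simp add: field_simps)
        then have "h z * q z * (1 - g / (g + of_real \<epsilon>)) = h z * q z * (of_real \<epsilon> / (g + of_real \<epsilon>))" by simp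
        then show ?thesis
          using True by (simp add: y_def u_def k_def h_def h'_def on_ball_def g_def[symmetric] algebra_simps)
      qed (simp add: y_def u_def k_def on_ball_def)
      then have "(\<lambda>z. h z * on_ball q z) - y = (\<lambda>z. q z * k z)" by (simp add: fun_eq_iff)
      then have "hardy_sobolev_norm \<beta> ((\<lambda>z. h z * on_ball q z) - y) \<le> Q * hardy_sobolev_norm \<beta> k"
        using Q[OF k(1)] by (simp only:)
      also have "\<dots> \<le> (\<bar>Q\<bar> + 1) * (C * \<epsilon>)" using k(2) by (intro mult_mono) auto
      also note small
      finally show "\<exists>x\<in>multiples \<beta> h'. hardy_sobolev_norm \<beta> ((\<lambda>z. h z * on_ball q z) - x) < e" using y by blast
    qed
  qed
  have "(\<lambda>z. h z * v z) \<in> hs.cl \<beta> (multiples \<beta> h')" if v: "v \<in> hardy_sobolev_space \<beta>" for v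
  proof -
    have P: "on_ball ` polys \<subseteq> hardy_sobolev_space \<beta>" using polys_hardy_sobolev by blast
    have vP: "v \<in> hs.cl \<beta> (on_ball ` polys)"
      unfolding hs.cl_def
    proof (intro CollectI conjI v allI impI)
      fix e :: real assume "e > 0"
      then obtain p where "p \<in> polys" "hardy_sobolev_norm \<beta> (v - on_ball p) < e" using polys_dense[OF v] by blast
      then show "\<exists>x\<in>on_ball ` polys. hardy_sobolev_norm \<beta> (v - x) < e" by blast
    qed
    have "(\<lambda>z. h z * x z) \<in> hs.cl \<beta> (multiples \<beta> h')" if "x \<in> on_ball ` polys" for x
      using that poly_case by blast
    from bounded_multiplication_cl[OF bounded_multiplication_polys[OF hp(1)] P this vP]
    have "(\<lambda>z. h z * v z) \<in> hs.cl \<beta> (hs.cl \<beta> (multiples \<beta> h'))" .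
    then show ?thesis using hs.cl_trans[OF order_refl h'V] by blast
  qed
  then show ?thesis unfolding h_def[symmetric] h'_def[symmetric] by (auto simp: multiples_def)
qed

lemma kernel_multiples:
  fixes \<zeta> :: "complex ^ 'n"
  assumes \<zeta>: "norm \<zeta> = 1" and \<beta>: "\<beta> \<le> real D" and ca: "2 + 2 * D \<le> c + 2 * a"
  shows "multiples \<beta> (\<lambda>z. (z $ i - \<zeta> $ i) ^ c * gap \<zeta> z ^ a)
    \<subseteq> hs.cl \<beta> (multiples \<beta> (\<lambda>z. (z $ i - \<zeta> $ i) ^ c * gap \<zeta> z ^ (a + k)))"
proof -
  have sp: "(\<lambda>z. z $ i - \<zeta> $ i) \<in> polys"
    using polys_add[OF polys_nth polys_const[of "- \<zeta> $ i"], of i] by simp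
  have V: "multiples \<beta> (\<lambda>z. (z $ i - \<zeta> $ i) ^ c * gap \<zeta> z ^ b) \<subseteq> hardy_sobolev_space \<beta>" for b
    by (intro multiples_subset bounded_multiplication_polys polys_mult polys_power sp polys_gap)
  show ?thesis
  proof (induction k)
    case 0
    then show ?case using hs.subset_cl[OF V[of a]] by simp
  next
    case (Suc k)
    have "2 + 2 * D \<le> c + 2 * (a + k)" using ca by simp
    from hs.cl_trans[OF kernel_multiples_step[OF \<zeta> \<beta> this, of i] V]
    show ?case using Suc.IH by (simp only: add_Suc_right)
  qed
qed

text \<open>High powers of every coordinate of z - \<zeta> lie in the closure of the multiples of
  gap^E. Modulo this closure only finitely many monomials in z - \<zeta> remain, first for
  polynomials and then, by closedness, for all elements.\<close>

lemma gap_power_codimension: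
  fixes \<zeta> :: "complex ^ 'n"
  assumes \<zeta>: "norm \<zeta> = 1"
  obtains E B where "finite B" "B \<subseteq> hardy_sobolev_space \<beta>"
    "\<And>k. multiples \<beta> (\<lambda>z. gap \<zeta> z ^ E) \<subseteq> hs.cl \<beta> (multiples \<beta> (\<lambda>z. gap \<zeta> z ^ (E + k)))"
    "\<And>v. v \<in> hardy_sobolev_space \<beta> \<Longrightarrow> \<exists>u\<in>hs.cl \<beta> (multiples \<beta> (\<lambda>z. gap \<zeta> z ^ E)). v - u \<in> cfun.span B"
proof -
  define D where "D = nat \<lceil>\<beta>\<rceil>"
  have \<beta>: "\<beta> \<le> real D" unfolding D_def by linarith
  define E where "E = Suc D"
  define m where "m = 2 * E"
  define Z where "Z = hs.cl \<beta> (multiples \<beta> (\<lambda>z. gap \<zeta> z ^ E))"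
  have bm: "bounded_multiplication \<beta> (\<lambda>z. gap \<zeta> z ^ k)" for k
    by (intro bounded_multiplication_polys polys_power polys_gap)
  have gV: "multiples \<beta> (\<lambda>z. gap \<zeta> z ^ k) \<subseteq> hardy_sobolev_space \<beta>" for k by (rule multiples_subset[OF bm])
  have chain: "multiples \<beta> (\<lambda>z. gap \<zeta> z ^ E) \<subseteq> hs.cl \<beta> (multiples \<beta> (\<lambda>z. gap \<zeta> z ^ (E + k)))" for k
  proof -
    have "2 + 2 * D \<le> 0 + 2 * E" by (simp add: E_def)
    \<comment> \<open>With c = 0 the coordinate factor is 1, so the index is arbitrary.\<close>
    from kernel_multiples[OF \<zeta> \<beta> this, of undefined k] show ?thesis by simp
  qed
  have Z: "cfun.subspace Z" "closedin (hs.metric.mtopology \<beta>) Z" "Z \<subseteq> hardy_sobolev_space \<beta>"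
    unfolding Z_def by (rule hs.subspace_cl[OF subspace_multiples gV] hs.closedin_cl[OF gV] hs.cl_subset_V)+
  have sp: "(\<lambda>z. z $ i - \<zeta> $ i) \<in> polys" for i
    using polys_add[OF polys_nth polys_const[of "- \<zeta> $ i"], of i] by simp
  have coord: "(\<lambda>z. (z $ i - \<zeta> $ i) ^ m * v z) \<in> Z" if v: "v \<in> hardy_sobolev_space \<beta>" for i v
  proof -
    have "2 + 2 * D \<le> m + 2 * 0" by (simp add: m_def E_def)
    from kernel_multiples[OF \<zeta> \<beta> this, of i E]
    have 1: "multiples \<beta> (\<lambda>z. (z $ i - \<zeta> $ i) ^ m) \<subseteq> hs.cl \<beta> (multiples \<beta> (\<lambda>z. (z $ i - \<zeta> $ i) ^ m * gap \<zeta> z ^ E))"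
      by simp
    have 2: "multiples \<beta> (\<lambda>z. (z $ i - \<zeta> $ i) ^ m * gap \<zeta> z ^ E) \<subseteq> Z"
    proof
      fix f assume "f \<in> multiples \<beta> (\<lambda>z. (z $ i - \<zeta> $ i) ^ m * gap \<zeta> z ^ E)"
      then obtain g where g: "g \<in> hardy_sobolev_space \<beta>" "f = (\<lambda>z. (z $ i - \<zeta> $ i) ^ m * gap \<zeta> z ^ E * g z)" by (rule multiplesE)
      have "f = (\<lambda>z. gap \<zeta> z ^ E * ((z $ i - \<zeta> $ i) ^ m * g z))" by (simp add: g fun_eq_iff)
      also have "\<dots> \<in> multiples \<beta> (\<lambda>z. gap \<zeta> z ^ E)"
        by (intro multiplesI hardy_sobolev_polys_mult[OF g(1)] polys_power sp)
      finally show "f \<in> Z" using hs.subset_cl[OF gV] unfolding Z_def by blast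
    qed
    have "multiples \<beta> (\<lambda>z. (z $ i - \<zeta> $ i) ^ m) \<subseteq> hs.cl \<beta> Z"
      using 1 hs.cl_trans[OF order_trans[OF 2 hs.subset_cl[OF Z(3)]] Z(3)] by blast
    then show ?thesis using multiplesI[OF v, of "\<lambda>z. (z $ i - \<zeta> $ i) ^ m"] hs.cl_closedin[OF Z(2)] by blast
  qed
  \<comment> \<open>A monomial in z - \<zeta> whose exponent is not in A contains an m-th power of
    some coordinate and hence lies in Z.\<close>
  define A where "A = {\<alpha> :: 'n \<Rightarrow> nat. \<forall>i. \<alpha> i < m}"
  have "A = Pi UNIV (\<lambda>_. {..<m})" by (auto simp: A_def)
  also have "\<dots> = PiE UNIV (\<lambda>_. {..<m})" by (simp add: PiE_def)
  finally have A: "finite A" by (simp add: finite_PiE)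
  define b where "b \<alpha> = on_ball (\<lambda>z. monomial \<alpha> (z - \<zeta>))" for \<alpha> :: "'n \<Rightarrow> nat"
  have bp: "(\<lambda>z. monomial \<alpha> (z - \<zeta>)) \<in> polys" for \<alpha>
    using polys_translate[OF polys_monomial, of \<alpha> "- \<zeta>"] by simp
  define B where "B = b ` A"
  have B: "finite B" "B \<subseteq> hardy_sobolev_space \<beta>" using A polys_hardy_sobolev[OF bp] by (auto simp: B_def b_def)
  have monom: "\<exists>s\<in>cfun.span B. b \<alpha> - s \<in> Z" for \<alpha>
  proof (cases "\<alpha> \<in> A")
    case True
    then have "b \<alpha> \<in> cfun.span B" by (auto simp: B_def intro: cfun.span_base)
    moreover have "b \<alpha> - b \<alpha> \<in> Z" using cfun.subspace_0[OF Z(1)] by simp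
    ultimately show ?thesis by blast
  next
    case False
    then obtain i where i: "m \<le> \<alpha> i" by (auto simp: A_def not_less)
    define \<alpha>' where "\<alpha>' = \<alpha>(i := \<alpha> i - m)"
    have "monomial \<alpha> w = (w $ i) ^ m * monomial \<alpha>' w" for w
    proof -
      have "monomial \<gamma> w = (w $ i) ^ \<gamma> i * (\<Prod>j\<in>UNIV - {i}. (w $ j) ^ \<gamma> j)" for \<gamma>
        unfolding monomial_def by (simp add: prod.remove[of UNIV i])
      note this[of \<alpha>] this[of \<alpha>']
      moreover have "(w $ i) ^ \<alpha> i = (w $ i) ^ m * (w $ i) ^ \<alpha>' i" using i by (simp add: \<alpha>'_def flip: power_add)
      ultimately show ?thesis by (simp add: \<alpha>'_def mult.assoc)
    qed
    then have "b \<alpha> = (\<lambda>z. (z $ i - \<zeta> $ i) ^ m * on_ball (\<lambda>z. monomial \<alpha>' (z - \<zeta>)) z)"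
      by (auto simp: b_def on_ball_def fun_eq_iff)
    also have "\<dots> \<in> Z" by (intro coord polys_hardy_sobolev bp)
    finally have "b \<alpha> - 0 \<in> Z" by simp
    then show ?thesis using cfun.span_zero by blast
  qed
  have poly: "\<exists>s\<in>cfun.span B. on_ball (\<lambda>z. r (z - \<zeta>)) - s \<in> Z" if "r \<in> polys" for r
    using that
  proof (induction rule: polys_induct)
    case zero
    have "on_ball (\<lambda>z. 0) - 0 = (0 :: complex ^ 'n \<Rightarrow> complex)" by (simp add: on_ball_def fun_eq_iff)
    then show ?case using cfun.span_zero cfun.subspace_0[OF Z(1)] by metis
  next
    case (add c \<alpha> r)
    obtain s where s: "s \<in> cfun.span B" "on_ball (\<lambda>z. r (z - \<zeta>)) - s \<in> Z" using add.IH by blast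
    obtain t where t: "t \<in> cfun.span B" "b \<alpha> - t \<in> Z" using monom by blast
    have eq: "on_ball (\<lambda>z. c * monomial \<alpha> (z - \<zeta>) + r (z - \<zeta>)) - (scale_fun c t + s) =
        scale_fun c (b \<alpha> - t) + (on_ball (\<lambda>z. r (z - \<zeta>)) - s)"
      by (simp add: fun_eq_iff scale_fun_def b_def on_ball_def algebra_simps)
    show ?case
      by (rule bexI[of _ "scale_fun c t + s"], unfold eq)
        (intro cfun.subspace_add[OF Z(1)] cfun.subspace_scale[OF Z(1)] s t cfun.span_add cfun.span_scale)+
  qed
  define W where "W = {f \<in> hardy_sobolev_space \<beta>. \<exists>s\<in>cfun.span B. f - s \<in> Z}"
  have W: "closedin (hs.metric.mtopology \<beta>) W" unfolding W_def by (rule hs.closedin_add_span[OF B Z(2,1)])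
  have pW: "on_ball q \<in> W" if q: "q \<in> polys" for q
  proof -
    have "(\<lambda>w. q (\<zeta> + w)) \<in> polys" by (rule polys_translate[OF q])
    from poly[OF this] have "\<exists>s\<in>cfun.span B. on_ball q - s \<in> Z" by simp
    then show ?thesis using polys_hardy_sobolev[OF q] by (simp add: W_def)
  qed
  \<comment> \<open>W contains the dense set of polynomials and is closed, since it arises from the
    closed subspace Z by adding a finite dimensional space.\<close>
  have V: "v \<in> W" if v: "v \<in> hardy_sobolev_space \<beta>" for v
  proof -
    have "v \<in> hs.cl \<beta> W"
      unfolding hs.cl_def
    proof (intro CollectI conjI v allI impI)
      fix e :: real assume "e > 0"
      then obtain p where "p \<in> polys" "hardy_sobolev_norm \<beta> (v - on_ball p) < e" using polys_dense[OF v] by blast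
      then show "\<exists>x\<in>W. hardy_sobolev_norm \<beta> (v - x) < e" using pW by blast
    qed
    then show ?thesis using hs.cl_closedin[OF W] by blast
  qed
  show thesis
  proof (rule that[OF B chain])
    fix v :: "complex ^ 'n \<Rightarrow> complex" assume "v \<in> hardy_sobolev_space \<beta>"
    then obtain s where s: "s \<in> cfun.span B" "v - s \<in> Z" using V by (auto simp: W_def)
    have "v - (v - s) \<in> cfun.span B" using s(1) by simp
    then show "\<exists>u\<in>hs.cl \<beta> (multiples \<beta> (\<lambda>z. gap \<zeta> z ^ E)). v - u \<in> cfun.span B" using s(2) unfolding Z_def by blast
  qed
qed

text \<open>A closed range is itself a Banach function space. The inverse of multiplication by
  \<psi> is defined on it by cancellation and has a closed graph, so it is bounded.\<close>

lemma multiplication_bounded_below: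
  fixes \<psi> :: "complex ^ 'n \<Rightarrow> complex"
  assumes \<psi>: "pointwise_multiplier \<beta> \<psi>" and z0: "\<psi> z0 \<noteq> 0" and cl: "closedin (hs.metric.mtopology \<beta>) (multiples \<beta> \<psi>)"
  obtains C where "C > 0" "\<And>f. f \<in> hardy_sobolev_space \<beta> \<Longrightarrow> hardy_sobolev_norm \<beta> f \<le> C * hardy_sobolev_norm \<beta> (\<lambda>z. \<psi> z * f z)"
proof -
  note h = pointwise_multiplierD(1)[OF \<psi>]
  have V: "multiples \<beta> \<psi> \<subseteq> hardy_sobolev_space \<beta>" by (rule multiples_subset[OF bounded_multiplication_multiplier[OF \<psi>]])
  have inj: "f = g" if f: "f \<in> hardy_sobolev_space \<beta>" and g: "g \<in> hardy_sobolev_space \<beta>" and eq: "(\<lambda>z. \<psi> z * f z) = (\<lambda>z. \<psi> z * g z)" for f g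
  proof
    fix z
    have "\<psi> z * (f z - g z) = 0" for z using fun_cong[OF eq, of z] by (simp add: right_diff_distrib)
    from holomorphic_ball_cancel[OF h z0 holomorphic_ball_diff[OF hardy_sobolev_holomorphic[OF f] hardy_sobolev_holomorphic[OF g]] this, of z]
    show "f z = g z" by simp
  qed
  \<comment> \<open>The chosen preimage is unique on the range by \<open>inj\<close>, which makes T
    linear there.\<close>
  define T where "T g = (SOME f. f \<in> hardy_sobolev_space \<beta> \<and> g = (\<lambda>z. \<psi> z * f z))" for g
  have T: "T g \<in> hardy_sobolev_space \<beta>" "g = (\<lambda>z. \<psi> z * T g z)" if "g \<in> multiples \<beta> \<psi>" for g
    using someI_ex[of "\<lambda>f. f \<in> hardy_sobolev_space \<beta> \<and> g = (\<lambda>z. \<psi> z * f z)"] that unfolding T_def[symmetric] by (auto elim: multiplesE)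
  have T_eq: "T (\<lambda>z. \<psi> z * f z) = f" if f: "f \<in> hardy_sobolev_space \<beta>" for f
    using inj[OF T(1)[OF multiplesI[OF f]] f] T(2)[OF multiplesI[OF f, of \<psi>]] by simp
  note sub = subspace_multiples[of \<beta> \<psi>]
  have S: "banach_function_space (multiples \<beta> \<psi>) (hardy_sobolev_norm \<beta>)"
    by (rule hs.closed_subspace[OF V cfun.subspace_0[OF sub] cfun.subspace_add[OF sub] cfun.subspace_scale[OF sub] cl])
  obtain C where C: "C > 0" "\<And>g. g \<in> multiples \<beta> \<psi> \<Longrightarrow> hardy_sobolev_norm \<beta> (T g) \<le> C * hardy_sobolev_norm \<beta> g"
  proof (rule banach_function_space.closed_graph[OF S banach_hardy_sobolev, of T])
    show "T f \<in> hardy_sobolev_space \<beta>" if "f \<in> multiples \<beta> \<psi>" for f by (rule T(1)[OF that])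
    show "T (f - g) = T f - T g" if fg: "f \<in> multiples \<beta> \<psi>" "g \<in> multiples \<beta> \<psi>" for f g
    proof -
      have "f - g = (\<lambda>z. \<psi> z * T f z) - (\<lambda>z. \<psi> z * T g z)" using T(2)[OF fg(1)] T(2)[OF fg(2)] by (rule arg_cong2)
      also have "\<dots> = (\<lambda>z. \<psi> z * (T f - T g) z)" by (simp add: fun_eq_iff right_diff_distrib)
      finally show ?thesis using T_eq[OF hs.diff_mem[OF T(1)[OF fg(1)] T(1)[OF fg(2)]]] by (simp only:)
    qed
    show "T (scale_fun c f) = scale_fun c (T f)" if f: "f \<in> multiples \<beta> \<psi>" for c f
    proof -
      have "scale_fun c f = scale_fun c (\<lambda>z. \<psi> z * T f z)" using T(2)[OF f] by (rule arg_cong)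
      also have "\<dots> = (\<lambda>z. \<psi> z * (scale_fun c (T f)) z)" by (simp add: fun_eq_iff scale_fun_def)
      finally show ?thesis using T_eq[OF hs.scale_mem[OF T(1)[OF f]], of c] by (simp only:)
    qed
    fix f :: "nat \<Rightarrow> complex ^ 'n \<Rightarrow> complex" and g k
    assume f: "\<And>m. f m \<in> multiples \<beta> \<psi>" and g: "g \<in> multiples \<beta> \<psi>" and k: "k \<in> hardy_sobolev_space \<beta>"
      and lim: "(\<lambda>m. hardy_sobolev_norm \<beta> (f m - g)) \<longlonglongrightarrow> 0" "(\<lambda>m. hardy_sobolev_norm \<beta> (T (f m) - k)) \<longlonglongrightarrow> 0"
    have "g z = \<psi> z * k z" for z
    proof -
      have "(\<lambda>m. f m z) \<longlonglongrightarrow> g z" by (rule hardy_sobolev_tendsto(1)[OF subsetD[OF V f] subsetD[OF V g] lim(1)])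
      moreover have "(\<lambda>m. \<psi> z * T (f m) z) \<longlonglongrightarrow> \<psi> z * k z"
        by (intro tendsto_mult_left hardy_sobolev_tendsto(1)[OF T(1)[OF f] k lim(2)])
      moreover have "\<psi> z * T (f m) z = f m z" for m using fun_cong[OF T(2)[OF f[of m]], of z] by (rule sym)
      ultimately show ?thesis by (simp add: LIMSEQ_unique)
    qed
    then have "g = (\<lambda>z. \<psi> z * k z)" by blast
    then show "T g = k" using T_eq[OF k] by (simp only:)
  qed (rule that)
  show thesis
  proof (rule that[OF C(1)])
    fix f :: "complex ^ 'n \<Rightarrow> complex" assume f: "f \<in> hardy_sobolev_space \<beta>"
    show "hardy_sobolev_norm \<beta> f \<le> C * hardy_sobolev_norm \<beta> (\<lambda>z. \<psi> z * f z)"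
      using C(2)[OF multiplesI[OF f, of \<psi>]] by (simp only: T_eq[OF f])
  qed
qed

text \<open>The lower bound makes the preimages of a convergent sequence Cauchy; their limit lies in
  X, and point evaluations identify its image.\<close>

lemma closedin_multiplication_image:
  fixes \<psi> :: "complex ^ 'n \<Rightarrow> complex"
  assumes \<psi>: "pointwise_multiplier \<beta> \<psi>"
    and C: "C > 0" "\<And>f. f \<in> hardy_sobolev_space \<beta> \<Longrightarrow> hardy_sobolev_norm \<beta> f \<le> C * hardy_sobolev_norm \<beta> (\<lambda>z. \<psi> z * f z)"
    and X: "closedin (hs.metric.mtopology \<beta>) X"
  shows "closedin (hs.metric.mtopology \<beta>) ((\<lambda>f z. \<psi> z * f z) ` X)"
  unfolding hs.closedin_iff
proof (intro conjI allI impI)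
  have XV: "X \<subseteq> hardy_sobolev_space \<beta>" using X unfolding hs.closedin_iff by blast
  then show "(\<lambda>f z. \<psi> z * f z) ` X \<subseteq> hardy_sobolev_space \<beta>" using pointwise_multiplierD(2)[OF \<psi>] by blast
  fix g :: "nat \<Rightarrow> complex ^ 'n \<Rightarrow> complex" and k
  assume g: "\<forall>n. g n \<in> (\<lambda>f z. \<psi> z * f z) ` X" and k: "k \<in> hardy_sobolev_space \<beta>" and lim: "(\<lambda>n. hardy_sobolev_norm \<beta> (g n - k)) \<longlonglongrightarrow> 0"
  have "\<forall>n. \<exists>x. x \<in> X \<and> g n = (\<lambda>z. \<psi> z * x z)" using g by blast
  then obtain x where x: "\<And>n. x n \<in> X" "\<And>n. g n = (\<lambda>z. \<psi> z * x n z)" by metis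
  have xV: "x n \<in> hardy_sobolev_space \<beta>" for n using x(1) XV by blast
  have gV: "g n \<in> hardy_sobolev_space \<beta>" for n unfolding x(2) by (rule pointwise_multiplierD(2)[OF \<psi> xV])
  have le: "hardy_sobolev_norm \<beta> (x m - x n) \<le> C * hardy_sobolev_norm \<beta> (g m - g n)" for m n
  proof -
    have "g m - g n = (\<lambda>z. \<psi> z * (x m - x n) z)" by (simp add: x(2) fun_eq_iff right_diff_distrib)
    then show ?thesis using C(2)[OF hs.diff_mem[OF xV[of m] xV[of n]]] by (simp only:)
  qed
  obtain y where y: "y \<in> hardy_sobolev_space \<beta>" "(\<lambda>m. hardy_sobolev_norm \<beta> (x m - y)) \<longlonglongrightarrow> 0"
  proof -
    have "\<exists>y\<in>hardy_sobolev_space \<beta>. (\<lambda>m. hardy_sobolev_norm \<beta> (x m - y)) \<longlonglongrightarrow> 0"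
    proof (rule hs.complete[OF xV])
      fix e :: real assume "e > 0"
      then have "e / (2 * C) > 0" using C(1) by simp
      then have "\<forall>\<^sub>F n in sequentially. hardy_sobolev_norm \<beta> (g n - k) < e / (2 * C)" by (rule order_tendstoD(2)[OF lim])
      then obtain M where M: "\<And>n. n \<ge> M \<Longrightarrow> hardy_sobolev_norm \<beta> (g n - k) < e / (2 * C)" by (auto simp: eventually_sequentially)
      have "hardy_sobolev_norm \<beta> (x m - x n) < e" if "m \<ge> M" "n \<ge> M" for m n
      proof -
        have "hardy_sobolev_norm \<beta> (g m - g n) \<le> hardy_sobolev_norm \<beta> (g m - k) + hardy_sobolev_norm \<beta> (k - g n)"
          by (rule hs.norm_triangle[OF gV k gV])
        also have "\<dots> < e / (2 * C) + e / (2 * C)" using M[OF that(1)] M[OF that(2)] hs.norm_commute[of \<beta> k "g n"] by linarith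
        also have "\<dots> = e / C" using C(1) by (simp add: field_simps)
        finally have "C * hardy_sobolev_norm \<beta> (g m - g n) < C * (e / C)" using C(1) by (intro mult_strict_left_mono)
        also have "\<dots> = e" using C(1) by simp
        finally show ?thesis using le[of m n] by linarith
      qed
      then show "\<exists>M. \<forall>m\<ge>M. \<forall>n\<ge>M. hardy_sobolev_norm \<beta> (x m - x n) < e" by blast
    qed
    then show thesis using that by blast
  qed
  have yX: "y \<in> X" using X[unfolded hs.closedin_iff, THEN conjunct2, rule_format, of x y] x(1) y by blast
  have "k z = \<psi> z * y z" for z
  proof -
    have "(\<lambda>m. g m z) \<longlonglongrightarrow> k z" by (rule hardy_sobolev_tendsto(1)[OF gV k lim])
    moreover have "(\<lambda>m. \<psi> z * x m z) \<longlonglongrightarrow> \<psi> z * y z"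
      by (intro tendsto_mult_left hardy_sobolev_tendsto(1)[OF xV y])
    ultimately show ?thesis by (simp add: x(2) LIMSEQ_unique)
  qed
  then have "k = (\<lambda>z. \<psi> z * y z)" by blast
  then show "k \<in> (\<lambda>f z. \<psi> z * f z) ` X" using yX by blast
qed

section \<open>Powers of a multiplication operator\<close>

lemma span_mult:
  assumes "s \<in> cfun.span B"
  shows "(\<lambda>z. h z * s z) \<in> cfun.span ((\<lambda>f z. h z * f z) ` B)"
  using assms
proof (induction rule: cfun.span_induct_alt)
  case base
  then show ?case using cfun.span_zero by (simp add: zero_fun_def)
next
  case (step c x y)
  have "(\<lambda>z. h z * (scale_fun c x + y) z) = scale_fun c (\<lambda>z. h z * x z) + (\<lambda>z. h z * y z)"
    by (simp add: fun_eq_iff scale_fun_def algebra_simps)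
  also have "\<dots> \<in> cfun.span ((\<lambda>f z. h z * f z) ` B)"
    using step by (intro cfun.span_add cfun.span_scale) (auto intro: cfun.span_base)
  finally show ?case .
qed

text \<open>The range of the power k + 1 is the image under \<psi> of the closed range of the power
  k, and the lower bound for \<psi> keeps it closed. Decomposing g modulo \<psi>^k and then the
  quotient modulo \<psi> controls the codimension.\<close>

lemma multiples_power:
  fixes \<psi> :: "complex ^ 'n \<Rightarrow> complex"
  assumes \<psi>: "pointwise_multiplier \<beta> \<psi>" and z0: "\<psi> z0 \<noteq> 0" and cl: "closedin (hs.metric.mtopology \<beta>) (multiples \<beta> \<psi>)"
    and B: "finite B" "B \<subseteq> hardy_sobolev_space \<beta>" "\<And>g. g \<in> hardy_sobolev_space \<beta> \<Longrightarrow> \<exists>f\<in>multiples \<beta> \<psi>. g - f \<in> cfun.span B"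
  shows "closedin (hs.metric.mtopology \<beta>) (multiples \<beta> (\<lambda>z. \<psi> z ^ k)) \<and>
    (\<exists>B. finite B \<and> B \<subseteq> hardy_sobolev_space \<beta> \<and> (\<forall>g\<in>hardy_sobolev_space \<beta>. \<exists>f\<in>multiples \<beta> (\<lambda>z. \<psi> z ^ k). g - f \<in> cfun.span B))"
proof -
  obtain C where C: "C > 0" "\<And>f. f \<in> hardy_sobolev_space \<beta> \<Longrightarrow> hardy_sobolev_norm \<beta> f \<le> C * hardy_sobolev_norm \<beta> (\<lambda>z. \<psi> z * f z)"
    using multiplication_bounded_below[OF \<psi> z0 cl] by blast
  have mem: "(\<lambda>z. \<psi> z ^ k * f z) \<in> hardy_sobolev_space \<beta>" if f: "f \<in> hardy_sobolev_space \<beta>" for f k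
  proof (induction k)
    case (Suc k)
    from pointwise_multiplierD(2)[OF \<psi> Suc.IH] show ?case by (simp add: mult.assoc)
  qed (use f in simp)
  show ?thesis
  proof (induction k)
    case 0
    have eq: "multiples \<beta> (\<lambda>z. \<psi> z ^ 0) = hardy_sobolev_space \<beta>" by (simp add: multiples_def)
    have "closedin (hs.metric.mtopology \<beta>) (hardy_sobolev_space \<beta>)" unfolding hs.closedin_iff by blast
    moreover have *: "\<exists>f\<in>hardy_sobolev_space \<beta>. g - f \<in> cfun.span {}" if "g \<in> hardy_sobolev_space \<beta>" for g :: "complex ^ 'n \<Rightarrow> complex"
      using that by (intro bexI[of _ g]) auto
    ultimately show ?case unfolding eq by (intro conjI exI[of _ "{}"] ballI finite.emptyI empty_subsetI)
  next
    case (Suc k)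
    have eq: "multiples \<beta> (\<lambda>z. \<psi> z ^ Suc k) = (\<lambda>f z. \<psi> z * f z) ` multiples \<beta> (\<lambda>z. \<psi> z ^ k)"
      by (simp add: multiples_def image_image mult.assoc)
    have "closedin (hs.metric.mtopology \<beta>) (multiples \<beta> (\<lambda>z. \<psi> z ^ Suc k))"
      unfolding eq by (rule closedin_multiplication_image[OF \<psi> C]) (use Suc.IH in blast)+
    moreover from Suc.IH obtain Bk where Bk: "finite Bk" "Bk \<subseteq> hardy_sobolev_space \<beta>"
      "\<And>g. g \<in> hardy_sobolev_space \<beta> \<Longrightarrow> \<exists>f\<in>multiples \<beta> (\<lambda>z. \<psi> z ^ k). g - f \<in> cfun.span Bk" by blast
    \<comment> \<open>If g = \<psi>^k f + s and f = \<psi> f' + t with s, t in the spans of Bk and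
      B, then g = \<psi>^(k+1) f' + s + \<psi>^k t.\<close>
    define B' where "B' = Bk \<union> (\<lambda>f z. \<psi> z ^ k * f z) ` B"
    have "\<exists>f\<in>multiples \<beta> (\<lambda>z. \<psi> z ^ Suc k). g - f \<in> cfun.span B'" if g: "g \<in> hardy_sobolev_space \<beta>" for g
    proof -
      obtain f where f: "f \<in> hardy_sobolev_space \<beta>" "g - (\<lambda>z. \<psi> z ^ k * f z) \<in> cfun.span Bk"
      proof -
        obtain f0 where f0: "f0 \<in> multiples \<beta> (\<lambda>z. \<psi> z ^ k)" "g - f0 \<in> cfun.span Bk" using Bk(3)[OF g] by blast
        from f0(1) show thesis by (rule multiplesE) (use that f0(2) in blast)
      qed
      obtain f' where f': "f' \<in> hardy_sobolev_space \<beta>" "f - (\<lambda>z. \<psi> z * f' z) \<in> cfun.span B"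
      proof -
        obtain f0 where f0: "f0 \<in> multiples \<beta> \<psi>" "f - f0 \<in> cfun.span B" using B(3)[OF f(1)] by blast
        from f0(1) show thesis by (rule multiplesE) (use that f0(2) in blast)
      qed
      have "g - (\<lambda>z. \<psi> z ^ Suc k * f' z) = (g - (\<lambda>z. \<psi> z ^ k * f z)) + (\<lambda>z. \<psi> z ^ k * (f - (\<lambda>z. \<psi> z * f' z)) z)"
        by (simp add: fun_eq_iff algebra_simps)
      also have "\<dots> \<in> cfun.span B'"
        using f(2) span_mult[OF f'(2), of "\<lambda>z. \<psi> z ^ k"] cfun.span_mono[of Bk B'] cfun.span_mono[of "(\<lambda>f z. \<psi> z ^ k * f z) ` B" B']
        by (intro cfun.span_add) (auto simp: B'_def)
      finally show ?thesis using multiplesI[OF f'(1), of "\<lambda>z. \<psi> z ^ Suc k"] by blast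
    qed
    moreover have "finite B'" "B' \<subseteq> hardy_sobolev_space \<beta>" using B Bk mem by (auto simp: B'_def)
    ultimately show ?case by blast
  qed
qed

lemma power_cancel:
  fixes \<psi> g :: "complex ^ 'n \<Rightarrow> complex"
  assumes \<psi>: "\<psi> \<in> holomorphic_ball" "\<psi> z0 \<noteq> 0" and g: "g \<in> holomorphic_ball" and eq: "\<And>z. \<psi> z ^ N * g z = 0"
  shows "g z = 0"
  using eq
proof (induction N arbitrary: z)
  case (Suc N)
  have h: "(\<lambda>z. \<psi> z ^ N * g z) \<in> holomorphic_ball"
  proof (induction N)
    case (Suc N)
    from holomorphic_ball_mult[OF \<psi>(1) Suc] show ?case by (simp add: mult.assoc)
  qed (simp add: g)
  have "\<psi> z * (\<psi> z ^ N * g z) = 0" for z using Suc.prems[of z] by (simp add: mult.assoc)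
  from Suc.IH[OF holomorphic_ball_cancel[OF \<psi> h this]] show ?case .
qed simp

text \<open>On the segment from 0 to \<zeta> the gap takes every value in (0, 1), and p has only
  finitely many roots.\<close>

lemma poly_gap_nonzero:
  fixes \<zeta> :: "complex ^ 'n"
  assumes \<zeta>: "norm \<zeta> = 1" and p: "p \<noteq> 0"
  obtains z where "norm z < 1" "poly p (gap \<zeta> z) \<noteq> 0"
proof -
  have "infinite (complex_of_real ` {0<..<1})"
    using infinite_Ioo[of 0 "1::real"] by (simp add: finite_image_iff inj_on_def)
  then have "\<not> complex_of_real ` {0<..<1} \<subseteq> {x. poly p x = 0}" using poly_roots_finite[OF p] finite_subset by blast
  then obtain x where "x \<in> complex_of_real ` {0<..<1}" "poly p x \<noteq> 0" by blast
  then obtain t where t: "0 < t" "t < 1" "poly p (complex_of_real t) \<noteq> 0" by auto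
  define a where "a = 1 - t"
  have "gap \<zeta> (complex_of_real a *s \<zeta>) = 1 - complex_of_real a" by (simp add: gap_smult gap_self[OF \<zeta>])
  also have "\<dots> = complex_of_real t" by (simp add: a_def)
  finally have "poly p (gap \<zeta> (complex_of_real a *s \<zeta>)) \<noteq> 0" using t(3) by (simp only: simp_thms)
  moreover have "norm (complex_of_real a *s \<zeta>) < 1" using t(1,2) \<zeta> by (simp only: norm_smult norm_of_real) (simp add: a_def)
  ultimately show thesis by (rule that[rotated])
qed

lemma order_zero_decomposition:
  fixes p :: "complex poly"
  assumes "p \<noteq> 0"
  obtains N q where "\<And>x. poly p x = x ^ N * poly q x" "poly q 0 \<noteq> 0"
proof -
  obtain q where q: "p = [:- 0, 1:] ^ order 0 p * q" "\<not> [:- 0, 1:] dvd q" using order_decomp[OF assms, of 0] by blast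
  show thesis
  proof (rule that)
    show "poly p x = x ^ order 0 p * poly q x" for x by (subst q(1)) (simp add: poly_power)
    show "poly q 0 \<noteq> 0" using q(2) by (simp add: poly_eq_0_iff_dvd)
  qed
qed

lemma not_closed_finite_codimension:
  fixes \<psi> :: "complex ^ 'n \<Rightarrow> complex"
  assumes \<psi>: "pointwise_multiplier \<beta> \<psi>" and cl: "closedin (hs.metric.mtopology \<beta>) (multiples \<beta> \<psi>)"
    and B: "finite B" "B \<subseteq> hardy_sobolev_space \<beta>" "\<And>g. g \<in> hardy_sobolev_space \<beta> \<Longrightarrow> \<exists>f\<in>multiples \<beta> \<psi>. g - f \<in> cfun.span B"
    and \<zeta>: "norm \<zeta> = 1" and w: "\<And>k. norm (w k) < 1" "w \<longlonglongrightarrow> \<zeta>" "(\<lambda>k. \<psi> (w k)) \<longlonglongrightarrow> 0"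
  shows False
proof -
  note h\<psi> = pointwise_multiplierD(1)[OF \<psi>]
  have gm: "(\<lambda>z. gap \<zeta> z * v z) \<in> hardy_sobolev_space \<beta>" if "v \<in> hardy_sobolev_space \<beta>" for v
    by (rule hardy_sobolev_polys_mult[OF that polys_gap])
  define I :: "complex ^ 'n \<Rightarrow> complex" where "I = on_ball (\<lambda>z. 1)"
  have I: "I \<in> hardy_sobolev_space \<beta>" unfolding I_def by (rule polys_hardy_sobolev[OF polys_const])
  have I1: "norm z < 1 \<Longrightarrow> I z = 1" for z by (simp add: I_def on_ball_def)
  \<comment> \<open>If \<psi> were zero, finite codimension would make the whole space finite
    dimensional. Some nonzero polynomial in the gap would then annihilate the constant 1.\<close>
  have "\<exists>z0. \<psi> z0 \<noteq> 0"
  proof (rule ccontr)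
    assume z: "\<nexists>z0. \<psi> z0 \<noteq> 0"
    have sub0: "cfun.subspace {0 :: complex ^ 'n \<Rightarrow> complex}"
      by (intro cfun.subspaceI) (auto simp: scale_fun_def fun_eq_iff)
    have dec: "\<exists>u\<in>{0}. v - u \<in> cfun.span B" if v: "v \<in> hardy_sobolev_space \<beta>" for v
    proof -
      obtain f where f: "f \<in> multiples \<beta> \<psi>" "v - f \<in> cfun.span B" using B(3)[OF v] by blast
      have "f = 0" using f(1) z by (auto simp: multiples_def fun_eq_iff)
      then show ?thesis using f(2) by blast
    qed
    have "\<exists>p. p \<noteq> 0 \<and> (\<forall>v\<in>hardy_sobolev_space \<beta>. (\<lambda>x. poly p (gap \<zeta> x) * v x) \<in> {0})"
      by (rule annihilating_polynomial[OF sub0 B(1,2) dec gm]) (auto simp: fun_eq_iff)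
    then obtain p where p: "p \<noteq> 0" "(\<lambda>x. poly p (gap \<zeta> x) * I x) = 0" using I by blast
    obtain x where x: "norm x < 1" "poly p (gap \<zeta> x) \<noteq> 0" using poly_gap_nonzero[OF \<zeta> p(1)] by blast
    show False using fun_cong[OF p(2), of x] x I1[OF x(1)] by simp
  qed
  then obtain z0 where z0: "\<psi> z0 \<noteq> 0" by blast
  obtain E B0 where B0: "finite B0" "B0 \<subseteq> hardy_sobolev_space \<beta>"
    and E: "\<And>k. multiples \<beta> (\<lambda>z. gap \<zeta> z ^ E) \<subseteq> hs.cl \<beta> (multiples \<beta> (\<lambda>z. gap \<zeta> z ^ (E + k)))"
    and decZ: "\<And>v. v \<in> hardy_sobolev_space \<beta> \<Longrightarrow> \<exists>u\<in>hs.cl \<beta> (multiples \<beta> (\<lambda>z. gap \<zeta> z ^ E)). v - u \<in> cfun.span B0"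
    by (rule gap_power_codimension[OF \<zeta>, of \<beta>]) (rule that)
  have gp: "(\<lambda>z. gap \<zeta> z ^ k) \<in> polys" for k by (intro polys_power polys_gap)
  have gV: "multiples \<beta> (\<lambda>z. gap \<zeta> z ^ k) \<subseteq> hardy_sobolev_space \<beta>" for k
    by (intro multiples_subset bounded_multiplication_polys gp)
  define Z where "Z = hs.cl \<beta> (multiples \<beta> (\<lambda>z. gap \<zeta> z ^ E))"
  have Zs: "cfun.subspace Z" unfolding Z_def by (rule hs.subspace_cl[OF subspace_multiples gV])
  have \<psi>Z: "(\<lambda>z. \<psi> z * u z) \<in> Z" if "u \<in> Z" for u
    unfolding Z_def
  proof (rule bounded_multiplication_cl[OF bounded_multiplication_multiplier[OF \<psi>] gV _ that[unfolded Z_def]])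
    fix x assume "x \<in> multiples \<beta> (\<lambda>z. gap \<zeta> z ^ E)"
    then obtain f where f: "f \<in> hardy_sobolev_space \<beta>" "x = (\<lambda>z. gap \<zeta> z ^ E * f z)" by (rule multiplesE)
    have "(\<lambda>z. \<psi> z * x z) = (\<lambda>z. gap \<zeta> z ^ E * (\<psi> z * f z))" by (simp add: f fun_eq_iff)
    also have "\<dots> \<in> multiples \<beta> (\<lambda>z. gap \<zeta> z ^ E)" by (intro multiplesI pointwise_multiplierD(2)[OF \<psi> f(1)])
    finally show "(\<lambda>z. \<psi> z * x z) \<in> multiples \<beta> (\<lambda>z. gap \<zeta> z ^ E)" .
  qed
  have "\<exists>p. p \<noteq> 0 \<and> (\<forall>v\<in>hardy_sobolev_space \<beta>. (\<lambda>x. poly p (\<psi> x) * v x) \<in> Z)"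
    by (rule annihilating_polynomial[OF Zs B0 decZ[folded Z_def] pointwise_multiplierD(2)[OF \<psi>] \<psi>Z])
  then obtain \<mu> where \<mu>: "\<mu> \<noteq> 0" "\<And>v. v \<in> hardy_sobolev_space \<beta> \<Longrightarrow> (\<lambda>x. poly \<mu> (\<psi> x) * v x) \<in> Z" by blast
  \<comment> \<open>N is the multiplicity of the root 0 of \<open>\<mu>\<close>, possibly 0. The
    other factor is nonzero at 0, the limit of \<psi> along w.\<close>
  obtain N q where q: "\<And>x. poly \<mu> x = x ^ N * poly q x" "poly q 0 \<noteq> 0" using order_zero_decomposition[OF \<mu>(1)] by blast
  \<comment> \<open>The exponent exceeds N by one so that a factor \<psi> is left on the right after
    \<psi>^N has been cancelled.\<close>
  define U where "U = multiples \<beta> (\<lambda>z. \<psi> z ^ Suc N)"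
  have Us: "cfun.subspace U" unfolding U_def by (rule subspace_multiples)
  obtain BU where BU: "finite BU" "BU \<subseteq> hardy_sobolev_space \<beta>"
    and decU: "\<And>g. g \<in> hardy_sobolev_space \<beta> \<Longrightarrow> \<exists>f\<in>U. g - f \<in> cfun.span BU"
    and Ucl: "closedin (hs.metric.mtopology \<beta>) U"
    using multiples_power[OF \<psi> z0 cl B, of "Suc N"] unfolding U_def by blast
  have gU: "(\<lambda>z. gap \<zeta> z * u z) \<in> U" if "u \<in> U" for u
  proof -
    from that obtain f where f: "f \<in> hardy_sobolev_space \<beta>" "u = (\<lambda>z. \<psi> z ^ Suc N * f z)" unfolding U_def by (rule multiplesE)
    have "(\<lambda>z. gap \<zeta> z * u z) = (\<lambda>z. \<psi> z ^ Suc N * (gap \<zeta> z * f z))" by (simp add: f fun_eq_iff)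
    also have "\<dots> \<in> U" unfolding U_def by (intro multiplesI gm f)
    finally show ?thesis .
  qed
  have "\<exists>p. p \<noteq> 0 \<and> (\<forall>v\<in>hardy_sobolev_space \<beta>. (\<lambda>x. poly p (gap \<zeta> x) * v x) \<in> U)"
    by (rule annihilating_polynomial[OF Us BU decU gm gU])
  then obtain p0 where p0: "p0 \<noteq> 0" "\<And>v. v \<in> hardy_sobolev_space \<beta> \<Longrightarrow> (\<lambda>x. poly p0 (gap \<zeta> x) * v x) \<in> U" by blast
  obtain d p where p: "\<And>x. poly p0 x = x ^ d * poly p x" "poly p 0 \<noteq> 0" using order_zero_decomposition[OF p0(1)] by blast
  have pgp: "(\<lambda>z. poly p (gap \<zeta> z)) \<in> polys"
    unfolding poly_altdef by (intro polys_sum polys_scale gp)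
  \<comment> \<open>Elements of Z can be approximated by multiples of gap^(E + d). The factor gap^d
    completes p to p0, which maps the space into U, and U is closed.\<close>
  have pZ: "(\<lambda>z. poly p (gap \<zeta> z) * u z) \<in> U" if u: "u \<in> Z" for u
  proof -
    have "Z \<subseteq> hs.cl \<beta> (multiples \<beta> (\<lambda>z. gap \<zeta> z ^ (E + d)))"
      unfolding Z_def by (rule hs.cl_trans[OF E gV])
    then have u': "u \<in> hs.cl \<beta> (multiples \<beta> (\<lambda>z. gap \<zeta> z ^ (E + d)))" using u by blast
    have "(\<lambda>z. poly p (gap \<zeta> z) * u z) \<in> hs.cl \<beta> U"
    proof (rule bounded_multiplication_cl[OF bounded_multiplication_polys[OF pgp] gV _ u'])
      fix x assume "x \<in> multiples \<beta> (\<lambda>z. gap \<zeta> z ^ (E + d))"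
      then obtain f where f: "f \<in> hardy_sobolev_space \<beta>" "x = (\<lambda>z. gap \<zeta> z ^ (E + d) * f z)" by (rule multiplesE)
      have "(\<lambda>z. poly p (gap \<zeta> z) * x z) = (\<lambda>z. poly p0 (gap \<zeta> z) * (gap \<zeta> z ^ E * f z))"
        by (simp add: f fun_eq_iff p(1) power_add)
      also have "\<dots> \<in> U" by (intro p0(2) hardy_sobolev_polys_mult[OF f(1) gp])
      finally show "(\<lambda>z. poly p (gap \<zeta> z) * x z) \<in> U" .
    qed
    then show ?thesis using hs.cl_closedin[OF Ucl] by blast
  qed
  have "\<exists>f\<in>hardy_sobolev_space \<beta>. \<forall>z. poly p (gap \<zeta> z) * poly q (\<psi> z) * v z = \<psi> z * f z" if v: "v \<in> hardy_sobolev_space \<beta>" for v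
  proof -
    have "(\<lambda>z. poly p (gap \<zeta> z) * (poly \<mu> (\<psi> z) * v z)) \<in> U" by (rule pZ[OF \<mu>(2)[OF v]])
    then obtain f where f: "f \<in> hardy_sobolev_space \<beta>"
      "(\<lambda>z. poly p (gap \<zeta> z) * (poly \<mu> (\<psi> z) * v z)) = (\<lambda>z. \<psi> z ^ Suc N * f z)" unfolding U_def by (rule multiplesE)
    have "(\<lambda>x. poly q (\<psi> x) * v x) \<in> hardy_sobolev_space \<beta>"
      by (rule poly_mult_mem[OF hs.subspace_V pointwise_multiplierD(2)[OF \<psi>] v])
    then have "(\<lambda>z. poly p (gap \<zeta> z) * (poly q (\<psi> z) * v z)) \<in> hardy_sobolev_space \<beta>" by (rule hardy_sobolev_polys_mult[OF _ pgp])
    \<comment> \<open>Cancelling \<psi>^N through the identity theorem is possible because this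
      difference is holomorphic on the ball and vanishes outside it.\<close>
    then have hol: "(\<lambda>z. poly p (gap \<zeta> z) * (poly q (\<psi> z) * v z) - \<psi> z * f z) \<in> holomorphic_ball"
      by (intro holomorphic_ball_diff holomorphic_ball_mult h\<psi> hardy_sobolev_holomorphic[OF f(1)] hardy_sobolev_holomorphic[of _ \<beta>])
    have "\<psi> z ^ N * (poly p (gap \<zeta> z) * (poly q (\<psi> z) * v z) - \<psi> z * f z) = 0" for z
      using fun_cong[OF f(2), of z] by (simp add: q(1) algebra_simps)
    from power_cancel[OF h\<psi> z0 hol this] show ?thesis using f(1) by (intro bexI[of _ f]) (auto simp: mult.assoc)
  qed
  then obtain F where F: "\<And>v. v \<in> hardy_sobolev_space \<beta> \<Longrightarrow> F v \<in> hardy_sobolev_space \<beta>"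
    "\<And>v z. v \<in> hardy_sobolev_space \<beta> \<Longrightarrow> poly p (gap \<zeta> z) * poly q (\<psi> z) * v z = \<psi> z * F v z" by metis
  \<comment> \<open>The quotient p(chi) q(psi) / psi, obtained by applying the division to the
    constant 1; it is holomorphic across the zeros of \<psi>.\<close>
  define m where "m = F I"
  have hm: "m \<in> holomorphic_ball" unfolding m_def by (rule hardy_sobolev_holomorphic[OF F(1)[OF I]])
  have m: "poly p (gap \<zeta> z) * poly q (\<psi> z) = \<psi> z * m z" if "norm z < 1" for z
    using F(2)[OF I, of z] I1[OF that] by (simp add: m_def)
  \<comment> \<open>Both \<open>F v\<close> and m v become p(chi) q(psi) v after multiplication by
    \<psi>. By cancellation they agree, so m v stays in the space.\<close>
  have "pointwise_multiplier \<beta> m"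
    unfolding pointwise_multiplier_def
  proof (intro conjI ballI hm)
    fix v :: "complex ^ 'n \<Rightarrow> complex" assume v: "v \<in> hardy_sobolev_space \<beta>"
    note hv = hardy_sobolev_holomorphic[OF v]
    have hol: "(\<lambda>z. F v z - m z * v z) \<in> holomorphic_ball"
      by (intro holomorphic_ball_diff holomorphic_ball_mult hm hv hardy_sobolev_holomorphic[OF F(1)[OF v]])
    have "\<psi> z * (F v z - m z * v z) = 0" for z
    proof (cases "norm z < 1")
      case True
      have "\<psi> z * F v z = \<psi> z * m z * v z" by (simp only: F(2)[OF v, symmetric] m[OF True])
      then show ?thesis unfolding right_diff_distrib by (simp only: mult.assoc diff_self)
    next
      case False
      then show ?thesis using h\<psi> by (simp add: holomorphic_ball_iff)
    qed
    from holomorphic_ball_cancel[OF h\<psi> z0 hol this] have "(\<lambda>z. m z * v z) = F v" by (simp add: fun_eq_iff)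
    then show "(\<lambda>z. m z * v z) \<in> hardy_sobolev_space \<beta>" using F(1)[OF v] by (simp only:)
  qed
  then obtain C where C: "\<And>z. cmod (m z) \<le> C" using pointwise_multiplier_bounded by blast
  have "(\<lambda>k. gap \<zeta> (w k)) \<longlonglongrightarrow> gap \<zeta> \<zeta>"
    by (rule continuous_on_tendsto_compose[OF polys_continuous[OF polys_gap, of UNIV] w(2)]) auto
  then have "(\<lambda>k. poly p (gap \<zeta> (w k)) * poly q (\<psi> (w k))) \<longlonglongrightarrow> poly p 0 * poly q 0"
    by (intro tendsto_mult isCont_tendsto_compose[OF poly_isCont] w(3)) (simp add: gap_self[OF \<zeta>])
  \<comment> \<open>Along w the product equals \<psi> m, where \<psi> tends to 0 and m is bounded as
    a multiplier. Continuity gives the other limit p(0) q(0).\<close>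
  moreover have "(\<lambda>k. poly p (gap \<zeta> (w k)) * poly q (\<psi> (w k))) \<longlonglongrightarrow> 0"
  proof (rule Lim_null_comparison)
    show "\<forall>\<^sub>F k in sequentially. norm (poly p (gap \<zeta> (w k)) * poly q (\<psi> (w k))) \<le> cmod (\<psi> (w k)) * C"
      using C by (intro always_eventually allI) (simp add: m[OF w(1)] norm_mult mult_left_mono)
    show "(\<lambda>k. cmod (\<psi> (w k)) * C) \<longlonglongrightarrow> 0" by (intro tendsto_mult_left_zero tendsto_norm_zero w(3))
  qed
  ultimately have "poly p 0 * poly q 0 = 0" by (rule LIMSEQ_unique)
  then show False using p(2) q(2) by simp
qed

section \<open>The essential spectrum\<close>

lemma fredholm_on_cong:
  assumes V: "cfun.subspace V" and eq: "\<And>f. f \<in> V \<Longrightarrow> S f = T f"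
  shows "fredholm_on V N S \<longleftrightarrow> fredholm_on V N T"
proof -
  have "S ` V = T ` V" using eq by (intro image_cong) auto
  moreover have "{f \<in> V. S f = 0} = {f \<in> V. T f = 0}" using eq by auto
  moreover have "bounded_operator_on V N S \<longleftrightarrow> bounded_operator_on V N T"
    unfolding bounded_operator_on_def
    by (intro arg_cong2[of _ _ _ _ "(\<and>)"] arg_cong[of _ _ Ex] ext ball_cong refl all_cong1)
      (simp_all add: eq cfun.subspace_add[OF V] cfun.subspace_scale[OF V])
  moreover have "(\<forall>g\<in>V. \<exists>f\<in>V. g - S f \<in> cfun.span B) \<longleftrightarrow> (\<forall>g\<in>V. \<exists>f\<in>V. g - T f \<in> cfun.span B)" for B
    by (intro ball_cong bex_cong refl) (simp only: eq)
  ultimately show ?thesis unfolding fredholm_on_def by (simp only:)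
qed

theorem theoremB:
  fixes \<phi> :: "complex ^ 'n \<Rightarrow> complex" and \<beta> :: real
  assumes "pointwise_multiplier \<beta> \<phi>"
  shows "essential_spectrum_on (hardy_sobolev_space \<beta>) (hardy_sobolev_norm \<beta>)
           (multiplication_operator \<phi>)
         = (\<Inter>r\<in>{0<..<1}. closure (\<phi> ` (ball 0 1 - ball 0 r)))"
proof -
  \<comment> \<open>The constant is cut off outside the ball so that \<open>\<psi> \<mu>\<close> is
    itself a multiplier in the sense of \<open>pointwise_multiplier\<close>; on the ball it equals
    \<mu> - \<phi>.\<close>
  define \<psi> where "\<psi> \<mu> = (\<lambda>z. on_ball (\<lambda>z. \<mu>) z + (- 1) * \<phi> z)" for \<mu>
  have \<psi>: "pointwise_multiplier \<beta> (\<psi> \<mu>)" for \<mu>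
    unfolding \<psi>_def by (intro pointwise_multiplier_add pointwise_multiplier_const pointwise_multiplier_scale assms)
  have \<psi>_eq: "\<psi> \<mu> z = \<mu> - \<phi> z" if "norm z < 1" for \<mu> z using that by (simp add: \<psi>_def on_ball_def)
  have "scale_fun \<mu> f - multiplication_operator \<phi> f = (\<lambda>z. \<psi> \<mu> z * f z)" if f: "f \<in> hardy_sobolev_space \<beta>" for \<mu> f
  proof
    fix z
    have "\<psi> \<mu> z * f z = on_ball (\<lambda>z. \<mu>) z * f z - \<phi> z * f z" by (simp add: \<psi>_def algebra_simps)
    then show "(scale_fun \<mu> f - multiplication_operator \<phi> f) z = \<psi> \<mu> z * f z"
      by (simp add: on_ball_mult[OF f] scale_fun_def multiplication_operator_def)
  qed
  from fredholm_on_cong[OF hs.subspace_V this]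
  have fredholm: "fredholm_on (hardy_sobolev_space \<beta>) (hardy_sobolev_norm \<beta>) (\<lambda>f. scale_fun \<mu> f - multiplication_operator \<phi> f)
      \<longleftrightarrow> fredholm_on (hardy_sobolev_space \<beta>) (hardy_sobolev_norm \<beta>) (\<lambda>f z. \<psi> \<mu> z * f z)" for \<mu> .
  have sub: "fredholm_on (hardy_sobolev_space \<beta>) (hardy_sobolev_norm \<beta>) (\<lambda>f z. \<psi> \<mu> z * f z)"
    if r: "0 < r" "r < 1" and \<mu>: "\<mu> \<notin> closure (\<phi> ` (ball 0 1 - ball 0 r))" for \<mu> r
  proof -
    obtain \<delta> where \<delta>: "\<delta> > 0" "\<And>y. y \<in> \<phi> ` (ball 0 1 - ball 0 r) \<Longrightarrow> \<delta> \<le> dist y \<mu>"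
      using \<mu> unfolding closure_approachable by (auto simp: not_less)
    have "\<delta> \<le> cmod (\<psi> \<mu> z)" if "r \<le> norm z" "norm z < 1" for z
      using \<delta>(2)[of "\<phi> z"] that by (auto simp: \<psi>_eq dist_norm norm_minus_commute)
    then show ?thesis by (rule fredholm_if_bounded_below[OF \<psi> r \<delta>(1)])
  qed
  have sup: "\<not> fredholm_on (hardy_sobolev_space \<beta>) (hardy_sobolev_norm \<beta>) (\<lambda>f z. \<psi> \<mu> z * f z)"
    if \<mu>: "\<And>r. 0 < r \<Longrightarrow> r < 1 \<Longrightarrow> \<mu> \<in> closure (\<phi> ` (ball 0 1 - ball 0 r))" for \<mu>
  proof
    assume "fredholm_on (hardy_sobolev_space \<beta>) (hardy_sobolev_norm \<beta>) (\<lambda>f z. \<psi> \<mu> z * f z)"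
    then have cl: "closedin (hs.metric.mtopology \<beta>) (multiples \<beta> (\<psi> \<mu>))"
      and "\<exists>B. finite B \<and> B \<subseteq> hardy_sobolev_space \<beta> \<and> (\<forall>g\<in>hardy_sobolev_space \<beta>. \<exists>f\<in>hardy_sobolev_space \<beta>. g - (\<lambda>z. \<psi> \<mu> z * f z) \<in> cfun.span B)"
      unfolding fredholm_on_def multiples_def by blast+
    then obtain B where B: "finite B" "B \<subseteq> hardy_sobolev_space \<beta>"
      "\<forall>g\<in>hardy_sobolev_space \<beta>. \<exists>f\<in>hardy_sobolev_space \<beta>. g - (\<lambda>z. \<psi> \<mu> z * f z) \<in> cfun.span B" by (elim exE conjE)
    have B3: "\<exists>f\<in>multiples \<beta> (\<psi> \<mu>). g - f \<in> cfun.span B" if g: "g \<in> hardy_sobolev_space \<beta>" for g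
    proof -
      obtain f where "f \<in> hardy_sobolev_space \<beta>" "g - (\<lambda>z. \<psi> \<mu> z * f z) \<in> cfun.span B" using B(3)[rule_format, OF g] by (elim bexE)
      then show ?thesis by (intro bexI[of _ "\<lambda>z. \<psi> \<mu> z * f z"] multiplesI)
    qed
    have "\<exists>z. 1 - 1 / real (k + 2) \<le> norm z \<and> norm z < 1 \<and> dist (\<phi> z) \<mu> < 1 / real (k + 1)" for k
    proof -
      \<comment> \<open>The shift by 2 keeps the radius strictly positive already at k = 0, as the
        intersection only runs over r in (0, 1).\<close>
      have "0 < 1 - 1 / real (k + 2)" "1 - 1 / real (k + 2) < 1" by auto
      from \<mu>[OF this] have "\<exists>y\<in>\<phi> ` (ball 0 1 - ball 0 (1 - 1 / real (k + 2))). dist y \<mu> < 1 / real (k + 1)"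
        unfolding closure_approachable by simp
      then show ?thesis by (auto simp: not_less)
    qed
    then obtain w where w: "\<And>k. 1 - 1 / real (k + 2) \<le> norm (w k)" "\<And>k. norm (w k) < 1" "\<And>k. dist (\<phi> (w k)) \<mu> < 1 / real (k + 1)" by metis
    \<comment> \<open>The points approach the sphere but may have several limit points there; a
      subsequence singles out one boundary point \<zeta> for the local argument.\<close>
    have "compact (cball (0 :: complex ^ 'n) 1)" by simp
    moreover have "\<forall>k. w k \<in> cball 0 1" using w(2) by (simp add: less_imp_le)
    ultimately obtain \<zeta> s where s: "strict_mono s" "(w \<circ> s) \<longlonglongrightarrow> \<zeta>" unfolding compact_def by meson
    have lim0: "(\<lambda>k. 1 / real (k + 1)) \<longlonglongrightarrow> 0" using LIMSEQ_inverse_real_of_nat by (simp add: inverse_eq_divide add.commute)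
    have "(\<lambda>k. 1 / real (k + 2)) \<longlonglongrightarrow> 0" using LIMSEQ_ignore_initial_segment[OF lim0, of 1] by (simp add: add.commute)
    from tendsto_diff[OF tendsto_const[of 1] this] have lim1: "(\<lambda>k. 1 - 1 / real (k + 2)) \<longlonglongrightarrow> 1" by simp
    have "(\<lambda>k. norm (w k)) \<longlonglongrightarrow> 1"
      by (rule tendsto_sandwich[OF _ _ lim1 tendsto_const]) (use w in \<open>auto intro!: always_eventually less_imp_le\<close>)
    then have "(\<lambda>k. norm (w (s k))) \<longlonglongrightarrow> 1" using s(1) by (rule LIMSEQ_subseq_LIMSEQ[unfolded comp_def])
    moreover have "(\<lambda>k. norm (w (s k))) \<longlonglongrightarrow> norm \<zeta>" using tendsto_norm[OF s(2)] by (simp add: comp_def)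
    ultimately have \<zeta>: "norm \<zeta> = 1" using LIMSEQ_unique by blast
    have "(\<lambda>k. \<psi> \<mu> (w k)) \<longlonglongrightarrow> 0"
    proof (rule Lim_null_comparison[OF _ lim0])
      show "\<forall>\<^sub>F k in sequentially. norm (\<psi> \<mu> (w k)) \<le> 1 / real (k + 1)"
        using w(3) by (intro always_eventually allI) (simp add: \<psi>_eq[OF w(2)] dist_norm norm_minus_commute less_imp_le)
    qed
    then have "(\<lambda>k. \<psi> \<mu> (w (s k))) \<longlonglongrightarrow> 0" using s(1) by (rule LIMSEQ_subseq_LIMSEQ[unfolded comp_def])
    then show False
      using not_closed_finite_codimension[OF \<psi> cl B(1,2) B3 \<zeta>, of "\<lambda>k. w (s k)"] w(2) s(2) by (simp add: comp_def)
  qed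
  show ?thesis
    unfolding essential_spectrum_on_def fredholm
  proof (intro equalityI subsetI)
    fix \<mu> assume "\<mu> \<in> {\<mu>. \<not> fredholm_on (hardy_sobolev_space \<beta>) (hardy_sobolev_norm \<beta>) (\<lambda>f z. \<psi> \<mu> z * f z)}"
    then show "\<mu> \<in> (\<Inter>r\<in>{0<..<1}. closure (\<phi> ` (ball 0 1 - ball 0 r)))" using sub by force
  next
    fix \<mu> assume "\<mu> \<in> (\<Inter>r\<in>{0<..<1}. closure (\<phi> ` (ball 0 1 - ball 0 r)))"
    then show "\<mu> \<in> {\<mu>. \<not> fredholm_on (hardy_sobolev_space \<beta>) (hardy_sobolev_norm \<beta>) (\<lambda>f z. \<psi> \<mu> z * f z)}" using sup by force
  qed
qed

end
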